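(* Let $G$ be a Lie group, $M$ a manifold, and $(\pi:P\to M, A)$ a principal $G$-bundle with connection 1-form $A$. Then the assignment $$\mathsf{hol}_M(P,A)\,(x\xrightarrow{[\gamma]}y) := \left(\,\|^A_\gamma : P_x\to P_y\,\right)$$ for every arrow $x\xrightarrow{[\gamma]}y$ of the thin fundamental groupoid $\Pi^{\mathrm{thin}}(M)$ (so that $x\mapsto P_x$, the fiber of $P$ over $x$, on objects) gives a well-defined transport functor $\mathsf{hol}_M(P,A):\Pi^{\mathrm{thin}}(M)\to G\text{-}\mathsf{tors}$.
   Context: Diffeology. A diffeology on a set $X$ is a collection of maps $U\to X$ ("plots"), $U$ ranging over open subsets of $\mathbb{R}^n$, $n\ge 0$, which contains all constant maps, is closed under precomposition with smooth maps $V\to U$ of such open sets, and is local (a map $U\to X$ that restricts to a plot on each member of an open cover of $U$ is a plot). A map of diffeological spaces is smooth if it sends plots to plots by composition. A manifold is a diffeological space whose plots are the smooth maps. Subspace diffeology on $Y\subset X$: plots of $X$ with image in $Y$. Quotient diffeology on $X/R$: maps $U\to X/R$ that locally on $U$ lift to plots of $X$. Thin fundamental groupoid. A path with sitting instances in a manifold $M$ is a smooth map $\gamma:[0,1]\to M$ that is constant near $0$ and near $1$; $\mathcal{P}(M)$ is the set of these, with the diffeology in which $p:U\to\mathcal{P}(M)$ is a plot iff $(u,t)\mapsto p(u)(t)$ is a smooth map $U\times[0,1]\to M$. Two such paths $\gamma_0,\gamma_1$ with the same endpoints are thinly homotopic if there is a smooth $H:[0,1]^2\to M$ with $H(s,0)=\gamma_0(s)$,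 $H(s,1)=\gamma_1(s)$, $H(0,t)=\gamma_0(0)$, $H(1,t)=\gamma_0(1)$, with $\mathrm{rank}(dH)\le 1$ everywhere, and with $H$ constant in $s$ near $\{0,1\}\times[0,1]$ and constant in $t$ near $[0,1]\times\{0,1\}$. This is an equivalence relation $\sim$. $\Pi^{\mathrm{thin}}(M)$ is the groupoid with objects the points of $M$, arrows $\mathcal{P}(M)/_\sim$ (quotient diffeology), source $[\gamma]\mapsto\gamma(0)$, target $[\gamma]\mapsto\gamma(1)$, composition $[\gamma][\tau]=[\gamma\tau]$ where $\gamma\tau$ is the concatenation ($\tau$ first, then $\gamma$, each at double speed), units the constant paths, inverses the reversed paths. $\pi_1^{\mathrm{thin}}(M,x)$ is the automorphism group of $x$ in $\Pi^{\mathrm{thin}}(M)$, with the subspace diffeology. Transport functors. $G\text{-}\mathsf{tors}$ is the groupoid of $G$-torsors (manifolds with a smooth free transitive right $G$-action such that $X\times G\to X\times X$, $(x,g)\mapsto(x,x\cdot g)$, is a diffeomorphism) and $G$-equivariant maps. For a $G$-torsor $X$, $\mathrm{Aut}(X)$ is a Lie group via the isomorphism $\mathrm{Aut}(X)\to G$, $f\mapsto d(x,f(x))$, where $x\in X$ is any point and $x\cdot d(x,y)=y$ (the structure does not depend on $x$). A functor $F:\Pi^{\mathrm{thin}}(M)\to G\text{-}\mathsf{tors}$ is a transport functor if for every $x\in M$ the map $F|_{\pi_1^{\mathrm{thin}}(M,x)}:\pi_1^{\mathrm{thin}}(M,x)\to\mathrm{Aut}(F(x))$ is smooth. Parallel transport.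 $\|^A_\gamma:P_{\gamma(0)}\to P_{\gamma(1)}$ sends $z$ to the endpoint of the $A$-horizontal lift of $\gamma$ starting at $z$. *)

theory Defs
  imports
    "HOL-Analysis.Analysis"
    "HOL-Algebra.Group"
    "HOL-Library.Function_Algebras"
begin

section \<open>Smooth functions on open subsets of Euclidean spaces\<close>

text \<open>
  The space \<open>\<real>\<^sup>n\<close>, for a natural number \<open>n\<close> (possibly \<open>0\<close>), is the library's
  \<^term>\<open>Euclidean_space n\<close>: sequences vanishing from index \<open>n\<close> on, with the product topology.
\<close>

definition partial_deriv :: "nat \<Rightarrow> ((nat \<Rightarrow> real) \<Rightarrow> real) \<Rightarrow> (nat \<Rightarrow> real) \<Rightarrow> real" where
  "partial_deriv i f x = deriv (\<lambda>t. f (x(i := t))) (x i)"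

primrec Ck_on :: "nat \<Rightarrow> nat \<Rightarrow> (nat \<Rightarrow> real) set \<Rightarrow> ((nat \<Rightarrow> real) \<Rightarrow> real) \<Rightarrow> bool" where
  "Ck_on n 0 U f \<longleftrightarrow>
     continuous_map (subtopology (Euclidean_space n) U) euclideanreal f"
| "Ck_on n (Suc k) U f \<longleftrightarrow>
     continuous_map (subtopology (Euclidean_space n) U) euclideanreal f \<and>
     (\<forall>i<n. (\<forall>x\<in>U. (\<lambda>t. f (x(i := t))) field_differentiable at (x i)) \<and>
            Ck_on n k U (partial_deriv i f))"

definition smooth_fun_on :: "nat \<Rightarrow> (nat \<Rightarrow> real) set \<Rightarrow> ((nat \<Rightarrow> real) \<Rightarrow> real) \<Rightarrow> bool" where
  "smooth_fun_on n U f \<longleftrightarrow> openin (Euclidean_space n) U \<and> (\<forall>k. Ck_on n k U f)"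

definition smooth_on ::
  "nat \<Rightarrow> (nat \<Rightarrow> real) set \<Rightarrow> nat \<Rightarrow> ((nat \<Rightarrow> real) \<Rightarrow> (nat \<Rightarrow> real)) \<Rightarrow> bool" where
  "smooth_on n U m f \<longleftrightarrow>
     openin (Euclidean_space n) U \<and> f ` U \<subseteq> topspace (Euclidean_space m) \<and>
     (\<forall>j<m. smooth_fun_on n U (\<lambda>x. f x j))"


section \<open>Diffeological spaces\<close>

text \<open>
  A plot is a triple \<open>(n, U, p)\<close> where \<open>U\<close> is open in \<open>\<real>\<^sup>n\<close> and \<open>p\<close> is a map on \<open>U\<close>,
  extended by \<^const>\<open>undefined\<close> outside \<open>U\<close>.
\<close>

type_synonym 'a plot = "nat \<times> (nat \<Rightarrow> real) set \<times> ((nat \<Rightarrow> real) \<Rightarrow> 'a)"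

record 'a dspace = "'a partial_object" +
  plots :: "'a plot set"

definition diffeology :: "('a, 'z) dspace_scheme \<Rightarrow> bool" where
  "diffeology X \<longleftrightarrow>
     (\<forall>(n, U, p) \<in> plots X. openin (Euclidean_space n) U \<and> p \<in> U \<rightarrow>\<^sub>E carrier X) \<and>
     (\<forall>n U. \<forall>x\<in>carrier X. openin (Euclidean_space n) U \<longrightarrow> (n, U, restrict (\<lambda>_. x) U) \<in> plots X) \<and>
     (\<forall>(n, U, p) \<in> plots X. \<forall>m V h. smooth_on m V n h \<and> h ` V \<subseteq> U
         \<longrightarrow> (m, V, restrict (p \<circ> h) V) \<in> plots X) \<and>
     (\<forall>n U p. openin (Euclidean_space n) U \<and> p \<in> U \<rightarrow>\<^sub>E carrier X \<and>
         (\<forall>u\<in>U. \<exists>V. u \<in> V \<and> V \<subseteq> U \<and> (n, V, restrict p V) \<in> plots X)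
         \<longrightarrow> (n, U, p) \<in> plots X)"

definition smooth_map ::
  "('a, 'y) dspace_scheme \<Rightarrow> ('b, 'z) dspace_scheme \<Rightarrow> ('a \<Rightarrow> 'b) \<Rightarrow> bool" where
  "smooth_map X Y f \<longleftrightarrow>
     f \<in> carrier X \<rightarrow> carrier Y \<and>
     (\<forall>(n, U, p) \<in> plots X. (n, U, restrict (f \<circ> p) U) \<in> plots Y)"

definition diffeomorphism ::
  "('a, 'y) dspace_scheme \<Rightarrow> ('b, 'z) dspace_scheme \<Rightarrow> ('a \<Rightarrow> 'b) \<Rightarrow> bool" where
  "diffeomorphism X Y f \<longleftrightarrow>
     bij_betw f (carrier X) (carrier Y) \<and>
     smooth_map X Y f \<and> smooth_map Y X (inv_into (carrier X) f)"

definition subspace_dspace :: "('a, 'z) dspace_scheme \<Rightarrow> 'a set \<Rightarrow> 'a dspace" where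
  "subspace_dspace X Y =
     \<lparr> carrier = Y, plots = {(n, U, p) \<in> plots X. p ` U \<subseteq> Y} \<rparr>"

definition product_dspace ::
  "('a, 'y) dspace_scheme \<Rightarrow> ('b, 'z) dspace_scheme \<Rightarrow> ('a \<times> 'b) dspace" where
  "product_dspace X Y =
     \<lparr> carrier = carrier X \<times> carrier Y,
       plots = {(n, U, p). p \<in> extensional U \<and>
                  (n, U, restrict (fst \<circ> p) U) \<in> plots X \<and>
                  (n, U, restrict (snd \<circ> p) U) \<in> plots Y} \<rparr>"

definition quotient_dspace :: "('a, 'z) dspace_scheme \<Rightarrow> ('a \<times> 'a) set \<Rightarrow> 'a set dspace" where
  "quotient_dspace X R =
     \<lparr> carrier = carrier X // R,
       plots = {(n, U, q). openin (Euclidean_space n) U \<and> q \<in> U \<rightarrow>\<^sub>E carrier X // R \<and>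
                  (\<forall>u\<in>U. \<exists>V p. u \<in> V \<and> V \<subseteq> U \<and> (n, V, p) \<in> plots X \<and>
                               (\<forall>v\<in>V. q v = R `` {p v}))} \<rparr>"

definition D_open :: "('a, 'z) dspace_scheme \<Rightarrow> 'a set \<Rightarrow> bool" where
  "D_open X W \<longleftrightarrow>
     W \<subseteq> carrier X \<and>
     (\<forall>(n, U, p) \<in> plots X. openin (Euclidean_space n) {u \<in> U. p u \<in> W})"

text \<open>
  Smoothness on a subset \<open>S\<close> of \<open>\<real>\<^sup>n\<close> that need not be open (such as \<open>[0,1]\<close>, \<open>U \<times> [0,1]\<close> or
  \<open>[0,1]\<^sup>2\<close>) means local extendability to a smooth map on an open subset of \<open>\<real>\<^sup>n\<close>.
\<close>

definition smooth_from ::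
  "nat \<Rightarrow> (nat \<Rightarrow> real) set \<Rightarrow> ('a, 'z) dspace_scheme \<Rightarrow> ((nat \<Rightarrow> real) \<Rightarrow> 'a) \<Rightarrow> bool" where
  "smooth_from n S X f \<longleftrightarrow>
     (\<forall>x\<in>S. \<exists>V g. x \<in> V \<and> (n, V, g) \<in> plots X \<and> (\<forall>y\<in>S \<inter> V. f y = g y))"


section \<open>Manifolds\<close>

definition smooth_atlas ::
  "nat \<Rightarrow> 'a topology \<Rightarrow> ('a set \<times> ('a \<Rightarrow> nat \<Rightarrow> real)) set \<Rightarrow> bool" where
  "smooth_atlas n T \<A> \<longleftrightarrow>
     Hausdorff_space T \<and> second_countable T \<and>
     (\<Union>(W, c)\<in>\<A>. W) = topspace T \<and>
     (\<forall>(W, c)\<in>\<A>. openin T W \<and> openin (Euclidean_space n) (c ` W) \<and>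
        homeomorphic_map (subtopology T W) (subtopology (Euclidean_space n) (c ` W)) c) \<and>
     (\<forall>(W, c)\<in>\<A>. \<forall>(W', c')\<in>\<A>. smooth_on n (c ` (W \<inter> W')) n (c' \<circ> inv_into W c))"

definition atlas_plots ::
  "nat \<Rightarrow> 'a topology \<Rightarrow> ('a set \<times> ('a \<Rightarrow> nat \<Rightarrow> real)) set \<Rightarrow> 'a plot set" where
  "atlas_plots n T \<A> =
     {(k, U, p). openin (Euclidean_space k) U \<and> p \<in> U \<rightarrow>\<^sub>E topspace T \<and>
        continuous_map (subtopology (Euclidean_space k) U) T p \<and>
        (\<forall>(W, c)\<in>\<A>. smooth_on k {u \<in> U. p u \<in> W} n (c \<circ> p))}"

text \<open>
  A manifold is a diffeological space whose plots are the smooth maps for some (Hausdorff,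
  second countable, finite-dimensional) smooth manifold structure on its carrier.
\<close>

definition manifold :: "('a, 'z) dspace_scheme \<Rightarrow> bool" where
  "manifold X \<longleftrightarrow> diffeology X \<and>
     (\<exists>n T \<A>. smooth_atlas n T \<A> \<and> carrier X = topspace T \<and> plots X = atlas_plots n T \<A>)"

definition smooth_functions :: "('a, 'z) dspace_scheme \<Rightarrow> ('a \<Rightarrow> real) set" where
  "smooth_functions X = {f. \<forall>(n, U, p) \<in> plots X. smooth_fun_on n U (f \<circ> p)}"

text \<open>
  Tangent vectors at \<open>x\<close> are derivations of the algebra of smooth functions. Values outside the
  carrier are irrelevant to membership in \<^const>\<open>smooth_functions\<close>; a derivation
  ignores them automatically, by the Leibniz rule. Derivations are set to \<open>0\<close> on non-smooth
  arguments, so that equality of functionals is equality of tangent vectors.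
\<close>

type_synonym 'a tvec = "('a \<Rightarrow> real) \<Rightarrow> real"

definition tangent_space :: "('a, 'z) dspace_scheme \<Rightarrow> 'a \<Rightarrow> 'a tvec set" where
  "tangent_space X x =
     {v. (\<forall>f. f \<notin> smooth_functions X \<longrightarrow> v f = 0) \<and>
         (\<forall>f\<in>smooth_functions X. \<forall>g\<in>smooth_functions X. \<forall>a b :: real.
            v (\<lambda>y. a * f y + b * g y) = a * v f + b * v g) \<and>
         (\<forall>f\<in>smooth_functions X. \<forall>g\<in>smooth_functions X.
            v (\<lambda>y. f y * g y) = f x * v g + g x * v f)}"

definition scale_tvec :: "real \<Rightarrow> 'a tvec \<Rightarrow> 'a tvec" where
  "scale_tvec c v = (\<lambda>f. c * v f)"

definition pushforward :: "('b, 'z) dspace_scheme \<Rightarrow> ('a \<Rightarrow> 'b) \<Rightarrow> 'a tvec \<Rightarrow> 'b tvec" where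
  "pushforward Y F v = (\<lambda>f. if f \<in> smooth_functions Y then v (f \<circ> F) else 0)"

definition velocity :: "('a, 'z) dspace_scheme \<Rightarrow> (real \<Rightarrow> 'a) \<Rightarrow> real \<Rightarrow> 'a tvec" where
  "velocity X \<gamma> t =
     (\<lambda>f. if f \<in> smooth_functions X
          then vector_derivative (f \<circ> \<gamma>) (at t within {0..1}) else 0)"

text \<open>The image of the \<open>i\<close>-th coordinate vector at \<open>u\<close> under the differential of a plot.\<close>

definition plot_partial ::
  "('a, 'z) dspace_scheme \<Rightarrow> nat \<Rightarrow> ((nat \<Rightarrow> real) \<Rightarrow> 'a) \<Rightarrow> (nat \<Rightarrow> real) \<Rightarrow> 'a tvec" where
  "plot_partial X i p u =
     (\<lambda>f. if f \<in> smooth_functions X then partial_deriv i (f \<circ> p) u else 0)"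


section \<open>The thin fundamental groupoid\<close>

definition smooth_path :: "('a, 'z) dspace_scheme \<Rightarrow> (real \<Rightarrow> 'a) \<Rightarrow> bool" where
  "smooth_path X \<gamma> \<longleftrightarrow>
     smooth_from 1 {x \<in> topspace (Euclidean_space 1). x 0 \<in> {0..1}} X (\<lambda>x. \<gamma> (x 0))"

definition sitting_paths :: "('a, 'z) dspace_scheme \<Rightarrow> (real \<Rightarrow> 'a) set" where
  "sitting_paths M =
     {\<gamma> \<in> {0..1} \<rightarrow>\<^sub>E carrier M. smooth_path M \<gamma> \<and>
        (\<exists>\<epsilon>>0. (\<forall>t\<in>{0..1}. t < \<epsilon> \<longrightarrow> \<gamma> t = \<gamma> 0) \<and>
               (\<forall>t\<in>{0..1}. 1 - \<epsilon> < t \<longrightarrow> \<gamma> t = \<gamma> 1))}"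

text \<open>A pair \<open>(u, t) \<in> U \<times> [0,1]\<close> is encoded as the point \<open>u(n := t)\<close> of \<open>\<real>\<^sup>n\<^sup>+\<^sup>1\<close>.\<close>

definition path_space :: "('a, 'z) dspace_scheme \<Rightarrow> (real \<Rightarrow> 'a) dspace" where
  "path_space M =
     \<lparr> carrier = sitting_paths M,
       plots = {(n, U, p). openin (Euclidean_space n) U \<and> p \<in> U \<rightarrow>\<^sub>E sitting_paths M \<and>
                  smooth_from (Suc n)
                    {x \<in> topspace (Euclidean_space (Suc n)). x(n := 0) \<in> U \<and> x n \<in> {0..1}}
                    M (\<lambda>x. p (x(n := 0)) (x n))} \<rparr>"

definition square_differential ::
  "('a, 'z) dspace_scheme \<Rightarrow> (real \<Rightarrow> real \<Rightarrow> 'a) \<Rightarrow> real \<Rightarrow> real \<Rightarrow> real \<times> real \<Rightarrow> 'a tvec" where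
  "square_differential M H s t = (\<lambda>(a, b). \<lambda>f.
     a * velocity M (\<lambda>s'. H s' t) s f + b * velocity M (\<lambda>t'. H s t') t f)"

definition rank_differential ::
  "('a, 'z) dspace_scheme \<Rightarrow> (real \<Rightarrow> real \<Rightarrow> 'a) \<Rightarrow> real \<Rightarrow> real \<Rightarrow> nat" where
  "rank_differential M H s t =
     vector_space.dim scale_tvec (range (square_differential M H s t))"

definition thin_homotopy ::
  "('a, 'z) dspace_scheme \<Rightarrow> (real \<Rightarrow> 'a) \<Rightarrow> (real \<Rightarrow> 'a) \<Rightarrow> (real \<Rightarrow> real \<Rightarrow> 'a) \<Rightarrow> bool" where
  "thin_homotopy M \<gamma>0 \<gamma>1 H \<longleftrightarrow>
     smooth_from 2 {x \<in> topspace (Euclidean_space 2). x 0 \<in> {0..1} \<and> x 1 \<in> {0..1}}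
       M (\<lambda>x. H (x 0) (x 1)) \<and>
     (\<forall>s\<in>{0..1}. H s 0 = \<gamma>0 s \<and> H s 1 = \<gamma>1 s) \<and>
     (\<forall>t\<in>{0..1}. H 0 t = \<gamma>0 0 \<and> H 1 t = \<gamma>0 1) \<and>
     (\<forall>s\<in>{0..1}. \<forall>t\<in>{0..1}. rank_differential M H s t \<le> 1) \<and>
     (\<exists>\<epsilon>>0. \<forall>s\<in>{0..1}. \<forall>t\<in>{0..1}.
        (s < \<epsilon> \<longrightarrow> H s t = H 0 t) \<and> (1 - \<epsilon> < s \<longrightarrow> H s t = H 1 t) \<and>
        (t < \<epsilon> \<longrightarrow> H s t = H s 0) \<and> (1 - \<epsilon> < t \<longrightarrow> H s t = H s 1))"

definition thin_rel :: "('a, 'z) dspace_scheme \<Rightarrow> ((real \<Rightarrow> 'a) \<times> (real \<Rightarrow> 'a)) set" where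
  "thin_rel M =
     {(\<gamma>0, \<gamma>1). \<gamma>0 \<in> sitting_paths M \<and> \<gamma>1 \<in> sitting_paths M \<and>
        \<gamma>0 0 = \<gamma>1 0 \<and> \<gamma>0 1 = \<gamma>1 1 \<and> (\<exists>H. thin_homotopy M \<gamma>0 \<gamma>1 H)}"

definition concat_path :: "(real \<Rightarrow> 'a) \<Rightarrow> (real \<Rightarrow> 'a) \<Rightarrow> real \<Rightarrow> 'a" where
  "concat_path \<gamma> \<tau> =
     restrict (\<lambda>t. if t \<le> 1/2 then \<tau> (2 * t) else \<gamma> (2 * t - 1)) {0..1}"

definition const_path :: "'a \<Rightarrow> real \<Rightarrow> 'a" where
  "const_path x = restrict (\<lambda>_. x) {0..1}"

definition thin_arrows :: "('a, 'z) dspace_scheme \<Rightarrow> (real \<Rightarrow> 'a) set dspace" where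
  "thin_arrows M = quotient_dspace (path_space M) (thin_rel M)"

record ('o, 'r) groupoid_data =
  Obj :: "'o set"
  Arr :: "'r set"
  Src :: "'r \<Rightarrow> 'o"
  Tgt :: "'r \<Rightarrow> 'o"
  Comp :: "'r \<Rightarrow> 'r \<Rightarrow> 'r"
  Unit :: "'o \<Rightarrow> 'r"
  Inv :: "'r \<Rightarrow> 'r"

text \<open>
  \<^term>\<open>Comp C a b\<close> is \<open>b\<close> followed by \<open>a\<close>. The unions over representatives below are the usual
  way of lifting a congruence to equivalence classes.
\<close>

definition thin_groupoid ::
  "('a, 'z) dspace_scheme \<Rightarrow> ('a, (real \<Rightarrow> 'a) set) groupoid_data" where
  "thin_groupoid M =
     \<lparr> Obj = carrier M,
       Arr = carrier (thin_arrows M),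
       Src = (\<lambda>a. the_elem ((\<lambda>\<gamma>. \<gamma> 0) ` a)),
       Tgt = (\<lambda>a. the_elem ((\<lambda>\<gamma>. \<gamma> 1) ` a)),
       Comp = (\<lambda>a b. \<Union>\<gamma>\<in>a. \<Union>\<tau>\<in>b. thin_rel M `` {concat_path \<gamma> \<tau>}),
       Unit = (\<lambda>x. thin_rel M `` {const_path x}),
       Inv = (\<lambda>a. \<Union>\<gamma>\<in>a. thin_rel M `` {restrict (\<lambda>t. \<gamma> (1 - t)) {0..1}}) \<rparr>"

definition thin_pi1 :: "('a, 'z) dspace_scheme \<Rightarrow> 'a \<Rightarrow> (real \<Rightarrow> 'a) set dspace" where
  "thin_pi1 M x =
     subspace_dspace (thin_arrows M)
       {a \<in> Arr (thin_groupoid M). Src (thin_groupoid M) a = x \<and> Tgt (thin_groupoid M) a = x}"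

definition is_functor ::
  "('o, 'r) groupoid_data \<Rightarrow> ('p, 's) groupoid_data \<Rightarrow> ('o \<Rightarrow> 'p) \<Rightarrow> ('r \<Rightarrow> 's) \<Rightarrow> bool" where
  "is_functor C D Fo Fa \<longleftrightarrow>
     (\<forall>x\<in>Obj C. Fo x \<in> Obj D) \<and>
     (\<forall>a\<in>Arr C. Fa a \<in> Arr D \<and> Src D (Fa a) = Fo (Src C a) \<and> Tgt D (Fa a) = Fo (Tgt C a)) \<and>
     (\<forall>x\<in>Obj C. Fa (Unit C x) = Unit D (Fo x)) \<and>
     (\<forall>a\<in>Arr C. \<forall>b\<in>Arr C. Src C a = Tgt C b
        \<longrightarrow> Fa (Comp C a b) = Comp D (Fa a) (Fa b))"


section \<open>Lie groups and torsors\<close>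

record 'g lie_group_data = "'g monoid" +
  group_plots :: "'g plot set"

definition lie_space :: "('g, 'z) lie_group_data_scheme \<Rightarrow> 'g dspace" where
  "lie_space G = \<lparr> carrier = carrier G, plots = group_plots G \<rparr>"

definition lie_group :: "('g, 'z) lie_group_data_scheme \<Rightarrow> bool" where
  "lie_group G \<longleftrightarrow>
     group G \<and> manifold (lie_space G) \<and>
     smooth_map (product_dspace (lie_space G) (lie_space G)) (lie_space G)
       (\<lambda>(g, h). g \<otimes>\<^bsub>G\<^esub> h) \<and>
     smooth_map (lie_space G) (lie_space G) (\<lambda>g. inv\<^bsub>G\<^esub> g)"

record ('x, 'g) gspace = "'x dspace" +
  act :: "'x \<Rightarrow> 'g \<Rightarrow> 'x"

definition smooth_right_action ::
  "('g, 'z) lie_group_data_scheme \<Rightarrow> ('x, 'g) gspace \<Rightarrow> bool" where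
  "smooth_right_action G X \<longleftrightarrow>
     smooth_map (product_dspace X (lie_space G)) X (\<lambda>(x, g). act X x g) \<and>
     (\<forall>x\<in>carrier X. act X x \<one>\<^bsub>G\<^esub> = x) \<and>
     (\<forall>x\<in>carrier X. \<forall>g\<in>carrier G. \<forall>h\<in>carrier G.
        act X x (g \<otimes>\<^bsub>G\<^esub> h) = act X (act X x g) h)"

definition torsor :: "('g, 'z) lie_group_data_scheme \<Rightarrow> ('x, 'g) gspace \<Rightarrow> bool" where
  "torsor G X \<longleftrightarrow>
     manifold X \<and> carrier X \<noteq> {} \<and> smooth_right_action G X \<and>
     (\<forall>x\<in>carrier X. \<forall>g\<in>carrier G. act X x g = x \<longrightarrow> g = \<one>\<^bsub>G\<^esub>) \<and>
     (\<forall>x\<in>carrier X. \<forall>y\<in>carrier X. \<exists>g\<in>carrier G. act X x g = y) \<and>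
     diffeomorphism (product_dspace X (lie_space G)) (product_dspace X X)
       (\<lambda>(x, g). (x, act X x g))"

definition torsor_diff ::
  "('g, 'z) lie_group_data_scheme \<Rightarrow> ('x, 'g) gspace \<Rightarrow> 'x \<Rightarrow> 'x \<Rightarrow> 'g" where
  "torsor_diff G X x y = (THE g. g \<in> carrier G \<and> act X x g = y)"

definition equivariant ::
  "('g, 'z) lie_group_data_scheme \<Rightarrow> ('x, 'g) gspace \<Rightarrow> ('x, 'g) gspace \<Rightarrow> ('x \<Rightarrow> 'x) \<Rightarrow> bool" where
  "equivariant G X Y f \<longleftrightarrow>
     (\<forall>x\<in>carrier X. \<forall>g\<in>carrier G. f (act X x g) = act Y (f x) g)"

text \<open>
  A morphism of torsors carries its source and target. As types are fixed, the objects of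
  \<open>torsor_groupoid G\<close> are the torsors whose points are taken from a given type \<open>'x\<close>.
\<close>

record ('x, 'g) torsor_map =
  tm_dom :: "('x, 'g) gspace"
  tm_cod :: "('x, 'g) gspace"
  tm_fun :: "'x \<Rightarrow> 'x"

definition torsor_groupoid ::
  "('g, 'z) lie_group_data_scheme \<Rightarrow> (('x, 'g) gspace, ('x, 'g) torsor_map) groupoid_data" where
  "torsor_groupoid G =
     \<lparr> Obj = {X. torsor G X},
       Arr = {\<lparr> tm_dom = X, tm_cod = Y, tm_fun = f \<rparr> | X Y f.
                torsor G X \<and> torsor G Y \<and> f \<in> carrier X \<rightarrow>\<^sub>E carrier Y \<and> equivariant G X Y f},
       Src = tm_dom,
       Tgt = tm_cod,
       Comp = (\<lambda>a b. \<lparr> tm_dom = tm_dom b, tm_cod = tm_cod a,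
                       tm_fun = compose (carrier (tm_dom b)) (tm_fun a) (tm_fun b) \<rparr>),
       Unit = (\<lambda>X. \<lparr> tm_dom = X, tm_cod = X, tm_fun = restrict id (carrier X) \<rparr>),
       Inv = (\<lambda>a. \<lparr> tm_dom = tm_cod a, tm_cod = tm_dom a,
                    tm_fun = restrict (inv_into (carrier (tm_dom a)) (tm_fun a))
                               (carrier (tm_cod a)) \<rparr>) \<rparr>"

text \<open>
  The smooth structure of \<open>Aut(X)\<close> is transported along \<open>f \<mapsto> d(x, f x)\<close>; it does not depend
  on the base point \<open>x\<close>, so quantifying over all base points involves no choice.
\<close>

definition aut_space ::
  "('g, 'z) lie_group_data_scheme \<Rightarrow> ('x, 'g) gspace \<Rightarrow> ('x, 'g) torsor_map dspace" where
  "aut_space G X =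
     (let Aut = {a \<in> Arr (torsor_groupoid G). tm_dom a = X \<and> tm_cod a = X} in
      \<lparr> carrier = Aut,
        plots = {(n, U, q). q \<in> U \<rightarrow>\<^sub>E Aut \<and>
                   (\<forall>x\<in>carrier X.
                      (n, U, restrict (\<lambda>u. torsor_diff G X x (tm_fun (q u) x)) U)
                        \<in> plots (lie_space G))} \<rparr>)"

definition transport_functor ::
  "('g, 'z) lie_group_data_scheme \<Rightarrow> ('m, 'y) dspace_scheme
     \<Rightarrow> ('m \<Rightarrow> ('x, 'g) gspace) \<Rightarrow> ((real \<Rightarrow> 'm) set \<Rightarrow> ('x, 'g) torsor_map) \<Rightarrow> bool" where
  "transport_functor G M Fo Fa \<longleftrightarrow>
     is_functor (thin_groupoid M) (torsor_groupoid G) Fo Fa \<and>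
     (\<forall>x\<in>carrier M. smooth_map (thin_pi1 M x) (aut_space G (Fo x)) Fa)"


section \<open>Principal bundles, connections and parallel transport\<close>

definition principal_bundle ::
  "('g, 'z) lie_group_data_scheme \<Rightarrow> ('m, 'y) dspace_scheme
     \<Rightarrow> ('p, 'g) gspace \<Rightarrow> ('p \<Rightarrow> 'm) \<Rightarrow> bool" where
  "principal_bundle G M P \<pi> \<longleftrightarrow>
     manifold P \<and> smooth_map P M \<pi> \<and> smooth_right_action G P \<and>
     (\<forall>p\<in>carrier P. \<forall>g\<in>carrier G. \<pi> (act P p g) = \<pi> p) \<and>
     (\<forall>x\<in>carrier M. \<exists>U \<phi>. x \<in> U \<and> D_open M U \<and>
        diffeomorphism (subspace_dspace P {p \<in> carrier P. \<pi> p \<in> U})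
          (product_dspace (subspace_dspace M U) (lie_space G)) \<phi> \<and>
        (\<forall>p\<in>carrier P. \<pi> p \<in> U \<longrightarrow>
           fst (\<phi> p) = \<pi> p \<and>
           (\<forall>g\<in>carrier G. \<phi> (act P p g) = (\<pi> p, snd (\<phi> p) \<otimes>\<^bsub>G\<^esub> g))))"

definition lie_algebra :: "('g, 'z) lie_group_data_scheme \<Rightarrow> 'g tvec set" where
  "lie_algebra G = tangent_space (lie_space G) \<one>\<^bsub>G\<^esub>"

definition Ad :: "('g, 'z) lie_group_data_scheme \<Rightarrow> 'g \<Rightarrow> 'g tvec \<Rightarrow> 'g tvec" where
  "Ad G g = pushforward (lie_space G) (\<lambda>h. g \<otimes>\<^bsub>G\<^esub> h \<otimes>\<^bsub>G\<^esub> inv\<^bsub>G\<^esub> g)"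

text \<open>
  Smoothness of a \<open>\<gg>\<close>-valued 1-form: the coefficients of its pullback along every plot (in
  particular along every inverse chart) are smooth. A map \<open>w\<close> into the finite-dimensional space
  \<open>\<gg>\<close> of derivations is smooth iff \<open>u \<mapsto> w u f\<close> is smooth for every smooth function \<open>f\<close>, since
  evaluations at smooth functions span the dual of \<open>\<gg>\<close>.
\<close>

definition smooth_lie_form ::
  "('g, 'z) lie_group_data_scheme \<Rightarrow> ('p, 'y) dspace_scheme
     \<Rightarrow> ('p \<Rightarrow> 'p tvec \<Rightarrow> 'g tvec) \<Rightarrow> bool" where
  "smooth_lie_form G P A \<longleftrightarrow>
     (\<forall>p\<in>carrier P. \<forall>v\<in>tangent_space P p. A p v \<in> lie_algebra G) \<and>
     (\<forall>p\<in>carrier P. \<forall>v\<in>tangent_space P p. \<forall>w\<in>tangent_space P p. \<forall>a b.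
        A p (scale_tvec a v + scale_tvec b w) = scale_tvec a (A p v) + scale_tvec b (A p w)) \<and>
     (\<forall>(n, U, q)\<in>plots P. \<forall>i<n. \<forall>f\<in>smooth_functions (lie_space G).
        smooth_fun_on n U (\<lambda>u. A (q u) (plot_partial P i q u) f))"

definition connection_form ::
  "('g, 'z) lie_group_data_scheme \<Rightarrow> ('p, 'g) gspace \<Rightarrow> ('p \<Rightarrow> 'p tvec \<Rightarrow> 'g tvec) \<Rightarrow> bool" where
  "connection_form G P A \<longleftrightarrow>
     smooth_lie_form G P A \<and>
     (\<forall>p\<in>carrier P. \<forall>\<xi>\<in>lie_algebra G. A p (pushforward P (act P p) \<xi>) = \<xi>) \<and>
     (\<forall>p\<in>carrier P. \<forall>g\<in>carrier G. \<forall>v\<in>tangent_space P p.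
        A (act P p g) (pushforward P (\<lambda>q. act P q g) v) = Ad G (inv\<^bsub>G\<^esub> g) (A p v))"

definition fibre :: "('p, 'g) gspace \<Rightarrow> ('p \<Rightarrow> 'm) \<Rightarrow> 'm \<Rightarrow> ('p, 'g) gspace" where
  "fibre P \<pi> x =
     (let F = {p \<in> carrier P. \<pi> p = x} in
      \<lparr> carrier = F, plots = plots (subspace_dspace P F), act = act P \<rparr>)"

definition horizontal_lift ::
  "('p, 'g) gspace \<Rightarrow> ('p \<Rightarrow> 'm) \<Rightarrow> ('p \<Rightarrow> 'p tvec \<Rightarrow> 'g tvec)
     \<Rightarrow> (real \<Rightarrow> 'm) \<Rightarrow> (real \<Rightarrow> 'p) \<Rightarrow> bool" where
  "horizontal_lift P \<pi> A \<gamma> \<sigma> \<longleftrightarrow>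
     smooth_path P \<sigma> \<and>
     (\<forall>t\<in>{0..1}. \<sigma> t \<in> carrier P \<and> \<pi> (\<sigma> t) = \<gamma> t \<and> A (\<sigma> t) (velocity P \<sigma> t) = 0)"

definition parallel_transport ::
  "('p, 'g) gspace \<Rightarrow> ('p \<Rightarrow> 'm) \<Rightarrow> ('p \<Rightarrow> 'p tvec \<Rightarrow> 'g tvec) \<Rightarrow> (real \<Rightarrow> 'm) \<Rightarrow> 'p \<Rightarrow> 'p" where
  "parallel_transport P \<pi> A \<gamma> =
     restrict (\<lambda>z. THE w. \<exists>\<sigma>. horizontal_lift P \<pi> A \<gamma> \<sigma> \<and> \<sigma> 0 = z \<and> \<sigma> 1 = w)
       (carrier (fibre P \<pi> (\<gamma> 0)))"

definition transport_map ::
  "('p, 'g) gspace \<Rightarrow> ('p \<Rightarrow> 'm) \<Rightarrow> ('p \<Rightarrow> 'p tvec \<Rightarrow> 'g tvec)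
     \<Rightarrow> (real \<Rightarrow> 'm) \<Rightarrow> ('p, 'g) torsor_map" where
  "transport_map P \<pi> A \<gamma> =
     \<lparr> tm_dom = fibre P \<pi> (\<gamma> 0), tm_cod = fibre P \<pi> (\<gamma> 1),
       tm_fun = parallel_transport P \<pi> A \<gamma> \<rparr>"

text \<open>
  The value of the holonomy on an arrow is computed from an arbitrary representative; that it does
  not depend on this choice is not built into the definition.
\<close>

definition hol ::
  "('p, 'g) gspace \<Rightarrow> ('p \<Rightarrow> 'm) \<Rightarrow> ('p \<Rightarrow> 'p tvec \<Rightarrow> 'g tvec)
     \<Rightarrow> (real \<Rightarrow> 'm) set \<Rightarrow> ('p, 'g) torsor_map" where
  "hol P \<pi> A a = transport_map P \<pi> A (SOME \<gamma>. \<gamma> \<in> a)"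

end

theory Submission
  imports Defs
begin

text \<open>
  Locally \<open>\<gamma>\<close> lifts to a path \<open>s\<close> in \<open>P\<close>, and \<open>s \<cdot> g\<close> is horizontal iff \<open>g\<close> solves an ordinary
  differential equation on \<open>G\<close> with coefficients \<open>A (s')\<close>. Its solutions depend smoothly on
  parameters; right translation continues them along all of \<open>\<gamma>\<close>, and two horizontal lifts of the
  same path differ by a constant element of \<open>G\<close>. Hence parallel transport exists, is equivariant,
  is compatible with concatenation, and depends smoothly on \<open>\<gamma>\<close>.

  Let \<open>H\<close> be a thin homotopy and let \<open>\<sigma>(t, s)\<close> be the horizontal lift of \<open>s \<mapsto> H s t\<close> from a fixed
  point. Where \<open>dH\<close> has rank at most 1, some combination of \<open>\<partial>\<^sub>t\<sigma>\<close> and \<open>\<partial>\<^sub>s\<sigma>\<close> is vertical. The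
  curvature is horizontal, so it vanishes on this pair of vectors, and as \<open>A(\<partial>\<^sub>s\<sigma>) = 0\<close> this amounts to
  \<open>\<partial>\<^sub>s (A(\<partial>\<^sub>t\<sigma>)) = 0\<close>. Since \<open>A(\<partial>\<^sub>t\<sigma>)\<close> is zero at \<open>s = 0\<close>, the end points \<open>\<sigma>(t, 1)\<close> form a horizontal
  curve over a constant path, and therefore do not depend on \<open>t\<close>.
\<close>

section \<open>Calculus on open subsets of Euclidean spaces\<close>

text \<open>A rank at most 1 gives a linear relation between the two partial derivatives of
  \<open>H\<close> at each point separately. The coefficients need not vary continuously, so the
  argument has to stay pointwise. This is possible because the antisymmetrised derivative of
  \<open>A\<close> along a surface depends only on the tangent vectors of the surface at the point,
  the second derivatives cancelling. The surface of lifts may thus be replaced, at one point, by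
  another with the same tangent vectors, on which the vanishing is visible from equivariance and
  from the values of \<open>A\<close> on vertical vectors; horizontality of the curvature enters in
  this form only.

  Paths and homotopies live on closed sets and are smooth only in the sense of local extension.
  Composition with a smooth map of the line into [0,1] that fixes 0 and 1 turns them into plots on
  open sets, and parallel transport does not notice the change of parameter. The zeros of the
  derivative of this map are harmless: there one of the two partial derivatives vanishes and the
  linear relation is trivial.\<close>

definition eucl :: "nat \<Rightarrow> (nat \<Rightarrow> real) set" where
  "eucl n = {x. \<forall>i\<ge>n. x i = 0}"

lemma topspace_eucl [simp]: "topspace (Euclidean_space n) = eucl n"
  by (simp add: topspace_Euclidean_space eucl_def)

abbreviation open_eucl :: "nat \<Rightarrow> (nat \<Rightarrow> real) set \<Rightarrow> bool" where
  "open_eucl n U \<equiv> openin (Euclidean_space n) U"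

text \<open>Cubes rather than balls serve as basic neighbourhoods: a point that takes each
  coordinate from one of two points of a cube lies in the cube again, which suits the mean value
  argument with one coordinate changed at a time.\<close>

definition cube :: "nat \<Rightarrow> (nat \<Rightarrow> real) \<Rightarrow> real \<Rightarrow> (nat \<Rightarrow> real) set" where
  "cube n x d = {y \<in> eucl n. \<forall>i<n. \<bar>y i - x i\<bar> < d}"

lemma in_eucl: "x \<in> eucl n \<longleftrightarrow> (\<forall>i\<ge>n. x i = 0)"
  by (simp add: eucl_def)

text \<open>The type \<open>nat \<Rightarrow> real\<close> carries the product topology, so all
  Euclidean spaces are subspaces of one type and \<open>continuous_on\<close> and
  \<open>open\<close> become available for them.\<close>

lemma Euclidean_space_eq: "Euclidean_space n = top_of_set (eucl n)"
  by (simp add: Euclidean_space_def eucl_def euclidean_product_topology)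

lemma subtopology_eucl: "U \<subseteq> eucl n \<Longrightarrow> subtopology (Euclidean_space n) U = top_of_set U"
  by (simp add: Euclidean_space_eq subtopology_subtopology Int_absorb1)

lemma open_eucl_subset: "open_eucl n U \<Longrightarrow> U \<subseteq> eucl n"
  by (metis openin_subset topspace_eucl)

lemma cube_subset: "cube n x d \<subseteq> eucl n" by (auto simp: cube_def)

lemma cube_self: "x \<in> eucl n \<Longrightarrow> d > 0 \<Longrightarrow> x \<in> cube n x d" by (auto simp: cube_def)

lemma cube_mono: "d \<le> e \<Longrightarrow> cube n x d \<subseteq> cube n x e" by (force simp: cube_def)

lemma continuous_on_coord: "continuous_on S (\<lambda>x::nat \<Rightarrow> real. x i)"
  using continuous_on_product_coordinates by (rule continuous_on_subset) simp

lemma open_eucl_Int_open: "open S \<Longrightarrow> open_eucl n (eucl n \<inter> S)"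
  by (auto simp: Euclidean_space_eq)

lemma open_eucl_cube: "open_eucl n (cube n x d)"
proof -
  have "open {y. \<bar>y i - x i\<bar> < d}" for i
    by (intro open_Collect_less continuous_intros continuous_on_coord)
  then have "open (\<Inter>i\<in>{..<n}. {y. \<bar>y i - x i\<bar> < d})" by blast
  from open_eucl_Int_open[OF this, of n] show ?thesis
    by (rule back_subst[where P="open_eucl n"]) (auto simp: cube_def)
qed

lemma open_euclD:
  assumes "open_eucl n U" "x \<in> U"
  obtains d where "d > 0" "cube n x d \<subseteq> U"
proof -
  obtain T where T: "open T" "U = eucl n \<inter> T"
    using assms by (auto simp: Euclidean_space_eq openin_open)
  have "openin (product_topology (\<lambda>i. euclidean) UNIV) T"
    using T by (simp add: euclidean_product_topology)
  from product_topology_open_contains_basis[OF this, of x] obtain X where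
    X: "x \<in> (\<Pi>\<^sub>E i\<in>UNIV. X i)" "\<And>i. open (X i)" "(\<Pi>\<^sub>E i\<in>UNIV. X i) \<subseteq> T"
    using assms T by auto
  have "\<exists>e>0. \<forall>t. \<bar>t - x i\<bar> < e \<longrightarrow> t \<in> X i" for i
    using X(1) open_dist[of "X i"] X(2)[of i] by (auto simp: dist_real_def PiE_iff)
  then obtain e where e: "\<And>i. e i > 0" "\<And>i t. \<bar>t - x i\<bar> < e i \<Longrightarrow> t \<in> X i" by metis
  \<comment> \<open>The extra \<open>1\<close> keeps the set nonempty when \<open>n = 0\<close>.
    Coordinates from \<open>n\<close> on impose no condition because they vanish on
    \<open>eucl n\<close>.\<close>
  define d where "d = Min (insert 1 (e ` {..<n}))"
  have d: "d > 0" "\<And>i. i < n \<Longrightarrow> d \<le> e i"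
    unfolding d_def using e(1) by (auto)
  have "cube n x d \<subseteq> U"
  proof
    fix y assume y: "y \<in> cube n x d"
    have "y i \<in> X i" for i
    proof (cases "i < n")
      case True then show ?thesis using y d(2)[OF True] by (intro e(2)) (force simp: cube_def)
    next
      case False
      then have "y i = x i" using y assms T by (auto simp: cube_def in_eucl)
      then show ?thesis using X(1) by auto
    qed
    then show "y \<in> U" using X(3) T y by (auto simp: cube_def)
  qed
  then show ?thesis using d that by blast
qed

lemma open_eucl_local:
  assumes "\<And>x. x \<in> U \<Longrightarrow> \<exists>V. open_eucl n V \<and> x \<in> V \<and> V \<subseteq> U"
  shows "open_eucl n U"
  using assms by (subst openin_subopen) blast

lemma open_eucl_vimage:
  assumes "open_eucl n U" "continuous_on U f" "open S"
  shows "open_eucl n {x \<in> U. f x \<in> S}"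
proof -
  have "openin (top_of_set U) (U \<inter> f -` S)"
    using assms by (intro continuous_openin_preimage_gen)
  then have "open_eucl n (U \<inter> f -` S)"
    using assms(1) unfolding Euclidean_space_eq by (rule openin_trans)
  then show ?thesis by (simp add: vimage_def Int_def)
qed

lemma continuous_on_into_eucl:
  assumes "\<And>j. j < m \<Longrightarrow> continuous_on U (\<lambda>x. h x j)" "h ` U \<subseteq> eucl m"
  shows "continuous_on U h"
proof (rule continuous_on_coordinatewise_then_product)
  fix j
  show "continuous_on U (\<lambda>x. h x j)"
  proof (cases "j < m")
    case False
    then have "\<forall>x\<in>U. h x j = 0" using assms(2) by (auto simp: in_eucl image_subset_iff)
    then show ?thesis using continuous_on_cong[OF refl, of U "\<lambda>x. h x j" "\<lambda>x. 0"] by simp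
  qed (use assms in blast)
qed

lemma open_eucl_preimage:
  assumes U: "open_eucl n U" and h: "\<And>j. j < m \<Longrightarrow> continuous_on U (\<lambda>x. h x j)" "h ` U \<subseteq> eucl m"
    and V: "open_eucl m V"
  shows "open_eucl n {x \<in> U. h x \<in> V}"
proof -
  obtain T where T: "open T" "V = eucl m \<inter> T"
    using V by (auto simp: Euclidean_space_eq openin_open)
  have "{x \<in> U. h x \<in> V} = {x \<in> U. h x \<in> T}" using T h(2) by blast
  then show ?thesis using open_eucl_vimage[OF U continuous_on_into_eucl[OF h] T(1)] by simp
qed

lemma continuous_on_cubeD:
  fixes f :: "(nat \<Rightarrow> real) \<Rightarrow> real"
  assumes "open_eucl n U" "continuous_on U f" "x \<in> U" "e > 0"
  obtains d where "d > 0" "cube n x d \<subseteq> U" "\<And>y. y \<in> cube n x d \<Longrightarrow> \<bar>f y - f x\<bar> < e"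
proof -
  have "open_eucl n {y \<in> U. f y \<in> ball (f x) e}" by (rule open_eucl_vimage[OF assms(1,2)]) simp
  then obtain d where "d > 0" "cube n x d \<subseteq> {y \<in> U. f y \<in> ball (f x) e}"
    using assms by (auto elim!: open_euclD[of _ _ x])
  then show ?thesis using that by (force simp: dist_real_def abs_minus_commute)
qed

section \<open>Locality of partial derivatives\<close>

lemma eventually_upd:
  assumes "open_eucl n U" "x \<in> U" "i < n"
  shows "eventually (\<lambda>t. x(i := t) \<in> U) (nhds (x i))"
proof -
  obtain d where d: "d > 0" "cube n x d \<subseteq> U" using assms by (auto elim: open_euclD)
  have "eventually (\<lambda>t. \<bar>t - x i\<bar> < d) (nhds (x i))"
    using d(1) by (auto simp: eventually_nhds_metric dist_real_def)
  then show ?thesis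
  proof (rule eventually_mono)
    fix t assume "\<bar>t - x i\<bar> < d"
    then have "x(i := t) \<in> cube n x d"
      using assms d open_eucl_subset[OF assms(1)] by (auto simp: cube_def in_eucl)
    then show "x(i := t) \<in> U" using d by auto
  qed
qed

lemma partial_deriv_cong:
  assumes "open_eucl n U" "x \<in> U" "i < n" "\<And>y. y \<in> U \<Longrightarrow> f y = g y"
  shows "partial_deriv i f x = partial_deriv i g x"
  unfolding partial_deriv_def
  by (rule deriv_cong_ev[OF eventually_mono[OF eventually_upd[OF assms(1-3)]]]) (use assms in auto)

lemma field_differentiable_upd_cong:
  assumes "open_eucl n U" "x \<in> U" "i < n" "\<And>y. y \<in> U \<Longrightarrow> f y = g y"
    "(\<lambda>t. f (x(i := t))) field_differentiable at (x i)"
  shows "(\<lambda>t. g (x(i := t))) field_differentiable at (x i)"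
proof -
  obtain D where "DERIV (\<lambda>t. f (x(i := t))) (x i) :> D" using assms(5) by (auto simp: field_differentiable_def)
  then have "DERIV (\<lambda>t. g (x(i := t))) (x i) :> D"
    by (subst DERIV_cong_ev[OF refl eventually_mono[OF eventually_upd[OF assms(1-3)]] refl, symmetric])
       (use assms in auto)
  then show ?thesis by (auto simp: field_differentiable_def)
qed

lemma DERIV_partial:
  assumes "(\<lambda>t. f (x(i := t))) field_differentiable at (x i)"
  shows "DERIV (\<lambda>t. f (x(i := t))) (x i) :> partial_deriv i f x"
  using assms by (simp add: partial_deriv_def DERIV_deriv_iff_field_differentiable)

lemma partial_derivI:
  "DERIV (\<lambda>t. f (x(i := t))) (x i) :> D \<Longrightarrow> partial_deriv i f x = D"
  by (simp add: partial_deriv_def DERIV_imp_deriv)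

section \<open>Functions of class C^k\<close>

lemma Ck_on_0: "U \<subseteq> eucl n \<Longrightarrow> Ck_on n 0 U f \<longleftrightarrow> continuous_on U f"
  by (simp add: subtopology_eucl)

lemma Ck_on_Suc:
  "U \<subseteq> eucl n \<Longrightarrow> Ck_on n (Suc k) U f \<longleftrightarrow> continuous_on U f \<and>
     (\<forall>i<n. (\<forall>x\<in>U. (\<lambda>t. f (x(i := t))) field_differentiable at (x i)) \<and> Ck_on n k U (partial_deriv i f))"
  by (simp add: subtopology_eucl)

declare Ck_on.simps [simp del]

lemma Ck_on_continuous: "U \<subseteq> eucl n \<Longrightarrow> Ck_on n k U f \<Longrightarrow> continuous_on U f"
  by (cases k) (auto simp: Ck_on_0 Ck_on_Suc)

lemma Ck_on_SucD: "U \<subseteq> eucl n \<Longrightarrow> Ck_on n (Suc k) U f \<Longrightarrow> Ck_on n k U f"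
  by (induction k arbitrary: f) (auto simp: Ck_on_0 Ck_on_Suc)

text \<open>Openness of \<open>U\<close> enters because a partial derivative at a point of
  \<open>U\<close> also looks at values at nearby points.\<close>

lemma Ck_on_cong:
  assumes U: "open_eucl n U"
  shows "(\<And>y. y \<in> U \<Longrightarrow> f y = g y) \<Longrightarrow> Ck_on n k U f \<Longrightarrow> Ck_on n k U g"
proof (induction k arbitrary: f g)
  case 0
  then show ?case using U by (auto simp: Ck_on_0 open_eucl_subset cong: continuous_on_cong)
next
  case (Suc k)
  have [simp]: "U \<subseteq> eucl n" using U by (rule open_eucl_subset)
  have "continuous_on U g" using Suc.prems by (auto simp: Ck_on_Suc cong: continuous_on_cong)
  moreover have "Ck_on n k U (partial_deriv i g)" if "i < n" for i
  proof (rule Suc.IH)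
    show "partial_deriv i f y = partial_deriv i g y" if "y \<in> U" for y
      using partial_deriv_cong[OF U that \<open>i < n\<close>] Suc.prems(1) by blast
  qed (use Suc.prems that in \<open>simp add: Ck_on_Suc\<close>)
  moreover have "(\<lambda>t. g (x(i := t))) field_differentiable at (x i)" if "i < n" "x \<in> U" for i x
    using Suc.prems that by (intro field_differentiable_upd_cong[OF U that(2,1), of f g]) (auto simp: Ck_on_Suc)
  ultimately show ?case by (simp add: Ck_on_Suc)
qed

lemma Ck_on_subset:
  assumes U: "U \<subseteq> eucl n" and V: "V \<subseteq> U"
  shows "Ck_on n k U f \<Longrightarrow> Ck_on n k V f"
proof (induction k arbitrary: f)
  case 0
  have "V \<subseteq> eucl n" using assms by blast
  then show ?case using 0 assms continuous_on_subset[OF _ V] by (simp add: Ck_on_0)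
next
  case (Suc k)
  have "V \<subseteq> eucl n" using assms by blast
  then show ?case using Suc assms continuous_on_subset[OF _ V] by (auto simp: Ck_on_Suc)
qed

lemma continuous_on_local:
  assumes "\<And>x. x \<in> U \<Longrightarrow> \<exists>V. open_eucl n V \<and> x \<in> V \<and> continuous_on (U \<inter> V) f" "U \<subseteq> eucl n"
  shows "continuous_on U f"
  unfolding continuous_on_eq_continuous_within
proof
  fix x assume x: "x \<in> U"
  then obtain V where V: "open_eucl n V" "x \<in> V" "continuous_on (U \<inter> V) f" using assms by blast
  obtain T where T: "open T" "V = eucl n \<inter> T"
    using V by (auto simp: Euclidean_space_eq openin_open)
  have "at x within U = at x within (U \<inter> V)"
    by (rule at_within_nhd[of x T]) (use T V assms in auto)
  then show "continuous (at x within U) f"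
    using V x by (auto simp: continuous_on_eq_continuous_within)
qed

lemma Ck_on_local:
  assumes U: "U \<subseteq> eucl n"
  shows "(\<And>x. x \<in> U \<Longrightarrow> \<exists>V. open_eucl n V \<and> x \<in> V \<and> Ck_on n k V f) \<Longrightarrow> Ck_on n k U f"
proof (induction k arbitrary: f)
  case 0
  show ?case using U
    by (auto simp: Ck_on_0 intro!: continuous_on_local[of _ n])
      (meson 0 Ck_on_0 continuous_on_subset inf_le2 open_eucl_subset)
next
  case (Suc k)
  have "continuous_on U f"
    by (rule continuous_on_local[OF _ U])
      (meson Suc.prems Ck_on_continuous continuous_on_subset inf_le2 open_eucl_subset)
  moreover have "Ck_on n k U (partial_deriv i f)" if "i < n" for i
    by (rule Suc.IH) (meson Suc.prems Ck_on_Suc open_eucl_subset that)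
  moreover have "(\<lambda>t. f (x(i := t))) field_differentiable at (x i)" if "i < n" "x \<in> U" for i x
    using Suc.prems[OF that(2)] that by (auto simp: Ck_on_Suc[OF open_eucl_subset])
  ultimately show ?case using U by (simp add: Ck_on_Suc)
qed

lemma Ck_on_const: "U \<subseteq> eucl n \<Longrightarrow> Ck_on n k U (\<lambda>x. c)"
proof (induction k arbitrary: c)
  case (Suc k)
  have "partial_deriv i (\<lambda>x. c) = (\<lambda>x. 0)" for i by (auto simp: partial_deriv_def)
  with Suc show ?case by (auto simp: Ck_on_Suc)
qed (simp add: Ck_on_0)

lemma Ck_on_coord: "U \<subseteq> eucl n \<Longrightarrow> Ck_on n k U (\<lambda>x. x j)"
proof (cases k)
  case (Suc k')
  have 1: "partial_deriv i (\<lambda>x. x j) = (\<lambda>x. if i = j then 1 else 0)" for i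
    by (auto simp: partial_deriv_def)
  have 2: "(\<lambda>t. (x(i := t)) j) field_differentiable at y" for x :: "nat \<Rightarrow> real" and i y
    by (cases "i = j") (auto simp: fun_upd_def)
  assume "U \<subseteq> eucl n"
  then show ?thesis using Suc 2 by (auto simp: Ck_on_Suc 1 continuous_on_coord Ck_on_const)
qed (simp add: Ck_on_0 continuous_on_coord)

lemma Ck_on_add:
  assumes U: "open_eucl n U"
  shows "Ck_on n k U f \<Longrightarrow> Ck_on n k U g \<Longrightarrow> Ck_on n k U (\<lambda>x. f x + g x)"
proof (induction k arbitrary: f g)
  case 0 then show ?case using U by (simp add: Ck_on_0 open_eucl_subset continuous_on_add)
next
  case (Suc k)
  have [simp]: "U \<subseteq> eucl n" using U by (rule open_eucl_subset)
  have D: "DERIV (\<lambda>t. f (x(i := t)) + g (x(i := t))) (x i) :> partial_deriv i f x + partial_deriv i g x"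
    if "i < n" "x \<in> U" for i x
    using Suc.prems that by (intro DERIV_add DERIV_partial) (auto simp: Ck_on_Suc)
  have P: "partial_deriv i (\<lambda>x. f x + g x) x = partial_deriv i f x + partial_deriv i g x"
    if "i < n" "x \<in> U" for i x
    by (rule partial_derivI) (rule D[OF that])
  have "Ck_on n k U (partial_deriv i (\<lambda>x. f x + g x))" if "i < n" for i
    by (rule Ck_on_cong[OF U, of "\<lambda>x. partial_deriv i f x + partial_deriv i g x"])
       (use Suc that P in \<open>auto simp: Ck_on_Suc\<close>)
  moreover have "continuous_on U (\<lambda>x. f x + g x)" using Suc.prems by (simp add: Ck_on_Suc continuous_on_add)
  ultimately show ?case using D by (simp add: Ck_on_Suc field_differentiable_def) blast
qed

lemma Ck_on_mult:
  assumes U: "open_eucl n U"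
  shows "Ck_on n k U f \<Longrightarrow> Ck_on n k U g \<Longrightarrow> Ck_on n k U (\<lambda>x. f x * g x)"
proof (induction k arbitrary: f g)
  case 0 then show ?case using U by (simp add: Ck_on_0 open_eucl_subset continuous_on_mult)
next
  case (Suc k)
  have [simp]: "U \<subseteq> eucl n" using U by (rule open_eucl_subset)
  have D: "DERIV (\<lambda>t. f (x(i := t)) * g (x(i := t))) (x i) :> partial_deriv i f x * g x + f x * partial_deriv i g x"
    if "i < n" "x \<in> U" for i x
  proof -
    have "DERIV (\<lambda>t. f (x(i := t)) * g (x(i := t))) (x i) :>
      partial_deriv i f x * g (x(i := x i)) + partial_deriv i g x * f (x(i := x i))"
      using Suc.prems that by (intro DERIV_mult DERIV_partial) (auto simp: Ck_on_Suc)
    then show ?thesis by (simp add: mult.commute)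
  qed
  have S: "Ck_on n k U (\<lambda>x. partial_deriv i f x * g x + f x * partial_deriv i g x)" if "i < n" for i
    using Suc that Ck_on_SucD[of U n k f] Ck_on_SucD[of U n k g] by (intro Ck_on_add[OF U] Suc.IH) (auto simp: Ck_on_Suc)
  have P: "partial_deriv i (\<lambda>x. f x * g x) x = partial_deriv i f x * g x + f x * partial_deriv i g x"
    if "i < n" "x \<in> U" for i x
    by (rule partial_derivI) (rule D[OF that])
  have "Ck_on n k U (partial_deriv i (\<lambda>x. f x * g x))" if "i < n" for i
    by (rule Ck_on_cong[OF U _ S[OF that]]) (simp add: P that)
  moreover have "continuous_on U (\<lambda>x. f x * g x)" using Suc.prems by (simp add: Ck_on_Suc continuous_on_mult)
  ultimately show ?case using D by (simp add: Ck_on_Suc field_differentiable_def) blast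
qed

lemma Ck_on_sum:
  assumes U: "open_eucl n U" and "\<And>j. j \<in> J \<Longrightarrow> Ck_on n k U (f j)"
  shows "Ck_on n k U (\<lambda>x. \<Sum>j\<in>J. f j x)"
  using assms(2)
proof (induction J rule: infinite_finite_induct)
  case (insert j J)
  then show ?case using Ck_on_add[OF U, of k "f j" "\<lambda>x. \<Sum>j\<in>J. f j x"] by auto
qed (use Ck_on_const[OF open_eucl_subset[OF U]] in auto)

subsection \<open>The chain rule\<close>

lemma MVT_segment:
  fixes f :: "real \<Rightarrow> real"
  assumes "\<And>t. min a b \<le> t \<Longrightarrow> t \<le> max a b \<Longrightarrow> DERIV f t :> f' t"
  shows "\<exists>t. min a b \<le> t \<and> t \<le> max a b \<and> f b - f a = f' t * (b - a)"
proof -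
  consider "a < b" | "a = b" | "b < a" by linarith
  then show ?thesis
  proof cases
    case 1
    then obtain z where "a < z" "z < b" "f b - f a = (b - a) * f' z" using MVT2[OF 1, of f f'] assms by auto
    then show ?thesis by (intro exI[of _ z]) auto
  next
    case 3
    then obtain z where "b < z" "z < a" "f a - f b = (a - b) * f' z" using MVT2[OF 3, of f f'] assms by auto
    then show ?thesis by (intro exI[of _ z]) (auto simp: algebra_simps)
  qed auto
qed

text \<open>The coordinate box spanned by two points. It contains, besides the segment, all mixtures
  of their coordinates, and these are the points visited when the coordinates are exchanged one by
  one.\<close>

definition between :: "(nat \<Rightarrow> real) \<Rightarrow> (nat \<Rightarrow> real) \<Rightarrow> (nat \<Rightarrow> real) set" where
  "between y z = {w. \<forall>i. min (y i) (z i) \<le> w i \<and> w i \<le> max (y i) (z i)}"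

lemma between_cube:
  assumes "y \<in> cube n x d" "z \<in> cube n x d"
  shows "between y z \<subseteq> cube n x d"
proof
  fix w assume "w \<in> between y z"
  then have w: "min (y i) (z i) \<le> w i" "w i \<le> max (y i) (z i)" for i by (auto simp: between_def)
  have "w i = 0" if "i \<ge> n" for i using w[of i] assms that by (simp add: cube_def in_eucl)
  moreover have "\<bar>w i - x i\<bar> < d" if "i < n" for i
  proof -
    have "\<bar>y i - x i\<bar> < d" "\<bar>z i - x i\<bar> < d" using assms that by (auto simp: cube_def)
    then show ?thesis using w[of i] by linarith
  qed
  ultimately show "w \<in> cube n x d" by (simp add: cube_def in_eucl)
qed

text \<open>Changing the coordinates of \<open>y\<close> into those of \<open>z\<close> one at a time reduces the mean value theorem
  to one variable.\<close>

lemma mean_value_coordinates: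
  assumes yz: "y \<in> eucl n" "z \<in> eucl n"
    and D: "\<And>i w. i < n \<Longrightarrow> w \<in> between y z \<Longrightarrow> (\<lambda>t. f (w(i := t))) field_differentiable at (w i)"
  shows "\<exists>\<xi>. (\<forall>i<n. \<xi> i \<in> between y z) \<and> f z - f y = (\<Sum>i<n. partial_deriv i f (\<xi> i) * (z i - y i))"
proof -
  define w where "w j = (\<lambda>i. if i < j then z i else y i)" for j :: nat
  have *: "\<exists>\<xi>\<in>between y z. f (w (Suc j)) - f (w j) = partial_deriv j f \<xi> * (z j - y j)" if j: "j < n" for j
  proof -
    have upd: "(w j)(j := t) \<in> between y z" if "min (y j) (z j) \<le> t" "t \<le> max (y j) (z j)" for t
      using that by (auto simp: between_def w_def)
    have "\<exists>t. min (y j) (z j) \<le> t \<and> t \<le> max (y j) (z j) \<and>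
       f ((w j)(j := z j)) - f ((w j)(j := y j)) = partial_deriv j f ((w j)(j := t)) * (z j - y j)"
    proof (rule MVT_segment)
      fix t assume "min (y j) (z j) \<le> t" "t \<le> max (y j) (z j)"
      from DERIV_partial[OF D[OF j upd[OF this]]]
      show "DERIV (\<lambda>t. f ((w j)(j := t))) t :> partial_deriv j f ((w j)(j := t))"
        unfolding fun_upd_upd fun_upd_same .
    qed
    moreover have "(w j)(j := z j) = w (Suc j)" "(w j)(j := y j) = w j"
      by (auto simp: w_def less_Suc_eq)
    ultimately show ?thesis using upd by metis
  qed
  then obtain \<xi> where \<xi>: "\<And>j. j < n \<Longrightarrow> \<xi> j \<in> between y z"
    "\<And>j. j < n \<Longrightarrow> f (w (Suc j)) - f (w j) = partial_deriv j f (\<xi> j) * (z j - y j)" by metis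
  have "w 0 = y" "w n = z" using yz by (auto simp: w_def in_eucl)
  then have "f z - f y = (\<Sum>j<n. f (w (Suc j)) - f (w j))" by (subst sum_lessThan_telescope) simp
  also have "\<dots> = (\<Sum>i<n. partial_deriv i f (\<xi> i) * (z i - y i))" using \<xi> by simp
  finally show ?thesis using \<xi> by blast
qed

text \<open>The increment of \<open>f\<close> is a combination of partial derivatives at points
  squeezed between \<open>c t0\<close> and \<open>c t\<close>, and continuity of the partial
  derivatives moves these points to \<open>c t0\<close>. The set \<open>S\<close> admits one-sided
  derivatives at the ends of an interval.\<close>

lemma DERIV_along_curve:
  assumes f: "Ck_on n (Suc 0) U f" and U: "open_eucl n U"
    and c: "\<And>i. i < n \<Longrightarrow> ((\<lambda>t. c t i) has_real_derivative c' i) (at t0 within S)"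
    and c0: "c t0 \<in> U" and ce: "\<And>t. t \<in> S \<Longrightarrow> c t \<in> eucl n"
  shows "((\<lambda>t. f (c t)) has_real_derivative (\<Sum>i<n. partial_deriv i f (c t0) * c' i)) (at t0 within S)"
proof -
  have UE: "U \<subseteq> eucl n" using U by (rule open_eucl_subset)
  have fd: "\<And>i x. i < n \<Longrightarrow> x \<in> U \<Longrightarrow> (\<lambda>t. f (x(i := t))) field_differentiable at (x i)"
    and cont: "\<And>i. i < n \<Longrightarrow> continuous_on U (partial_deriv i f)"
    using f by (auto simp: Ck_on_Suc[OF UE] Ck_on_0[OF UE])
  have ev: "eventually (\<lambda>t. c t \<in> cube n (c t0) d) (at t0 within S)" if "d > 0" for d
  proof -
    have "eventually (\<lambda>t. \<bar>c t i - c t0 i\<bar> < d) (at t0 within S)" if "i < n" for i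
    proof -
      have "((\<lambda>t. c t i) \<longlongrightarrow> c t0 i) (at t0 within S)"
        using c[OF that] DERIV_continuous continuous_within by blast
      from tendstoD[OF this \<open>d > 0\<close>] show ?thesis by (simp add: dist_real_def)
    qed
    then have "eventually (\<lambda>t. \<forall>i\<in>{..<n}. \<bar>c t i - c t0 i\<bar> < d) (at t0 within S)"
      by (subst eventually_ball_finite_distrib) auto
    moreover have "eventually (\<lambda>t. t \<in> S) (at t0 within S)" by (simp add: eventually_at_filter)
    ultimately show ?thesis by eventually_elim (auto simp: cube_def ce)
  qed
  obtain d where d: "d > 0" "cube n (c t0) d \<subseteq> U" using U c0 by (auto elim: open_euclD)
  have "\<exists>\<xi>. (\<forall>i<n. \<xi> i \<in> between (c t0) (c t)) \<and>
          f (c t) - f (c t0) = (\<Sum>i<n. partial_deriv i f (\<xi> i) * (c t i - c t0 i))"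
    if "c t \<in> cube n (c t0) d" for t
  proof (rule mean_value_coordinates)
    have "between (c t0) (c t) \<subseteq> U"
      using between_cube[OF cube_self that] d c0 UE by blast
    then show "(\<lambda>t. f (w(i := t))) field_differentiable at (w i)"
      if "i < n" "w \<in> between (c t0) (c t)" for i w using fd that by blast
  qed (use c0 UE that in \<open>auto simp: cube_def\<close>)
  then have "\<forall>t. \<exists>\<xi>. c t \<in> cube n (c t0) d \<longrightarrow> (\<forall>i<n. \<xi> i \<in> between (c t0) (c t)) \<and>
          f (c t) - f (c t0) = (\<Sum>i<n. partial_deriv i f (\<xi> i) * (c t i - c t0 i))" by blast
  from choice[OF this] obtain \<xi> where "\<forall>t. c t \<in> cube n (c t0) d \<longrightarrow> (\<forall>i<n. \<xi> t i \<in> between (c t0) (c t)) \<and>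
       f (c t) - f (c t0) = (\<Sum>i<n. partial_deriv i f (\<xi> t i) * (c t i - c t0 i))" by blast
  then have \<xi>: "\<And>t i. c t \<in> cube n (c t0) d \<Longrightarrow> i < n \<Longrightarrow> \<xi> t i \<in> between (c t0) (c t)"
    "\<And>t. c t \<in> cube n (c t0) d \<Longrightarrow>
       f (c t) - f (c t0) = (\<Sum>i<n. partial_deriv i f (\<xi> t i) * (c t i - c t0 i))" by blast+
  have lim: "((\<lambda>t. partial_deriv i f (\<xi> t i)) \<longlongrightarrow> partial_deriv i f (c t0)) (at t0 within S)" if i: "i < n" for i
  proof (rule tendstoI)
    fix e :: real assume "e > 0"
    from continuous_on_cubeD[OF U cont[OF i] c0 this] obtain d' where
      d': "d' > 0" "\<And>y. y \<in> cube n (c t0) d' \<Longrightarrow> \<bar>partial_deriv i f y - partial_deriv i f (c t0)\<bar> < e" by metis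
    show "eventually (\<lambda>t. dist (partial_deriv i f (\<xi> t i)) (partial_deriv i f (c t0)) < e) (at t0 within S)"
      using ev[OF d(1)] ev[OF d'(1)]
    proof eventually_elim
      case (elim t)
      have "\<xi> t i \<in> cube n (c t0) d'"
        using \<xi>(1)[OF elim(1) i] between_cube[OF cube_self elim(2)] c0 UE d'(1) by blast
      then show ?case using d'(2) by (simp add: dist_real_def)
    qed
  qed
  have "((\<lambda>t. \<Sum>i<n. partial_deriv i f (\<xi> t i) * ((c t i - c t0 i) / (t - t0))) \<longlongrightarrow>
      (\<Sum>i<n. partial_deriv i f (c t0) * c' i)) (at t0 within S)"
    using c by (intro tendsto_sum tendsto_mult lim) (auto simp: has_field_derivative_iff)
  moreover have "eventually (\<lambda>t. (\<Sum>i<n. partial_deriv i f (\<xi> t i) * ((c t i - c t0 i) / (t - t0)))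
      = (f (c t) - f (c t0)) / (t - t0)) (at t0 within S)"
    using ev[OF d(1)] by eventually_elim (simp add: \<xi>(2) sum_divide_distrib)
  ultimately show ?thesis
    unfolding has_field_derivative_iff by (rule Lim_transform_eventually)
qed

lemma DERIV_comp_upd:
  assumes f: "Ck_on m (Suc 0) V f" and V: "open_eucl m V" and U: "open_eucl n U"
    and h: "\<And>j. j < m \<Longrightarrow> Ck_on n (Suc 0) U (\<lambda>x. h x j)" "h ` U \<subseteq> V" and x: "x \<in> U" and i: "i < n"
  shows "DERIV (\<lambda>t. f (h (x(i := t)))) (x i) :>
     (\<Sum>j<m. partial_deriv j f (h x) * partial_deriv i (\<lambda>x. h x j) x)"
proof -
  have UE: "U \<subseteq> eucl n" using U by (rule open_eucl_subset)
  \<comment> \<open>Off this set nothing is known about \<open>h\<close>, so the curve is restricted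
    to it. As the set is open, the restriction does not affect the derivative.\<close>
  let ?S = "{t. x(i := t) \<in> U}"
  have "open ?S"
  proof (rule openI)
    fix t assume "t \<in> ?S"
    then have "eventually (\<lambda>s. (x(i := t))(i := s) \<in> U) (nhds ((x(i := t)) i))" by (intro eventually_upd[OF U _ i]) simp
    then show "\<exists>e>0. ball t e \<subseteq> ?S" by (auto simp: eventually_nhds_metric dist_commute subset_iff)
  qed
  then have at: "at (x i) within ?S = at (x i)" using x by (intro at_within_open) auto
  have "((\<lambda>t. f (h (x(i := t)))) has_real_derivative
      (\<Sum>j<m. partial_deriv j f (h (x(i := x i))) * partial_deriv i (\<lambda>x. h x j) x)) (at (x i) within ?S)"
    unfolding at[symmetric]
  proof (rule DERIV_along_curve[OF f V])
    fix j assume "j < m"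
    then show "((\<lambda>t. h (x(i := t)) j) has_real_derivative partial_deriv i (\<lambda>x. h x j) x) (at (x i) within ?S)"
      unfolding at using h(1) x i by (intro DERIV_partial) (auto simp: Ck_on_Suc[OF UE])
  qed (use h x open_eucl_subset[OF V] in auto)
  then show ?thesis by (simp add: at)
qed

lemma Ck_on_1: "U \<subseteq> eucl n \<Longrightarrow> Ck_on n (Suc k) U f \<Longrightarrow> Ck_on n (Suc 0) U f"
  by (auto simp: Ck_on_Suc Ck_on_0 Ck_on_continuous)

text \<open>The chain rule writes a partial derivative of the composite as a sum of products in
  which the outer functions are partial derivatives of \<open>f\<close>. The induction therefore
  generalises \<open>f\<close> and keeps \<open>h\<close>.\<close>

lemma Ck_on_compose:
  assumes V: "open_eucl m V" and U: "open_eucl n U"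
  shows "Ck_on m k V f \<Longrightarrow> (\<And>j. j < m \<Longrightarrow> Ck_on n k U (\<lambda>x. h x j)) \<Longrightarrow> h ` U \<subseteq> V \<Longrightarrow> Ck_on n k U (\<lambda>x. f (h x))"
proof (induction k arbitrary: f)
  case 0
  have "continuous_on U h"
    using 0 U V by (intro continuous_on_into_eucl[of m]) (auto simp: Ck_on_0 open_eucl_subset dest: open_eucl_subset)
  moreover have "continuous_on V f" using 0 by (simp add: Ck_on_0 open_eucl_subset[OF V])
  ultimately have "continuous_on U (\<lambda>x. f (h x))" using 0(3) continuous_on_compose2 by blast
  then show ?case by (simp add: Ck_on_0 open_eucl_subset[OF U])
next
  case (Suc k)
  have [simp]: "U \<subseteq> eucl n" "V \<subseteq> eucl m" using U V by (auto dest: open_eucl_subset)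
  have "continuous_on U h"
  proof (rule continuous_on_into_eucl)
    show "continuous_on U (\<lambda>x. h x j)" if "j < m" for j
      by (rule Ck_on_continuous[OF _ Suc.prems(2)[OF that]]) simp
  qed (use Suc.prems(3) open_eucl_subset[OF V] in blast)
  moreover have "continuous_on V f" using Suc.prems by (auto simp: Ck_on_Suc)
  ultimately have "continuous_on U (\<lambda>x. f (h x))" using Suc.prems(3) continuous_on_compose2 by blast
  moreover have D: "DERIV (\<lambda>t. f (h (x(i := t)))) (x i) :>
     (\<Sum>j<m. partial_deriv j f (h x) * partial_deriv i (\<lambda>x. h x j) x)" if "x \<in> U" "i < n" for x i
    by (rule DERIV_comp_upd[OF Ck_on_1[OF _ Suc.prems(1)] V U Ck_on_1[OF _ Suc.prems(2)] Suc.prems(3) that]) simp_all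
  moreover have "Ck_on n k U (partial_deriv i (\<lambda>x. f (h x)))" if i: "i < n" for i
  proof (rule Ck_on_cong[OF U])
    show "Ck_on n k U (\<lambda>x. \<Sum>j<m. partial_deriv j f (h x) * partial_deriv i (\<lambda>x. h x j) x)"
    proof (intro Ck_on_sum[OF U] Ck_on_mult[OF U])
      fix j assume j: "j \<in> {..<m}"
      then show "Ck_on n k U (\<lambda>x. partial_deriv j f (h x))"
        using Suc.prems(1) by (intro Suc.IH[OF _ Ck_on_SucD[OF _ Suc.prems(2)] Suc.prems(3)]) (auto simp: Ck_on_Suc)
      show "Ck_on n k U (partial_deriv i (\<lambda>x. h x j))" using Suc.prems(2)[of j] j i by (auto simp: Ck_on_Suc)
    qed
    show "(\<Sum>j<m. partial_deriv j f (h x) * partial_deriv i (\<lambda>x. h x j) x) = partial_deriv i (\<lambda>x. f (h x)) x" if "x \<in> U" for x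
      using partial_derivI[OF D[OF that i]] by simp
  qed
  ultimately show ?case by (auto simp: Ck_on_Suc field_differentiable_def)
qed

subsection \<open>Smooth functions\<close>

lemma smooth_fun_on_open: "smooth_fun_on n U f \<Longrightarrow> open_eucl n U"
  by (simp add: smooth_fun_on_def)

lemma smooth_fun_on_Ck: "smooth_fun_on n U f \<Longrightarrow> Ck_on n k U f"
  by (simp add: smooth_fun_on_def)

lemma smooth_fun_on_continuous: "smooth_fun_on n U f \<Longrightarrow> continuous_on U f"
  using Ck_on_continuous[OF open_eucl_subset] by (auto simp: smooth_fun_on_def)

lemma smooth_fun_on_cong:
  assumes "\<And>y. y \<in> U \<Longrightarrow> f y = g y"
  shows "smooth_fun_on n U f \<longleftrightarrow> smooth_fun_on n U g"
  using Ck_on_cong[of n U f g] Ck_on_cong[of n U g f] assms by (auto simp: smooth_fun_on_def)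

lemma smooth_fun_on_subset: "smooth_fun_on n U f \<Longrightarrow> open_eucl n V \<Longrightarrow> V \<subseteq> U \<Longrightarrow> smooth_fun_on n V f"
  unfolding smooth_fun_on_def using Ck_on_subset[OF open_eucl_subset, of n U V] by blast

lemma smooth_fun_on_local:
  assumes "\<And>x. x \<in> U \<Longrightarrow> \<exists>V. x \<in> V \<and> V \<subseteq> U \<and> smooth_fun_on n V f"
  shows "smooth_fun_on n U f"
proof -
  have U: "open_eucl n U"
    by (rule open_eucl_local) (drule assms, auto dest: smooth_fun_on_open)
  show ?thesis unfolding smooth_fun_on_def
  proof (intro conjI U allI)
    fix k
    show "Ck_on n k U f"
      by (rule Ck_on_local[OF open_eucl_subset[OF U]])
         (drule assms, auto simp: smooth_fun_on_def)
  qed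
qed

lemma smooth_fun_on_const: "open_eucl n U \<Longrightarrow> smooth_fun_on n U (\<lambda>x. c)"
  by (simp add: smooth_fun_on_def Ck_on_const open_eucl_subset)

lemma smooth_fun_on_coord: "open_eucl n U \<Longrightarrow> smooth_fun_on n U (\<lambda>x. x j)"
  by (simp add: smooth_fun_on_def Ck_on_coord open_eucl_subset)

lemma smooth_fun_on_add: "smooth_fun_on n U f \<Longrightarrow> smooth_fun_on n U g \<Longrightarrow> smooth_fun_on n U (\<lambda>x. f x + g x)"
  by (simp add: smooth_fun_on_def Ck_on_add)

lemma smooth_fun_on_mult: "smooth_fun_on n U f \<Longrightarrow> smooth_fun_on n U g \<Longrightarrow> smooth_fun_on n U (\<lambda>x. f x * g x)"
  by (simp add: smooth_fun_on_def Ck_on_mult)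

lemma smooth_fun_on_minus:
  assumes "smooth_fun_on n U f"
  shows "smooth_fun_on n U (\<lambda>x. - f x)"
  using smooth_fun_on_mult[OF smooth_fun_on_const[OF smooth_fun_on_open[OF assms], of "-1"] assms] by simp

lemma smooth_fun_on_diff:
  assumes "smooth_fun_on n U f" "smooth_fun_on n U g"
  shows "smooth_fun_on n U (\<lambda>x. f x - g x)"
  using smooth_fun_on_add[OF assms(1) smooth_fun_on_minus[OF assms(2)]] by simp

lemma smooth_fun_on_sum:
  "open_eucl n U \<Longrightarrow> (\<And>j. j \<in> J \<Longrightarrow> smooth_fun_on n U (f j)) \<Longrightarrow> smooth_fun_on n U (\<lambda>x. \<Sum>j\<in>J. f j x)"
  by (simp add: smooth_fun_on_def Ck_on_sum)

lemma smooth_fun_on_partial: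
  assumes "smooth_fun_on n U f" "i < n"
  shows "smooth_fun_on n U (partial_deriv i f)"
proof -
  have "U \<subseteq> eucl n" using assms by (simp add: smooth_fun_on_def open_eucl_subset)
  then show ?thesis using assms unfolding smooth_fun_on_def by (metis Ck_on_Suc)
qed

lemma smooth_fun_on_DERIV:
  assumes "smooth_fun_on n U f" "i < n" "x \<in> U"
  shows "DERIV (\<lambda>t. f (x(i := t))) (x i) :> partial_deriv i f x"
proof (rule DERIV_partial)
  have "U \<subseteq> eucl n" using assms by (simp add: smooth_fun_on_def open_eucl_subset)
  then show "(\<lambda>t. f (x(i := t))) field_differentiable at (x i)"
    using assms unfolding smooth_fun_on_def by (metis Ck_on_Suc)
qed

lemma smooth_fun_on_DERIV_upd:
  assumes "smooth_fun_on n U f" "i < n" "x(i := t) \<in> U"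
  shows "DERIV (\<lambda>t. f (x(i := t))) t :> partial_deriv i f (x(i := t))"
  using smooth_fun_on_DERIV[OF assms] unfolding fun_upd_upd fun_upd_same .

lemma smooth_on_open: "smooth_on n U m h \<Longrightarrow> open_eucl n U"
  by (simp add: smooth_on_def)

lemma smooth_on_coord: "smooth_on n U m h \<Longrightarrow> j < m \<Longrightarrow> smooth_fun_on n U (\<lambda>x. h x j)"
  by (simp add: smooth_on_def)

lemma smooth_onI:
  "open_eucl n U \<Longrightarrow> (\<And>x. x \<in> U \<Longrightarrow> h x \<in> eucl m) \<Longrightarrow> (\<And>j. j < m \<Longrightarrow> smooth_fun_on n U (\<lambda>x. h x j)) \<Longrightarrow> smooth_on n U m h"
  by (auto simp: smooth_on_def)

lemma smooth_on_cong: "(\<And>x. x \<in> U \<Longrightarrow> h x = g x) \<Longrightarrow> smooth_on n U m h \<longleftrightarrow> smooth_on n U m g"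
  using smooth_fun_on_cong[of U "\<lambda>x. h x j" "\<lambda>x. g x j" for j] by (simp add: smooth_on_def cong: image_cong)

lemma smooth_on_subset: "smooth_on n U m h \<Longrightarrow> open_eucl n V \<Longrightarrow> V \<subseteq> U \<Longrightarrow> smooth_on n V m h"
  unfolding smooth_on_def using smooth_fun_on_subset[of n U _ V] by blast

lemma smooth_fun_on_compose:
  assumes "smooth_fun_on m V f" "smooth_on n U m h" "h ` U \<subseteq> V"
  shows "smooth_fun_on n U (\<lambda>x. f (h x))"
  unfolding smooth_fun_on_def
  using Ck_on_compose[of m V n U _ f h] assms by (auto simp: smooth_on_def smooth_fun_on_def)

lemma smooth_on_id: "open_eucl n U \<Longrightarrow> smooth_on n U n (\<lambda>x. x)"
  using open_eucl_subset by (intro smooth_onI smooth_fun_on_coord) auto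

lemma open_eucl_smooth_preimage:
  "smooth_on n U m h \<Longrightarrow> open_eucl m V \<Longrightarrow> open_eucl n {x \<in> U. h x \<in> V}"
  by (rule open_eucl_preimage) (auto simp: smooth_on_def smooth_fun_on_continuous)

lemma partial_deriv_comp:
  assumes "smooth_fun_on m V f" "smooth_on n U m h" "h ` U \<subseteq> V" "x \<in> U" "i < n"
  shows "partial_deriv i (\<lambda>x. f (h x)) x = (\<Sum>j<m. partial_deriv i (\<lambda>x. h x j) x * partial_deriv j f (h x))"
proof -
  have "DERIV (\<lambda>t. f (h (x(i := t)))) (x i) :> (\<Sum>j<m. partial_deriv j f (h x) * partial_deriv i (\<lambda>x. h x j) x)"
    using assms by (intro DERIV_comp_upd[of m V f n U h]) (auto simp: smooth_on_def smooth_fun_on_def)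
  from partial_derivI[of "\<lambda>x. f (h x)", OF this] show ?thesis by (simp add: mult.commute)
qed

lemma smooth_DERIV_along_curve:
  assumes "smooth_fun_on n U f"
    and "\<And>i. i < n \<Longrightarrow> ((\<lambda>t. c t i) has_real_derivative c' i) (at t0 within S)"
    and "c t0 \<in> U" "\<And>t. t \<in> S \<Longrightarrow> c t \<in> eucl n"
  shows "((\<lambda>t. f (c t)) has_real_derivative (\<Sum>i<n. partial_deriv i f (c t0) * c' i)) (at t0 within S)"
  using assms by (intro DERIV_along_curve[of n U]) (auto simp: smooth_fun_on_def)

lemma partial_deriv_add:
  assumes "smooth_fun_on n U f" "smooth_fun_on n U g" "i < n" "x \<in> U"
  shows "partial_deriv i (\<lambda>x. f x + g x) x = partial_deriv i f x + partial_deriv i g x"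
  by (rule partial_derivI) (rule DERIV_add[OF smooth_fun_on_DERIV[OF assms(1,3,4)] smooth_fun_on_DERIV[OF assms(2-4)]])

lemma partial_deriv_mult:
  assumes "smooth_fun_on n U f" "smooth_fun_on n U g" "i < n" "x \<in> U"
  shows "partial_deriv i (\<lambda>x. f x * g x) x = partial_deriv i f x * g x + f x * partial_deriv i g x"
  by (rule partial_derivI)
     (use DERIV_mult[OF smooth_fun_on_DERIV[OF assms(1,3,4)] smooth_fun_on_DERIV[OF assms(2-4)]]
      in \<open>simp add: mult.commute\<close>)

lemma partial_deriv_const [simp]: "partial_deriv i (\<lambda>x. c) x = 0"
  by (simp add: partial_deriv_def)

subsection \<open>Smooth functions of one real variable\<close>

text \<open>The identification of the real line with \<open>eucl (Suc 0)\<close>; it mediates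
  between paths, which take a real argument, and plots.\<close>

definition vec1 :: "real \<Rightarrow> nat \<Rightarrow> real" where
  "vec1 t = (\<lambda>i. if i = 0 then t else 0)"

lemma vec1_0 [simp]: "vec1 t 0 = t" by (simp add: vec1_def)
lemma vec1_eucl [simp]: "vec1 t \<in> eucl (Suc 0)" by (simp add: vec1_def in_eucl)
lemma vec1_upd [simp]: "(vec1 t)(0 := s) = vec1 s" by (auto simp: vec1_def)
lemma vec1_eta: "x \<in> eucl (Suc 0) \<Longrightarrow> vec1 (x 0) = x" by (auto simp: vec1_def in_eucl fun_eq_iff)

text \<open>A set of functions closed under differentiation consists of smooth functions. With such
  a set at hand the induction on \<open>k\<close> gets by without formulas for higher
  derivatives.\<close>

lemma Ck_on_real:
  assumes "open S" "\<And>\<phi>. \<phi> \<in> D \<Longrightarrow> \<exists>\<psi>\<in>D. \<forall>t\<in>S. DERIV \<phi> t :> \<psi> t"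
  shows "\<phi> \<in> D \<Longrightarrow> Ck_on 1 k {x \<in> eucl 1. x 0 \<in> S} (\<lambda>x. \<phi> (x 0))"
proof (induction k arbitrary: \<phi>)
  let ?U = "{x \<in> eucl 1. x 0 \<in> S}"
  have U: "open_eucl 1 ?U"
    using open_eucl_vimage[of 1 "eucl 1" "\<lambda>x. x 0" S] assms(1) by (simp add: continuous_on_coord flip: topspace_eucl)
  have cont: "continuous_on ?U (\<lambda>x. \<phi> (x 0))" if "\<phi> \<in> D" for \<phi>
  proof (rule continuous_on_compose2[of S \<phi>])
    show "continuous_on S \<phi>"
      using assms(2)[OF that] assms(1) by (meson DERIV_isCont continuous_at_imp_continuous_on)
  qed (auto simp: continuous_on_coord)
  { case 0 then show ?case using cont by (simp add: Ck_on_0) }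
  case (Suc k)
  obtain \<psi> where \<psi>: "\<psi> \<in> D" "\<And>t. t \<in> S \<Longrightarrow> DERIV \<phi> t :> \<psi> t" using assms(2) Suc.prems by blast
  have D: "DERIV (\<lambda>t. \<phi> ((x(0 := t)) 0)) (x 0) :> \<psi> (x 0)" if "x \<in> ?U" for x using \<psi> that by simp
  have "Ck_on 1 k ?U (partial_deriv 0 (\<lambda>x. \<phi> (x 0)))"
    by (rule Ck_on_cong[OF U _ Suc.IH[OF \<psi>(1)]]) (rule partial_derivI[OF D, symmetric])
  then show ?case using cont[OF Suc.prems] D
    by (subst Ck_on_Suc) (auto simp: field_differentiable_def)
qed

lemma smooth_fun_on_real_compose:
  assumes S: "open S" and D: "\<And>\<phi>. \<phi> \<in> D \<Longrightarrow> \<exists>\<psi>\<in>D. \<forall>t\<in>S. DERIV \<phi> t :> \<psi> t" and \<phi>: "\<phi> \<in> D"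
    and f: "smooth_fun_on n U f" "f ` U \<subseteq> S"
  shows "smooth_fun_on n U (\<lambda>x. \<phi> (f x))"
proof -
  have "open_eucl 1 {x \<in> eucl 1. x 0 \<in> S}"
    using open_eucl_vimage[of 1 "eucl 1" "\<lambda>x. x 0" S] assms(1) by (simp add: continuous_on_coord flip: topspace_eucl)
  then have "smooth_fun_on 1 {x \<in> eucl 1. x 0 \<in> S} (\<lambda>x. \<phi> (x 0))"
    using Ck_on_real[OF S D \<phi>] by (simp add: smooth_fun_on_def)
  then have "smooth_fun_on n U (\<lambda>x. \<phi> (vec1 (f x) 0))"
    by (rule smooth_fun_on_compose)
       (use f smooth_fun_on_open[OF f(1)] in \<open>auto intro!: smooth_onI\<close>)
  then show ?thesis by simp
qed

text \<open>A smooth map of the whole line into [0,1] that fixes the end points. A path on [0,1]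
  composed with it is defined on an open set and has the same end points at the times 0 and
  1.\<close>

definition smooth_step :: "real \<Rightarrow> real" where
  "smooth_step t = (1 - cos (pi * t)) / 2"

lemma smooth_step_0 [simp]: "smooth_step 0 = 0" and smooth_step_1 [simp]: "smooth_step 1 = 1"
  by (auto simp: smooth_step_def)

lemma smooth_step_range: "0 \<le> smooth_step t" "smooth_step t \<le> 1"
  unfolding smooth_step_def using cos_ge_minus_one[of "pi * t"] cos_le_one[of "pi * t"] by auto

lemma DERIV_smooth_step: "DERIV smooth_step t :> pi * sin (pi * t) / 2"
  unfolding smooth_step_def[abs_def] by (auto intro!: derivative_eq_intros)

lemma smooth_fun_on_step:
  assumes "smooth_fun_on n U f"
  shows "smooth_fun_on n U (\<lambda>x. smooth_step (f x))"
proof -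
  \<comment> \<open>The span of \<open>sin (pi * t)\<close>, \<open>cos (pi * t)\<close> and the
    constants is closed under differentiation and contains the step function.\<close>
  define D where "D = {\<lambda>t::real. a * sin (pi * t) + b * cos (pi * t) + c | a b c. True}"
  have *: "\<exists>\<psi>\<in>D. \<forall>t\<in>UNIV. DERIV \<phi> t :> \<psi> t" if \<phi>: "\<phi> \<in> D" for \<phi>
  proof -
    obtain a b c where "\<phi> = (\<lambda>t. a * sin (pi * t) + b * cos (pi * t) + c)" using \<phi> by (auto simp: D_def)
    then have "DERIV \<phi> t :> (- (b * pi)) * sin (pi * t) + (a * pi) * cos (pi * t) + 0" for t
      by (auto intro!: derivative_eq_intros simp: algebra_simps)
    moreover have "(\<lambda>t. (- (b * pi)) * sin (pi * t) + (a * pi) * cos (pi * t) + 0) \<in> D"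
      unfolding D_def by blast
    ultimately show ?thesis by (intro bexI[of _ "\<lambda>t. (- (b * pi)) * sin (pi * t) + (a * pi) * cos (pi * t) + 0"] ballI)
  qed
  have "smooth_step = (\<lambda>t. 0 * sin (pi * t) + (- 1/2) * cos (pi * t) + 1/2)"
    by (auto simp: smooth_step_def fun_eq_iff field_simps)
  then have "smooth_step \<in> D" unfolding D_def by blast
  from smooth_fun_on_real_compose[OF open_UNIV * this assms] show ?thesis by simp
qed

text \<open>For \<open>p = 1\<close> this is the classical function that is flat at 0. The
  polynomial in \<open>1 / x\<close> makes the family closed under differentiation.\<close>

definition expbump :: "real poly \<Rightarrow> real \<Rightarrow> real" where
  "expbump p x = (if x > 0 then poly p (1 / x) * exp (- (1 / x)) else 0)"

lemma expbump_tendsto_0: "(expbump p \<longlongrightarrow> 0) (at 0)"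
proof -
  have 1: "((\<lambda>y. poly p y * exp (- y)) \<longlongrightarrow> 0) at_top"
  proof -
    have "((\<lambda>y. \<Sum>i\<le>degree p. coeff p i * (y ^ i / exp y)) \<longlongrightarrow> (\<Sum>i\<le>degree p. coeff p i * 0)) at_top"
      by (intro tendsto_sum tendsto_mult tendsto_const tendsto_power_div_exp_0)
    then show ?thesis by (simp add: poly_altdef sum_distrib_right sum_divide_distrib exp_minus field_simps)
  qed
  have "((\<lambda>x. poly p (1 / x) * exp (- (1 / x))) \<longlongrightarrow> 0) (at_right 0)"
    using filterlim_compose[OF 1 filterlim_inverse_at_top_right] by (simp add: divide_inverse)
  then have "(expbump p \<longlongrightarrow> 0) (at_right 0)"
    by (rule Lim_transform_eventually) (auto simp: eventually_at_filter expbump_def)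
  moreover have "(expbump p \<longlongrightarrow> 0) (at_left 0)"
    by (rule Lim_transform_eventually[OF tendsto_const]) (auto simp: eventually_at_filter expbump_def)
  ultimately show ?thesis by (rule filterlim_split_at[rotated])
qed

text \<open>In the variable \<open>y = 1 / x\<close> differentiation is \<open>- y^2 d/dy\<close>,
  which sends \<open>p(y) exp(-y)\<close> to \<open>y^2 (p(y) - p'(y)) exp(-y)\<close>. This is
  where the polynomial on the right comes from.\<close>

lemma DERIV_expbump: "DERIV (expbump p) x :> expbump ((p - pderiv p) * [:0, 0, 1:]) x"
proof -
  consider "x > 0" | "x < 0" | "x = 0" by linarith
  then show ?thesis
  proof cases
    case 1
    have "DERIV (\<lambda>x. poly p (1 / x) * exp (- (1 / x))) x :> expbump ((p - pderiv p) * [:0, 0, 1:]) x"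
      using 1 by (auto intro!: derivative_eq_intros poly_DERIV[THEN DERIV_chain2]
         simp: expbump_def field_simps power2_eq_square)
    moreover have "eventually (\<lambda>y. poly p (1 / y) * exp (- (1 / y)) = expbump p y) (nhds x)"
      using eventually_nhds_in_open[of "{0<..}" x] 1 by (auto elim!: eventually_mono simp: expbump_def)
    ultimately show ?thesis by (subst DERIV_cong_ev[OF refl _ refl, symmetric])
  next
    case 2
    have "eventually (\<lambda>y. 0 = expbump p y) (nhds x)"
      using eventually_nhds_in_open[of "{..<0}" x] 2 by (auto elim!: eventually_mono simp: expbump_def)
    then have "DERIV (expbump p) x :> 0"
      using DERIV_const[of 0 "at x"] by (subst DERIV_cong_ev[OF refl _ refl, symmetric])
    then show ?thesis using 2 by (simp add: expbump_def)
  next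
    case 3
    \<comment> \<open>Division by \<open>y\<close> multiplies the polynomial in \<open>1 / y\<close>
      by its variable, so the difference quotient at 0 belongs to the family as well and tends to
      0.\<close>
    have "(\<lambda>y. (expbump p y - expbump p 0) / (y - 0)) = expbump (p * [:0, 1:])"
      by (auto simp: expbump_def fun_eq_iff)
    then have "DERIV (expbump p) 0 :> 0"
      unfolding has_field_derivative_iff using expbump_tendsto_0[of "p * [:0, 1:]"] by simp
    then show ?thesis using 3 by (simp add: expbump_def)
  qed
qed

lemma smooth_fun_on_expbump:
  assumes "smooth_fun_on n U f"
  shows "smooth_fun_on n U (\<lambda>x. expbump p (f x))"
  using smooth_fun_on_real_compose[OF open_UNIV _ _ assms, of "range expbump" "expbump p"]
    DERIV_expbump by blast

subsection \<open>Integrals depending on a parameter\<close>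

text \<open>By Leibniz's rule a partial derivative passes under the integral and yields an integral
  of the same kind with \<open>F\<close> replaced by a partial derivative of \<open>F\<close>; hence
  the induction over all integrands.\<close>

lemma Ck_on_integral:
  assumes V: "open_eucl (Suc n) V" and U: "open_eucl n U"
    and UV: "\<And>x \<theta>. x \<in> U \<Longrightarrow> \<theta> \<in> {0..1} \<Longrightarrow> x(n := \<theta>) \<in> V"
  shows "Ck_on (Suc n) k V F \<Longrightarrow> Ck_on n k U (\<lambda>x. integral {0..1} (\<lambda>\<theta>. F (x(n := \<theta>))))"
proof (induction k arbitrary: F)
  have UE: "U \<subseteq> eucl n" "V \<subseteq> eucl (Suc n)" using U V by (auto dest: open_eucl_subset)
  have upd: "continuous_on (S \<times> {0..1}) (\<lambda>p. (fst p)(n := snd p) :: nat \<Rightarrow> real)" for S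
  proof (rule continuous_on_coordinatewise_then_product)
    fix i
    have "continuous_on (S \<times> {0..1}) (\<lambda>p::(nat \<Rightarrow> real) \<times> real. fst p i)"
      by (rule continuous_on_compose2[OF continuous_on_coord[of UNIV] continuous_on_fst[OF continuous_on_id]]) simp
    then show "continuous_on (S \<times> {0..1}) (\<lambda>p. ((fst p)(n := snd p)) i)"
      by (cases "i = n") (auto intro: continuous_on_snd continuous_on_id)
  qed
  have pc: "continuous_on (U \<times> {0..1}) (\<lambda>(x, \<theta>). F (x(n := \<theta>)))" if "continuous_on V F" for F :: "_ \<Rightarrow> real"
    unfolding case_prod_beta by (rule continuous_on_compose2[OF that upd]) (use UV in auto)
  have cont: "continuous_on U (\<lambda>x. integral {0..1} (\<lambda>\<theta>. F (x(n := \<theta>))))" if "continuous_on V F" for F :: "_ \<Rightarrow> real"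
    using integral_continuous_on_param[of U 0 "1::real" "\<lambda>x \<theta>. F (x(n := \<theta>))"] pc[OF that] by (simp add: cbox_interval)
  { case 0 then show ?case using cont unfolding Ck_on_0[OF UE(1)] Ck_on_0[OF UE(2)] by blast }
  case (Suc k)
  have F: "continuous_on V F" using Suc.prems UE by (simp add: Ck_on_Suc)
  have D: "DERIV (\<lambda>t. integral {0..1} (\<lambda>\<theta>. F ((x(i := t))(n := \<theta>)))) (x i) :>
      integral {0..1} (\<lambda>\<theta>. partial_deriv i F (x(n := \<theta>)))" if x: "x \<in> U" and i: "i < n" for x i
  proof -
    have "Ck_on (Suc n) k V (partial_deriv i F)" using Suc.prems i UE by (auto simp: Ck_on_Suc)
    then have Fi: "continuous_on V (partial_deriv i F)" by (rule Ck_on_continuous[OF UE(2)])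
    have fd: "\<forall>y\<in>V. (\<lambda>t. F (y(i := t))) field_differentiable at (y i)"
      using Suc.prems i UE by (auto simp: Ck_on_Suc)
    obtain d where d: "d > 0" "cube n x d \<subseteq> U" using open_euclD[OF U x] by blast
    let ?T = "ball (x i) d"
    have xt: "x(i := t) \<in> U" if "t \<in> ?T" for t
      using that d x i UE by (auto simp: cube_def in_eucl dist_real_def subset_iff)
    have cu: "continuous_on (?T \<times> cbox 0 (1::real)) (\<lambda>(t, \<theta>). (x(i := t), \<theta>))"
      unfolding case_prod_beta
    proof (intro continuous_on_Pair continuous_on_coordinatewise_then_product continuous_on_snd continuous_on_id)
      show "continuous_on (?T \<times> cbox 0 (1::real)) (\<lambda>p. (x(i := fst p)) j)" for j
        by (cases "j = i") (auto intro!: continuous_intros)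
    qed
    have "((\<lambda>t. integral (cbox 0 1) (\<lambda>\<theta>. F ((x(i := t))(n := \<theta>)))) has_field_derivative
      integral (cbox 0 1) (\<lambda>\<theta>. partial_deriv i F ((x(i := x i))(n := \<theta>)))) (at (x i) within ?T)"
    proof (rule leibniz_rule_field_derivative)
      show "((\<lambda>t. F ((x(i := t))(n := \<theta>))) has_field_derivative partial_deriv i F ((x(i := t))(n := \<theta>))) (at t within ?T)"
        if "t \<in> ?T" "\<theta> \<in> cbox 0 1" for t \<theta>
      proof -
        let ?y = "(x(i := t))(n := \<theta>)"
        have "?y \<in> V" using UV[OF xt[OF that(1)]] that by simp
        then have "DERIV (\<lambda>t. F (?y(i := t))) (?y i) :> partial_deriv i F ?y"
          using fd by (intro DERIV_partial) blast
        moreover have "?y(i := s) = (x(i := s))(n := \<theta>)" for s using i by (auto simp: fun_upd_def)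
        ultimately show ?thesis using i by (simp add: has_field_derivative_at_within)
      qed
      show "(\<lambda>\<theta>. F ((x(i := t))(n := \<theta>))) integrable_on cbox 0 1" if "t \<in> ?T" for t
      proof (rule integrable_continuous)
        have "continuous_on (cbox 0 1) (\<lambda>\<theta>. (case (x(i := t), \<theta>) of (x, \<theta>) \<Rightarrow> F (x(n := \<theta>))))"
          by (rule continuous_on_compose2[OF pc[OF F]]) (use xt that in \<open>auto intro!: continuous_intros\<close>)
        then show "continuous_on (cbox 0 1) (\<lambda>\<theta>. F ((x(i := t))(n := \<theta>)))" by simp
      qed
      show "continuous_on (?T \<times> cbox 0 1) (\<lambda>(t, \<theta>). partial_deriv i F ((x(i := t))(n := \<theta>)))"
      proof -
        have "(\<lambda>(t, \<theta>). (x(i := t), \<theta>)) ` (?T \<times> cbox 0 (1::real)) \<subseteq> U \<times> {0..1}" using xt by auto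
        from continuous_on_compose2[OF pc[OF Fi] cu this] show ?thesis by (simp add: case_prod_beta)
      qed
    qed (use d in auto)
    then show ?thesis using d at_within_open[of "x i" ?T] by (simp add: cbox_interval)
  qed
  have P: "partial_deriv i (\<lambda>x. integral {0..1} (\<lambda>\<theta>. F (x(n := \<theta>)))) x = integral {0..1} (\<lambda>\<theta>. partial_deriv i F (x(n := \<theta>)))"
    if "x \<in> U" "i < n" for x i
    by (rule partial_derivI) (rule D[OF that])
  have "Ck_on n k U (partial_deriv i (\<lambda>x. integral {0..1} (\<lambda>\<theta>. F (x(n := \<theta>)))))" if i: "i < n" for i
  proof (rule Ck_on_cong[OF U P[OF _ i, symmetric] Suc.IH])
    show "Ck_on (Suc n) k V (partial_deriv i F)" using Suc.prems UE i by (auto simp: Ck_on_Suc)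
  qed
  moreover have "(\<lambda>t. integral {0..1} (\<lambda>\<theta>. F ((x(i := t))(n := \<theta>)))) field_differentiable at (x i)"
    if "x \<in> U" "i < n" for x i
    unfolding field_differentiable_def using D[OF that] by blast
  ultimately show ?case using cont[OF F] unfolding Ck_on_Suc[OF UE(1)] by blast
qed

lemma smooth_fun_on_integral:
  assumes "smooth_fun_on (Suc n) V F" "open_eucl n U"
    and "\<And>x \<theta>. x \<in> U \<Longrightarrow> \<theta> \<in> {0..1} \<Longrightarrow> x(n := \<theta>) \<in> V"
  shows "smooth_fun_on n U (\<lambda>x. integral {0..1} (\<lambda>\<theta>. F (x(n := \<theta>))))"
  using assms Ck_on_integral[of n V U _ F] by (simp add: smooth_fun_on_def)

section \<open>Hadamard's lemma\<close>

lemma cube_segment: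
  assumes x: "x \<in> eucl n" and z: "z \<in> cube n x d" and \<theta>: "0 \<le> \<theta>" "\<theta> \<le> 1"
  shows "(\<lambda>i. x i + \<theta> * (z i - x i)) \<in> cube n x d"
proof -
  have "\<bar>\<theta> * (z i - x i)\<bar> < d" if "i < n" for i
  proof -
    have "\<bar>\<theta> * (z i - x i)\<bar> \<le> 1 * \<bar>z i - x i\<bar>" unfolding abs_mult using \<theta> by (intro mult_right_mono) auto
    also have "\<dots> < d" using z that by (auto simp: cube_def)
    finally show ?thesis .
  qed
  then show ?thesis using x z by (auto simp: cube_def in_eucl)
qed

text \<open>Integration of the derivative of \<open>f\<close> along the segment from
  \<open>x\<close> to \<open>z\<close> splits off the factors \<open>z k - x k\<close>. The
  remaining integrals depend smoothly on \<open>z\<close>. This will make every derivation at a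
  point a combination of coordinate derivatives.\<close>

lemma hadamard:
  assumes f: "smooth_fun_on m (cube m x d) f" and x: "x \<in> eucl m" and d: "d > 0"
  obtains g where "\<And>k. k < m \<Longrightarrow> smooth_fun_on m (cube m x d) (g k)"
    "\<And>k. k < m \<Longrightarrow> g k x = partial_deriv k f x"
    "\<And>z. z \<in> cube m x d \<Longrightarrow> f z = f x + (\<Sum>k<m. (z k - x k) * g k z)"
proof -
  \<comment> \<open>The parameter of the segment is stored in coordinate \<open>m\<close>, so this
    coordinate has to be reset to 0 for the value to lie in \<open>eucl m\<close>.\<close>
  define seg where "seg w = (\<lambda>i. if i < m then x i + w m * (w i - x i) else 0)" for w :: "nat \<Rightarrow> real"
  define g where "g k z = integral {0..1} (\<lambda>\<theta>. partial_deriv k f (seg (z(m := \<theta>))))" for k z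
  have seg: "seg (z(m := \<theta>)) = (\<lambda>i. x i + \<theta> * (z i - x i))" if "z \<in> cube m x d" for z \<theta>
    using that x by (auto simp: seg_def cube_def in_eucl fun_eq_iff)
  have sm0: "smooth_on (Suc m) (eucl (Suc m)) m seg"
  proof (rule smooth_onI)
    show *: "open_eucl (Suc m) (eucl (Suc m))" by (simp flip: topspace_eucl)
    show "smooth_fun_on (Suc m) (eucl (Suc m)) (\<lambda>w. seg w j)" if "j < m" for j
      unfolding seg_def using that
      by (auto intro!: smooth_fun_on_add smooth_fun_on_mult smooth_fun_on_diff smooth_fun_on_const smooth_fun_on_coord *)
  qed (auto simp: seg_def in_eucl)
  let ?V = "{w \<in> eucl (Suc m). seg w \<in> cube m x d}"
  have V: "open_eucl (Suc m) ?V" by (rule open_eucl_smooth_preimage[OF sm0 open_eucl_cube])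
  have segV: "z(m := \<theta>) \<in> ?V" if "z \<in> cube m x d" "\<theta> \<in> {0..1}" for z \<theta>
    using cube_segment[OF x that(1)] that by (auto simp: seg[OF that(1)] cube_def in_eucl)
  have sm: "smooth_fun_on m (cube m x d) (g k)" if "k < m" for k
    unfolding g_def
  proof (rule smooth_fun_on_integral[OF _ open_eucl_cube segV])
    show "smooth_fun_on (Suc m) ?V (\<lambda>w. partial_deriv k f (seg w))"
      by (rule smooth_fun_on_compose[OF smooth_fun_on_partial[OF f that] smooth_on_subset[OF sm0 V]]) auto
  qed
  have xs: "x \<in> cube m x d" using x d by (rule cube_self)
  have gx: "g k x = partial_deriv k f x" if "k < m" for k by (simp add: g_def seg[OF xs])
  have fz: "f z = f x + (\<Sum>k<m. (z k - x k) * g k z)" if z: "z \<in> cube m x d" for z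
  proof -
    let ?c = "\<lambda>\<theta> i. x i + \<theta> * (z i - x i)"
    have c: "?c \<theta> \<in> cube m x d" if "\<theta> \<in> {0..1}" for \<theta> using cube_segment[OF x z] that by auto
    have D: "((\<lambda>\<theta>. f (?c \<theta>)) has_vector_derivative (\<Sum>k<m. partial_deriv k f (?c \<theta>) * (z k - x k))) (at \<theta> within {0..1})"
      if "\<theta> \<in> {0..1}" for \<theta>
      unfolding has_real_derivative_iff_has_vector_derivative[symmetric]
    proof (rule smooth_DERIV_along_curve[OF f])
      show "((\<lambda>\<theta>. x i + \<theta> * (z i - x i)) has_real_derivative z i - x i) (at \<theta> within {0..1})" for i
        by (auto intro!: derivative_eq_intros)
    qed (use c[OF that] c[THEN subsetD[OF cube_subset]] in auto)
    have int: "(\<lambda>\<theta>. partial_deriv k f (?c \<theta>)) integrable_on {0..1}" if "k < m" for k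
    proof (rule integrable_continuous_real, rule continuous_on_compose2[of "cube m x d" "partial_deriv k f" _ ?c])
      show "continuous_on (cube m x d) (partial_deriv k f)"
        by (rule smooth_fun_on_continuous[OF smooth_fun_on_partial[OF f that]])
      show "continuous_on {0..1} ?c"
        by (intro continuous_on_coordinatewise_then_product continuous_intros)
    qed (use c in auto)
    have "((\<lambda>\<theta>. \<Sum>k<m. partial_deriv k f (?c \<theta>) * (z k - x k)) has_integral f (?c 1) - f (?c 0)) {0..1}"
      by (rule fundamental_theorem_of_calculus) (use D in auto)
    moreover have "((\<lambda>\<theta>. \<Sum>k<m. partial_deriv k f (?c \<theta>) * (z k - x k)) has_integral (\<Sum>k<m. g k z * (z k - x k))) {0..1}"
      using int by (intro has_integral_sum has_integral_mult_left) (auto simp: g_def seg[OF z] integrable_integral)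
    ultimately have "f (?c 1) - f (?c 0) = (\<Sum>k<m. g k z * (z k - x k))" by (rule has_integral_unique)
    moreover have "?c 1 = z" "?c 0 = x" by auto
    ultimately show ?thesis by (simp add: mult.commute)
  qed
  show thesis by (rule that[OF sm gx fz])
qed

section \<open>Ordinary differential equations with smooth parameters\<close>

definition ccube :: "nat \<Rightarrow> (nat \<Rightarrow> real) \<Rightarrow> real \<Rightarrow> (nat \<Rightarrow> real) set" where
  "ccube n x d = {y \<in> eucl n. \<forall>i<n. \<bar>y i - x i\<bar> \<le> d}"

text \<open>From \<open>n\<close> on the factors are \<open>{0}\<close>, so the closed cube is a
  product of compact sets over all indices and Tychonoff's theorem applies.\<close>

lemma compact_ccube:
  assumes "x \<in> eucl n" shows "compact (ccube n x d)"
proof -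
  define S where "S i = (if i < n then {x i - d..x i + d} else {0})" for i
  have "compactin (product_topology (\<lambda>i. euclidean) UNIV) (PiE UNIV S)"
    unfolding compactin_PiE by (auto simp: S_def compactin_euclidean_iff)
  then have *: "compact (PiE UNIV S)"
    by (simp add: euclidean_product_topology compactin_euclidean_iff)
  have "PiE UNIV S = ccube n x d"
  proof (rule subset_antisym; rule subsetI)
    fix y assume "y \<in> PiE UNIV S"
    then have y: "y i \<in> S i" for i by auto
    show "y \<in> ccube n x d"
      unfolding ccube_def in_eucl mem_Collect_eq
    proof (intro conjI allI impI)
      show "y i = 0" if "n \<le> i" for i using y[of i] that by (simp add: S_def)
      show "\<bar>y i - x i\<bar> \<le> d" if "i < n" for i using y[of i] that by (auto simp: S_def)
    qed
  qed (auto simp: S_def ccube_def in_eucl abs_le_iff)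
  with * show ?thesis by simp
qed

lemma ccube_subset_cube: "r < d \<Longrightarrow> ccube n x r \<subseteq> cube n x d"
  by (force simp: ccube_def cube_def)

lemma cube_subset_ccube: "cube n x r \<subseteq> ccube n x r"
  by (force simp: ccube_def cube_def)

section \<open>Integral equations of Volterra type\<close>

lemma continuous_on_comp:
  "continuous_on T g \<Longrightarrow> continuous_on S f \<Longrightarrow> (\<And>x. x \<in> S \<Longrightarrow> f x \<in> T) \<Longrightarrow> continuous_on S (\<lambda>x. g (f x))"
  by (rule continuous_on_compose2) auto

lemma continuous_on_section:
  assumes "continuous_on (K \<times> T) (\<lambda>(u, t). g u t)" "u \<in> K" "S \<subseteq> T"
  shows "continuous_on S (g u)"
proof -
  have "continuous_on S (\<lambda>s. (u, s))" by (intro continuous_intros)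
  from continuous_on_comp[OF assms(1) this] assms show ?thesis by auto
qed

text \<open>The substitution \<open>s = a + \<theta> * (t - a)\<close> turns the variable upper
  limit into a parameter of an integral over the fixed interval [0,1], for which joint continuity is
  known.\<close>

lemma continuous_on_indefinite_integral:
  fixes g :: "'p::topological_space \<Rightarrow> real \<Rightarrow> real"
  assumes g: "continuous_on (K \<times> {a..b}) (\<lambda>(u, t). g u t)"
  shows "continuous_on (K \<times> {a..b}) (\<lambda>(u, t). integral {a..t} (g u))"
proof -
  have c: "continuous_on ((K \<times> {a..b}) \<times> cbox 0 (1::real)) (\<lambda>(p, \<theta>). g (fst p) (a + \<theta> * (snd p - a)))"
  proof -
    have "continuous_on ((K \<times> {a..b}) \<times> cbox 0 (1::real)) (\<lambda>q. (fst (fst q), a + snd q * (snd (fst q) - a)))"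
      by (intro continuous_intros)
    moreover have "a + \<theta> * (t - a) \<in> {a..b}" if "t \<in> {a..b}" "\<theta> \<in> cbox 0 (1::real)" for t \<theta>
    proof -
      have "\<theta> * (t - a) \<le> 1 * (t - a)" using that by (intro mult_right_mono) auto
      then show ?thesis using that by auto
    qed
    ultimately show ?thesis
      using continuous_on_comp[OF g, of "(K \<times> {a..b}) \<times> cbox 0 (1::real)" "\<lambda>q. (fst (fst q), a + snd q * (snd (fst q) - a))"]
      by (simp add: case_prod_beta) fastforce
  qed
  have "continuous_on (K \<times> {a..b}) (\<lambda>p. (snd p - a) * integral (cbox 0 1) (\<lambda>\<theta>. g (fst p) (a + \<theta> * (snd p - a))))"
    by (intro continuous_intros integral_continuous_on_param c)
  moreover have "(t - a) * integral (cbox 0 1) (\<lambda>\<theta>. g u (a + \<theta> * (t - a))) = integral {a..t} (g u)"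
    if "u \<in> K" "t \<in> {a..b}" for u t
  proof (cases "t = a")
    case False
    then have ta: "a < t" using that by auto
    have "continuous_on {a..t} (g u)"
      by (rule continuous_on_section[OF g]) (use that in auto)
    then have "(g u has_integral integral {a..t} (g u)) (cbox a t)"
      by (simp add: integrable_integral integrable_continuous_real)
    from has_integral_affinity[OF this, of "t - a" a] ta
    have "((\<lambda>x. g u ((t - a) * x + a)) has_integral (integral {a..t} (g u) / (t - a)))
      ((\<lambda>x. (1 / (t - a)) * x + - ((1 / (t - a)) * a)) ` {a..t})" by simp
    also have "((\<lambda>x. (1 / (t - a)) * x + - ((1 / (t - a)) * a)) ` {a..t}) = {0..1}"
    proof -
      have "t / (t - a) - a / (t - a) = 1" using ta by (simp add: diff_divide_distrib[symmetric])
      then show ?thesis using ta by (subst image_affinity_atLeastAtMost) auto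
    qed
    finally have "integral {0..1} (\<lambda>x. g u ((t - a) * x + a)) = integral {a..t} (g u) / (t - a)"
      by (rule integral_unique)
    then have "(t - a) * integral {0..1} (\<lambda>x. g u ((t - a) * x + a)) = integral {a..t} (g u)" using ta by simp
    then show ?thesis by (simp add: mult.commute add.commute cbox_interval)
  qed simp
  ultimately show ?thesis
    by (subst continuous_on_cong[OF refl]) (auto simp: case_prod_beta)
qed

text \<open>The weight \<open>exp (\<kappa> (t - a))\<close> turns the Volterra operator of a Lipschitz equation into a
  contraction with factor \<open>1/2\<close>, however long the interval is.\<close>

lemma weighted_integral_bound:
  fixes h :: "real \<Rightarrow> real"
  assumes I: "(h has_integral I) {a..t}" and at: "a \<le> t" and \<kappa>: "\<kappa> > 0" "2 * B \<le> \<kappa>" and c: "c \<ge> 0"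
    and h: "\<And>s. s \<in> {a..t} \<Longrightarrow> \<bar>h s\<bar> \<le> B * (c * exp (\<kappa> * (s - a)))"
  shows "\<bar>I\<bar> \<le> c / 2 * exp (\<kappa> * (t - a))"
proof -
  let ?J = "B * c / \<kappa> * exp (\<kappa> * (t - a)) - B * c / \<kappa> * exp (\<kappa> * (a - a))"
  have "((\<lambda>s. B * c / \<kappa> * exp (\<kappa> * (s - a))) has_vector_derivative B * (c * exp (\<kappa> * (s - a)))) (at s within {a..t})" for s
    unfolding has_real_derivative_iff_has_vector_derivative[symmetric]
    using \<kappa> by (auto intro!: derivative_eq_intros)
  then have J: "((\<lambda>s. B * (c * exp (\<kappa> * (s - a)))) has_integral ?J) {a..t}"
    by (intro fundamental_theorem_of_calculus at)
  have "I \<le> ?J" using h by (intro has_integral_le[OF I J]) (auto simp: abs_le_iff)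
  moreover have "- I \<le> ?J" using h by (intro has_integral_le[OF has_integral_neg[OF I] J]) (auto simp: abs_le_iff)
  ultimately have I_le: "\<bar>I\<bar> \<le> ?J" by simp
  have "0 \<le> \<bar>h a\<bar>" by simp
  also have "\<dots> \<le> B * c" using h[of a] at by simp
  finally have "0 \<le> B * c / \<kappa>" using \<kappa> by simp
  moreover have "B * c / \<kappa> \<le> c / 2"
  proof -
    have "B * c \<le> (\<kappa> / 2) * c" using \<kappa> c by (intro mult_right_mono) auto
    then show ?thesis using \<kappa> by (simp add: field_simps)
  qed
  ultimately have "?J \<le> c / 2 * exp (\<kappa> * (t - a))"
    by (smt (verit) exp_ge_zero mult_right_mono mult_nonneg_nonneg)
  with I_le show ?thesis by (rule order_trans)
qed

text \<open>Uniqueness for linear equations: \<open>r\<close> is bounded, and each insertion of a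
  bound for \<open>r\<close> into the integral halves it in the weighted norm.\<close>

lemma volterra_zero:
  fixes r :: "real \<Rightarrow> nat \<Rightarrow> real"
  assumes cont: "\<And>l. l < d \<Longrightarrow> continuous_on {a..b} (\<lambda>t. r t l)"
    and r: "\<And>t l. t \<in> {a..b} \<Longrightarrow> l < d \<Longrightarrow> (h l has_integral r t l) {a..t}"
    and h: "\<And>t l. t \<in> {a..b} \<Longrightarrow> l < d \<Longrightarrow> \<bar>h l t\<bar> \<le> L * (\<Sum>k<d. \<bar>r t k\<bar>)"
    and L: "0 \<le> L" and t: "t \<in> {a..b}" and l: "l < d"
  shows "r t l = 0"
proof -
  have "continuous_on {a..b} (\<lambda>t. \<Sum>k<d. \<bar>r t k\<bar>)" using cont by (intro continuous_intros) auto
  then have "bounded ((\<lambda>t. \<Sum>k<d. \<bar>r t k\<bar>) ` {a..b})"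
    by (intro compact_imp_bounded compact_continuous_image) auto
  then obtain c where "\<forall>x\<in>(\<lambda>t. \<Sum>k<d. \<bar>r t k\<bar>) ` {a..b}. norm x \<le> c" by (auto simp: bounded_iff)
  then have c: "\<And>t. t \<in> {a..b} \<Longrightarrow> (\<Sum>k<d. \<bar>r t k\<bar>) \<le> c" by (auto simp: abs_le_iff)
  \<comment> \<open>The factor \<open>d\<close> comes from the sum over the components; the summand
    1 keeps the weight positive when \<open>L\<close> or \<open>d\<close> is 0.\<close>
  define \<kappa> where "\<kappa> = 2 * (L * d) + 1"
  have \<kappa>: "\<kappa> > 0" "2 * (L * d) \<le> \<kappa>" using L by (auto simp: \<kappa>_def add_nonneg_pos)
  have c0: "c \<ge> 0" using c[OF t] sum_nonneg[of "{..<d}" "\<lambda>k. \<bar>r t k\<bar>"] by linarith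
  have "\<bar>r t l\<bar> \<le> c * (1/2) ^ m * exp (\<kappa> * (t - a))" if "t \<in> {a..b}" "l < d" for t l m
    using that
  proof (induction m arbitrary: t l)
    case 0
    have "\<bar>r t l\<bar> \<le> (\<Sum>k<d. \<bar>r t k\<bar>)" using 0 by (intro member_le_sum) auto
    also have "\<dots> \<le> c * 1" using c 0 by simp
    also have "\<dots> \<le> c * exp (\<kappa> * (t - a))" using 0 \<kappa> c0 by (intro mult_left_mono) auto
    finally show ?case by simp
  next
    case (Suc m)
    have "\<bar>r t l\<bar> \<le> (c * (1/2) ^ m) / 2 * exp (\<kappa> * (t - a))"
    proof (rule weighted_integral_bound[OF r[OF Suc.prems] _ \<kappa>])
      show "\<bar>h l s\<bar> \<le> L * d * (c * (1/2) ^ m * exp (\<kappa> * (s - a)))" if "s \<in> {a..t}" for s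
      proof -
        have s: "s \<in> {a..b}" using that Suc.prems by auto
        have "\<bar>h l s\<bar> \<le> L * (\<Sum>k<d. \<bar>r s k\<bar>)" using h s Suc.prems by blast
        also have "\<dots> \<le> L * (\<Sum>k<d. c * (1/2) ^ m * exp (\<kappa> * (s - a)))"
          using Suc.IH[OF s] L by (intro mult_left_mono sum_mono) auto
        finally show ?thesis by simp
      qed
    qed (use Suc.prems c0 in auto)
    then show ?case by simp
  qed
  from this[OF t l] have "\<bar>r t l\<bar> \<le> c * (1/2) ^ m * exp (\<kappa> * (t - a))" for m .
  moreover have "(\<lambda>m. c * (1/2) ^ m * exp (\<kappa> * (t - a))) \<longlonglongrightarrow> c * 0 * exp (\<kappa> * (t - a))"
    by (intro tendsto_intros LIMSEQ_power_zero) auto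
  ultimately have "\<bar>r t l\<bar> \<le> c * 0 * exp (\<kappa> * (t - a))" by (intro LIMSEQ_le_const[where a="\<bar>r t l\<bar>"]) blast+
  then show ?thesis by simp
qed

text \<open>Picard iteration carried out for all parameters in \<open>K\<close> at once. The
  Lipschitz bound is uniform over all states, so the solution exists on the whole interval, and
  convergence is uniform in parameter and time, so it is jointly continuous.\<close>

lemma picard:
  fixes F :: "'p::topological_space \<Rightarrow> real \<Rightarrow> (nat \<Rightarrow> real) \<Rightarrow> nat \<Rightarrow> real"
  assumes K: "compact K" and L: "0 \<le> L"
    and cont: "\<And>l. l < d \<Longrightarrow> continuous_on (K \<times> {a..b} \<times> UNIV) (\<lambda>(u, t, y). F u t y l)"
    and lip: "\<And>u t y y' l. u \<in> K \<Longrightarrow> t \<in> {a..b} \<Longrightarrow> l < d \<Longrightarrow>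
      \<bar>F u t y l - F u t y' l\<bar> \<le> L * (\<Sum>k<d. \<bar>y k - y' k\<bar>)"
  shows "\<exists>Y. (\<forall>l<d. continuous_on (K \<times> {a..b}) (\<lambda>(u, t). Y u t l)) \<and>
    (\<forall>u\<in>K. \<forall>t\<in>{a..b}. \<forall>l<d. ((\<lambda>s. F u s (Y u s) l) has_integral Y u t l - y0 l) {a..t})"
proof -
  \<comment> \<open>The components from \<open>d\<close> on are held at 0, so that every iterate is
    continuous as a map into sequences and can be inserted into \<open>F\<close>.\<close>
  define Z where "Z = rec_nat (\<lambda>(u::'p) (t::real) l. if l < d then y0 l else 0)
    (\<lambda>_ Y u t l. if l < d then y0 l + integral {a..t} (\<lambda>s. F u s (Y u s) l) else 0)"
  have Z0: "Z 0 u t l = (if l < d then y0 l else 0)" for u t l by (simp add: Z_def)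
  have ZS: "Z (Suc m) u t l = (if l < d then y0 l + integral {a..t} (\<lambda>s. F u s (Z m u s) l) else 0)" for m u t l
    by (simp add: Z_def)
  have FY: "continuous_on (K \<times> {a..b}) (\<lambda>(u, t). F u t (Y u t) l)"
    if "\<And>l. continuous_on (K \<times> {a..b}) (\<lambda>(u, t). Y u t l)" "l < d" for Y l
  proof -
    have "continuous_on (K \<times> {a..b}) (\<lambda>p. (fst p, snd p, Y (fst p) (snd p)))"
      using that(1) by (intro continuous_intros continuous_on_coordinatewise_then_product) (simp add: case_prod_beta)
    from continuous_on_comp[OF cont[OF that(2)] this] show ?thesis by (simp add: case_prod_beta) fastforce
  qed
  have Zc: "continuous_on (K \<times> {a..b}) (\<lambda>(u, t). Z m u t l)" for m l
  proof (induction m arbitrary: l)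
    case (Suc m)
    show ?case
    proof (cases "l < d")
      case True
      then show ?thesis
        using continuous_on_indefinite_integral[OF FY[OF Suc True]] by (auto simp: ZS case_prod_beta intro!: continuous_intros)
    qed (simp add: ZS case_prod_beta)
  qed (simp add: Z0 case_prod_beta)
  have sec: "continuous_on {a..t} (\<lambda>s. G u s)" if "continuous_on (K \<times> {a..b}) (\<lambda>(u, t). G u t)" "u \<in> K" "t \<in> {a..b}"
    for G :: "'p \<Rightarrow> real \<Rightarrow> real" and u t
    by (rule continuous_on_section[OF that(1)]) (use that in auto)
  have FI: "((\<lambda>s. F u s (Y u s) l) has_integral integral {a..t} (\<lambda>s. F u s (Y u s) l)) {a..t}"
    if "\<And>l. continuous_on (K \<times> {a..b}) (\<lambda>(u, t). Y u t l)" "l < d" "u \<in> K" "t \<in> {a..b}" for Y l u t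
    by (intro integrable_integral integrable_continuous_real sec[OF FY[OF that(1,2)] that(3,4)])
  define \<kappa> where "\<kappa> = 2 * (L * d) + 1"
  have \<kappa>: "\<kappa> > 0" "2 * (L * d) \<le> \<kappa>" using L by (auto simp: \<kappa>_def add_nonneg_pos)
  have "\<exists>c\<ge>0. \<forall>u\<in>K. \<forall>t\<in>{a..b}. \<forall>l<d. \<bar>Z 1 u t l - Z 0 u t l\<bar> \<le> c"
  proof -
    have "continuous_on (K \<times> {a..b}) (\<lambda>p. \<Sum>l<d. \<bar>Z 1 (fst p) (snd p) l - Z 0 (fst p) (snd p) l\<bar>)"
      using Zc by (intro continuous_intros) (auto simp: case_prod_beta)
    then have "bounded ((\<lambda>p. \<Sum>l<d. \<bar>Z 1 (fst p) (snd p) l - Z 0 (fst p) (snd p) l\<bar>) ` (K \<times> {a..b}))"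
      by (intro compact_imp_bounded compact_continuous_image compact_Times K) auto
    then obtain c where c: "\<forall>p\<in>K \<times> {a..b}. norm (\<Sum>l<d. \<bar>Z 1 (fst p) (snd p) l - Z 0 (fst p) (snd p) l\<bar>) \<le> c"
      by (auto simp: bounded_iff)
    have "\<bar>Z 1 u t l - Z 0 u t l\<bar> \<le> max c 0" if "u \<in> K" "t \<in> {a..b}" "l < d" for u t l
    proof -
      have "\<bar>Z 1 u t l - Z 0 u t l\<bar> \<le> (\<Sum>l<d. \<bar>Z 1 u t l - Z 0 u t l\<bar>)"
        using that by (intro member_le_sum[of l "{..<d}" "\<lambda>l. \<bar>Z 1 u t l - Z 0 u t l\<bar>"]) auto
      also have "\<dots> \<le> c" using c that by (auto simp: abs_le_iff)
      finally show ?thesis by simp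
    qed
    then show ?thesis by (intro exI[of _ "max c 0"]) auto
  qed
  then obtain c where c: "c \<ge> 0" "\<And>u t l. u \<in> K \<Longrightarrow> t \<in> {a..b} \<Longrightarrow> l < d \<Longrightarrow> \<bar>Z 1 u t l - Z 0 u t l\<bar> \<le> c" by blast
  have Zd: "\<bar>Z (Suc m) u t l - Z m u t l\<bar> \<le> c / 2 ^ m * exp (\<kappa> * (t - a))"
    if "u \<in> K" "t \<in> {a..b}" "l < d" for u t l m
    using that
  proof (induction m arbitrary: t l)
    case 0
    have "\<bar>Z 1 u t l - Z 0 u t l\<bar> \<le> c * 1" using c 0 by simp
    also have "\<dots> \<le> c * exp (\<kappa> * (t - a))" using 0 \<kappa> c by (intro mult_left_mono) auto
    finally show ?case by simp
  next
    case (Suc m)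
    have "((\<lambda>s. F u s (Z (Suc m) u s) l - F u s (Z m u s) l) has_integral Z (Suc (Suc m)) u t l - Z (Suc m) u t l) {a..t}"
    proof -
      have "Z (Suc (Suc m)) u t l - Z (Suc m) u t l =
          integral {a..t} (\<lambda>s. F u s (Z (Suc m) u s) l) - integral {a..t} (\<lambda>s. F u s (Z m u s) l)"
        using Suc.prems by (subst (1 2) ZS) simp
      then show ?thesis
        using has_integral_diff[OF FI[where Y="Z (Suc m)", OF Zc Suc.prems(3,1,2)] FI[where Y="Z m", OF Zc Suc.prems(3,1,2)]]
        by simp
    qed
    then have "\<bar>Z (Suc (Suc m)) u t l - Z (Suc m) u t l\<bar> \<le> (c / 2 ^ m) / 2 * exp (\<kappa> * (t - a))"
    proof (rule weighted_integral_bound[OF _ _ \<kappa>])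
      show "\<bar>F u s (Z (Suc m) u s) l - F u s (Z m u s) l\<bar> \<le> L * d * (c / 2 ^ m * exp (\<kappa> * (s - a)))" if "s \<in> {a..t}" for s
      proof -
        have s: "s \<in> {a..b}" using that Suc.prems by auto
        have "\<bar>F u s (Z (Suc m) u s) l - F u s (Z m u s) l\<bar> \<le> L * (\<Sum>k<d. \<bar>Z (Suc m) u s k - Z m u s k\<bar>)"
          using lip s Suc.prems by blast
        also have "\<dots> \<le> L * (\<Sum>k<d. c / 2 ^ m * exp (\<kappa> * (s - a)))"
          using Suc.IH[OF Suc.prems(1) s] L by (intro mult_left_mono sum_mono) auto
        finally show ?thesis by simp
      qed
    qed (use Suc.prems c in auto)
    then show ?case by simp
  qed
  define C where "C = c * exp (\<kappa> * (b - a))"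
  have Zd': "\<bar>Z (Suc m) u t l - Z m u t l\<bar> \<le> C * (1/2) ^ m" if "u \<in> K" "t \<in> {a..b}" for u t l m
  proof (cases "l < d")
    case True
    have "\<bar>Z (Suc m) u t l - Z m u t l\<bar> \<le> c / 2 ^ m * exp (\<kappa> * (t - a))" using Zd that True by blast
    also have "\<dots> \<le> c / 2 ^ m * exp (\<kappa> * (b - a))" using that \<kappa> c by (intro mult_left_mono) auto
    finally show ?thesis by (simp add: C_def power_one_over field_simps)
  next
    case False
    then have "Z (Suc m) u t l = 0" "Z m u t l = 0" by (cases m; simp add: Z0 ZS)+
    then show ?thesis using c by (simp add: C_def)
  qed
  define Y where "Y u t l = Z 0 u t l + (\<Sum>m. Z (Suc m) u t l - Z m u t l)" for u t l
  have ul: "uniform_limit (K \<times> {a..b}) (\<lambda>m p. Z m (fst p) (snd p) l) (\<lambda>p. Y (fst p) (snd p) l) sequentially" for l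
  proof -
    have "uniform_limit (K \<times> {a..b}) (\<lambda>n p. \<Sum>m<n. Z (Suc m) (fst p) (snd p) l - Z m (fst p) (snd p) l)
       (\<lambda>p. \<Sum>m. Z (Suc m) (fst p) (snd p) l - Z m (fst p) (snd p) l) sequentially"
      by (rule Weierstrass_m_test[where M="\<lambda>m. C * (1/2) ^ m"])
         (use Zd' in \<open>auto intro!: summable_mult summable_geometric\<close>)
    then have "uniform_limit (K \<times> {a..b}) (\<lambda>n p. Z 0 (fst p) (snd p) l + (\<Sum>m<n. Z (Suc m) (fst p) (snd p) l - Z m (fst p) (snd p) l))
       (\<lambda>p. Y (fst p) (snd p) l) sequentially"
      unfolding Y_def by (intro uniform_limit_intros)
    moreover have "Z 0 u t l + (\<Sum>m<n. Z (Suc m) u t l - Z m u t l) = Z n u t l" for n u t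
      by (induction n) auto
    ultimately show ?thesis by (simp only:)
  qed
  have Yc: "continuous_on (K \<times> {a..b}) (\<lambda>(u, t). Y u t l)" for l
    unfolding case_prod_beta
    by (rule uniform_limit_theorem[OF _ ul]) (use Zc in \<open>auto simp: case_prod_beta\<close>)
  have "((\<lambda>s. F u s (Y u s) l) has_integral Y u t l - y0 l) {a..t}" if u: "u \<in> K" and t: "t \<in> {a..b}" and l: "l < d" for u t l
  proof -
    let ?I = "integral {a..t} (\<lambda>s. F u s (Y u s) l)"
    \<comment> \<open>The limit is not interchanged with the integral. For each \<open>e\<close> the
      solution is compared with one iterate that is uniformly \<open>e\<close>-close to it and with
      the next one.\<close>
    have "\<bar>Y u t l - y0 l - ?I\<bar> \<le> e * (1 + L * d * (t - a))" if "e > 0" for e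
    proof -
      have "\<forall>\<^sub>F m in sequentially. \<forall>l\<in>{..<d}. \<forall>p\<in>K \<times> {a..b}. dist (Z m (fst p) (snd p) l) (Y (fst p) (snd p) l) < e"
        using ul that by (subst eventually_ball_finite_distrib) (auto simp: uniform_limit_iff)
      then obtain N where N: "\<And>m u t l. m \<ge> N \<Longrightarrow> u \<in> K \<Longrightarrow> t \<in> {a..b} \<Longrightarrow> l < d \<Longrightarrow> \<bar>Z m u t l - Y u t l\<bar> < e"
        unfolding eventually_sequentially dist_real_def by fastforce
      have "((\<lambda>s. F u s (Z N u s) l - F u s (Y u s) l) has_integral Z (Suc N) u t l - y0 l - ?I) {a..t}"
        using has_integral_diff[OF FI[OF Zc[of N] l u t] FI[OF Yc l u t]] l by (simp add: ZS)
      moreover have "norm (F u s (Z N u s) l - F u s (Y u s) l) \<le> L * (real d * e)" if "s \<in> cbox a t" for s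
      proof -
        have s: "s \<in> {a..b}" using that t by auto
        have "\<bar>F u s (Z N u s) l - F u s (Y u s) l\<bar> \<le> L * (\<Sum>k<d. \<bar>Z N u s k - Y u s k\<bar>)"
          using lip s u l by blast
        also have "\<dots> \<le> L * (\<Sum>k<d. e)"
          using N[OF order_refl u s] L by (intro mult_left_mono sum_mono) (auto intro: less_imp_le)
        finally show ?thesis by simp
      qed
      ultimately have "norm (Z (Suc N) u t l - y0 l - ?I) \<le> L * (real d * e) * measure lborel (cbox a t)"
        using L \<open>e > 0\<close> by (intro has_integral_bound[of "L * (real d * e)"]) auto
      then have "\<bar>Z (Suc N) u t l - y0 l - ?I\<bar> \<le> L * (real d * e) * (t - a)" using t by simp
      moreover have "\<bar>Z (Suc N) u t l - Y u t l\<bar> < e" using N u t l by simp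
      ultimately have "\<bar>Y u t l - y0 l - ?I\<bar> \<le> e + L * (real d * e) * (t - a)" by linarith
      then show ?thesis by (simp add: algebra_simps)
    qed
    then have "\<bar>Y u t l - y0 l - ?I\<bar> / (1 + L * d * (t - a)) \<le> e" if "e > 0" for e
      using that L t by (subst pos_divide_le_eq) (auto intro!: add_pos_nonneg mult_nonneg_nonneg)
    then have "\<bar>Y u t l - y0 l - ?I\<bar> / (1 + L * d * (t - a)) \<le> 0" by (rule field_le_epsilon[of _ 0, simplified])
    moreover have "1 + L * d * (t - a) > 0" using L t by (auto intro!: add_pos_nonneg mult_nonneg_nonneg)
    ultimately have "Y u t l - y0 l = ?I" by (simp add: divide_le_0_iff)
    then show ?thesis using FI[OF Yc l u t] by simp
  qed
  with Yc show ?thesis by blast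
qed

text \<open>Time is the coordinate with index \<open>n\<close>, after the parameters; the state occupies the \<open>d\<close>
  coordinates from \<open>Suc n\<close> on.\<close>

definition join :: "nat \<Rightarrow> nat \<Rightarrow> (nat \<Rightarrow> real) \<Rightarrow> (nat \<Rightarrow> real) \<Rightarrow> nat \<Rightarrow> real" where
  "join n d v y = (\<lambda>i. if i < Suc n then v i else if i < Suc n + d then y (i - Suc n) else 0)"

lemma join_simps [simp]:
  "i < Suc n \<Longrightarrow> join n d v y i = v i"
  "k < d \<Longrightarrow> join n d v y (Suc (n + k)) = y k"
  "join n d v y \<in> eucl (Suc n + d)"
  by (auto simp: join_def in_eucl)

section \<open>Smooth dependence of solutions on parameters\<close>

lemma sum_lessThan_add: "(\<Sum>i<m + k. f i) = (\<Sum>i<m. f i) + (\<Sum>i<k. f (m + i))" for f :: "nat \<Rightarrow> 'a::comm_monoid_add"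
  by (induction k) (auto simp: add.assoc)

text \<open>The product of \<open>W\<close> and \<open>T\<close> in the encoding that is also used
  for plots of the path space: resetting coordinate \<open>n\<close> to 0 recovers the parameter,
  and coordinate \<open>n\<close> is the time.\<close>

definition slab :: "nat \<Rightarrow> (nat \<Rightarrow> real) set \<Rightarrow> real set \<Rightarrow> (nat \<Rightarrow> real) set" where
  "slab n W T = {v \<in> eucl (Suc n). v(n := 0) \<in> W \<and> v n \<in> T}"

lemma slab_upd: "v \<in> slab n W T \<Longrightarrow> s \<in> T' \<Longrightarrow> v(n := s) \<in> slab n W T'"
  by (auto simp: slab_def in_eucl)

lemma slab_mono: "W \<subseteq> W' \<Longrightarrow> T \<subseteq> T' \<Longrightarrow> slab n W T \<subseteq> slab n W' T'"
  by (auto simp: slab_def)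

lemma slabI: "u \<in> W \<Longrightarrow> u \<in> eucl n \<Longrightarrow> t \<in> T \<Longrightarrow> u(n := t) \<in> slab n W T"
  by (auto simp: slab_def in_eucl fun_upd_idem)

lemma continuous_on_drop_last: "continuous_on S (\<lambda>v::nat \<Rightarrow> real. v(n := 0))"
proof (rule continuous_on_coordinatewise_then_product)
  show "continuous_on S (\<lambda>v::nat \<Rightarrow> real. (v(n := 0)) i)" for i
    by (cases "i = n") (auto simp: continuous_on_coord)
qed

lemma continuous_on_upd2:
  fixes f :: "'c::topological_space \<Rightarrow> nat \<Rightarrow> real"
  assumes "continuous_on S f" "continuous_on S g"
  shows "continuous_on S (\<lambda>p. (f p)(n := g p))"
proof (rule continuous_on_coordinatewise_then_product)
  show "continuous_on S (\<lambda>p. ((f p)(n := g p)) i)" for i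
    using assms by (cases "i = n") (auto intro: continuous_on_product_then_coordinatewise)
qed

lemma drop_last_eucl: "v \<in> eucl (Suc n) \<Longrightarrow> v(n := 0) \<in> eucl n"
  by (auto simp: in_eucl)

lemma open_eucl_slab:
  assumes "open_eucl n W" "open T"
  shows "open_eucl (Suc n) (slab n W T)"
proof -
  have E: "open_eucl (Suc n) (eucl (Suc n))" by (simp flip: topspace_eucl)
  have "open_eucl (Suc n) {v \<in> eucl (Suc n). v(n := 0) \<in> W}"
    by (rule open_eucl_preimage[OF E _ _ assms(1)])
       (auto intro!: drop_last_eucl continuous_on_coord)
  from open_eucl_vimage[OF this continuous_on_coord assms(2)] show ?thesis
    by (rule back_subst[where P="open_eucl (Suc n)"]) (auto simp: slab_def)
qed

text \<open>For a solution with values in a convex domain, the difference quotients in the direction of a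
  parameter solve a linear equation whose coefficients depend continuously on the step \<open>h\<close>, including
  \<open>h = 0\<close>. Continuous dependence of linear equations on parameters thus gives the derivative.\<close>

lemma solution_difference_quotient:
  fixes y :: "nat \<Rightarrow> (nat \<Rightarrow> real) \<Rightarrow> real"
  assumes \<Omega>: "open_eucl (Suc n + d) \<Omega>"
    and conv: "\<And>z z' \<theta>. z \<in> \<Omega> \<Longrightarrow> z' \<in> \<Omega> \<Longrightarrow> \<theta> \<in> {0..1} \<Longrightarrow> (\<lambda>i. z i + \<theta> * (z' i - z i)) \<in> \<Omega>"
    and F: "\<And>l. l < d \<Longrightarrow> smooth_fun_on (Suc n + d) \<Omega> (F l)"
    and W: "cube n x (2 * r) \<subseteq> W" and x: "x \<in> eucl n" and r: "r > 0"
    and cont: "\<And>l. l < d \<Longrightarrow> continuous_on (slab n W {a..b}) (y l)"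
    and y\<Omega>: "\<And>v. v \<in> slab n W {a..b} \<Longrightarrow> join n d v (\<lambda>l. y l v) \<in> \<Omega>"
    and sol: "\<And>v l. v \<in> slab n W {a..b} \<Longrightarrow> l < d \<Longrightarrow>
      ((\<lambda>s. F l (join n d (v(n := s)) (\<lambda>k. y k (v(n := s))))) has_integral y l v - init l) {a..v n}"
    and j: "j < n"
  defines "z \<equiv> \<lambda>v. join n d v (\<lambda>l. y l v)"
  shows "\<exists>w. (\<forall>l<d. continuous_on (slab n (cube n x r) {a..b}) (w l)) \<and>
     (\<forall>v\<in>slab n (cube n x r) {a..b}. \<forall>l<d. DERIV (\<lambda>s. y l (v(j := s))) (v j) :> w l v \<and>
       ((\<lambda>s. (\<Sum>k<d. partial_deriv (Suc n + k) (F l) (z (v(n := s))) * w k (v(n := s)))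
          + partial_deriv j (F l) (z (v(n := s)))) has_integral w l v) {a..v n})"
proof -
  \<comment> \<open>A point of \<open>K\<close> is a base point together with a step, the step 0
    included. Steps of size at most \<open>r / 2\<close> from the closed cube of radius
    \<open>r\<close> remain in the open cube of radius \<open>2 * r\<close>.\<close>
  define K where "K = ccube n x r \<times> {- r / 2..r / 2}"
  have K: "compact K" unfolding K_def by (intro compact_Times compact_ccube x) auto
  \<comment> \<open>\<open>A\<close> is the base point at time \<open>t\<close>, and
    \<open>B\<close> is the same point moved by the step in direction \<open>j\<close>; their
    solution values are compared.\<close>
  define A where "A p t = ((fst p)(n := t) :: nat \<Rightarrow> real)" for p :: "(nat \<Rightarrow> real) \<times> real" and t
  define B where "B p t = ((fst p)(j := fst p j + snd p, n := t) :: nat \<Rightarrow> real)" for p :: "(nat \<Rightarrow> real) \<times> real" and t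
  have ccW: "ccube n x r \<subseteq> W" using ccube_subset_cube[of r "2 * r" n x] W r by auto
  have ccE: "u \<in> eucl n" if "u \<in> ccube n x r" for u using that by (simp add: ccube_def)
  have A_in: "A p t \<in> slab n W {a..b}" if "p \<in> K" "t \<in> {a..b}" for p t
    unfolding A_def using that ccW ccE by (intro slabI) (auto simp: K_def)
  have B_in: "B p t \<in> slab n W {a..b}" if "p \<in> K" "t \<in> {a..b}" for p t
  proof -
    have "(fst p)(j := fst p j + snd p) \<in> W"
    proof (rule subsetD[OF W], unfold cube_def mem_Collect_eq, intro conjI allI impI)
      show "(fst p)(j := fst p j + snd p) \<in> eucl n" using that ccE j by (auto simp: K_def in_eucl)
      fix i assume "i < n"
      then have "\<bar>fst p i - x i\<bar> \<le> r" "\<bar>snd p\<bar> \<le> r / 2" using that by (auto simp: K_def ccube_def abs_le_iff)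
      then show "\<bar>((fst p)(j := fst p j + snd p)) i - x i\<bar> < 2 * r" using r by (auto simp: abs_if split: if_splits)
    qed
    then show ?thesis unfolding B_def using that ccE j by (intro slabI) (auto simp: K_def in_eucl)
  qed
  have zc: "continuous_on S (\<lambda>p. z (f p))" if "continuous_on S f" "\<And>p. p \<in> S \<Longrightarrow> f p \<in> slab n W {a..b}"
    for S :: "'c::topological_space set" and f
  proof (rule continuous_on_coordinatewise_then_product)
    fix i
    consider "i < Suc n" | k where "i = Suc n + k" "k < d" | "i \<ge> Suc n + d"
      by (metis add_less_cancel_left le_add_diff_inverse not_less)
    then show "continuous_on S (\<lambda>p. z (f p) i)"
    proof cases
      case 1 then show ?thesis using that(1) by (simp add: z_def continuous_on_product_then_coordinatewise)
    next
      case 2 then show ?thesis using continuous_on_comp[OF cont[OF 2(2)] that] by (simp add: z_def)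
    qed (simp add: z_def join_def)
  qed
  \<comment> \<open>The segment between the two solution values, including parameters and time.
    Convexity of \<open>\<Omega>\<close> keeps it in the domain of \<open>F\<close>.\<close>
  define Z where "Z p t \<theta> = (\<lambda>i. z (A p t) i + \<theta> * (z (B p t) i - z (A p t) i))" for p t \<theta>
  have Z_in: "Z p t \<theta> \<in> \<Omega>" if "p \<in> K" "t \<in> {a..b}" "\<theta> \<in> {0..1}" for p t \<theta>
    unfolding Z_def using A_in[OF that(1,2)] B_in[OF that(1,2)] that(3) y\<Omega> by (intro conv) (auto simp: z_def)
  have fc: "continuous_on S (\<lambda>q. fst (f q) i)" if "continuous_on S f" for S :: "'c::topological_space set" and f :: "_ \<Rightarrow> (nat \<Rightarrow> real) \<times> real" and i
    using continuous_on_product_then_coordinatewise[OF continuous_on_fst[OF that]] by simp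
  have Zc: "continuous_on ((K \<times> {a..b}) \<times> {0..1}) (\<lambda>q. Z (fst (fst q)) (snd (fst q)) (snd q))"
  proof -
    have c1: "continuous_on ((K \<times> {a..b}) \<times> {0..1::real}) (\<lambda>q. z (A (fst (fst q)) (snd (fst q))))"
      unfolding A_def by (intro zc continuous_on_upd2 continuous_intros) (use A_in in \<open>auto simp: A_def\<close>)
    have c2: "continuous_on ((K \<times> {a..b}) \<times> {0..1::real}) (\<lambda>q. z (B (fst (fst q)) (snd (fst q))))"
      unfolding B_def by (intro zc continuous_on_upd2 continuous_intros fc) (use B_in in \<open>auto simp: B_def\<close>)
    show ?thesis
      unfolding Z_def
      by (rule continuous_on_coordinatewise_then_product)
         (intro continuous_intros continuous_on_product_then_coordinatewise[OF c1] continuous_on_product_then_coordinatewise[OF c2])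
  qed
  have pint: "continuous_on (K \<times> {a..b}) (\<lambda>(p, t). integral {0..1} (\<lambda>\<theta>. g (Z p t \<theta>)))" if g: "continuous_on \<Omega> g" for g :: "_ \<Rightarrow> real"
    using integral_continuous_on_param[of "K \<times> {a..b}" 0 "1::real" "\<lambda>pt \<theta>. g (Z (fst pt) (snd pt) \<theta>)"]
      continuous_on_comp[OF g Zc] Z_in by (simp add: case_prod_beta mem_Times_iff)
  \<comment> \<open>The partial derivatives of \<open>F\<close> averaged over this segment: with
    them the increment of \<open>F\<close> is exactly linear in the increments of its arguments, and
    at step 0 they become the partial derivatives themselves.\<close>
  define Bm where "Bm l k p t = integral {0..1} (\<lambda>\<theta>. partial_deriv (Suc n + k) (F l) (Z p t \<theta>))" for l k p t
  define Cm where "Cm l p t = integral {0..1} (\<lambda>\<theta>. partial_deriv j (F l) (Z p t \<theta>))" for l p t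
  have pdc: "continuous_on \<Omega> (partial_deriv i (F l))" if "l < d" "i < Suc n + d" for i l
    by (rule smooth_fun_on_continuous[OF smooth_fun_on_partial[OF F[OF that(1)] that(2)]])
  have Bc: "continuous_on (K \<times> {a..b}) (\<lambda>(p, t). Bm l k p t)" if "l < d" "k < d" for l k
    unfolding Bm_def using that by (intro pint pdc) auto
  have Cc: "continuous_on (K \<times> {a..b}) (\<lambda>(p, t). Cm l p t)" if "l < d" for l
    unfolding Cm_def using that j by (intro pint pdc) auto
  have "\<exists>L\<ge>0. \<forall>p\<in>K. \<forall>t\<in>{a..b}. \<forall>l<d. \<forall>k<d. \<bar>Bm l k p t\<bar> \<le> L"
  proof -
    have "continuous_on (K \<times> {a..b}) (\<lambda>q. \<Sum>l<d. \<Sum>k<d. \<bar>Bm l k (fst q) (snd q)\<bar>)"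
      using Bc by (intro continuous_intros) (auto simp: case_prod_beta)
    then have "bounded ((\<lambda>q. \<Sum>l<d. \<Sum>k<d. \<bar>Bm l k (fst q) (snd q)\<bar>) ` (K \<times> {a..b}))"
      by (intro compact_imp_bounded compact_continuous_image compact_Times K) auto
    then obtain c where c: "\<forall>q\<in>K \<times> {a..b}. norm (\<Sum>l<d. \<Sum>k<d. \<bar>Bm l k (fst q) (snd q)\<bar>) \<le> c"
      by (auto simp: bounded_iff)
    have "\<bar>Bm l k p t\<bar> \<le> max c 0" if "p \<in> K" "t \<in> {a..b}" "l < d" "k < d" for p t l k
    proof -
      have "\<bar>Bm l k p t\<bar> \<le> (\<Sum>k<d. \<bar>Bm l k p t\<bar>)"
        using that by (intro member_le_sum[of k "{..<d}" "\<lambda>k. \<bar>Bm l k p t\<bar>"]) auto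
      also have "\<dots> \<le> (\<Sum>l<d. \<Sum>k<d. \<bar>Bm l k p t\<bar>)"
        using that by (intro member_le_sum[of l "{..<d}" "\<lambda>l. \<Sum>k<d. \<bar>Bm l k p t\<bar>"]) (auto intro: sum_nonneg)
      also have "\<dots> \<le> c" using bspec[OF c, of "(p, t)"] that by (auto simp: abs_le_iff)
      finally show ?thesis by simp
    qed
    then show ?thesis by (intro exI[of _ "max c 0"]) auto
  qed
  then obtain L where L: "L \<ge> 0" "\<And>p t l k. p \<in> K \<Longrightarrow> t \<in> {a..b} \<Longrightarrow> l < d \<Longrightarrow> k < d \<Longrightarrow> \<bar>Bm l k p t\<bar> \<le> L" by blast
  have lin: "\<bar>\<Sum>k<d. Bm l k p t * w k\<bar> \<le> L * (\<Sum>k<d. \<bar>w k\<bar>)" if "p \<in> K" "t \<in> {a..b}" "l < d" for l p t w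
  proof -
    have "\<bar>\<Sum>k<d. Bm l k p t * w k\<bar> \<le> (\<Sum>k<d. \<bar>Bm l k p t * w k\<bar>)" by (rule sum_abs)
    also have "\<dots> \<le> (\<Sum>k<d. L * \<bar>w k\<bar>)" unfolding abs_mult using L(2)[OF that] by (intro sum_mono mult_right_mono) auto
    finally show ?thesis by (simp add: sum_distrib_left)
  qed
  \<comment> \<open>The candidate \<open>Q\<close> for the difference quotient is obtained by
    solving the linear equation, not by division; it is therefore defined and continuous at step 0
    too.\<close>
  have "\<exists>Q. (\<forall>l<d. continuous_on (K \<times> {a..b}) (\<lambda>(p, t). Q p t l)) \<and>
    (\<forall>p\<in>K. \<forall>t\<in>{a..b}. \<forall>l<d. ((\<lambda>s. (\<Sum>k<d. Bm l k p s * Q p s k) + Cm l p s) has_integral Q p t l - (\<lambda>_. 0) l) {a..t})"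
  proof (rule picard[OF K L(1)])
    show "continuous_on (K \<times> {a..b} \<times> UNIV) (\<lambda>(p, t, w). (\<Sum>k<d. Bm l k p t * w k) + Cm l p t)" if l: "l < d" for l
    proof -
      have "continuous_on (K \<times> {a..b} \<times> UNIV) (\<lambda>q. g (fst q) (fst (snd q)))"
        if g: "continuous_on (K \<times> {a..b}) (\<lambda>(p, t). g p t)" for g :: "_ \<Rightarrow> _ \<Rightarrow> real"
      proof -
        have "continuous_on (K \<times> {a..b} \<times> UNIV) (\<lambda>q. (fst q, fst (snd q)))" by (intro continuous_intros)
        from continuous_on_comp[OF g this] show ?thesis by auto
      qed
      note coef = this[OF Bc[OF l]] this[OF Cc[OF l]]
      have "continuous_on (K \<times> {a..b} \<times> UNIV) (\<lambda>q. snd (snd q) k :: real)" for k :: nat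
        by (rule continuous_on_product_then_coordinatewise) (intro continuous_intros)
      then show ?thesis
        unfolding case_prod_beta using coef
        by (intro continuous_on_add continuous_on_sum continuous_on_mult) auto
    qed
    show "\<bar>(\<Sum>k<d. Bm l k p t * w k) + Cm l p t - ((\<Sum>k<d. Bm l k p t * w' k) + Cm l p t)\<bar> \<le> L * (\<Sum>k<d. \<bar>w k - w' k\<bar>)"
      if "p \<in> K" "t \<in> {a..b}" "l < d" for p t w w' l
      using lin[OF that, of "\<lambda>k. w k - w' k"] by (simp add: right_diff_distrib sum_subtractf)
  qed
  then obtain Q where Qc: "\<And>l. l < d \<Longrightarrow> continuous_on (K \<times> {a..b}) (\<lambda>(p, t). Q p t l)"
    and Q: "\<And>p t l. p \<in> K \<Longrightarrow> t \<in> {a..b} \<Longrightarrow> l < d \<Longrightarrow>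
       ((\<lambda>s. (\<Sum>k<d. Bm l k p s * Q p s k) + Cm l p s) has_integral Q p t l) {a..t}"
    by (simp only: diff_zero) blast
  have incr: "F l (z (B p t)) - F l (z (A p t)) = Cm l p t * snd p + (\<Sum>k<d. Bm l k p t * (y k (B p t) - y k (A p t)))"
    if p: "p \<in> K" "t \<in> {a..b}" and l: "l < d" for p t l
  proof -
    let ?D = "\<lambda>i. z (B p t) i - z (A p t) i"
    have D: "((\<lambda>\<theta>. F l (Z p t \<theta>)) has_vector_derivative (\<Sum>i<Suc n + d. partial_deriv i (F l) (Z p t \<theta>) * ?D i)) (at \<theta> within {0..1})"
      if "\<theta> \<in> {0..1}" for \<theta>
      unfolding has_real_derivative_iff_has_vector_derivative[symmetric]
    proof (rule smooth_DERIV_along_curve[OF F[OF l]])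
      show "((\<lambda>\<theta>. Z p t \<theta> i) has_real_derivative ?D i) (at \<theta> within {0..1})" for i
        unfolding Z_def by (auto intro!: derivative_eq_intros)
    qed (use Z_in[OF p] that open_eucl_subset[OF \<Omega>] in auto)
    have Zt: "continuous_on {0..1} (Z p t)"
      unfolding Z_def by (intro continuous_on_coordinatewise_then_product continuous_intros)
    have int: "(\<lambda>\<theta>. partial_deriv i (F l) (Z p t \<theta>)) integrable_on {0..1}" if "i < Suc n + d" for i
      by (intro integrable_continuous_real continuous_on_comp[OF pdc[OF l that] Zt] Z_in p)
    have "((\<lambda>\<theta>. \<Sum>i<Suc n + d. partial_deriv i (F l) (Z p t \<theta>) * ?D i) has_integral F l (Z p t 1) - F l (Z p t 0)) {0..1}"
      by (rule fundamental_theorem_of_calculus) (use D in auto)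
    moreover have "((\<lambda>\<theta>. \<Sum>i<Suc n + d. partial_deriv i (F l) (Z p t \<theta>) * ?D i) has_integral
       (\<Sum>i<Suc n + d. integral {0..1} (\<lambda>\<theta>. partial_deriv i (F l) (Z p t \<theta>)) * ?D i)) {0..1}"
      using int by (intro has_integral_sum has_integral_mult_left) (auto simp: integrable_integral)
    ultimately have "F l (Z p t 1) - F l (Z p t 0) = (\<Sum>i<Suc n + d. integral {0..1} (\<lambda>\<theta>. partial_deriv i (F l) (Z p t \<theta>)) * ?D i)"
      by (rule has_integral_unique)
    also have "\<dots> = (\<Sum>i<Suc n. integral {0..1} (\<lambda>\<theta>. partial_deriv i (F l) (Z p t \<theta>)) * ?D i) +
       (\<Sum>k<d. integral {0..1} (\<lambda>\<theta>. partial_deriv (Suc n + k) (F l) (Z p t \<theta>)) * ?D (Suc n + k))"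
      by (rule sum_lessThan_add)
    also have "(\<Sum>i<Suc n. integral {0..1} (\<lambda>\<theta>. partial_deriv i (F l) (Z p t \<theta>)) * ?D i) = (\<Sum>i<Suc n. if i = j then Cm l p t * snd p else 0)"
      using j by (intro sum.cong) (auto simp: z_def A_def B_def Cm_def)
    also have "\<dots> = Cm l p t * snd p" using j by simp
    finally show ?thesis by (simp add: Z_def Bm_def z_def)
  qed
  have AB_s: "(A p t)(n := s) = A p s" "(B p t)(n := s) = B p s" "A p t n = t" "B p t n = t" for p t s
    by (auto simp: A_def B_def)
  \<comment> \<open>Stated with a product in place of a quotient, so that step 0 is no separate
    case. The difference of the two sides solves the homogeneous linear equation and vanishes by
    uniqueness.\<close>
  have quot: "y l (B p t) - y l (A p t) = snd p * Q p t l" if p: "p \<in> K" and t: "t \<in> {a..b}" and l: "l < d" for p t l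
  proof -
    let ?r = "\<lambda>t l. y l (B p t) - y l (A p t) - snd p * Q p t l"
    have yc: "continuous_on {a..b} (\<lambda>t. y l (A p t))" "continuous_on {a..b} (\<lambda>t. y l (B p t))" if "l < d" for l
    proof -
      have "continuous_on {a..b} (A p)" "continuous_on {a..b} (B p)"
        unfolding A_def[abs_def] B_def[abs_def] by (intro continuous_on_upd2 continuous_intros)+
      then show "continuous_on {a..b} (\<lambda>t. y l (A p t))" "continuous_on {a..b} (\<lambda>t. y l (B p t))"
        using continuous_on_comp[OF cont[OF that]] A_in B_in p by blast+
    qed
    have "?r t l = 0"
    proof (rule volterra_zero[where r="?r" and h="\<lambda>l s. \<Sum>k<d. Bm l k p s * ?r s k" and L=L])
      show "continuous_on {a..b} (\<lambda>t. ?r t l)" if "l < d" for l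
        using yc[OF that] continuous_on_section[OF Qc[OF that] p order_refl] by (intro continuous_intros) auto
      show "((\<lambda>s. \<Sum>k<d. Bm l k p s * ?r s k) has_integral ?r t l) {a..t}" if t: "t \<in> {a..b}" and l: "l < d" for t l
      proof -
        have "((\<lambda>s. F l (z (B p s)) - F l (z (A p s)) - snd p * ((\<Sum>k<d. Bm l k p s * Q p s k) + Cm l p s))
           has_integral (y l (B p t) - init l) - (y l (A p t) - init l) - snd p * Q p t l) {a..t}"
          using sol[OF A_in[OF p t] l] sol[OF B_in[OF p t] l] Q[OF p t l]
          by (intro has_integral_diff has_integral_mult_right) (simp_all add: AB_s z_def)
        moreover have "F l (z (B p s)) - F l (z (A p s)) - snd p * ((\<Sum>k<d. Bm l k p s * Q p s k) + Cm l p s)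
          = (\<Sum>k<d. Bm l k p s * ?r s k)" if "s \<in> {a..t}" for s
          using incr[OF p _ l, of s] that t
          by (simp add: right_diff_distrib sum_subtractf sum_distrib_left sum.distrib algebra_simps)
        ultimately show ?thesis
          by (subst has_integral_cong[of "{a..t}" _ "\<lambda>s. F l (z (B p s)) - F l (z (A p s)) - snd p * ((\<Sum>k<d. Bm l k p s * Q p s k) + Cm l p s)"]) auto
      qed
    qed (use lin p L(1) t l in auto)
    then show ?thesis by simp
  qed
  \<comment> \<open>The value of \<open>Q\<close> at step 0, which is the limit of the difference
    quotients.\<close>
  define w where "w l v = Q (v(n := 0), 0) (v n) l" for l v
  have K0: "(v(n := 0), 0) \<in> K" if "v \<in> slab n (cube n x r) T" for v T
    using that r cube_subset_ccube[of n x r] by (auto simp: K_def slab_def)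
  have "continuous_on (slab n (cube n x r) {a..b}) (w l)" if "l < d" for l
  proof -
    have "continuous_on (slab n (cube n x r) {a..b}) (\<lambda>v. ((v(n := 0), 0::real), v n))"
      by (intro continuous_intros continuous_on_drop_last continuous_on_coord)
    from continuous_on_comp[OF Qc[OF that] this] show ?thesis
      using K0 by (auto simp: w_def[abs_def] slab_def)
  qed
  moreover have "DERIV (\<lambda>s. y l (v(j := s))) (v j) :> w l v" if v: "v \<in> slab n (cube n x r) {a..b}" and l: "l < d" for v l
  proof -
    let ?u = "v(n := 0)"
    have pK: "(?u, h) \<in> K" if "h \<in> {- r / 2..r / 2}" for h
      using K0[OF v] that by (auto simp: K_def)
    have t: "v n \<in> {a..b}" using v by (simp add: slab_def)
    have q: "y l (v(j := v j + h)) - y l v = h * Q (?u, h) (v n) l" if "h \<in> {- r / 2..r / 2}" for h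
    proof -
      have "B (?u, h) (v n) = v(j := v j + h)" "A (?u, h) (v n) = v"
        using j by (auto simp: A_def B_def fun_eq_iff)
      then show ?thesis using quot[OF pK[OF that] t l] by simp
    qed
    have "continuous_on {- r / 2..r / 2} (\<lambda>h. ((?u, h), v n))" by (intro continuous_intros)
    from continuous_on_comp[OF Qc[OF l] this] have "continuous_on {- r / 2..r / 2} (\<lambda>h. Q (?u, h) (v n) l)"
      using pK t by auto
    then have "isCont (\<lambda>h. Q (?u, h) (v n) l) 0" by (rule continuous_on_interior) (use r in auto)
    then have lim: "((\<lambda>h. Q (?u, h) (v n) l) \<longlongrightarrow> w l v) (at 0)" by (simp add: isCont_def w_def)
    have ev: "eventually (\<lambda>h. Q (?u, h) (v n) l = (y l (v(j := v j + h)) - y l (v(j := v j))) / h) (at 0)"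
    proof -
      have "eventually (\<lambda>h. h \<in> {- r / 2<..<r / 2}) (at 0)"
        using r by (intro eventually_at_in_open') auto
      moreover have "eventually (\<lambda>h::real. h \<noteq> 0) (at 0)" by (simp add: eventually_at_filter)
      ultimately show ?thesis by eventually_elim (use q in auto)
    qed
    have "((\<lambda>h. (y l (v(j := v j + h)) - y l (v(j := v j))) / h) \<longlongrightarrow> w l v) (at 0)"
      by (rule Lim_transform_eventually[OF lim ev])
    then show ?thesis by (simp add: DERIV_def)
  qed
  moreover have "((\<lambda>s. (\<Sum>k<d. partial_deriv (Suc n + k) (F l) (z (v(n := s))) * w k (v(n := s)))
          + partial_deriv j (F l) (z (v(n := s)))) has_integral w l v) {a..v n}"
    if v: "v \<in> slab n (cube n x r) {a..b}" and l: "l < d" for v l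
  proof -
    let ?p = "(v(n := 0), 0::real)"
    have t: "v n \<in> {a..b}" using v by (simp add: slab_def)
    have "A ?p s = v(n := s)" "B ?p s = v(n := s)" for s using j by (auto simp: A_def B_def fun_eq_iff)
    then have "Z ?p s \<theta> = z (v(n := s))" for s \<theta> by (simp add: Z_def)
    then have "Bm l k ?p s = partial_deriv (Suc n + k) (F l) (z (v(n := s)))" "Cm l ?p s = partial_deriv j (F l) (z (v(n := s)))" for k s
      by (simp_all add: Bm_def Cm_def)
    with Q[OF K0[OF v] t l] show ?thesis by (simp add: w_def)
  qed
  ultimately show ?thesis by blast
qed

lemma join_eucl [simp]: "join n d v y \<in> eucl (Suc (n + d))"
  using join_simps(3)[of n d v y] by simp

lemma open_eucl_eucl [simp]: "open_eucl n (eucl n)"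
  by (simp flip: topspace_eucl)

lemma slab_eucl: "slab n W T \<subseteq> eucl (Suc n)" by (auto simp: slab_def)

lemma continuous_on_join:
  assumes "\<And>l. l < d \<Longrightarrow> continuous_on S (y l)" "continuous_on S f"
  shows "continuous_on S (\<lambda>v. join n d (f v) (\<lambda>l. y l v))"
proof (rule continuous_on_coordinatewise_then_product)
  fix i
  consider "i < Suc n" | k where "i = Suc n + k" "k < d" | "i \<ge> Suc n + d"
    by (metis add_less_cancel_left le_add_diff_inverse not_less)
  then show "continuous_on S (\<lambda>v. join n d (f v) (\<lambda>l. y l v) i)"
  proof cases
    case 1 then show ?thesis using assms by (simp add: continuous_on_product_then_coordinatewise)
  next
    case 2 then show ?thesis using assms by simp
  qed (simp add: join_def)
qed

lemma solution_time_derivative: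
  assumes F: "continuous_on \<Omega> (F l)"
    and cont: "\<And>l. l < d \<Longrightarrow> continuous_on (slab n W {a..b}) (y l)"
    and y\<Omega>: "\<And>v. v \<in> slab n W {a..b} \<Longrightarrow> join n d v (\<lambda>l. y l v) \<in> \<Omega>"
    and sol: "\<And>v. v \<in> slab n W {a..b} \<Longrightarrow>
      ((\<lambda>s. F l (join n d (v(n := s)) (\<lambda>k. y k (v(n := s))))) has_integral y l v - init l) {a..v n}"
    and v: "v \<in> slab n W {a<..<b}"
  shows "DERIV (\<lambda>s. y l (v(n := s))) (v n) :> F l (join n d v (\<lambda>l. y l v))"
proof -
  let ?g = "\<lambda>s. F l (join n d (v(n := s)) (\<lambda>k. y k (v(n := s))))"
  have vs: "v(n := s) \<in> slab n W {a..b}" if "s \<in> {a..b}" for s using slab_upd[OF v that] .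
  have c: "continuous_on {a..b} (\<lambda>s. v(n := s))" by (intro continuous_on_upd2 continuous_intros)
  have "continuous_on {a..b} (\<lambda>s. join n d (v(n := s)) (\<lambda>k. y k (v(n := s))))"
    using continuous_on_comp[OF cont c] vs by (intro continuous_on_join c) auto
  then have "continuous_on {a..b} ?g" using y\<Omega>[OF vs] by (intro continuous_on_comp[OF F]) auto
  moreover have vn: "v n \<in> {a<..<b}" using v by (simp add: slab_def)
  ultimately have "((\<lambda>s. integral {a..s} ?g) has_real_derivative ?g (v n)) (at (v n) within {a..b})"
    by (intro integral_has_real_derivative) auto
  then have "((\<lambda>s. init l + integral {a..s} ?g) has_real_derivative ?g (v n)) (at (v n))"
    using vn DERIV_add[OF DERIV_const] by (simp add: at_within_Icc_at)
  moreover have "init l + integral {a..s} ?g = y l (v(n := s))" if "s \<in> {a<..<b}" for s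
    using integral_unique[OF sol[OF vs, of s]] that by simp
  then have "eventually (\<lambda>s. init l + integral {a..s} ?g = y l (v(n := s))) (nhds (v n))"
    using eventually_nhds_in_open[of "{a<..<b}" "v n"] vn by (auto elim!: eventually_mono)
  ultimately have "DERIV (\<lambda>s. y l (v(n := s))) (v n) :> ?g (v n)"
    by (subst (asm) DERIV_cong_ev[OF refl _ refl]) auto
  then show ?thesis by simp
qed

text \<open>The solution together with its derivative in one parameter direction solves a system of
  the same type with \<open>d + d\<close> unknowns. The induction hypothesis for this doubled system
  shows that the parameter derivatives are of class C^k; hence \<open>d\<close>,
  \<open>\<Omega>\<close> and \<open>F\<close> have to vary in the induction. The time derivative is
  a composite of \<open>F\<close> with the solution.\<close>

lemma solution_smooth:
  fixes y :: "nat \<Rightarrow> (nat \<Rightarrow> real) \<Rightarrow> real"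
  assumes "open_eucl (Suc n + d) \<Omega>"
    and "\<And>z z' \<theta>. z \<in> \<Omega> \<Longrightarrow> z' \<in> \<Omega> \<Longrightarrow> \<theta> \<in> {0..1} \<Longrightarrow> (\<lambda>i. z i + \<theta> * (z' i - z i)) \<in> \<Omega>"
    and "\<And>l. l < d \<Longrightarrow> smooth_fun_on (Suc n + d) \<Omega> (F l)"
    and "open_eucl n W"
    and "\<And>l. l < d \<Longrightarrow> continuous_on (slab n W {a..b}) (y l)"
    and "\<And>v. v \<in> slab n W {a..b} \<Longrightarrow> join n d v (\<lambda>l. y l v) \<in> \<Omega>"
    and "\<And>v l. v \<in> slab n W {a..b} \<Longrightarrow> l < d \<Longrightarrow>
      ((\<lambda>s. F l (join n d (v(n := s)) (\<lambda>k. y k (v(n := s))))) has_integral y l v - init l) {a..v n}"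
    and "l < d"
  shows "Ck_on (Suc n) k (slab n W {a<..<b}) (y l)"
  using assms
proof (induction k arbitrary: d \<Omega> F W y init l)
  case 0
  have "continuous_on (slab n W {a<..<b}) (y l)"
    using 0(5)[OF 0(8)] by (rule continuous_on_subset) (intro slab_mono; auto)
  then show ?case by (simp add: Ck_on_0 slab_eucl)
next
  case (Suc k)
  note \<Omega> = Suc.prems(1) and conv = Suc.prems(2) and F = Suc.prems(3) and W = Suc.prems(4)
    and cont = Suc.prems(5) and y\<Omega> = Suc.prems(6) and sol = Suc.prems(7) and l = Suc.prems(8)
  have yk: "Ck_on (Suc n) k (slab n W {a<..<b}) (y l)" if "l < d" for l
    by (rule Suc.IH[OF Suc.prems(1-7) that])
  have SO: "open_eucl (Suc n) (slab n W {a<..<b})" using W by (intro open_eucl_slab) auto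
  have sub: "slab n W {a<..<b} \<subseteq> slab n W {a..b}" by (intro slab_mono) auto
  have Dn: "DERIV (\<lambda>s. y l (v(n := s))) (v n) :> F l (join n d v (\<lambda>l. y l v))"
    if "v \<in> slab n W {a<..<b}" for v
    by (rule solution_time_derivative[where F=F and l=l and n=n and d=d and W=W and a=a and b=b and y=y and init=init, OF smooth_fun_on_continuous[OF F[OF l]] cont y\<Omega> sol[OF _ l] that])
  have Ckn: "Ck_on (Suc n) k (slab n W {a<..<b}) (partial_deriv n (y l))"
  proof (rule Ck_on_cong[OF SO])
    show "Ck_on (Suc n) k (slab n W {a<..<b}) (\<lambda>v. F l (join n d v (\<lambda>l. y l v)))"
    proof (rule Ck_on_compose[OF \<Omega> SO smooth_fun_on_Ck[OF F[OF l]]])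
      show "Ck_on (Suc n) k (slab n W {a<..<b}) (\<lambda>v. join n d v (\<lambda>l. y l v) i)" if "i < Suc n + d" for i
      proof (cases "i < Suc n")
        case False
        then obtain m where "i = Suc n + m" "m < d" using \<open>i < Suc n + d\<close>
          by (metis add_less_cancel_left le_add_diff_inverse not_less)
        then show ?thesis using yk by simp
      qed (simp add: Ck_on_coord slab_eucl)
    qed (use y\<Omega> sub in auto)
    show "F l (join n d v (\<lambda>l. y l v)) = partial_deriv n (y l) v" if "v \<in> slab n W {a<..<b}" for v
      by (rule partial_derivI[OF Dn[OF that], symmetric])
  qed
  \<comment> \<open>The variational equation is available only on a cube around each parameter
    value. This suffices, since being of class C^k is a local property.\<close>
  have main: "\<exists>V. open_eucl (Suc n) V \<and> v \<in> V \<and> Ck_on (Suc n) k V (partial_deriv j (y l)) \<and>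
      (\<lambda>s. y l (v(j := s))) field_differentiable at (v j)" if v: "v \<in> slab n W {a<..<b}" and j: "j < n" for v j
  proof -
    define x where "x = v(n := 0)"
    have xW: "x \<in> W" using v by (simp add: slab_def x_def)
    obtain e where e: "e > 0" "cube n x e \<subseteq> W" using open_euclD[OF W xW] by blast
    define r where "r = e / 2"
    have r: "r > 0" "cube n x (2 * r) \<subseteq> W" using e by (auto simp: r_def)
    have x: "x \<in> eucl n" using open_eucl_subset[OF W] xW by blast
    let ?W = "cube n x r"
    have WW: "?W \<subseteq> W" using r cube_mono[of r "2 * r" n x] by auto
    let ?V = "slab n ?W {a<..<b}"
    have VO: "open_eucl (Suc n) ?V" by (intro open_eucl_slab open_eucl_cube) auto
    have vV: "v \<in> ?V" using v cube_self[OF x r(1)] by (auto simp: slab_def x_def)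
    have subV: "slab n ?W {a..b} \<subseteq> slab n W {a..b}" using WW by (intro slab_mono) auto
    from solution_difference_quotient[where W=W and y=y and init=init and a=a and b=b, OF \<Omega> conv F r(2) x r(1) cont y\<Omega> sol j]
    obtain w where w: "(\<forall>l<d. continuous_on (slab n ?W {a..b}) (w l)) \<and>
     (\<forall>v\<in>slab n ?W {a..b}. \<forall>l<d. DERIV (\<lambda>s. y l (v(j := s))) (v j) :> w l v \<and>
       ((\<lambda>s. (\<Sum>k<d. partial_deriv (Suc n + k) (F l) (join n d (v(n := s)) (\<lambda>l. y l (v(n := s)))) * w k (v(n := s)))
          + partial_deriv j (F l) (join n d (v(n := s)) (\<lambda>l. y l (v(n := s))))) has_integral w l v) {a..v n})"
      by (rule exE)
    have wc: "continuous_on (slab n ?W {a..b}) (w l)" if "l < d" for l using w that by blast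
    have wD: "DERIV (\<lambda>s. y l (v(j := s))) (v j) :> w l v" if "v \<in> slab n ?W {a..b}" "l < d" for v l
      using w that by blast
    have wI: "((\<lambda>s. (\<Sum>k<d. partial_deriv (Suc n + k) (F l) (join n d (v(n := s)) (\<lambda>l. y l (v(n := s)))) * w k (v(n := s)))
          + partial_deriv j (F l) (join n d (v(n := s)) (\<lambda>l. y l (v(n := s))))) has_integral w l v) {a..v n}"
      if "v \<in> slab n ?W {a..b}" "l < d" for v l
      using w that by blast
    \<comment> \<open>Forgets the second half of the doubled state, on which the equation for the
      first half does not depend.\<close>
    define trunc where "trunc z = (\<lambda>i. if i < Suc n + d then z i else 0)" for z :: "nat \<Rightarrow> real"
    let ?N = "Suc n + (d + d)"
    define \<Omega>' where "\<Omega>' = {z \<in> eucl ?N. trunc z \<in> \<Omega>}"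
    \<comment> \<open>The components from \<open>d\<close> on are the linearised equation, with the
      inhomogeneous term that stems from the explicit dependence of \<open>F\<close> on the
      parameter \<open>j\<close>.\<close>
    define F' where "F' l z = (if l < d then F l (trunc z) else
       (\<Sum>k<d. partial_deriv (Suc n + k) (F (l - d)) (trunc z) * z (Suc n + (d + k))) + partial_deriv j (F (l - d)) (trunc z))" for l z
    define y' where "y' l = (if l < d then y l else w (l - d))" for l
    have trunc: "smooth_on ?N (eucl ?N) (Suc n + d) trunc"
      by (rule smooth_onI) (auto simp: trunc_def in_eucl intro!: smooth_fun_on_coord)
    have \<Omega>': "open_eucl ?N \<Omega>'" unfolding \<Omega>'_def by (rule open_eucl_smooth_preimage[OF trunc \<Omega>])
    have trunc': "smooth_on ?N \<Omega>' (Suc n + d) trunc"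
      by (rule smooth_on_subset[OF trunc \<Omega>']) (auto simp: \<Omega>'_def)
    have smt: "smooth_fun_on ?N \<Omega>' (\<lambda>z. g (trunc z))" if "smooth_fun_on (Suc n + d) \<Omega> g" for g
      by (rule smooth_fun_on_compose[OF that trunc']) (auto simp: \<Omega>'_def)
    have F': "smooth_fun_on ?N \<Omega>' (F' l)" if "l < d + d" for l
    proof (cases "l < d")
      case True then show ?thesis using smt[OF F[OF True]] by (simp add: F'_def[abs_def])
    next
      case False
      then have "l - d < d" using that by simp
      have "smooth_fun_on ?N \<Omega>' (\<lambda>z. (\<Sum>k<d. partial_deriv (Suc n + k) (F (l - d)) (trunc z) * z (Suc n + (d + k)))
          + partial_deriv j (F (l - d)) (trunc z))"
        by (intro smooth_fun_on_add smooth_fun_on_sum smooth_fun_on_mult smt smooth_fun_on_partial F smooth_fun_on_coord \<Omega>')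
           (use \<open>l - d < d\<close> j in auto)
      then show ?thesis using False by (simp add: F'_def[abs_def])
    qed
    have trj: "trunc (join n (d + d) v (\<lambda>l. y' l v)) = join n d v (\<lambda>l. y l v)" for v
      by (auto simp: trunc_def join_def y'_def fun_eq_iff)
    \<comment> \<open>The initial values in the second half are 0, because the original ones do not
      depend on the parameters.\<close>
    have "Ck_on (Suc n) k ?V (y' l)" if "l < d + d" for l
    proof (rule Suc.IH[where \<Omega>=\<Omega>' and F=F' and init="\<lambda>l. if l < d then init l else 0", OF \<Omega>' _ F' open_eucl_cube _ _ _ that])
      show "(\<lambda>i. z i + \<theta> * (z' i - z i)) \<in> \<Omega>'" if z: "z \<in> \<Omega>'" "z' \<in> \<Omega>'" "\<theta> \<in> {0..1}" for z z' \<theta>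
      proof -
        have "trunc (\<lambda>i. z i + \<theta> * (z' i - z i)) = (\<lambda>i. trunc z i + \<theta> * (trunc z' i - trunc z i))"
          by (auto simp: trunc_def)
        moreover have "\<dots> \<in> \<Omega>" using z by (intro conv) (auto simp: \<Omega>'_def)
        ultimately show ?thesis using z by (auto simp: \<Omega>'_def in_eucl)
      qed
      show "continuous_on (slab n ?W {a..b}) (y' l)" if "l < d + d" for l
        using that wc[of "l - d"] continuous_on_subset[OF cont subV] by (auto simp: y'_def)
      show "join n (d + d) v (\<lambda>l. y' l v) \<in> \<Omega>'" if "v \<in> slab n ?W {a..b}" for v
        using y\<Omega>[of v] subV that by (auto simp: \<Omega>'_def trj)
      show "((\<lambda>s. F' l (join n (d + d) (v(n := s)) (\<lambda>k. y' k (v(n := s))))) has_integral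
          y' l v - (if l < d then init l else 0)) {a..v n}" if v: "v \<in> slab n ?W {a..b}" and l: "l < d + d" for v l
      proof (cases "l < d")
        case True
        have F'eq: "F' l (join n (d + d) v (\<lambda>k. y' k v)) = F l (join n d v (\<lambda>k. y k v))" for v
          using True by (simp add: F'_def trj)
        have y'eq: "y' l = y l" "(if l < d then init l else 0) = init l" using True by (auto simp: y'_def)
        show ?thesis unfolding F'eq y'eq by (rule sol[OF subsetD[OF subV v] True])
      next
        case False
        then have ld: "l - d < d" using l by simp
        have F'eq: "F' l (join n (d + d) v (\<lambda>k. y' k v)) =
           (\<Sum>k<d. partial_deriv (Suc n + k) (F (l - d)) (join n d v (\<lambda>l. y l v)) * w k v)
             + partial_deriv j (F (l - d)) (join n d v (\<lambda>l. y l v))" for v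
        proof -
          have "join n (d + d) v (\<lambda>k. y' k v) (Suc n + (d + k)) = w k v" if "k < d" for k
            using that by (simp add: y'_def)
          then show ?thesis using False by (simp add: F'_def trj)
        qed
        have y'eq: "y' l v - (if l < d then init l else 0) = w (l - d) v" for v using False by (auto simp: y'_def)
        show ?thesis unfolding F'eq y'eq by (rule wI[OF v ld])
      qed
    qed
    from this[of "d + l"] have wk: "Ck_on (Suc n) k ?V (w l)" using l by (simp add: y'_def)
    have "Ck_on (Suc n) k ?V (partial_deriv j (y l))"
    proof (rule Ck_on_cong[OF VO _ wk])
      fix v assume "v \<in> ?V"
      then have "v \<in> slab n ?W {a..b}" by (auto simp: slab_def)
      from partial_derivI[OF wD[OF this l]] show "w l v = partial_deriv j (y l) v" by simp
    qed
    moreover have "(\<lambda>s. y l (v(j := s))) field_differentiable at (v j)"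
      using wD[OF _ l, of v] vV slab_mono[of ?W ?W "{a<..<b}" "{a..b}" n] unfolding field_differentiable_def by force
    ultimately show ?thesis using VO vV by blast
  qed
  have "Ck_on (Suc n) k (slab n W {a<..<b}) (partial_deriv i (y l))" if "i < Suc n" for i
  proof (cases "i = n")
    case False
    then have "i < n" using that by simp
    show ?thesis by (rule Ck_on_local[OF slab_eucl]) (use main[OF _ \<open>i < n\<close>] in blast)
  qed (simp add: Ckn)
  moreover have "(\<lambda>s. y l (v(i := s))) field_differentiable at (v i)" if "i < Suc n" "v \<in> slab n W {a<..<b}" for i v
  proof (cases "i = n")
    case False
    then have "i < n" using that by simp
    then show ?thesis using main that(2) by blast
  next
    case True
    then show ?thesis using Dn[OF that(2)] unfolding field_differentiable_def by blast
  qed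
  moreover have "continuous_on (slab n W {a<..<b}) (y l)"
    using cont[OF l] sub by (rule continuous_on_subset)
  ultimately show ?case unfolding Ck_on_Suc[OF slab_eucl] by blast
qed

text \<open>Picard iteration wants a Lipschitz condition for all states, so the state is clamped to
  a box before it enters \<open>F\<close>, and the time interval is made so short that the solution
  never leaves the box. No initial value is prescribed: for the lifts it will be adjusted afterwards
  by right translation.\<close>

theorem ode_local_solution:
  assumes z0: "z0 \<in> \<Omega>0" and \<Omega>0: "open_eucl (Suc n + d) \<Omega>0"
    and F: "\<And>l. l < d \<Longrightarrow> smooth_fun_on (Suc n + d) \<Omega>0 (F l)"
  defines "v0 \<equiv> \<lambda>i. if i < Suc n then z0 i else 0"
  obtains \<delta> y where "\<delta> > 0"
    "\<And>l. l < d \<Longrightarrow> smooth_fun_on (Suc n) (cube (Suc n) v0 \<delta>) (y l)"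
    "\<And>v. v \<in> cube (Suc n) v0 \<delta> \<Longrightarrow> join n d v (\<lambda>l. y l v) \<in> \<Omega>0"
    "\<And>v l. v \<in> cube (Suc n) v0 \<delta> \<Longrightarrow> l < d \<Longrightarrow> partial_deriv n (y l) v = F l (join n d v (\<lambda>l. y l v))"
proof -
  let ?N = "Suc n + d"
  have zE: "z0 \<in> eucl ?N" using z0 open_eucl_subset[OF \<Omega>0] by blast
  obtain e where e: "e > 0" "cube ?N z0 e \<subseteq> \<Omega>0" using open_euclD[OF \<Omega>0 z0] by blast
  \<comment> \<open>Since \<open>2 * r < e\<close>, even the closed cube of radius
    \<open>2 * r\<close> lies in the domain, which gives bounds by compactness; the box for the
    state has radius \<open>r\<close>, strictly inside.\<close>
  define r where "r = e / 3"
  have r: "r > 0" using e by (simp add: r_def)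
  have cc: "ccube ?N z0 (2 * r) \<subseteq> \<Omega>0" using ccube_subset_cube[of "2 * r" e ?N z0] e r by (auto simp: r_def)
  let ?\<Omega> = "cube ?N z0 (2 * r)"
  have \<Omega>sub: "?\<Omega> \<subseteq> \<Omega>0" using cube_subset_ccube cc by blast
  define bnd where "bnd z = (\<Sum>l<d. \<bar>F l z\<bar> + (\<Sum>i<?N. \<bar>partial_deriv i (F l) z\<bar>))" for z
  have "continuous_on (ccube ?N z0 (2 * r)) bnd"
    unfolding bnd_def
    by (intro continuous_on_sum continuous_on_add continuous_on_rabs continuous_on_subset[OF smooth_fun_on_continuous[of ?N] cc] smooth_fun_on_partial F)
      auto
  then have "bounded (bnd ` ccube ?N z0 (2 * r))"
    by (intro compact_imp_bounded compact_continuous_image compact_ccube zE)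
  then obtain c where c: "\<And>z. z \<in> ccube ?N z0 (2 * r) \<Longrightarrow> \<bar>bnd z\<bar> \<le> c" by (auto simp: bounded_iff)
  \<comment> \<open>A common bound for the components of \<open>F\<close> and their partial
    derivatives, made positive because \<open>\<delta>\<close> is defined by division by it.\<close>
  define L where "L = max c 0 + 1"
  have L: "L > 0" by (simp add: L_def)
  have bF: "\<bar>F l z\<bar> \<le> L" and bP: "\<And>i. i < ?N \<Longrightarrow> \<bar>partial_deriv i (F l) z\<bar> \<le> L" if "z \<in> ?\<Omega>" "l < d" for z l
  proof -
    have "\<bar>F l z\<bar> + (\<Sum>i<?N. \<bar>partial_deriv i (F l) z\<bar>) \<le> bnd z"
      unfolding bnd_def using that
      by (intro member_le_sum[of l "{..<d}" "\<lambda>l. \<bar>F l z\<bar> + (\<Sum>i<?N. \<bar>partial_deriv i (F l) z\<bar>)"]) (auto intro!: add_nonneg_nonneg sum_nonneg)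
    also have "\<dots> \<le> L" using c[of z] that cube_subset_ccube[of ?N z0 "2 * r"] by (auto simp: L_def)
    finally have *: "\<bar>F l z\<bar> + (\<Sum>i<?N. \<bar>partial_deriv i (F l) z\<bar>) \<le> L" .
    moreover have "0 \<le> (\<Sum>i<?N. \<bar>partial_deriv i (F l) z\<bar>)" by (intro sum_nonneg) auto
    ultimately show "\<bar>F l z\<bar> \<le> L" by linarith
    fix i assume "i < ?N"
    then have "\<bar>partial_deriv i (F l) z\<bar> \<le> (\<Sum>i<?N. \<bar>partial_deriv i (F l) z\<bar>)"
      by (intro member_le_sum[of i "{..<?N}" "\<lambda>i. \<bar>partial_deriv i (F l) z\<bar>"]) auto
    then show "\<bar>partial_deriv i (F l) z\<bar> \<le> L" using * by linarith
  qed
  define init where "init k = z0 (Suc n + k)" for k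
  \<comment> \<open>Clamping is 1-Lipschitz in each coordinate, so the bound for the partial
    derivatives becomes a Lipschitz bound on the whole state space.\<close>
  define cl where "cl y = (\<lambda>k. max (init k - r) (min (init k + r) (y k)))" for y
  define u0 where "u0 = v0(n := 0)"
  have u0: "u0 \<in> eucl n" by (auto simp: u0_def v0_def in_eucl)
  \<comment> \<open>The time interval has length \<open>2 * \<delta>\<close>, so a solution of speed
    at most \<open>L\<close> moves by at most \<open>2 * L * \<delta> \<le> r\<close> and is not
    affected by the clamping.\<close>
  define \<delta> where "\<delta> = min r (r / (2 * L))"
  have \<delta>: "\<delta> > 0" "\<delta> \<le> r" "2 * L * \<delta> \<le> r" using r L by (auto simp: \<delta>_def min_def field_simps)
  \<comment> \<open>The value \<open>init\<close> is assumed at the left end \<open>a\<close>, not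
    in the middle of the interval, so that the integral equation runs in one direction of time
    only.\<close>
  define a b where "a = v0 n - \<delta>" and "b = v0 n + \<delta>"
  let ?K = "ccube n u0 r"
  have join_in: "join n d (u(n := t)) y \<in> ?\<Omega>" if "u \<in> ?K" "t \<in> {a..b}" "\<And>k. k < d \<Longrightarrow> \<bar>y k - init k\<bar> \<le> r" for u t y
    unfolding cube_def mem_Collect_eq
  proof (intro conjI allI impI)
    fix i assume "i < ?N"
    then consider "i < n" | "i = n" | k where "i = Suc n + k" "k < d"
      by (metis add_less_cancel_left le_add_diff_inverse not_less less_Suc_eq)
    then show "\<bar>join n d (u(n := t)) y i - z0 i\<bar> < 2 * r"
    proof cases
      case 1
      then have "\<bar>u i - z0 i\<bar> \<le> r" using that(1) by (auto simp: ccube_def u0_def v0_def)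
      then show ?thesis using 1 r by simp
    next
      case 2 then show ?thesis using that(2) \<delta> r by (auto simp: a_def b_def v0_def)
    next
      case 3 then show ?thesis using that(3)[OF 3(2)] r by (simp add: init_def)
    qed
  qed simp
  have cl: "\<bar>cl y k - init k\<bar> \<le> r" for y k using r by (auto simp: cl_def)
  have clid: "cl y k = y k" if "\<bar>y k - init k\<bar> \<le> r" for y k using that by (auto simp: cl_def)
  have lip: "\<bar>F l (join n d (u(n := t)) (cl y)) - F l (join n d (u(n := t)) (cl y'))\<bar> \<le> L * (\<Sum>k<d. \<bar>y k - y' k\<bar>)"
    if "u \<in> ?K" "t \<in> {a..b}" "l < d" for u t y y' l
  proof -
    let ?j = "join n d (u(n := t)) (cl y)" and ?j' = "join n d (u(n := t)) (cl y')"
    have j: "?j \<in> ?\<Omega>" "?j' \<in> ?\<Omega>" using join_in[OF that(1,2), of "cl y"] join_in[OF that(1,2), of "cl y'"] cl by blast+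
    have "\<exists>\<xi>. (\<forall>i<?N. \<xi> i \<in> between ?j' ?j) \<and> F l ?j - F l ?j' = (\<Sum>i<?N. partial_deriv i (F l) (\<xi> i) * (?j i - ?j' i))"
    proof (rule mean_value_coordinates)
      fix i w assume iw: "i < ?N" "w \<in> between ?j' ?j"
      then have "w \<in> \<Omega>0" using between_cube[OF j(2,1)] \<Omega>sub by blast
      then show "(\<lambda>t. F l (w(i := t))) field_differentiable at (w i)"
        using smooth_fun_on_DERIV[OF F[OF that(3)] iw(1)] field_differentiable_def by blast
    qed (use j cube_subset in auto)
    then obtain \<xi> where \<xi>: "\<And>i. i < ?N \<Longrightarrow> \<xi> i \<in> between ?j' ?j"
      "F l ?j - F l ?j' = (\<Sum>i<?N. partial_deriv i (F l) (\<xi> i) * (?j i - ?j' i))" by blast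
    have "\<bar>F l ?j - F l ?j'\<bar> \<le> (\<Sum>i<?N. \<bar>partial_deriv i (F l) (\<xi> i) * (?j i - ?j' i)\<bar>)"
      unfolding \<xi>(2) by (rule sum_abs)
    also have "\<dots> \<le> (\<Sum>i<?N. L * \<bar>?j i - ?j' i\<bar>)"
    proof (rule sum_mono)
      fix i assume "i \<in> {..<?N}"
      then have "\<bar>partial_deriv i (F l) (\<xi> i)\<bar> \<le> L" using \<xi>(1)[of i] between_cube[OF j(2,1)] that by (intro bP) auto
      then show "\<bar>partial_deriv i (F l) (\<xi> i) * (?j i - ?j' i)\<bar> \<le> L * \<bar>?j i - ?j' i\<bar>"
        unfolding abs_mult by (rule mult_right_mono) simp
    qed
    also have "\<dots> = (\<Sum>i<Suc n. L * \<bar>?j i - ?j' i\<bar>) + (\<Sum>k<d. L * \<bar>?j (Suc n + k) - ?j' (Suc n + k)\<bar>)"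
      by (rule sum_lessThan_add)
    also have "\<dots> = (\<Sum>k<d. L * \<bar>cl y k - cl y' k\<bar>)" by simp
    also have "\<dots> \<le> (\<Sum>k<d. L * \<bar>y k - y' k\<bar>)"
      using L by (intro sum_mono mult_left_mono) (auto simp: cl_def max_def min_def abs_if)
    finally show ?thesis by (simp add: sum_distrib_left)
  qed
  have "\<exists>Y. (\<forall>l<d. continuous_on (?K \<times> {a..b}) (\<lambda>(u, t). Y u t l)) \<and>
    (\<forall>u\<in>?K. \<forall>t\<in>{a..b}. \<forall>l<d. ((\<lambda>s. F l (join n d (u(n := s)) (cl (Y u s)))) has_integral Y u t l - init l) {a..t})"
  proof (rule picard[OF compact_ccube[OF u0], of L])
    show "continuous_on (?K \<times> {a..b} \<times> UNIV) (\<lambda>(u, t, y). F l (join n d (u(n := t)) (cl y)))" if "l < d" for l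
    proof -
      have "continuous_on (?K \<times> {a..b} \<times> UNIV) (\<lambda>q. snd (snd q) k :: real)" for k :: nat
        by (rule continuous_on_product_then_coordinatewise) (intro continuous_intros)
      then have "continuous_on (?K \<times> {a..b} \<times> UNIV) (\<lambda>q. join n d ((fst q)(n := fst (snd q))) (\<lambda>k. cl (snd (snd q)) k))"
        unfolding cl_def by (intro continuous_on_join[where y="\<lambda>k q. max (init k - r) (min (init k + r) (snd (snd q) k))"] continuous_on_upd2 continuous_intros)
      moreover have "join n d ((fst q)(n := fst (snd q))) (\<lambda>k. cl (snd (snd q)) k) \<in> \<Omega>0"
        if "q \<in> ?K \<times> {a..b} \<times> UNIV" for q
        using join_in[of "fst q" "fst (snd q)" "cl (snd (snd q))"] cl \<Omega>sub that by auto
      ultimately have "continuous_on (?K \<times> {a..b} \<times> UNIV)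
          (\<lambda>q. F l (join n d ((fst q)(n := fst (snd q))) (\<lambda>k. cl (snd (snd q)) k)))"
        by (rule continuous_on_comp[OF smooth_fun_on_continuous[OF F[OF that]]])
      then show ?thesis by (simp add: case_prod_beta)
    qed
    show "\<bar>F l (join n d (u(n := t)) (cl y)) - F l (join n d (u(n := t)) (cl y'))\<bar> \<le> L * (\<Sum>k<d. \<bar>y k - y' k\<bar>)"
      if "u \<in> ?K" "t \<in> {a..b}" "l < d" for u t y y' l by (rule lip[OF that])
  qed (use L in simp)
  then obtain Y where Yc: "\<And>l. l < d \<Longrightarrow> continuous_on (?K \<times> {a..b}) (\<lambda>(u, t). Y u t l)"
    and Y: "\<And>u t l. u \<in> ?K \<Longrightarrow> t \<in> {a..b} \<Longrightarrow> l < d \<Longrightarrow>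
       ((\<lambda>s. F l (join n d (u(n := s)) (cl (Y u s)))) has_integral Y u t l - init l) {a..t}" by blast
  have Yr: "\<bar>Y u t l - init l\<bar> \<le> r" if "u \<in> ?K" "t \<in> {a..b}" "l < d" for u t l
  proof -
    have "norm (Y u t l - init l) \<le> L * measure lborel (cbox a t)"
    proof (rule has_integral_bound)
      show "((\<lambda>s. F l (join n d (u(n := s)) (cl (Y u s)))) has_integral Y u t l - init l) (cbox a t)"
        using Y[OF that] by simp
      show "norm (F l (join n d (u(n := s)) (cl (Y u s)))) \<le> L" if "s \<in> cbox a t" for s
        using bF[OF join_in[OF \<open>u \<in> ?K\<close> _ cl] \<open>l < d\<close>] that \<open>t \<in> {a..b}\<close> by auto
    qed (use L in auto)
    also have "\<dots> \<le> L * (2 * \<delta>)" using that L by (intro mult_left_mono) (auto simp: a_def b_def)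
    finally show ?thesis using \<delta> by simp
  qed
  define y where "y l v = Y (v(n := 0)) (v n) l" for l v
  let ?W = "cube n u0 r"
  have slK: "v(n := 0) \<in> ?K" "v n \<in> T" if "v \<in> slab n ?W T" for v T
    using that cube_subset_ccube by (auto simp: slab_def)
  have c1: "continuous_on (slab n ?W {a..b}) (y l)" if "l < d" for l
  proof -
    have "continuous_on (slab n ?W {a..b}) (\<lambda>v. (v(n := 0), v n))"
      by (intro continuous_intros continuous_on_drop_last continuous_on_coord)
    from continuous_on_comp[OF Yc[OF that] this]
    have "continuous_on (slab n ?W {a..b}) (\<lambda>v. case (v(n := 0), v n) of (u, t) \<Rightarrow> Y u t l)"
      using slK by blast
    then show ?thesis by (simp add: y_def[abs_def])
  qed
  have c2: "join n d v (\<lambda>l. y l v) \<in> ?\<Omega>" if "v \<in> slab n ?W {a..b}" for v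
    using join_in[OF slK[OF that], of "\<lambda>l. y l v"] Yr slK[OF that] by (simp add: y_def)
  have c3: "((\<lambda>s. F l (join n d (v(n := s)) (\<lambda>k. y k (v(n := s))))) has_integral y l v - init l) {a..v n}"
    if "v \<in> slab n ?W {a..b}" "l < d" for v l
  proof -
    have "join n d ((v(n := 0))(n := s)) (cl (Y (v(n := 0)) s)) = join n d (v(n := s)) (\<lambda>k. y k (v(n := s)))" if s: "s \<in> {a..v n}" for s
    proof -
      have "cl (Y (v(n := 0)) s) k = y k (v(n := s))" if "k < d" for k
        using slK[OF \<open>v \<in> slab n ?W {a..b}\<close>] s that Yr[of "v(n := 0)" s k] by (simp add: y_def clid)
      then show ?thesis by (auto simp: join_def)
    qed
    then show ?thesis using Y[OF slK[OF that(1)] that(2)] unfolding y_def[of l v]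
      by (subst has_integral_cong) auto
  qed
  have \<Omega>c: "(\<lambda>i. z i + \<theta> * (z' i - z i)) \<in> ?\<Omega>" if "z \<in> ?\<Omega>" "z' \<in> ?\<Omega>" "\<theta> \<in> {0..1}" for z z' \<theta>
  proof -
    have "\<bar>z i + \<theta> * (z' i - z i) - z0 i\<bar> < 2 * r" if "i < ?N" for i
    proof -
      have *: "z i \<in> {z0 i - 2 * r<..<z0 i + 2 * r}" "z' i \<in> {z0 i - 2 * r<..<z0 i + 2 * r}"
        using \<open>z \<in> ?\<Omega>\<close> \<open>z' \<in> ?\<Omega>\<close> \<open>i < ?N\<close> by (auto simp: cube_def abs_less_iff)
      have "(1 - \<theta>) * z i + \<theta> * z' i \<in> {z0 i - 2 * r<..<z0 i + 2 * r}"
        using convexD[OF convex_real_interval(8) *, of "1 - \<theta>" \<theta>] \<open>\<theta> \<in> {0..1}\<close> by simp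
      then show ?thesis by (auto simp: algebra_simps abs_less_iff)
    qed
    then show ?thesis using that by (auto simp: cube_def in_eucl)
  qed
  have Fs: "smooth_fun_on ?N ?\<Omega> (F l)" if "l < d" for l
    by (rule smooth_fun_on_subset[OF F[OF that] open_eucl_cube \<Omega>sub])
  have SO: "open_eucl (Suc n) (slab n ?W {a<..<b})" by (intro open_eucl_slab open_eucl_cube) auto
  have sm: "smooth_fun_on (Suc n) (slab n ?W {a<..<b}) (y l)" if "l < d" for l
    unfolding smooth_fun_on_def
    using SO solution_smooth[where W="?W" and y=y and F=F and init=init, OF open_eucl_cube \<Omega>c Fs open_eucl_cube c1 c2 c3 that] by blast
  have sub: "cube (Suc n) v0 \<delta> \<subseteq> slab n ?W {a<..<b}"
  proof
    fix v assume v: "v \<in> cube (Suc n) v0 \<delta>"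
    have vi: "\<bar>v i - v0 i\<bar> < \<delta>" if "i < Suc n" for i using v that by (auto simp: cube_def)
    have "v(n := 0) \<in> ?W"
      unfolding cube_def mem_Collect_eq
    proof (intro conjI allI impI)
      show "v(n := 0) \<in> eucl n" using v by (intro drop_last_eucl) (simp add: cube_def)
      show "\<bar>(v(n := 0)) i - u0 i\<bar> < r" if "i < n" for i using vi[of i] that \<delta>(2) by (simp add: u0_def)
    qed
    then show "v \<in> slab n ?W {a<..<b}" using v vi[of n] by (auto simp: slab_def cube_def a_def b_def)
  qed
  show thesis
  proof (rule that[OF \<delta>(1)])
    show "smooth_fun_on (Suc n) (cube (Suc n) v0 \<delta>) (y l)" if "l < d" for l
      by (rule smooth_fun_on_subset[OF sm[OF that] open_eucl_cube sub])
    have sub2: "slab n ?W {a<..<b} \<subseteq> slab n ?W {a..b}" by (intro slab_mono) auto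
    show "join n d v (\<lambda>l. y l v) \<in> \<Omega>0" if "v \<in> cube (Suc n) v0 \<delta>" for v
      using c2 that sub sub2 \<Omega>sub by blast
    show "partial_deriv n (y l) v = F l (join n d v (\<lambda>l. y l v))" if v: "v \<in> cube (Suc n) v0 \<delta>" and l: "l < d" for v l
    proof (rule partial_derivI)
      show "DERIV (\<lambda>s. y l (v(n := s))) (v n) :> F l (join n d v (\<lambda>l. y l v))"
        by (rule solution_time_derivative[where F=F and l=l and n=n and d=d and W="?W" and a=a and b=b and y=y and init=init, OF smooth_fun_on_continuous[OF Fs[OF l]] c1 c2 c3[OF _ l]])
           (use v sub in auto)
    qed
  qed
qed

section \<open>Plots, charts and tangent vectors\<close>

text \<open>Elements of \<open>plots\<close> are \<open>undefined\<close> off their domain. This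
  version disregards values there, so that plots can be written as plain terms and compared on their
  domain.\<close>

definition is_plot :: "('a, 'z) dspace_scheme \<Rightarrow> nat \<Rightarrow> (nat \<Rightarrow> real) set \<Rightarrow> ((nat \<Rightarrow> real) \<Rightarrow> 'a) \<Rightarrow> bool" where
  "is_plot X n U p \<longleftrightarrow> (n, U, restrict p U) \<in> plots X"

lemma is_plot_cong: "(\<And>u. u \<in> U \<Longrightarrow> p u = q u) \<Longrightarrow> is_plot X n U p \<longleftrightarrow> is_plot X n U q"
  unfolding is_plot_def using restrict_ext[of U p q] by simp

lemma is_plot_restrict [simp]: "is_plot X n U (restrict p U) \<longleftrightarrow> is_plot X n U p"
  by (rule is_plot_cong) simp

lemma is_plot_open: "diffeology X \<Longrightarrow> is_plot X n U p \<Longrightarrow> open_eucl n U"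
  by (auto simp: diffeology_def is_plot_def)

lemma is_plot_carrier: "diffeology X \<Longrightarrow> is_plot X n U p \<Longrightarrow> u \<in> U \<Longrightarrow> p u \<in> carrier X"
  by (fastforce simp: diffeology_def is_plot_def)

lemma plots_is_plot:
  assumes "diffeology X" "(n, U, p) \<in> plots X"
  shows "is_plot X n U p" "restrict p U = p"
proof -
  have "p \<in> U \<rightarrow>\<^sub>E carrier X" using assms by (auto simp: diffeology_def)
  then show "restrict p U = p" by (simp add: PiE_restrict)
  then show "is_plot X n U p" using assms by (simp add: is_plot_def)
qed

lemma is_plot_const: "diffeology X \<Longrightarrow> x \<in> carrier X \<Longrightarrow> open_eucl n U \<Longrightarrow> is_plot X n U (\<lambda>_. x)"
  by (auto simp: diffeology_def is_plot_def)

lemma is_plot_comp: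
  assumes X: "diffeology X" and p: "is_plot X n U p" and h: "smooth_on m V n h" "\<And>v. v \<in> V \<Longrightarrow> h v \<in> U"
  shows "is_plot X m V (\<lambda>v. p (h v))"
proof -
  have "\<forall>m V h. smooth_on m V n h \<and> h ` V \<subseteq> U \<longrightarrow> (m, V, restrict (restrict p U \<circ> h) V) \<in> plots X"
    using X p unfolding diffeology_def is_plot_def by fast
  then have "(m, V, restrict (restrict p U \<circ> h) V) \<in> plots X" using h by blast
  moreover have "restrict (restrict p U \<circ> h) V = restrict (\<lambda>v. p (h v)) V" using h(2) by (intro restrict_ext) auto
  ultimately show ?thesis by (simp add: is_plot_def)
qed

lemma is_plot_subset:
  assumes "diffeology X" "is_plot X n U p" "open_eucl n V" "V \<subseteq> U"
  shows "is_plot X n V p"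
  using is_plot_comp[OF assms(1,2) smooth_on_id[OF assms(3)]] assms(4) by auto

lemma is_plot_local:
  assumes X: "diffeology X" and loc: "\<And>u. u \<in> U \<Longrightarrow> \<exists>V. u \<in> V \<and> V \<subseteq> U \<and> is_plot X n V p"
  shows "is_plot X n U p"
proof -
  have U: "open_eucl n U"
    by (rule open_eucl_local) (drule loc, auto dest: is_plot_open[OF X])
  have carr: "p u \<in> carrier X" if "u \<in> U" for u using loc[OF that] is_plot_carrier[OF X] by blast
  have *: "\<exists>V. u \<in> V \<and> V \<subseteq> U \<and> (n, V, restrict (restrict p U) V) \<in> plots X" if "u \<in> U" for u
  proof -
    obtain V where V: "u \<in> V" "V \<subseteq> U" "is_plot X n V p" using loc[OF \<open>u \<in> U\<close>] by blast
    have "restrict (restrict p U) V = restrict p V" using V(2) by (intro restrict_ext) auto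
    then show ?thesis using V by (auto simp: is_plot_def)
  qed
  have "\<forall>n U p. open_eucl n U \<and> p \<in> U \<rightarrow>\<^sub>E carrier X \<and>
         (\<forall>u\<in>U. \<exists>V. u \<in> V \<and> V \<subseteq> U \<and> (n, V, restrict p V) \<in> plots X) \<longrightarrow> (n, U, p) \<in> plots X"
    using X unfolding diffeology_def by blast
  from this[rule_format, of n U "restrict p U"] show ?thesis
    unfolding is_plot_def using U carr * by auto
qed

lemma is_plot_image:
  assumes "smooth_map X Y F" "is_plot X n U p"
  shows "is_plot Y n U (\<lambda>u. F (p u))"
proof -
  have "(n, U, restrict (F \<circ> restrict p U) U) \<in> plots Y" using assms by (auto simp: smooth_map_def is_plot_def)
  moreover have "restrict (F \<circ> restrict p U) U = restrict (\<lambda>u. F (p u)) U" by (rule restrict_ext) simp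
  ultimately show ?thesis by (simp add: is_plot_def)
qed

lemma smooth_mapI:
  assumes "diffeology X" "\<And>x. x \<in> carrier X \<Longrightarrow> F x \<in> carrier Y"
    "\<And>n U p. is_plot X n U p \<Longrightarrow> is_plot Y n U (\<lambda>u. F (p u))"
  shows "smooth_map X Y F"
  unfolding smooth_map_def
proof (intro conjI ballI)
  fix q assume "q \<in> plots X"
  then obtain n U p where "q = (n, U, p)" "is_plot X n U p"
    using plots_is_plot[OF assms(1)] by (metis prod_cases3)
  then show "case q of (n, U, p) \<Rightarrow> (n, U, restrict (F \<circ> p) U) \<in> plots Y"
    using assms(3)[of n U p] by (simp add: is_plot_def comp_def)
qed (use assms in auto)

lemma is_plot_product:
  "is_plot (product_dspace X Y) n U p \<longleftrightarrow> is_plot X n U (\<lambda>u. fst (p u)) \<and> is_plot Y n U (\<lambda>u. snd (p u))"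
proof -
  have "restrict (fst \<circ> restrict p U) U = restrict (\<lambda>u. fst (p u)) U" "restrict (snd \<circ> restrict p U) U = restrict (\<lambda>u. snd (p u)) U"
    by (auto simp: restrict_def)
  then show ?thesis by (simp add: is_plot_def product_dspace_def)
qed

lemma is_plot_subspace:
  "is_plot (subspace_dspace X S) n U p \<longleftrightarrow> is_plot X n U p \<and> (\<forall>u\<in>U. p u \<in> S)"
  by (auto simp: is_plot_def subspace_dspace_def)

lemma diffeology_subspace:
  assumes X: "diffeology X" and S: "S \<subseteq> carrier X"
  shows "diffeology (subspace_dspace X S)"
proof -
  have *: "(n, U, p) \<in> plots (subspace_dspace X S) \<longleftrightarrow> is_plot X n U p \<and> p \<in> U \<rightarrow>\<^sub>E S" for n U p
  proof
    assume "(n, U, p) \<in> plots (subspace_dspace X S)"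
    then have p: "(n, U, p) \<in> plots X" "p ` U \<subseteq> S" by (auto simp: subspace_dspace_def)
    then have "p \<in> extensional U" using plots_is_plot(2)[OF X p(1)] by (metis restrict_extensional)
    then show "is_plot X n U p \<and> p \<in> U \<rightarrow>\<^sub>E S" using p plots_is_plot(1)[OF X p(1)] by (auto simp: PiE_iff)
  next
    assume "is_plot X n U p \<and> p \<in> U \<rightarrow>\<^sub>E S"
    then show "(n, U, p) \<in> plots (subspace_dspace X S)"
      by (auto simp: subspace_dspace_def is_plot_def PiE_restrict)
  qed
  show ?thesis
    unfolding diffeology_def
  proof (intro conjI ballI allI impI)
    fix q assume q: "q \<in> plots (subspace_dspace X S)"
    show "case q of (n, U, p) \<Rightarrow> open_eucl n U \<and> p \<in> U \<rightarrow>\<^sub>E carrier (subspace_dspace X S)"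
    proof (cases q)
      case (fields n U p)
      then have "is_plot X n U p" "p \<in> U \<rightarrow>\<^sub>E S" using q * by auto
      then show ?thesis using is_plot_open[OF X] fields by (simp add: subspace_dspace_def)
    qed
  next
    fix n U x assume "x \<in> carrier (subspace_dspace X S)" "open_eucl n U"
    then show "(n, U, restrict (\<lambda>_. x) U) \<in> plots (subspace_dspace X S)"
      using is_plot_const[OF X, of x n U] S unfolding is_plot_def subspace_dspace_def by auto
  next
    fix q assume q: "q \<in> plots (subspace_dspace X S)"
    show "case q of (n, U, p) \<Rightarrow> \<forall>m V h. smooth_on m V n h \<and> h ` V \<subseteq> U \<longrightarrow> (m, V, restrict (p \<circ> h) V) \<in> plots (subspace_dspace X S)"
    proof (cases q)
      case (fields n U p)
      then have p: "is_plot X n U p" "p \<in> U \<rightarrow>\<^sub>E S" using q * by auto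
      show ?thesis unfolding fields prod.case
      proof (intro allI impI)
        fix m V h assume h: "smooth_on m V n h \<and> h ` V \<subseteq> U"
        then have "is_plot X m V (\<lambda>v. p (h v))" using is_plot_comp[OF X p(1), of m V h] by auto
        then show "(m, V, restrict (p \<circ> h) V) \<in> plots (subspace_dspace X S)"
          unfolding * using p h by (auto simp: comp_def)
      qed
    qed
  next
    fix n U p
    assume H: "open_eucl n U \<and> p \<in> U \<rightarrow>\<^sub>E carrier (subspace_dspace X S) \<and>
         (\<forall>u\<in>U. \<exists>V. u \<in> V \<and> V \<subseteq> U \<and> (n, V, restrict p V) \<in> plots (subspace_dspace X S))"
    then have p: "p \<in> U \<rightarrow>\<^sub>E S" by (simp add: subspace_dspace_def)
    have "is_plot X n U p"
    proof (rule is_plot_local[OF X])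
      show "\<exists>V. u \<in> V \<and> V \<subseteq> U \<and> is_plot X n V p" if "u \<in> U" for u
        using H that unfolding * is_plot_restrict by blast
    qed
    with p show "(n, U, p) \<in> plots (subspace_dspace X S)" unfolding * by blast
  qed
qed

text \<open>The last condition is what remains of the Hausdorff property: it allows functions with compact
  support inside a chart to be extended by zero.\<close>

definition chart :: "('a, 'z) dspace_scheme \<Rightarrow> nat \<Rightarrow> 'a set \<Rightarrow> ('a \<Rightarrow> nat \<Rightarrow> real) \<Rightarrow> bool" where
  "chart X m W c \<longleftrightarrow> W \<subseteq> carrier X \<and> inj_on c W \<and> open_eucl m (c ` W) \<and>
     is_plot X m (c ` W) (inv_into W c) \<and>
     (\<forall>k U p. is_plot X k U p \<longrightarrow> smooth_on k {u \<in> U. p u \<in> W} m (\<lambda>u. c (p u))) \<and>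
     (\<forall>K. compact K \<and> K \<subseteq> c ` W \<longrightarrow> D_open X (carrier X - {y \<in> W. c y \<in> K}))"

text \<open>The Hausdorff property is spent on the last condition: a compact subset of the chart
  image corresponds to a compact and hence closed subset of \<open>T\<close>, whose complement has
  open preimages under plots.\<close>

lemma atlas_chart:
  assumes at: "smooth_atlas n T \<A>" and X: "carrier X = topspace T" "plots X = atlas_plots n T \<A>" and D: "diffeology X"
    and Wc: "(W, c) \<in> \<A>"
  shows "chart X n W c"
proof -
  have W: "openin T W" and cW: "open_eucl n (c ` W)"
    and hom: "homeomorphic_map (subtopology T W) (subtopology (Euclidean_space n) (c ` W)) c"
    and H: "Hausdorff_space T"
    using at Wc by (auto simp: smooth_atlas_def)
  have trans: "smooth_on n (c ` (W \<inter> W')) n (c' \<circ> inv_into W c)" if "(W', c') \<in> \<A>" for W' c'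
  proof -
    have "\<forall>a\<in>\<A>. \<forall>b\<in>\<A>. (case a of (W, c) \<Rightarrow> case b of (W', c') \<Rightarrow> smooth_on n (c ` (W \<inter> W')) n (c' \<circ> inv_into W c))"
      using at unfolding smooth_atlas_def by fast
    then show ?thesis using Wc that by fastforce
  qed
  have WT: "W \<subseteq> topspace T" using W by (rule openin_subset)
  have tW: "topspace (subtopology T W) = W" using WT by auto
  have tc: "topspace (subtopology (Euclidean_space n) (c ` W)) = c ` W"
    using openin_subset[OF cW] by auto
  have inj: "inj_on c W" using homeomorphic_imp_injective_map[OF hom] tW by simp
  obtain g where g: "homeomorphic_maps (subtopology T W) (subtopology (Euclidean_space n) (c ` W)) c g"
    using hom homeomorphic_map_maps by blast
  have gc: "continuous_map (subtopology (Euclidean_space n) (c ` W)) (subtopology T W) g"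
    and gi: "\<And>x. x \<in> W \<Longrightarrow> g (c x) = x"
    using g tW by (auto simp: homeomorphic_maps_def)
  have ginv: "inv_into W c z = g z" if "z \<in> c ` W" for z
    using that inj gi by auto
  have pl: "is_plot X n (c ` W) (inv_into W c)"
    unfolding is_plot_def X atlas_plots_def mem_Collect_eq prod.case
  proof (intro conjI ballI cW)
    show "restrict (inv_into W c) (c ` W) \<in> c ` W \<rightarrow>\<^sub>E topspace T"
      using WT by (auto intro!: inv_into_into)
    have "continuous_map (subtopology (Euclidean_space n) (c ` W)) T g"
      using gc continuous_map_in_subtopology by blast
    then show "continuous_map (subtopology (Euclidean_space n) (c ` W)) T (restrict (inv_into W c) (c ` W))"
      by (rule continuous_map_eq) (use tc ginv in auto)
    fix a assume "a \<in> \<A>"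
    then show "case a of (W', c') \<Rightarrow>
         smooth_on n {u \<in> c ` W. restrict (inv_into W c) (c ` W) u \<in> W'} n (c' \<circ> restrict (inv_into W c) (c ` W))"
    proof (cases a)
      case (Pair W' c')
      have "restrict (inv_into W c) (c ` W) (c y) = y" if "y \<in> W" for y using inj that by simp
      then have "{u \<in> c ` W. restrict (inv_into W c) (c ` W) u \<in> W'} = c ` (W \<inter> W')" by force
      moreover have "smooth_on n (c ` (W \<inter> W')) n (c' \<circ> restrict (inv_into W c) (c ` W))"
        by (subst smooth_on_cong[where g="c' \<circ> inv_into W c"]) (use trans Pair \<open>a \<in> \<A>\<close> in auto)
      ultimately show ?thesis using Pair by simp
    qed
  qed
  have sm: "smooth_on k {u \<in> U. p u \<in> W} n (\<lambda>u. c (p u))" if "is_plot X k U p" for k U p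
  proof -
    have "smooth_on k {u \<in> U. restrict p U u \<in> W} n (c \<circ> restrict p U)"
      using that Wc unfolding is_plot_def X atlas_plots_def by blast
    moreover have "{u \<in> U. restrict p U u \<in> W} = {u \<in> U. p u \<in> W}" by auto
    ultimately show ?thesis by (subst smooth_on_cong[where g="c \<circ> restrict p U"]) auto
  qed
  have closed: "D_open X (carrier X - {y \<in> W. c y \<in> K})" if K: "compact K" "K \<subseteq> c ` W" for K
  proof -
    have "compactin (subtopology (Euclidean_space n) (c ` W)) K"
      using K openin_subset[OF cW] by (simp add: compactin_subtopology Euclidean_space_eq subset_trans)
    then have "compactin T (g ` K)"
      using image_compactin[OF _ gc] compactin_subtopology by blast
    then have cl: "closedin T (g ` K)" using H by (rule compactin_imp_closedin[rotated])
    have "{y \<in> W. c y \<in> K} = g ` K"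
    proof (intro subset_antisym subsetI)
      show "y \<in> g ` K" if "y \<in> {y \<in> W. c y \<in> K}" for y using that gi by force
      show "y \<in> {y \<in> W. c y \<in> K}" if "y \<in> g ` K" for y using that K(2) gi by force
    qed
    then have op: "openin T (carrier X - {y \<in> W. c y \<in> K})" using cl X(1) by auto
    show ?thesis
      unfolding D_open_def
    proof (intro conjI ballI)
      fix q assume q: "q \<in> plots X"
      show "case q of (k, U, p) \<Rightarrow> open_eucl k {u \<in> U. p u \<in> carrier X - {y \<in> W. c y \<in> K}}"
      proof (cases q)
        case (fields k U p)
        then have "open_eucl k U" "continuous_map (subtopology (Euclidean_space k) U) T p"
          using q X by (auto simp: atlas_plots_def)
        from openin_continuous_map_preimage[OF this(2) op] this(1)
        have "open_eucl k {u \<in> topspace (subtopology (Euclidean_space k) U). p u \<in> carrier X - {y \<in> W. c y \<in> K}}"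
          using openin_trans_full by blast
        moreover have tU: "topspace (subtopology (Euclidean_space k) U) = U" using openin_subset[OF \<open>open_eucl k U\<close>] by auto
        ultimately have "open_eucl k {u \<in> U. p u \<in> carrier X - {y \<in> W. c y \<in> K}}" by (simp only: tU)
        then show ?thesis using fields by simp
      qed
    qed auto
  qed
  show ?thesis unfolding chart_def using WT X(1) inj cW pl sm closed by auto
qed

lemma manifold_diffeology: "manifold X \<Longrightarrow> diffeology X"
  by (simp add: manifold_def)

lemma manifold_chart:
  assumes "manifold X" "x \<in> carrier X"
  obtains m W c where "chart X m W c" "x \<in> W"
proof -
  obtain n T \<A> where at: "smooth_atlas n T \<A>" "carrier X = topspace T" "plots X = atlas_plots n T \<A>"
    using assms(1) unfolding manifold_def by blast
  have "(\<Union>(W, c)\<in>\<A>. W) = topspace T" using at(1) unfolding smooth_atlas_def by blast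
  then have "x \<in> (\<Union>(W, c)\<in>\<A>. W)" using at(2) assms(2) by simp
  then obtain W c where "(W, c) \<in> \<A>" "x \<in> W" by blast
  then show ?thesis using atlas_chart[OF at manifold_diffeology[OF assms(1)]] that by blast
qed

lemma chartD:
  assumes "chart X m W c"
  shows "W \<subseteq> carrier X" "inj_on c W" "open_eucl m (c ` W)" "is_plot X m (c ` W) (inv_into W c)"
    "\<And>k U p. is_plot X k U p \<Longrightarrow> smooth_on k {u \<in> U. p u \<in> W} m (\<lambda>u. c (p u))"
    "\<And>K. compact K \<Longrightarrow> K \<subseteq> c ` W \<Longrightarrow> D_open X (carrier X - {y \<in> W. c y \<in> K})"
  using assms by (auto simp: chart_def)

lemma D_open_plot: "D_open X S \<Longrightarrow> is_plot X k U p \<Longrightarrow> open_eucl k {u \<in> U. p u \<in> S}"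
proof -
  assume "D_open X S" "is_plot X k U p"
  then have "open_eucl k {u \<in> U. restrict p U u \<in> S}" unfolding D_open_def is_plot_def by blast
  moreover have "{u \<in> U. restrict p U u \<in> S} = {u \<in> U. p u \<in> S}" by auto
  ultimately show ?thesis by simp
qed

subsection \<open>Smooth functions on diffeological spaces\<close>

lemma smooth_functions_plot:
  assumes "f \<in> smooth_functions X" "is_plot X n U p"
  shows "smooth_fun_on n U (\<lambda>u. f (p u))"
proof -
  have "smooth_fun_on n U (f \<circ> restrict p U)" using assms by (auto simp: smooth_functions_def is_plot_def)
  then show ?thesis by (subst smooth_fun_on_cong[where g="f \<circ> restrict p U"]) auto
qed

lemma smooth_functionsI:
  assumes "diffeology X" "\<And>n U p. is_plot X n U p \<Longrightarrow> smooth_fun_on n U (\<lambda>u. f (p u))"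
  shows "f \<in> smooth_functions X"
  unfolding smooth_functions_def using assms plots_is_plot(1)[OF assms(1)] by (auto simp: comp_def)

lemma smooth_functions_comp:
  assumes "diffeology X" "f \<in> smooth_functions Y" "smooth_map X Y F"
  shows "(\<lambda>x. f (F x)) \<in> smooth_functions X"
  using smooth_functions_plot[OF assms(2) is_plot_image[OF assms(3)]] by (intro smooth_functionsI[OF assms(1)])

lemma smooth_functions_const: "diffeology X \<Longrightarrow> (\<lambda>x. c) \<in> smooth_functions X"
  by (intro smooth_functionsI smooth_fun_on_const is_plot_open)

lemma smooth_functions_mult:
  "diffeology X \<Longrightarrow> f \<in> smooth_functions X \<Longrightarrow> g \<in> smooth_functions X \<Longrightarrow> (\<lambda>x. f x * g x) \<in> smooth_functions X"
  by (rule smooth_functionsI, assumption, rule smooth_fun_on_mult; rule smooth_functions_plot)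

lemma smooth_functions_add:
  "diffeology X \<Longrightarrow> f \<in> smooth_functions X \<Longrightarrow> g \<in> smooth_functions X \<Longrightarrow> (\<lambda>x. f x + g x) \<in> smooth_functions X"
  by (rule smooth_functionsI, assumption, rule smooth_fun_on_add; rule smooth_functions_plot)

lemma smooth_functions_sum:
  assumes "diffeology X" "\<And>k. k \<in> J \<Longrightarrow> f k \<in> smooth_functions X"
  shows "(\<lambda>x. \<Sum>k\<in>J. f k x) \<in> smooth_functions X"
  by (intro smooth_functionsI[OF assms(1)] smooth_fun_on_sum is_plot_open[OF assms(1)] smooth_functions_plot[OF assms(2)])

text \<open>The support is contained in the round ball of radius \<open>d / 2\<close>, hence in a
  compact subset of the open cube of radius \<open>d\<close>.\<close>

definition bump :: "nat \<Rightarrow> (nat \<Rightarrow> real) \<Rightarrow> real \<Rightarrow> (nat \<Rightarrow> real) \<Rightarrow> real" where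
  "bump m x d z = expbump 1 ((d / 2)\<^sup>2 - (\<Sum>i<m. (z i - x i)\<^sup>2))"

definition bump_ext :: "nat \<Rightarrow> 'a set \<Rightarrow> ('a \<Rightarrow> nat \<Rightarrow> real) \<Rightarrow> (nat \<Rightarrow> real) \<Rightarrow> real \<Rightarrow> ((nat \<Rightarrow> real) \<Rightarrow> real) \<Rightarrow> 'a \<Rightarrow> real" where
  "bump_ext m W c x d h y = (if y \<in> W \<and> c y \<in> cube m x d then bump m x d (c y) * h (c y) else 0)"

lemma bump_center: "d > 0 \<Longrightarrow> bump m x d x > 0"
  by (simp add: bump_def expbump_def)

lemma smooth_fun_on_bump: "open_eucl m U \<Longrightarrow> smooth_fun_on m U (bump m x d)"
  unfolding bump_def[abs_def] power2_eq_square
  by (intro smooth_fun_on_expbump smooth_fun_on_diff smooth_fun_on_const smooth_fun_on_sum smooth_fun_on_mult smooth_fun_on_coord)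

lemma bump_support:
  assumes "x \<in> eucl m" "d > 0"
  obtains K where "compact K" "K \<subseteq> cube m x d" "\<And>z. z \<in> eucl m \<Longrightarrow> z \<notin> K \<Longrightarrow> bump m x d z = 0"
proof
  define K where "K = ccube m x (d / 2) \<inter> {z. (\<Sum>i<m. (z i - x i)\<^sup>2) \<le> (d / 2)\<^sup>2}"
  have "closed {z. (\<Sum>i<m. (z i - x i)\<^sup>2) \<le> (d / 2)\<^sup>2}"
    by (intro closed_Collect_le continuous_intros continuous_on_coord)
  then show "compact K" unfolding K_def using compact_ccube[OF assms(1)] by (intro compact_Int_closed)
  show "K \<subseteq> cube m x d" unfolding K_def using ccube_subset_cube[of "d / 2" d m x] assms by auto
  fix z assume z: "z \<in> eucl m" "z \<notin> K"
  have "\<bar>z i - x i\<bar> \<le> d / 2" if "(\<Sum>i<m. (z i - x i)\<^sup>2) \<le> (d / 2)\<^sup>2" "i < m" for i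
  proof -
    have "(z i - x i)\<^sup>2 \<le> (\<Sum>i<m. (z i - x i)\<^sup>2)"
      using that by (intro member_le_sum[of i "{..<m}" "\<lambda>i. (z i - x i)\<^sup>2"]) auto
    then have "(z i - x i)\<^sup>2 \<le> (d / 2)\<^sup>2" using that by linarith
    then show ?thesis using abs_le_square_iff[of "z i - x i" "d / 2"] assms by simp
  qed
  then have "\<not> (\<Sum>i<m. (z i - x i)\<^sup>2) \<le> (d / 2)\<^sup>2" using z by (auto simp: K_def ccube_def)
  then show "bump m x d z = 0" by (simp add: bump_def expbump_def)
qed

text \<open>The domain of a plot is covered by two open sets: the part that the plot maps into the
  cube, where the function is a product of smooth functions, and the part that avoids the compact
  support, where it is 0. Openness of the second part is the last condition on charts.\<close>

lemma bump_ext_smooth: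
  assumes X: "diffeology X" and ch: "chart X m W c" and x: "x \<in> eucl m" and d: "d > 0" "cube m x d \<subseteq> c ` W"
    and h: "smooth_fun_on m (cube m x d) h"
  shows "bump_ext m W c x d h \<in> smooth_functions X"
proof (rule smooth_functionsI[OF X])
  fix n U p assume p: "is_plot X n U p"
  obtain K where K: "compact K" "K \<subseteq> cube m x d" "\<And>z. z \<in> eucl m \<Longrightarrow> z \<notin> K \<Longrightarrow> bump m x d z = 0"
    using bump_support[OF x d(1)] by blast
  have UW: "smooth_on n {u \<in> U. p u \<in> W} m (\<lambda>u. c (p u))" by (rule chartD(5)[OF ch p])
  let ?V1 = "{u \<in> {u \<in> U. p u \<in> W}. c (p u) \<in> cube m x d}"
  have V1: "open_eucl n ?V1" by (rule open_eucl_smooth_preimage[OF UW open_eucl_cube])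
  have UW1: "smooth_on n ?V1 m (\<lambda>u. c (p u))" by (rule smooth_on_subset[OF UW V1]) auto
  have s1: "smooth_fun_on n ?V1 (\<lambda>u. bump_ext m W c x d h (p u))"
  proof (subst smooth_fun_on_cong)
    show "smooth_fun_on n ?V1 (\<lambda>u. bump m x d (c (p u)) * h (c (p u)))"
      by (intro smooth_fun_on_mult smooth_fun_on_compose[OF smooth_fun_on_bump[OF open_eucl_cube] UW1]
           smooth_fun_on_compose[OF h UW1]) auto
  qed (auto simp: bump_ext_def)
  let ?V2 = "{u \<in> U. p u \<in> carrier X - {y \<in> W. c y \<in> K}}"
  have V2: "open_eucl n ?V2" using D_open_plot[OF chartD(6)[OF ch K(1)] p] K(2) d(2) by auto
  have z: "bump_ext m W c x d h (p u) = 0" if "u \<in> ?V2" for u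
    using that K(3)[of "c (p u)"] cube_subset[of m x d] by (auto simp: bump_ext_def)
  have s2: "smooth_fun_on n ?V2 (\<lambda>u. bump_ext m W c x d h (p u))"
    using smooth_fun_on_cong[of ?V2 "\<lambda>u. bump_ext m W c x d h (p u)" "\<lambda>_. 0" n] z smooth_fun_on_const[OF V2, of 0] by blast
  show "smooth_fun_on n U (\<lambda>u. bump_ext m W c x d h (p u))"
  proof (rule smooth_fun_on_local)
    fix u assume u: "u \<in> U"
    show "\<exists>V. u \<in> V \<and> V \<subseteq> U \<and> smooth_fun_on n V (\<lambda>u. bump_ext m W c x d h (p u))"
    proof (cases "u \<in> ?V1")
      case True
      show ?thesis by (rule exI[of _ ?V1]) (intro conjI True s1; fast)
    next
      case False
      have "u \<in> ?V2" using False u is_plot_carrier[OF X p u] K(2) by auto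
      show ?thesis by (rule exI[of _ ?V2]) (intro conjI \<open>u \<in> ?V2\<close> s2; fast)
    qed
  qed
qed

lemma chart_cube:
  assumes "chart X m W c" "x \<in> W"
  obtains d where "d > 0" "cube m (c x) d \<subseteq> c ` W"
  using open_euclD[OF chartD(3)[OF assms(1)], of "c x"] assms(2) by blast

lemma chart_eucl: "chart X m W c \<Longrightarrow> x \<in> W \<Longrightarrow> c x \<in> eucl m"
  using open_eucl_subset[OF chartD(3)] by blast

text \<open>A bump at \<open>x\<close> on a cube too small to contain \<open>y\<close>. Separation
  by functions later turns vanishing derivatives into equality of points of
  \<open>G\<close>.\<close>

lemma smooth_functions_separate:
  assumes X: "manifold X" and xy: "x \<in> carrier X" "y \<in> carrier X" "x \<noteq> y"
  obtains f where "f \<in> smooth_functions X" "f x \<noteq> f y"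
proof -
  note D = manifold_diffeology[OF X]
  obtain m W c where ch: "chart X m W c" and x: "x \<in> W" using manifold_chart[OF X xy(1)] .
  obtain d where d: "d > 0" "cube m (c x) d \<subseteq> c ` W" using chart_cube[OF ch x] .
  have cx: "c x \<in> eucl m" by (rule chart_eucl[OF ch x])
  have "\<exists>e>0. e \<le> d \<and> (y \<in> W \<longrightarrow> c y \<notin> cube m (c x) e)"
  proof (cases "y \<in> W")
    case True
    then have "c x \<noteq> c y" using inj_onD[OF chartD(2)[OF ch]] x xy by blast
    then obtain i where i: "c x i \<noteq> c y i" by auto
    then have "i < m" using chart_eucl[OF ch True] cx by (metis in_eucl not_less)
    then have "c y \<notin> cube m (c x) (min d \<bar>c y i - c x i\<bar>)" by (force simp: cube_def)
    then show ?thesis using d i by (intro exI[of _ "min d \<bar>c y i - c x i\<bar>"]) auto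
  qed (use d in auto)
  then obtain e where e: "e > 0" "e \<le> d" "y \<in> W \<longrightarrow> c y \<notin> cube m (c x) e" by blast
  have "bump_ext m W c (c x) e (\<lambda>_. 1) \<in> smooth_functions X"
    using cube_mono[OF e(2)] d by (intro bump_ext_smooth[OF D ch cx e(1)] smooth_fun_on_const open_eucl_cube) blast
  moreover have "bump_ext m W c (c x) e (\<lambda>_. 1) y = 0" "bump_ext m W c (c x) e (\<lambda>_. 1) x \<noteq> 0"
    using e x cube_self[OF cx e(1)] bump_center[OF e(1), of m "c x"] by (auto simp: bump_ext_def)
  ultimately show ?thesis using that by metis
qed

subsection \<open>Derivations in coordinates\<close>

lemma tangentD:
  assumes "v \<in> tangent_space X x" "f \<in> smooth_functions X" "g \<in> smooth_functions X"
  shows "v (\<lambda>y. a * f y + b * g y) = a * v f + b * v g"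
    "v (\<lambda>y. f y * g y) = f x * v g + g x * v f"
  using assms by (auto simp: tangent_space_def)

lemma tangent_sum:
  assumes X: "diffeology X" and v: "v \<in> tangent_space X x" and J: "finite J"
    and f: "\<And>k. k \<in> J \<Longrightarrow> f k \<in> smooth_functions X"
  shows "v (\<lambda>y. \<Sum>k\<in>J. f k y) = (\<Sum>k\<in>J. v (f k))"
  using J f
proof (induction J)
  case empty
  show ?case using tangentD(1)[OF v smooth_functions_const[OF X] smooth_functions_const[OF X], of 0 0 0 0] by simp
next
  case (insert k J)
  then have "v (\<lambda>y. 1 * f k y + 1 * (\<Sum>k\<in>J. f k y)) = 1 * v (f k) + 1 * v (\<lambda>y. \<Sum>k\<in>J. f k y)"
    by (intro tangentD(1)[OF v] smooth_functions_sum[OF X]) auto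
  then show ?case using insert by simp
qed

text \<open>Multiplying Hadamard's expansion of \<open>f\<close> by the square of a bump function turns it into an
  identity between smooth functions on the whole manifold.\<close>

lemma coordinate_functions:
  assumes X: "diffeology X" and ch: "chart X m W c" and x: "x \<in> W"
  obtains e where "\<And>k. k < m \<Longrightarrow> e k \<in> smooth_functions X"
    "\<And>j k. j < m \<Longrightarrow> k < m \<Longrightarrow> partial_deriv k (\<lambda>z. e j (inv_into W c z)) (c x) = (if j = k then 1 else 0)"
    "\<And>v f. v \<in> tangent_space X x \<Longrightarrow> f \<in> smooth_functions X \<Longrightarrow>
       v f = (\<Sum>k<m. v (e k) * partial_deriv k (\<lambda>z. f (inv_into W c z)) (c x))"
proof -
  obtain d where d: "d > 0" "cube m (c x) d \<subseteq> c ` W" using chart_cube[OF ch x] .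
  have cx: "c x \<in> eucl m" by (rule chart_eucl[OF ch x])
  let ?C = "cube m (c x) d"
  let ?E = "bump_ext m W c (c x) d"
  let ?b = "bump m (c x) d"
  have cxC: "c x \<in> ?C" by (rule cube_self[OF cx d(1)])
  have b0: "?b (c x) > 0" by (rule bump_center[OF d(1)])
  have E: "?E h \<in> smooth_functions X" if "smooth_fun_on m ?C h" for h
    by (rule bump_ext_smooth[OF X ch cx d that])
  have Einv: "?E h (inv_into W c z) = ?b z * h z" if "z \<in> ?C" for h z
    using that d(2) by (auto simp: bump_ext_def f_inv_into_f inv_into_into subset_iff)
  have sk: "smooth_fun_on m ?C (\<lambda>z. z k - c x k)" for k
    by (intro smooth_fun_on_diff smooth_fun_on_coord smooth_fun_on_const open_eucl_cube)
  \<comment> \<open>The factor \<open>z k - c x k\<close> vanishes at the centre, so only the value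
    of the bump there enters the first derivative; division by this value makes it 1.\<close>
  define e where "e k y = 1 / ?b (c x) * ?E (\<lambda>z. z k - c x k) y" for k y
  have e: "e k \<in> smooth_functions X" for k
    unfolding e_def[abs_def] by (intro smooth_functions_mult[OF X] smooth_functions_const[OF X] E sk)
  have de: "partial_deriv k (\<lambda>z. e j (inv_into W c z)) (c x) = (if j = k then 1 else 0)" if "j < m" "k < m" for j k
  proof -
    let ?b' = "\<lambda>z. 1 / ?b (c x) * ?b z"
    have b': "smooth_fun_on m ?C ?b'"
      by (intro smooth_fun_on_mult smooth_fun_on_const smooth_fun_on_bump open_eucl_cube)
    have "partial_deriv k (\<lambda>z. e j (inv_into W c z)) (c x) = partial_deriv k (\<lambda>z. ?b' z * (z j - c x j)) (c x)"
      by (rule partial_deriv_cong[OF open_eucl_cube cxC that(2)]) (simp add: e_def Einv)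
    also have "\<dots> = partial_deriv k ?b' (c x) * (c x j - c x j) + ?b' (c x) * partial_deriv k (\<lambda>z. z j - c x j) (c x)"
      by (rule partial_deriv_mult[OF b' sk that(2) cxC])
    also have "partial_deriv k (\<lambda>z. z j - c x j) (c x) = (if j = k then 1 else 0)"
      by (rule partial_derivI) (cases "j = k"; auto intro!: derivative_eq_intros)
    finally show ?thesis using b0 by simp
  qed
  have exp: "v f = (\<Sum>k<m. v (e k) * partial_deriv k (\<lambda>z. f (inv_into W c z)) (c x))"
    if v: "v \<in> tangent_space X x" and f: "f \<in> smooth_functions X" for v f
  proof -
    let ?\<phi> = "\<lambda>z. f (inv_into W c z)"
    have \<phi>: "smooth_fun_on m ?C ?\<phi>"
      by (rule smooth_fun_on_subset[OF smooth_functions_plot[OF f chartD(4)[OF ch]] open_eucl_cube d(2)])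
    have \<phi>x: "?\<phi> (c x) = f x" using x chartD(2)[OF ch] by simp
    obtain g where g: "\<And>k. k < m \<Longrightarrow> smooth_fun_on m ?C (g k)"
      "\<And>k. k < m \<Longrightarrow> g k (c x) = partial_deriv k ?\<phi> (c x)"
      "\<And>z. z \<in> ?C \<Longrightarrow> ?\<phi> z = ?\<phi> (c x) + (\<Sum>k<m. (z k - c x k) * g k z)"
      using hadamard[OF \<phi> cx d(1)] by blast
    \<comment> \<open>One bump is absorbed by the factor \<open>z k - c x k\<close> and one by
      \<open>g k\<close>: only then are both factors smooth functions on the whole manifold, to
      which the Leibniz rule applies.\<close>
    let ?B = "\<lambda>y. ?E (\<lambda>_. 1) y * ?E (\<lambda>_. 1) y"
    have E1: "?E (\<lambda>_. 1) \<in> smooth_functions X" by (intro E smooth_fun_on_const open_eucl_cube)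
    have B: "?B \<in> smooth_functions X" by (intro smooth_functions_mult[OF X] E1)
    let ?S = "\<lambda>y. \<Sum>k<m. ?E (\<lambda>z. z k - c x k) y * ?E (g k) y"
    have S: "?S \<in> smooth_functions X"
      by (intro smooth_functions_sum[OF X] smooth_functions_mult[OF X] E sk g(1)) auto
    have "(\<lambda>y. f y * ?B y) = (\<lambda>y. f x * ?B y + 1 * ?S y)"
    proof
      fix y
      show "f y * ?B y = f x * ?B y + 1 * ?S y"
      proof (cases "y \<in> W \<and> c y \<in> ?C")
        case True
        then have "f y = f x + (\<Sum>k<m. (c y k - c x k) * g k (c y))"
          using g(3)[of "c y"] \<phi>x chartD(2)[OF ch] by simp
        then show ?thesis using True by (simp add: bump_ext_def algebra_simps sum_distrib_left sum_distrib_right)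
      qed (auto simp: bump_ext_def)
    qed
    then have "v (\<lambda>y. f y * ?B y) = v (\<lambda>y. f x * ?B y + 1 * ?S y)" by simp
    also have "\<dots> = f x * v ?B + 1 * v ?S" by (rule tangentD(1)[OF v B S])
    also have "v (\<lambda>y. f y * ?B y) = f x * v ?B + ?B x * v f" by (rule tangentD(2)[OF v f B])
    \<comment> \<open>The term \<open>f x * v ?B\<close> occurs on both sides and cancels, so the
      value of the derivation on the bump never has to be known.\<close>
    finally have 1: "?B x * v f = v ?S" by simp
    have "v ?S = (\<Sum>k<m. v (\<lambda>y. ?E (\<lambda>z. z k - c x k) y * ?E (g k) y))"
      by (intro tangent_sum[OF X v] smooth_functions_mult[OF X] E sk g(1)) auto
    also have "\<dots> = (\<Sum>k<m. ?b (c x) * partial_deriv k ?\<phi> (c x) * v (?E (\<lambda>z. z k - c x k)))"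
    proof (rule sum.cong[OF refl])
      fix k assume "k \<in> {..<m}"
      then have k: "k < m" by simp
      have "v (\<lambda>y. ?E (\<lambda>z. z k - c x k) y * ?E (g k) y) =
         ?E (\<lambda>z. z k - c x k) x * v (?E (g k)) + ?E (g k) x * v (?E (\<lambda>z. z k - c x k))"
        by (intro tangentD(2)[OF v] E sk g(1) k)
      then show "v (\<lambda>y. ?E (\<lambda>z. z k - c x k) y * ?E (g k) y) = ?b (c x) * partial_deriv k ?\<phi> (c x) * v (?E (\<lambda>z. z k - c x k))"
        using x cxC g(2)[OF k] by (simp add: bump_ext_def)
    qed
    also have "\<dots> = (\<Sum>k<m. ?b (c x) * ?b (c x) * (v (e k) * partial_deriv k ?\<phi> (c x)))"
    proof (rule sum.cong[OF refl])
      fix k assume "k \<in> {..<m}"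
      have "v (\<lambda>y. 1 / ?b (c x) * ?E (\<lambda>z. z k - c x k) y + 0 * ?E (\<lambda>_. 1) y) = 1 / ?b (c x) * v (?E (\<lambda>z. z k - c x k)) + 0 * v (?E (\<lambda>_. 1))"
        by (intro tangentD(1)[OF v] E sk E1)
      then have "v (e k) = 1 / ?b (c x) * v (?E (\<lambda>z. z k - c x k))" by (simp add: e_def[abs_def])
      then show "?b (c x) * partial_deriv k ?\<phi> (c x) * v (?E (\<lambda>z. z k - c x k)) = ?b (c x) * ?b (c x) * (v (e k) * partial_deriv k ?\<phi> (c x))"
        using b0 by simp
    qed
    finally have "v ?S = ?B x * (\<Sum>k<m. v (e k) * partial_deriv k ?\<phi> (c x))"
      using x cxC by (simp add: bump_ext_def sum_distrib_left)
    with 1 have "?B x * v f = ?B x * (\<Sum>k<m. v (e k) * partial_deriv k ?\<phi> (c x))" by simp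
    moreover have "?B x \<noteq> 0" using b0 x cxC by (simp add: bump_ext_def)
    ultimately show ?thesis by simp
  qed
  show thesis by (rule that[OF e de exp])
qed

subsection \<open>Velocities of plots\<close>

lemma plot_partial_apply:
  "f \<in> smooth_functions X \<Longrightarrow> plot_partial X i p u f = partial_deriv i (\<lambda>u. f (p u)) u"
  by (simp add: plot_partial_def comp_def)

lemma plot_partial_cong:
  assumes "open_eucl n U" "u \<in> U" "i < n" "\<And>v. v \<in> U \<Longrightarrow> p v = q v"
  shows "plot_partial X i p u = plot_partial X i q u"
proof -
  have "partial_deriv i (f \<circ> p) u = partial_deriv i (f \<circ> q) u" for f
    by (rule partial_deriv_cong[OF assms(1-3)]) (simp add: assms(4))
  then show ?thesis unfolding plot_partial_def by (intro ext) (simp only:)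
qed

lemma plot_partial_tangent:
  assumes X: "diffeology X" and p: "is_plot X n U p" and u: "u \<in> U" and i: "i < n"
  shows "plot_partial X i p u \<in> tangent_space X (p u)"
  unfolding tangent_space_def mem_Collect_eq
proof (intro conjI ballI allI impI)
  fix f g and a b :: real assume f: "f \<in> smooth_functions X" and g: "g \<in> smooth_functions X"
  note fp = smooth_functions_plot[OF f p] and gp = smooth_functions_plot[OF g p]
  note U = is_plot_open[OF X p]
  have c: "(\<lambda>y. c) \<in> smooth_functions X" for c by (rule smooth_functions_const[OF X])
  have "(\<lambda>y. a * f y + b * g y) \<in> smooth_functions X"
    by (intro smooth_functions_add[OF X] smooth_functions_mult[OF X] c f g)
  moreover have "partial_deriv i (\<lambda>u. a * f (p u) + b * g (p u)) u = a * partial_deriv i (\<lambda>u. f (p u)) u + b * partial_deriv i (\<lambda>u. g (p u)) u"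
    by (subst partial_deriv_add[OF _ _ i u] partial_deriv_mult[OF _ _ i u]
        | intro smooth_fun_on_mult smooth_fun_on_const U fp gp | simp)+
  ultimately show "plot_partial X i p u (\<lambda>y. a * f y + b * g y) = a * plot_partial X i p u f + b * plot_partial X i p u g"
    by (simp add: plot_partial_apply f g)
  have "(\<lambda>y. f y * g y) \<in> smooth_functions X" by (rule smooth_functions_mult[OF X f g])
  then show "plot_partial X i p u (\<lambda>y. f y * g y) = f (p u) * plot_partial X i p u g + g (p u) * plot_partial X i p u f"
    using partial_deriv_mult[OF fp gp i u] by (simp add: plot_partial_apply f g mult.commute add.commute)
qed (simp add: plot_partial_def)

lemma plot_partial_comp:
  assumes q: "is_plot X m V q" and h: "smooth_on n U m h" "\<And>u. u \<in> U \<Longrightarrow> h u \<in> V" and u: "u \<in> U" and i: "i < n"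
  shows "plot_partial X i (\<lambda>u. q (h u)) u = (\<lambda>f. \<Sum>j<m. partial_deriv i (\<lambda>u. h u j) u * plot_partial X j q (h u) f)"
proof
  fix f
  show "plot_partial X i (\<lambda>u. q (h u)) u f = (\<Sum>j<m. partial_deriv i (\<lambda>u. h u j) u * plot_partial X j q (h u) f)"
  proof (cases "f \<in> smooth_functions X")
    case True
    then show ?thesis
      using partial_deriv_comp[OF smooth_functions_plot[OF True q] h(1) _ u i] h(2) by (simp add: plot_partial_apply image_subset_iff)
  qed (simp add: plot_partial_def)
qed

lemma plot_partial_pushforward:
  assumes "diffeology X" "smooth_map X Y F"
  shows "plot_partial Y i (\<lambda>u. F (p u)) u = pushforward Y F (plot_partial X i p u)"
proof
  fix f
  show "plot_partial Y i (\<lambda>u. F (p u)) u f = pushforward Y F (plot_partial X i p u) f"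
  proof (cases "f \<in> smooth_functions Y")
    case True
    then show ?thesis
      using smooth_functions_comp[OF assms(1) True assms(2)] by (simp add: plot_partial_def pushforward_def comp_def)
  qed (simp add: plot_partial_def pushforward_def)
qed

text \<open>Smoothness of \<open>f\<close> is required only on an open part of the chart, because
  one of the functions inserted later is built from a local section of the bundle.\<close>

lemma chart_partial:
  assumes X: "diffeology X" and ch: "chart X m W c" and p: "is_plot X n U p" and u: "u \<in> U" "p u \<in> W" and i: "i < n"
    and f: "smooth_fun_on m V (\<lambda>z. f (inv_into W c z))" "V \<subseteq> c ` W" "c (p u) \<in> V"
  shows "partial_deriv i (\<lambda>u. f (p u)) u =
    (\<Sum>k<m. partial_deriv i (\<lambda>u. c (p u) k) u * partial_deriv k (\<lambda>z. f (inv_into W c z)) (c (p u)))"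
proof -
  note sm = chartD(5)[OF ch p]
  let ?U = "{v \<in> {u \<in> U. p u \<in> W}. c (p v) \<in> V}"
  have O: "open_eucl n ?U" by (rule open_eucl_smooth_preimage[OF sm smooth_fun_on_open[OF f(1)]])
  have sm': "smooth_on n ?U m (\<lambda>u. c (p u))" by (rule smooth_on_subset[OF sm O]) auto
  have uU: "u \<in> ?U" using u f(3) by simp
  have "partial_deriv i (\<lambda>u. f (p u)) u = partial_deriv i (\<lambda>u. f (inv_into W c (c (p u)))) u"
    by (rule partial_deriv_cong[OF O uU i]) (use chartD(2)[OF ch] in simp)
  also have "\<dots> = (\<Sum>k<m. partial_deriv i (\<lambda>u. c (p u) k) u * partial_deriv k (\<lambda>z. f (inv_into W c z)) (c (p u)))"
    by (rule partial_deriv_comp[OF f(1) sm' _ uU i]) auto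
  finally show ?thesis .
qed

lemma smooth_functions_chart: "chart X m W c \<Longrightarrow> f \<in> smooth_functions X \<Longrightarrow> smooth_fun_on m (c ` W) (\<lambda>z. f (inv_into W c z))"
  using smooth_functions_plot chartD(4) by blast

text \<open>A global smooth function that agrees with the coordinate \<open>k\<close> to first order
  at \<open>x\<close>. It lets coordinate derivatives be read off from tangent vectors, which are
  derivations on global functions.\<close>

lemma partial_coordinate:
  assumes X: "diffeology X" and ch: "chart X m W c" and x: "x \<in> W" and k: "k < m"
  obtains e where "e \<in> smooth_functions X"
    "\<And>n U p u i. is_plot X n U p \<Longrightarrow> u \<in> U \<Longrightarrow> p u = x \<Longrightarrow> i < n \<Longrightarrow>
       plot_partial X i p u e = partial_deriv i (\<lambda>u. c (p u) k) u"
proof (rule coordinate_functions[OF X ch x])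
  fix e assume e: "\<And>k. k < m \<Longrightarrow> e k \<in> smooth_functions X"
    "\<And>j k. j < m \<Longrightarrow> k < m \<Longrightarrow> partial_deriv k (\<lambda>z. e j (inv_into W c z)) (c x) = (if j = k then 1 else 0)"
  have "plot_partial X i p u (e k) = partial_deriv i (\<lambda>u. c (p u) k) u"
    if p: "is_plot X n U p" and u: "u \<in> U" "p u = x" and i: "i < n" for n U p u i
  proof -
    have "plot_partial X i p u (e k) =
      (\<Sum>l<m. partial_deriv i (\<lambda>u. c (p u) l) u * partial_deriv l (\<lambda>z. e k (inv_into W c z)) (c (p u)))"
      unfolding plot_partial_apply[OF e(1)[OF k]]
      by (rule chart_partial[OF X ch p u(1) _ i smooth_functions_chart[OF ch e(1)[OF k]]]) (use u x in auto)
    also have "\<dots> = (\<Sum>l<m. partial_deriv i (\<lambda>u. c (p u) l) u * (if k = l then 1 else 0))"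
      using e(2)[OF k] u by (intro sum.cong) auto
    also have "\<dots> = (\<Sum>l<m. if k = l then partial_deriv i (\<lambda>u. c (p u) l) u else 0)"
      by (intro sum.cong) auto
    finally show ?thesis using k by simp
  qed
  then show thesis by (rule that[OF e(1)[OF k]])
qed

section \<open>Linear combinations of tangent vectors and values of forms\<close>

lemma zero_tangent: "(\<lambda>f. 0) \<in> tangent_space X x"
  by (simp add: tangent_space_def)

lemma tangent_lincomb:
  assumes "v \<in> tangent_space X x" "w \<in> tangent_space X x"
  shows "(\<lambda>f. a * v f + b * w f) \<in> tangent_space X x"
  using assms unfolding tangent_space_def by (auto simp: algebra_simps)

lemma form_lincomb:
  assumes "smooth_lie_form G P A" "p \<in> carrier P" "v \<in> tangent_space P p" "w \<in> tangent_space P p"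
  shows "A p (\<lambda>f. a * v f + b * w f) = (\<lambda>f. a * A p v f + b * A p w f)"
proof -
  have "A p (scale_tvec a v + scale_tvec b w) = scale_tvec a (A p v) + scale_tvec b (A p w)"
    using assms unfolding smooth_lie_form_def by blast
  then show ?thesis by (simp add: scale_tvec_def plus_fun_def)
qed

lemma form_zero:
  assumes "smooth_lie_form G P A" "p \<in> carrier P"
  shows "A p (\<lambda>f. 0) = (\<lambda>f. 0)"
  using form_lincomb[OF assms zero_tangent zero_tangent, of 0 0] by simp

lemma form_sum:
  assumes A: "smooth_lie_form G P A" "p \<in> carrier P" and v: "\<And>k. k < m \<Longrightarrow> v k \<in> tangent_space P p"
  shows "A p (\<lambda>f. \<Sum>k<m::nat. a k * v k f) = (\<lambda>f. \<Sum>k<m. a k * A p (v k) f) \<and>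
    (\<lambda>f. \<Sum>k<m. a k * v k f) \<in> tangent_space P p"
  using v
proof (induction m)
  case 0
  then show ?case using form_zero[OF A] by (simp add: zero_tangent)
next
  case (Suc m)
  then have IH: "A p (\<lambda>f. \<Sum>k<m. a k * v k f) = (\<lambda>f. \<Sum>k<m. a k * A p (v k) f)"
    "(\<lambda>f. \<Sum>k<m. a k * v k f) \<in> tangent_space P p" by auto
  have "v m \<in> tangent_space P p" using Suc.prems by simp
  from form_lincomb[OF A IH(2) this, of 1 "a m"] tangent_lincomb[OF IH(2) this, of 1 "a m"]
  show ?case by (simp add: IH(1))
qed

lemma form_plot_comp:
  assumes X: "diffeology P" and A: "smooth_lie_form G P A" and q: "is_plot P m V q"
    and h: "smooth_on n U m h" "\<And>u. u \<in> U \<Longrightarrow> h u \<in> V" and u: "u \<in> U" and i: "i < n"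
  shows "A (q (h u)) (plot_partial P i (\<lambda>u. q (h u)) u) =
    (\<lambda>f. \<Sum>j<m. partial_deriv i (\<lambda>u. h u j) u * A (q (h u)) (plot_partial P j q (h u)) f)"
proof -
  have hu: "h u \<in> V" by (rule h(2)[OF u])
  have "A (q (h u)) (\<lambda>f. \<Sum>j<m. partial_deriv i (\<lambda>u. h u j) u * plot_partial P j q (h u) f) =
     (\<lambda>f. \<Sum>j<m. partial_deriv i (\<lambda>u. h u j) u * A (q (h u)) (plot_partial P j q (h u)) f)"
    using form_sum[OF A is_plot_carrier[OF X q hu], of m "\<lambda>j. plot_partial P j q (h u)" "\<lambda>j. partial_deriv i (\<lambda>u. h u j) u"]
      plot_partial_tangent[OF X q hu] by blast
  with arg_cong[OF plot_partial_comp[OF q h u i], of "A (q (h u))"] show ?thesis by (rule trans)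
qed

section \<open>Principal bundles with connection\<close>

text \<open>The pullback by \<open>g\<close> of the left invariant Maurer-Cartan form, evaluated on
  the coordinate direction \<open>i\<close>.\<close>

definition MC :: "('g, 'z) lie_group_data_scheme \<Rightarrow> nat \<Rightarrow> ((nat \<Rightarrow> real) \<Rightarrow> 'g) \<Rightarrow> (nat \<Rightarrow> real) \<Rightarrow> 'g tvec" where
  "MC G i g u = plot_partial (lie_space G) i (\<lambda>v. inv\<^bsub>G\<^esub> (g u) \<otimes>\<^bsub>G\<^esub> g v) u"

locale bundle_connection =
  fixes G :: "'g lie_group_data" and M :: "'m dspace" and P :: "('p, 'g) gspace"
    and \<pi> :: "'p \<Rightarrow> 'm" and A :: "'p \<Rightarrow> 'p tvec \<Rightarrow> 'g tvec"
  assumes lie: "lie_group G" and M: "manifold M" and pbundle: "principal_bundle G M P \<pi>"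
    and conn: "connection_form G P A"
begin

abbreviation "L \<equiv> lie_space G"

sublocale group G using lie by (simp add: lie_group_def)

lemma carrier_L [simp]: "carrier L = carrier G" by (simp add: lie_space_def)

lemma L: "manifold L" using lie by (simp add: lie_group_def)
lemma DL: "diffeology L" by (rule manifold_diffeology[OF L])
lemma DM: "diffeology M" by (rule manifold_diffeology[OF M])
lemma P: "manifold P" using pbundle by (simp add: principal_bundle_def)
lemma DP: "diffeology P" by (rule manifold_diffeology[OF P])
lemma \<pi>_smooth: "smooth_map P M \<pi>" using pbundle by (simp add: principal_bundle_def)
lemma action: "smooth_right_action G P" using pbundle by (simp add: principal_bundle_def)
lemma form: "smooth_lie_form G P A" using conn by (simp add: connection_form_def)

lemma \<pi>_carrier: "p \<in> carrier P \<Longrightarrow> \<pi> p \<in> carrier M"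
  using \<pi>_smooth by (auto simp: smooth_map_def)

lemma \<pi>_act [simp]: "p \<in> carrier P \<Longrightarrow> g \<in> carrier G \<Longrightarrow> \<pi> (act P p g) = \<pi> p"
  using pbundle by (simp add: principal_bundle_def)

lemma act_carrier [simp]: "p \<in> carrier P \<Longrightarrow> g \<in> carrier G \<Longrightarrow> act P p g \<in> carrier P"
proof -
  assume "p \<in> carrier P" "g \<in> carrier G"
  then have "(p, g) \<in> carrier (product_dspace P L)" by (simp add: product_dspace_def)
  moreover have "(\<lambda>(x, g). act P x g) \<in> carrier (product_dspace P L) \<rightarrow> carrier P"
    using action by (simp add: smooth_right_action_def smooth_map_def)
  ultimately show ?thesis by (auto dest: funcset_mem)
qed

lemma act_one [simp]: "p \<in> carrier P \<Longrightarrow> act P p \<one>\<^bsub>G\<^esub> = p"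
  using action by (simp add: smooth_right_action_def)

lemma act_mult: "p \<in> carrier P \<Longrightarrow> g \<in> carrier G \<Longrightarrow> h \<in> carrier G \<Longrightarrow>
    act P (act P p g) h = act P p (g \<otimes>\<^bsub>G\<^esub> h)"
  using action by (simp add: smooth_right_action_def)

lemma plot_act:
  assumes "is_plot P n U s" "is_plot L n U g"
  shows "is_plot P n U (\<lambda>u. act P (s u) (g u))"
  using is_plot_image[of "product_dspace P L" P "\<lambda>(x, g). act P x g" n U "\<lambda>u. (s u, g u)"] action assms
  by (simp add: smooth_right_action_def is_plot_product)

lemma plot_mult:
  assumes "is_plot L n U g" "is_plot L n U h"
  shows "is_plot L n U (\<lambda>u. g u \<otimes>\<^bsub>G\<^esub> h u)"
  using is_plot_image[of "product_dspace L L" L "\<lambda>(g, h). g \<otimes>\<^bsub>G\<^esub> h" n U "\<lambda>u. (g u, h u)"] lie assms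
  by (simp add: lie_group_def is_plot_product)

lemma plot_inv: "is_plot L n U g \<Longrightarrow> is_plot L n U (\<lambda>u. inv\<^bsub>G\<^esub> (g u))"
  using is_plot_image[of L L "\<lambda>g. inv\<^bsub>G\<^esub> g"] lie by (simp add: lie_group_def)

lemma plot_\<pi>: "is_plot P n U s \<Longrightarrow> is_plot M n U (\<lambda>u. \<pi> (s u))"
  by (rule is_plot_image[OF \<pi>_smooth])

lemma plot_G: "is_plot L n U g \<Longrightarrow> u \<in> U \<Longrightarrow> g u \<in> carrier G"
  using is_plot_carrier[OF DL] by fastforce

lemma plot_constG: "is_plot L n U g \<Longrightarrow> h \<in> carrier G \<Longrightarrow> is_plot L n U (\<lambda>_. h)"
  by (rule is_plot_const[OF DL]) (auto intro: is_plot_open[OF DL])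

lemma act_right_smooth: "g \<in> carrier G \<Longrightarrow> smooth_map P P (\<lambda>q. act P q g)"
  by (rule smooth_mapI[OF DP]) (auto intro!: plot_act is_plot_const[OF DL] is_plot_open[OF DP])

lemma act_left_smooth: "p \<in> carrier P \<Longrightarrow> smooth_map L P (act P p)"
  by (rule smooth_mapI[OF DL]) (auto intro!: plot_act is_plot_const[OF DP] is_plot_open[OF DL])

lemma mult_left_smooth: "g \<in> carrier G \<Longrightarrow> smooth_map L L (\<lambda>h. g \<otimes>\<^bsub>G\<^esub> h)"
  by (rule smooth_mapI[OF DL]) (auto intro!: plot_mult plot_constG)

lemma mult_right_smooth: "g \<in> carrier G \<Longrightarrow> smooth_map L L (\<lambda>h. h \<otimes>\<^bsub>G\<^esub> g)"
  by (rule smooth_mapI[OF DL]) (auto intro!: plot_mult plot_constG)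

lemma A_lie: "p \<in> carrier P \<Longrightarrow> v \<in> tangent_space P p \<Longrightarrow> A p v \<in> lie_algebra G"
  using form by (simp add: smooth_lie_form_def)

lemma A_coeff_smooth:
  assumes "is_plot P n U q" "i < n" "f \<in> smooth_functions L"
  shows "smooth_fun_on n U (\<lambda>u. A (q u) (plot_partial P i q u) f)"
proof -
  have "smooth_fun_on n U (\<lambda>u. A (restrict q U u) (plot_partial P i (restrict q U) u) f)"
    using form assms unfolding smooth_lie_form_def is_plot_def by blast
  moreover have "plot_partial P i (restrict q U) u = plot_partial P i q u" if "u \<in> U" for u
    by (rule plot_partial_cong[OF is_plot_open[OF DP assms(1)] that assms(2)]) simp
  ultimately show ?thesis by (subst smooth_fun_on_cong[where g="\<lambda>u. A (restrict q U u) (plot_partial P i (restrict q U) u) f"]) auto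
qed

subsection \<open>Leibniz rule for the action\<close>

lemma plot_upd:
  assumes X: "diffeology X" and p: "is_plot X n U p" and u: "u \<in> eucl n" and i: "i < n" and D: "smooth_on m D 1 (\<lambda>x. vec1 (h x))"
    "\<And>x. x \<in> D \<Longrightarrow> u(i := h x) \<in> U"
  shows "is_plot X m D (\<lambda>x. p (u(i := h x)))"
proof (rule is_plot_comp[OF X p])
  show "smooth_on m D n (\<lambda>x. u(i := h x))"
  proof (rule smooth_onI)
    show O: "open_eucl m D" by (rule smooth_on_open[OF D(1)])
    show "smooth_fun_on m D (\<lambda>x. (u(i := h x)) j)" for j
    proof (cases "j = i")
      case True
      then show ?thesis using smooth_on_coord[OF D(1), of 0] by simp
    qed (simp add: smooth_fun_on_const O)
  qed (use u i in \<open>auto simp: in_eucl\<close>)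
qed (use D in auto)

text \<open>The two occurrences of the variable are made independent: \<open>s\<close> at one time
  acted on by \<open>g\<close> at another is a plot of two real variables, and the derivative along
  the diagonal is the sum of its two partial derivatives.\<close>

lemma act_leibniz:
  assumes s: "is_plot P n U s" and g: "is_plot L n U g" and u: "u \<in> U" and i: "i < n"
  shows "plot_partial P i (\<lambda>v. act P (s v) (g v)) u =
    (\<lambda>f. plot_partial P i (\<lambda>v. act P (s v) (g u)) u f + plot_partial P i (\<lambda>v. act P (s u) (g v)) u f)"
proof
  fix f
  show "plot_partial P i (\<lambda>v. act P (s v) (g v)) u f =
    plot_partial P i (\<lambda>v. act P (s v) (g u)) u f + plot_partial P i (\<lambda>v. act P (s u) (g v)) u f"
  proof (cases "f \<in> smooth_functions P")
    case True
    have U: "open_eucl n U" by (rule is_plot_open[OF DP s])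
    have uE: "u \<in> eucl n" using u open_eucl_subset[OF U] by blast
    define D where "D = {x \<in> {x \<in> eucl 2. u(i := x 0) \<in> U}. u(i := x 1) \<in> U}"
    have E: "open_eucl 2 (eucl 2)" by simp
    have cu: "continuous_on S (\<lambda>x. (u(i := x k)) j)" for S :: "(nat \<Rightarrow> real) set" and k j
      by (cases "j = i") (auto simp: continuous_on_coord)
    have im: "(\<lambda>x. u(i := x k)) ` S \<subseteq> eucl n" for S :: "(nat \<Rightarrow> real) set" and k
      using uE i by (auto simp: in_eucl)
    have D: "open_eucl 2 D"
      unfolding D_def by (rule open_eucl_preimage[OF open_eucl_preimage[OF E cu im U] cu im U])
    have v1: "smooth_on 2 D 1 (\<lambda>x. vec1 (x k))" for k
      by (rule smooth_onI[OF D]) (auto intro!: smooth_fun_on_coord[OF D])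
    have "is_plot P 2 D (\<lambda>x. s (u(i := x 0)))" "is_plot L 2 D (\<lambda>x. g (u(i := x 1)))"
      by (rule plot_upd[OF DP s uE i v1] plot_upd[OF DL g uE i v1], simp add: D_def)+
    from smooth_functions_plot[OF True plot_act[OF this]]
    have \<Psi>: "smooth_fun_on 2 D (\<lambda>x. f (act P (s (u(i := x 0))) (g (u(i := x 1)))))" (is "smooth_fun_on 2 D ?\<Psi>") .
    \<comment> \<open>The diagonal of the plane of the two independent times.\<close>
    define c where "c t = (\<lambda>k::nat. if k < 2 then t else 0)" for t :: real
    have cs: "c t \<in> eucl 2" "c t 0 = t" "c t (Suc 0) = t" for t by (auto simp: c_def in_eucl)
    have "((\<lambda>t. ?\<Psi> (c t)) has_real_derivative (\<Sum>k<2. partial_deriv k ?\<Psi> (c (u i)) * 1)) (at (u i) within UNIV)"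
      by (rule smooth_DERIV_along_curve[OF \<Psi>]) (use cs u in \<open>auto simp: c_def D_def\<close>)
    then have "DERIV (\<lambda>t. f (act P (s (u(i := t))) (g (u(i := t))))) (u i) :> partial_deriv 0 ?\<Psi> (c (u i)) + partial_deriv 1 ?\<Psi> (c (u i))"
      by (simp add: cs numeral_2_eq_2)
    then have "partial_deriv i (\<lambda>v. f (act P (s v) (g v))) u = partial_deriv 0 ?\<Psi> (c (u i)) + partial_deriv 1 ?\<Psi> (c (u i))"
      by (intro partial_derivI)
    moreover have "partial_deriv 0 ?\<Psi> (c (u i)) = partial_deriv i (\<lambda>v. f (act P (s v) (g u))) u"
      "partial_deriv 1 ?\<Psi> (c (u i)) = partial_deriv i (\<lambda>v. f (act P (s u) (g v))) u"
      by (simp_all add: partial_deriv_def cs)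
    ultimately show ?thesis using True by (simp add: plot_partial_apply)
  qed (simp add: plot_partial_def)
qed

lemma MC_lie:
  assumes "is_plot L n U g" "u \<in> U" "i < n"
  shows "MC G i g u \<in> lie_algebra G"
proof -
  have "is_plot L n U (\<lambda>v. inv\<^bsub>G\<^esub> (g u) \<otimes>\<^bsub>G\<^esub> g v)"
    using plot_G[OF assms(1,2)] by (intro plot_mult plot_constG[OF assms(1)] assms(1)) auto
  from plot_partial_tangent[OF DL this assms(2,3)] show ?thesis
    using plot_G[OF assms(1,2)] by (simp add: MC_def lie_algebra_def)
qed

text \<open>Writing \<open>p g(v)\<close> as \<open>(p g(u)) (g(u)^-1 g(v))\<close> shows that the
  derivative at \<open>u\<close> is the fundamental vector of the Maurer-Cartan value at the point
  \<open>p g(u)\<close>, where a connection form is prescribed.\<close>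

lemma A_vertical:
  assumes g: "is_plot L n U g" and u: "u \<in> U" and i: "i < n" and p: "p \<in> carrier P"
  shows "plot_partial P i (\<lambda>v. act P p (g v)) u = pushforward P (act P (act P p (g u))) (MC G i g u)"
    "A (act P p (g u)) (plot_partial P i (\<lambda>v. act P p (g v)) u) = MC G i g u"
proof -
  have gu: "g u \<in> carrier G" by (rule plot_G[OF g u])
  have "plot_partial P i (\<lambda>v. act P p (g v)) u =
    plot_partial P i (\<lambda>v. act P (act P p (g u)) (inv\<^bsub>G\<^esub> (g u) \<otimes>\<^bsub>G\<^esub> g v)) u"
  proof (rule plot_partial_cong[OF is_plot_open[OF DL g] u i])
    fix v assume v: "v \<in> U"
    have gv: "g v \<in> carrier G" by (rule plot_G[OF g v])
    have "act P (act P p (g u)) (inv\<^bsub>G\<^esub> (g u) \<otimes>\<^bsub>G\<^esub> g v) = act P p (g u \<otimes>\<^bsub>G\<^esub> (inv\<^bsub>G\<^esub> (g u) \<otimes>\<^bsub>G\<^esub> g v))"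
      using p gu gv by (intro act_mult) auto
    then show "act P p (g v) = act P (act P p (g u)) (inv\<^bsub>G\<^esub> (g u) \<otimes>\<^bsub>G\<^esub> g v)"
      using gu gv by (simp add: m_assoc[symmetric])
  qed
  also have "\<dots> = pushforward P (act P (act P p (g u))) (MC G i g u)"
    unfolding MC_def by (rule plot_partial_pushforward[OF DL act_left_smooth]) (use p gu in simp)
  finally show *: "plot_partial P i (\<lambda>v. act P p (g v)) u = pushforward P (act P (act P p (g u))) (MC G i g u)" .
  show "A (act P p (g u)) (plot_partial P i (\<lambda>v. act P p (g v)) u) = MC G i g u"
    unfolding * using conn MC_lie[OF g u i] p gu by (simp add: connection_form_def)
qed

lemma A_right:
  assumes s: "is_plot P n U s" and u: "u \<in> U" and i: "i < n" and h: "h \<in> carrier G"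
  shows "A (act P (s u) h) (plot_partial P i (\<lambda>v. act P (s v) h) u) = Ad G (inv\<^bsub>G\<^esub> h) (A (s u) (plot_partial P i s u))"
  unfolding plot_partial_pushforward[OF DP act_right_smooth[OF h]]
  using conn is_plot_carrier[OF DP s u] h plot_partial_tangent[OF DP s u i] by (simp add: connection_form_def)

text \<open>The gauge transformation law: the Leibniz rule splits the derivative into a right
  translate of \<open>\<partial>s\<close> and a vertical vector, and the two axioms of a connection
  form evaluate \<open>A\<close> on them.\<close>

lemma A_mult:
  assumes s: "is_plot P n U s" and g: "is_plot L n U g" and u: "u \<in> U" and i: "i < n"
  shows "A (act P (s u) (g u)) (plot_partial P i (\<lambda>v. act P (s v) (g v)) u) =
    (\<lambda>f. Ad G (inv\<^bsub>G\<^esub> (g u)) (A (s u) (plot_partial P i s u)) f + MC G i g u f)"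
proof -
  have su: "s u \<in> carrier P" and gu: "g u \<in> carrier G" using is_plot_carrier[OF DP s u] plot_G[OF g u] by auto
  have U: "open_eucl n U" by (rule is_plot_open[OF DP s])
  have t1: "plot_partial P i (\<lambda>v. act P (s v) (g u)) u \<in> tangent_space P (act P (s u) (g u))"
    by (rule plot_partial_tangent[OF DP plot_act[OF s plot_constG[OF g gu]] u i])
  have t2: "plot_partial P i (\<lambda>v. act P (s u) (g v)) u \<in> tangent_space P (act P (s u) (g u))"
    by (rule plot_partial_tangent[OF DP plot_act[OF is_plot_const[OF DP su U] g] u i])
  show ?thesis
    using form_lincomb[OF form _ t1 t2, of 1 1] su gu A_right[OF s u i gu] A_vertical(2)[OF g u i su]
    by (simp add: act_leibniz[OF s g u i])
qed

text \<open>Left translation by \<open>g u\<close> carries test functions near \<open>g u\<close> to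
  test functions near the unit, where \<open>MC\<close> takes its values.\<close>

lemma MC_zero_partial:
  assumes g: "is_plot L n U g" and u: "u \<in> U" and i: "i < n" and 0: "MC G i g u = (\<lambda>f. 0)" and f: "f \<in> smooth_functions L"
  shows "partial_deriv i (\<lambda>v. f (g v)) u = 0"
proof -
  have gu: "g u \<in> carrier G" by (rule plot_G[OF g u])
  let ?f = "\<lambda>h. f (g u \<otimes>\<^bsub>G\<^esub> h)"
  have "?f \<in> smooth_functions L" by (rule smooth_functions_comp[OF DL f mult_left_smooth[OF gu]])
  then have "partial_deriv i (\<lambda>v. ?f (inv\<^bsub>G\<^esub> (g u) \<otimes>\<^bsub>G\<^esub> g v)) u = 0"
    using fun_cong[OF 0, of ?f] by (simp add: MC_def plot_partial_apply)
  moreover have "partial_deriv i (\<lambda>v. f (g v)) u = partial_deriv i (\<lambda>v. ?f (inv\<^bsub>G\<^esub> (g u) \<otimes>\<^bsub>G\<^esub> g v)) u"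
  proof (rule partial_deriv_cong[OF is_plot_open[OF DL g] u i])
    fix v assume "v \<in> U"
    then have "g v \<in> carrier G" by (rule plot_G[OF g])
    then show "f (g v) = ?f (inv\<^bsub>G\<^esub> (g u) \<otimes>\<^bsub>G\<^esub> g v)" using gu by (simp add: m_assoc[symmetric])
  qed
  ultimately show ?thesis by simp
qed

text \<open>Since smooth functions separate the points of \<open>G\<close>, it is enough that each
  of them is constant along the coordinate segment.\<close>

lemma MC_zero_const:
  assumes g: "is_plot L n U g" and i: "i < n" and 0: "\<And>v. v \<in> U \<Longrightarrow> MC G i g v = (\<lambda>f. 0)"
    and seg: "\<And>t. min a b \<le> t \<Longrightarrow> t \<le> max a b \<Longrightarrow> u(i := t) \<in> U"
  shows "g (u(i := a)) = g (u(i := b))"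
proof (rule ccontr)
  assume ne: "g (u(i := a)) \<noteq> g (u(i := b))"
  have "u(i := a) \<in> U" "u(i := b) \<in> U" using seg by auto
  then obtain f where f: "f \<in> smooth_functions L" "f (g (u(i := a))) \<noteq> f (g (u(i := b)))"
    using smooth_functions_separate[OF L, of "g (u(i := a))" "g (u(i := b))"] plot_G[OF g] ne by auto
  have "\<exists>t. min a b \<le> t \<and> t \<le> max a b \<and> f (g (u(i := b))) - f (g (u(i := a))) = 0 * (b - a)"
  proof (rule MVT_segment)
    fix t assume t: "min a b \<le> t" "t \<le> max a b"
    have "DERIV (\<lambda>t. f (g (u(i := t)))) t :> partial_deriv i (\<lambda>v. f (g v)) (u(i := t))"
      by (rule smooth_fun_on_DERIV_upd[OF smooth_functions_plot[OF f(1) g] i seg[OF t]])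
    then show "DERIV (\<lambda>t. f (g (u(i := t)))) t :> 0"
      using MC_zero_partial[OF g seg[OF t] i 0[OF seg[OF t]] f(1)] by simp
  qed
  then show False using f(2) by simp
qed

subsection \<open>Local triviality\<close>

lemma trivialization:
  assumes "x \<in> carrier M"
  obtains U \<phi> where "x \<in> U" "D_open M U"
    "diffeomorphism (subspace_dspace P {p \<in> carrier P. \<pi> p \<in> U}) (product_dspace (subspace_dspace M U) L) \<phi>"
    "\<And>p. p \<in> carrier P \<Longrightarrow> \<pi> p \<in> U \<Longrightarrow> fst (\<phi> p) = \<pi> p"
    "\<And>p g. p \<in> carrier P \<Longrightarrow> \<pi> p \<in> U \<Longrightarrow> g \<in> carrier G \<Longrightarrow> \<phi> (act P p g) = (\<pi> p, snd (\<phi> p) \<otimes>\<^bsub>G\<^esub> g)"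
proof -
  have "\<forall>x\<in>carrier M. \<exists>U \<phi>. x \<in> U \<and> D_open M U \<and>
        diffeomorphism (subspace_dspace P {p \<in> carrier P. \<pi> p \<in> U}) (product_dspace (subspace_dspace M U) L) \<phi> \<and>
        (\<forall>p\<in>carrier P. \<pi> p \<in> U \<longrightarrow> fst (\<phi> p) = \<pi> p \<and>
           (\<forall>g\<in>carrier G. \<phi> (act P p g) = (\<pi> p, snd (\<phi> p) \<otimes>\<^bsub>G\<^esub> g)))"
    using pbundle unfolding principal_bundle_def by (elim conjE)
  from bspec[OF this assms] obtain U \<phi> where *: "x \<in> U \<and> D_open M U \<and>
        diffeomorphism (subspace_dspace P {p \<in> carrier P. \<pi> p \<in> U}) (product_dspace (subspace_dspace M U) L) \<phi> \<and>
        (\<forall>p\<in>carrier P. \<pi> p \<in> U \<longrightarrow> fst (\<phi> p) = \<pi> p \<and>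
           (\<forall>g\<in>carrier G. \<phi> (act P p g) = (\<pi> p, snd (\<phi> p) \<otimes>\<^bsub>G\<^esub> g)))" by (elim exE)
  show thesis by (rule that[of U \<phi>]) (use * in auto)
qed

lemma difference_in_trivialization:
  assumes \<phi>: "diffeomorphism (subspace_dspace P {p \<in> carrier P. \<pi> p \<in> U}) (product_dspace (subspace_dspace M U) L) \<phi>"
    "\<And>p. p \<in> carrier P \<Longrightarrow> \<pi> p \<in> U \<Longrightarrow> fst (\<phi> p) = \<pi> p"
    "\<And>p g. p \<in> carrier P \<Longrightarrow> \<pi> p \<in> U \<Longrightarrow> g \<in> carrier G \<Longrightarrow> \<phi> (act P p g) = (\<pi> p, snd (\<phi> p) \<otimes>\<^bsub>G\<^esub> g)"
    and p: "p \<in> carrier P" "\<pi> p \<in> U" and q: "q \<in> carrier P" "\<pi> q = \<pi> p"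
  shows "snd (\<phi> p) \<in> carrier G" "snd (\<phi> q) \<in> carrier G"
    "g \<in> carrier G \<Longrightarrow> act P p g = q \<longleftrightarrow> g = inv\<^bsub>G\<^esub> (snd (\<phi> p)) \<otimes>\<^bsub>G\<^esub> snd (\<phi> q)"
proof -
  have bij: "bij_betw \<phi> {p \<in> carrier P. \<pi> p \<in> U} (U \<times> carrier G)"
    using \<phi>(1) by (simp add: diffeomorphism_def subspace_dspace_def product_dspace_def)
  then have mem: "\<phi> r \<in> U \<times> carrier G" if "r \<in> carrier P" "\<pi> r \<in> U" for r
    using that bij_betwE by fastforce
  show a: "snd (\<phi> p) \<in> carrier G" and b: "snd (\<phi> q) \<in> carrier G" using mem[OF p] mem[of q] p q by auto
  assume g: "g \<in> carrier G"
  have "act P p g = q \<longleftrightarrow> \<phi> (act P p g) = \<phi> q"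
    using bij_betw_imp_inj_on[OF bij] p q g by (auto simp: inj_on_def)
  also have "\<dots> \<longleftrightarrow> snd (\<phi> p) \<otimes>\<^bsub>G\<^esub> g = snd (\<phi> q)"
    using \<phi>(2)[of q] \<phi>(3)[OF p g] p q by (auto simp: prod_eq_iff)
  also have "\<dots> \<longleftrightarrow> g = inv\<^bsub>G\<^esub> (snd (\<phi> p)) \<otimes>\<^bsub>G\<^esub> snd (\<phi> q)"
    using a b g by (metis inv_solve_left)
  finally show "act P p g = q \<longleftrightarrow> g = inv\<^bsub>G\<^esub> (snd (\<phi> p)) \<otimes>\<^bsub>G\<^esub> snd (\<phi> q)" .
qed

abbreviation "\<delta> \<equiv> torsor_diff G P"

lemma act_unique:
  assumes "p \<in> carrier P" "q \<in> carrier P" "\<pi> q = \<pi> p"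
  shows "\<exists>!g. g \<in> carrier G \<and> act P p g = q"
proof -
  obtain U \<phi> where U: "\<pi> p \<in> U" "D_open M U" and
    \<phi>: "diffeomorphism (subspace_dspace P {p \<in> carrier P. \<pi> p \<in> U}) (product_dspace (subspace_dspace M U) L) \<phi>"
    "\<And>p. p \<in> carrier P \<Longrightarrow> \<pi> p \<in> U \<Longrightarrow> fst (\<phi> p) = \<pi> p"
    "\<And>p g. p \<in> carrier P \<Longrightarrow> \<pi> p \<in> U \<Longrightarrow> g \<in> carrier G \<Longrightarrow> \<phi> (act P p g) = (\<pi> p, snd (\<phi> p) \<otimes>\<^bsub>G\<^esub> g)"
    using trivialization[OF \<pi>_carrier[OF assms(1)]] by blast
  note * = difference_in_trivialization[OF \<phi> assms(1) U(1) assms(2,3)]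
  show ?thesis using *(3) m_closed[OF inv_closed[OF *(1)] *(2)] by blast
qed

lemma diff_carrier: "p \<in> carrier P \<Longrightarrow> q \<in> carrier P \<Longrightarrow> \<pi> q = \<pi> p \<Longrightarrow> \<delta> p q \<in> carrier G"
  and act_diff: "p \<in> carrier P \<Longrightarrow> q \<in> carrier P \<Longrightarrow> \<pi> q = \<pi> p \<Longrightarrow> act P p (\<delta> p q) = q"
  using theI'[OF act_unique] by (auto simp: torsor_diff_def)

lemma diff_eqI: "p \<in> carrier P \<Longrightarrow> g \<in> carrier G \<Longrightarrow> act P p g = q \<Longrightarrow> \<delta> p q = g"
  using act_unique[of p q] diff_carrier[of p q] act_diff[of p q] by (metis \<pi>_act act_carrier)

text \<open>Smoothness of the division map of the bundle: in a local trivialisation it is the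
  quotient of the two components in \<open>G\<close>.\<close>

lemma plot_diff:
  assumes s: "is_plot P n V s" and s': "is_plot P n V s'" and eq: "\<And>v. v \<in> V \<Longrightarrow> \<pi> (s' v) = \<pi> (s v)"
  shows "is_plot L n V (\<lambda>v. \<delta> (s v) (s' v))"
proof (rule is_plot_local[OF DL])
  fix v assume v: "v \<in> V"
  have sv: "s v \<in> carrier P" if "v \<in> V" for v by (rule is_plot_carrier[OF DP s that])
  have sv': "s' v \<in> carrier P" if "v \<in> V" for v by (rule is_plot_carrier[OF DP s' that])
  obtain U \<phi> where U: "\<pi> (s v) \<in> U" "D_open M U" and
    \<phi>: "diffeomorphism (subspace_dspace P {p \<in> carrier P. \<pi> p \<in> U}) (product_dspace (subspace_dspace M U) L) \<phi>"
    "\<And>p. p \<in> carrier P \<Longrightarrow> \<pi> p \<in> U \<Longrightarrow> fst (\<phi> p) = \<pi> p"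
    "\<And>p g. p \<in> carrier P \<Longrightarrow> \<pi> p \<in> U \<Longrightarrow> g \<in> carrier G \<Longrightarrow> \<phi> (act P p g) = (\<pi> p, snd (\<phi> p) \<otimes>\<^bsub>G\<^esub> g)"
    using trivialization[OF \<pi>_carrier[OF sv[OF v]]] by blast
  let ?V = "{v \<in> V. \<pi> (s v) \<in> U}"
  have V: "open_eucl n ?V" by (rule D_open_plot[OF U(2) plot_\<pi>[OF s]])
  have sp: "is_plot L n ?V (\<lambda>v. snd (\<phi> (r v)))" if r: "is_plot P n V r" and "\<And>v. v \<in> V \<Longrightarrow> \<pi> (r v) = \<pi> (s v)" for r
  proof -
    have "is_plot P n ?V r" by (rule is_plot_subset[OF DP r V]) auto
    then have "is_plot (subspace_dspace P {p \<in> carrier P. \<pi> p \<in> U}) n ?V r"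
      using that is_plot_carrier[OF DP r] by (auto simp: is_plot_subspace)
    then show ?thesis
      using is_plot_image[of _ "product_dspace (subspace_dspace M U) L" \<phi>] \<phi>(1) by (auto simp: diffeomorphism_def is_plot_product)
  qed
  have "is_plot L n ?V (\<lambda>v. inv\<^bsub>G\<^esub> (snd (\<phi> (s v))) \<otimes>\<^bsub>G\<^esub> snd (\<phi> (s' v)))"
    by (intro plot_mult plot_inv sp s s') (use eq in auto)
  moreover have "\<delta> (s v) (s' v) = inv\<^bsub>G\<^esub> (snd (\<phi> (s v))) \<otimes>\<^bsub>G\<^esub> snd (\<phi> (s' v))" if "v \<in> ?V" for v
  proof (rule diff_eqI)
    have v: "v \<in> V" "\<pi> (s v) \<in> U" using that by auto
    note * = difference_in_trivialization[OF \<phi> sv[OF v(1)] v(2) sv'[OF v(1)] eq[OF v(1)]]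
    show "inv\<^bsub>G\<^esub> (snd (\<phi> (s v))) \<otimes>\<^bsub>G\<^esub> snd (\<phi> (s' v)) \<in> carrier G" using *(1,2) by simp
    then show "act P (s v) (inv\<^bsub>G\<^esub> (snd (\<phi> (s v))) \<otimes>\<^bsub>G\<^esub> snd (\<phi> (s' v))) = s' v" using *(3) by simp
    show "s v \<in> carrier P" by (rule sv[OF v(1)])
  qed
  ultimately have "is_plot L n ?V (\<lambda>v. \<delta> (s v) (s' v))" by (subst is_plot_cong) auto
  then show "\<exists>W. v \<in> W \<and> W \<subseteq> V \<and> is_plot L n W (\<lambda>v. \<delta> (s v) (s' v))"
    by (intro exI[of _ ?V] conjI) (use v U in auto)
qed

text \<open>The section corresponds to the unit in a trivialisation. Its smoothness is recorded
  through its effect on plots with values in \<open>U\<close>, which keeps the subspace diffeology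
  out of later arguments.\<close>

lemma local_section:
  assumes x: "x \<in> carrier M"
  obtains U S where "x \<in> U" "D_open M U" "\<And>y. y \<in> U \<Longrightarrow> \<pi> (S y) = y"
    "\<And>n V \<Gamma>. is_plot M n V \<Gamma> \<Longrightarrow> (\<And>v. v \<in> V \<Longrightarrow> \<Gamma> v \<in> U) \<Longrightarrow> is_plot P n V (\<lambda>v. S (\<Gamma> v))"
proof -
  obtain U \<phi> where U: "x \<in> U" "D_open M U" and
    \<phi>: "diffeomorphism (subspace_dspace P {p \<in> carrier P. \<pi> p \<in> U}) (product_dspace (subspace_dspace M U) L) \<phi>"
    "\<And>p. p \<in> carrier P \<Longrightarrow> \<pi> p \<in> U \<Longrightarrow> fst (\<phi> p) = \<pi> p"
    "\<And>p g. p \<in> carrier P \<Longrightarrow> \<pi> p \<in> U \<Longrightarrow> g \<in> carrier G \<Longrightarrow> \<phi> (act P p g) = (\<pi> p, snd (\<phi> p) \<otimes>\<^bsub>G\<^esub> g)"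
    using trivialization[OF x] by blast
  let ?S = "{p \<in> carrier P. \<pi> p \<in> U}"
  let ?s = "\<lambda>y. inv_into ?S \<phi> (y, \<one>\<^bsub>G\<^esub>)"
  show thesis
  proof (rule that[OF U, of ?s])
    fix y assume "y \<in> U"
    then have m: "(y, \<one>\<^bsub>G\<^esub>) \<in> U \<times> carrier G" by simp
    have bij: "bij_betw \<phi> ?S (U \<times> carrier G)"
      using \<phi>(1) by (simp add: diffeomorphism_def subspace_dspace_def product_dspace_def)
    have "?s y \<in> ?S" using m bij_betw_imp_surj_on[OF bij] by (intro inv_into_into) simp
    moreover have "\<phi> (?s y) = (y, \<one>\<^bsub>G\<^esub>)" using bij_betw_inv_into_right[OF bij m] .
    ultimately show "\<pi> (?s y) = y" using \<phi>(2)[of "?s y"] by simp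
  next
    fix n V \<Gamma> assume \<Gamma>: "is_plot M n V \<Gamma>" "\<And>v. v \<in> V \<Longrightarrow> \<Gamma> v \<in> U"
    have "is_plot (product_dspace (subspace_dspace M U) L) n V (\<lambda>v. (\<Gamma> v, \<one>\<^bsub>G\<^esub>))"
      using \<Gamma> is_plot_const[OF DL _ is_plot_open[OF DM \<Gamma>(1)], of "\<one>\<^bsub>G\<^esub>"] by (auto simp: is_plot_product is_plot_subspace)
    moreover have "smooth_map (product_dspace (subspace_dspace M U) L) (subspace_dspace P ?S) (inv_into ?S \<phi>)"
      using \<phi>(1) by (simp add: diffeomorphism_def subspace_dspace_def)
    ultimately have "is_plot (subspace_dspace P ?S) n V (\<lambda>v. ?s (\<Gamma> v))" using is_plot_image by fastforce
    then show "is_plot P n V (\<lambda>v. ?s (\<Gamma> v))" by (simp add: is_plot_subspace)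
  qed
qed

lemma local_lift:
  assumes \<Gamma>: "is_plot M n V \<Gamma>" and v: "v \<in> V"
  obtains V' s where "v \<in> V'" "V' \<subseteq> V" "is_plot P n V' s" "\<And>w. w \<in> V' \<Longrightarrow> \<pi> (s w) = \<Gamma> w"
proof (rule local_section[OF is_plot_carrier[OF DM \<Gamma> v]])
  fix U S assume U: "\<Gamma> v \<in> U" "D_open M U" and S: "\<And>y. y \<in> U \<Longrightarrow> \<pi> (S y) = y"
    "\<And>n V \<Gamma>. is_plot M n V \<Gamma> \<Longrightarrow> (\<And>v. v \<in> V \<Longrightarrow> \<Gamma> v \<in> U) \<Longrightarrow> is_plot P n V (\<lambda>v. S (\<Gamma> v))"
  let ?V = "{w \<in> V. \<Gamma> w \<in> U}"
  have V: "open_eucl n ?V" by (rule D_open_plot[OF U(2) \<Gamma>])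
  show thesis
  proof (rule that[of ?V "\<lambda>w. S (\<Gamma> w)"])
    show "is_plot P n ?V (\<lambda>w. S (\<Gamma> w))" by (rule S(2)[OF is_plot_subset[OF DM \<Gamma> V]]) auto
  qed (use v U S(1) in auto)
qed

end

context bundle_connection begin

lemma Ad_zero [simp]: "Ad G g (\<lambda>f. 0) = (\<lambda>f. 0)"
  by (auto simp: Ad_def pushforward_def)

subsection \<open>Horizontal lifts\<close>

text \<open>Horizontal in a single coordinate direction, usually time. In the other directions, the
  parameters of a family of lifts, no condition is imposed.\<close>

definition horizontal :: "nat \<Rightarrow> (nat \<Rightarrow> real) set \<Rightarrow> ((nat \<Rightarrow> real) \<Rightarrow> 'p) \<Rightarrow> bool" where
  "horizontal i U \<sigma> \<longleftrightarrow> (\<forall>u\<in>U. A (\<sigma> u) (plot_partial P i \<sigma> u) = (\<lambda>f. 0))"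

lemma A_plot_cong:
  assumes "open_eucl n U" "u \<in> U" "i < n" "\<And>v. v \<in> U \<Longrightarrow> \<sigma> v = \<tau> v"
  shows "A (\<sigma> u) (plot_partial P i \<sigma> u) = A (\<tau> u) (plot_partial P i \<tau> u)"
  using plot_partial_cong[OF assms, where X=P] assms(4)[OF assms(2)] by simp

lemma horizontal_cong:
  assumes "open_eucl n U" "i < n" "\<And>v. v \<in> U \<Longrightarrow> \<sigma> v = \<tau> v"
  shows "horizontal i U \<sigma> \<longleftrightarrow> horizontal i U \<tau>"
  unfolding horizontal_def using A_plot_cong[OF assms(1) _ assms(2), of _ \<sigma> \<tau>] assms(3) by simp

lemma horizontal_act:
  assumes s: "is_plot P n U \<sigma>" and h: "horizontal i U \<sigma>" and k: "is_plot L n U k" and i: "i < n"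
  shows "horizontal i U (\<lambda>v. act P (\<sigma> v) (k v)) \<longleftrightarrow> (\<forall>u\<in>U. MC G i k u = (\<lambda>f. 0))"
  unfolding horizontal_def using A_mult[OF s k _ i] h by (simp add: horizontal_def)

text \<open>The element of \<open>G\<close> that relates the two lifts has vanishing Maurer-Cartan
  value in direction \<open>i\<close>. The condition on the segment replaces connectedness of
  \<open>U\<close>: only the coordinate line from \<open>a\<close> to \<open>b\<close>
  matters.\<close>

lemma horizontal_lift_unique:
  assumes \<sigma>: "is_plot P n U \<sigma>" "horizontal i U \<sigma>" and \<tau>: "is_plot P n U \<tau>" "horizontal i U \<tau>"
    and \<pi>: "\<And>v. v \<in> U \<Longrightarrow> \<pi> (\<tau> v) = \<pi> (\<sigma> v)" and i: "i < n"
    and seg: "\<And>t. min a b \<le> t \<Longrightarrow> t \<le> max a b \<Longrightarrow> u(i := t) \<in> U"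
    and eq: "\<sigma> (u(i := a)) = \<tau> (u(i := a))"
  shows "\<sigma> (u(i := b)) = \<tau> (u(i := b))"
proof -
  define k where "k v = \<delta> (\<sigma> v) (\<tau> v)" for v
  have k: "is_plot L n U k" unfolding k_def by (rule plot_diff[OF \<sigma>(1) \<tau>(1) \<pi>])
  have c: "\<sigma> v \<in> carrier P" "\<tau> v \<in> carrier P" if "v \<in> U" for v
    using that is_plot_carrier[OF DP] \<sigma> \<tau> by blast+
  have \<tau>k: "\<tau> v = act P (\<sigma> v) (k v)" if "v \<in> U" for v
    using act_diff[OF c[OF that] \<pi>[OF that]] by (simp add: k_def)
  have "horizontal i U (\<lambda>v. act P (\<sigma> v) (k v))"
    using \<tau>(2) horizontal_cong[where \<sigma>=\<tau> and \<tau>="\<lambda>v. act P (\<sigma> v) (k v)", OF is_plot_open[OF DP \<sigma>(1)] i \<tau>k] by blast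
  then have "MC G i k u = (\<lambda>f. 0)" if "u \<in> U" for u using horizontal_act[OF \<sigma> k i] that by blast
  then have kk: "k (u(i := a)) = k (u(i := b))" by (rule MC_zero_const[OF k i _ seg])
  have ab: "u(i := a) \<in> U" "u(i := b) \<in> U" using seg by auto
  have "k (u(i := a)) = \<one>\<^bsub>G\<^esub>"
    unfolding k_def using c[OF ab(1)] eq by (intro diff_eqI) auto
  then show ?thesis using \<tau>k[OF ab(2)] kk c[OF ab(2)] by simp
qed

lemma smooth_on_drop_last:
  assumes "open_eucl (Suc n) V"
  shows "smooth_on (Suc n) V n (\<lambda>v. v(n := 0))"
  using open_eucl_subset[OF assms]
  by (intro smooth_onI assms) (auto intro!: drop_last_eucl smooth_fun_on_coord assms)

lemma smooth_on_insert_last: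
  assumes "open_eucl n U"
  shows "smooth_on n U (Suc n) (\<lambda>u. u(n := t))"
proof (rule smooth_onI[OF assms])
  show "smooth_fun_on n U (\<lambda>u. (u(n := t)) j)" for j
    by (cases "j = n") (auto intro!: smooth_fun_on_coord smooth_fun_on_const assms)
qed (use open_eucl_subset[OF assms] in \<open>auto simp: in_eucl\<close>)

text \<open>A group element that does not depend on time has no Maurer-Cartan value in the time
  direction. Initial values of a family of lifts can thus be changed smoothly in the
  parameters.\<close>

lemma plot_translate:
  assumes \<sigma>: "is_plot P (Suc n) (slab n N T) \<sigma>" and h: "horizontal n (slab n N T) \<sigma>" and k: "is_plot L n N k"
  shows "is_plot P (Suc n) (slab n N T) (\<lambda>v. act P (\<sigma> v) (k (v(n := 0))))"
    "horizontal n (slab n N T) (\<lambda>v. act P (\<sigma> v) (k (v(n := 0))))"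
    "\<And>v. v \<in> slab n N T \<Longrightarrow> \<pi> (act P (\<sigma> v) (k (v(n := 0)))) = \<pi> (\<sigma> v)"
proof -
  have O: "open_eucl (Suc n) (slab n N T)" by (rule is_plot_open[OF DP \<sigma>])
  have k': "is_plot L (Suc n) (slab n N T) (\<lambda>v. k (v(n := 0)))"
    by (rule is_plot_comp[OF DL k smooth_on_drop_last[OF O]]) (simp add: slab_def)
  show "is_plot P (Suc n) (slab n N T) (\<lambda>v. act P (\<sigma> v) (k (v(n := 0))))" by (rule plot_act[OF \<sigma> k'])
  have "MC G n (\<lambda>v. k (v(n := 0))) u = (\<lambda>f. 0)" for u
    by (auto simp: MC_def plot_partial_def partial_deriv_def comp_def)
  then show "horizontal n (slab n N T) (\<lambda>v. act P (\<sigma> v) (k (v(n := 0))))"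
    using horizontal_act[OF \<sigma> h k'] by simp
  show "\<pi> (act P (\<sigma> v) (k (v(n := 0)))) = \<pi> (\<sigma> v)" if "v \<in> slab n N T" for v
    using is_plot_carrier[OF DP \<sigma> that] plot_G[OF k, of "v(n := 0)"] that by (simp add: slab_def)
qed

text \<open>In a chart of \<open>G\<close> at the unit, the equation for \<open>g\<close> making \<open>s \<cdot> g\<close> horizontal is the flow equation
  of the right invariant vector fields with the coefficients \<open>- A (\<partial>s)\<close>.\<close>

lemma local_horizontal_lift:
  assumes \<Gamma>: "is_plot M (Suc n) V \<Gamma>" and v0: "v0 \<in> V"
  obtains r \<sigma> where "r > 0" "cube (Suc n) v0 r \<subseteq> V" "is_plot P (Suc n) (cube (Suc n) v0 r) \<sigma>"
    "\<And>v. v \<in> cube (Suc n) v0 r \<Longrightarrow> \<pi> (\<sigma> v) = \<Gamma> v" "horizontal n (cube (Suc n) v0 r) \<sigma>"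
proof -
  obtain V' s where V': "v0 \<in> V'" "V' \<subseteq> V" and s: "is_plot P (Suc n) V' s" and \<pi>s: "\<And>w. w \<in> V' \<Longrightarrow> \<pi> (s w) = \<Gamma> w"
    using local_lift[OF \<Gamma> v0] by blast
  have V'O: "open_eucl (Suc n) V'" by (rule is_plot_open[OF DP s])
  have v0E: "v0 \<in> eucl (Suc n)" using V'(1) open_eucl_subset[OF V'O] by blast
  obtain d W c where ch: "chart L d W c" and 1: "\<one>\<^bsub>G\<^esub> \<in> W"
    using manifold_chart[OF L, of "\<one>\<^bsub>G\<^esub>"] by auto
  define ci where "ci = inv_into W c"
  define x0 where "x0 = c \<one>\<^bsub>G\<^esub>"
  have WG: "W \<subseteq> carrier G" using chartD(1)[OF ch] by simp
  have inj: "inj_on c W" by (rule chartD(2)[OF ch])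
  have cO: "open_eucl d (c ` W)" by (rule chartD(3)[OF ch])
  have cip: "is_plot L d (c ` W) ci" unfolding ci_def by (rule chartD(4)[OF ch])
  have x0W: "x0 \<in> c ` W" using 1 by (simp add: x0_def)
  have x0E: "x0 \<in> eucl d" using x0W open_eucl_subset[OF cO] by blast
  have ci_x0: "ci x0 = \<one>\<^bsub>G\<^esub>" using inj 1 by (simp add: ci_def x0_def)
  have ciW: "ci z \<in> W" "c (ci z) = z" if "z \<in> c ` W" for z
    using that by (auto simp: ci_def inv_into_into f_inv_into_f)
  show thesis
  proof (rule coordinate_functions[OF DL ch 1])
    fix e assume e: "\<And>k. k < d \<Longrightarrow> e k \<in> smooth_functions L"
      and exp: "\<And>v f. v \<in> tangent_space L \<one>\<^bsub>G\<^esub> \<Longrightarrow> f \<in> smooth_functions L \<Longrightarrow>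
       v f = (\<Sum>k<d. v (e k) * partial_deriv k (\<lambda>z. f (inv_into W c z)) (c \<one>\<^bsub>G\<^esub>))"
    \<comment> \<open>Pairs of points of the chart are encoded in \<open>d + d\<close> coordinates,
      so that the multiplication of \<open>G\<close> becomes a plot on an open set of pairs.\<close>
    define pr1 where "pr1 w = (\<lambda>i. if i < d then w i else 0)" for w :: "nat \<Rightarrow> real"
    define pr2 where "pr2 w = (\<lambda>i. if i < d then w (d + i) else 0)" for w :: "nat \<Rightarrow> real"
    have E: "open_eucl (d + d) (eucl (d + d))" by simp
    have pr: "smooth_on (d + d) (eucl (d + d)) d pr1" "smooth_on (d + d) (eucl (d + d)) d pr2"
      by (rule smooth_onI[OF E]; auto simp: pr1_def pr2_def in_eucl intro!: smooth_fun_on_coord)+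
    define D1 where "D1 = {w \<in> eucl (d + d). pr1 w \<in> c ` W}"
    define D where "D = {w \<in> D1. pr2 w \<in> c ` W}"
    have D1: "open_eucl (d + d) D1" unfolding D1_def by (rule open_eucl_smooth_preimage[OF pr(1) cO])
    have pr2D1: "smooth_on (d + d) D1 d pr2" by (rule smooth_on_subset[OF pr(2) D1]) (auto simp: D1_def)
    have D: "open_eucl (d + d) D" unfolding D_def by (rule open_eucl_smooth_preimage[OF pr2D1 cO])
    have prD: "smooth_on (d + d) D d pr1" "smooth_on (d + d) D d pr2"
    proof -
      have sub: "D \<subseteq> eucl (d + d)" by (auto simp: D_def D1_def)
      show "smooth_on (d + d) D d pr1" by (rule smooth_on_subset[OF pr(1) D sub])
      show "smooth_on (d + d) D d pr2" by (rule smooth_on_subset[OF pr(2) D sub])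
    qed
    define \<mu> where "\<mu> w = ci (pr1 w) \<otimes>\<^bsub>G\<^esub> ci (pr2 w)" for w
    have \<mu>: "is_plot L (d + d) D \<mu>"
      unfolding \<mu>_def
      by (intro plot_mult is_plot_comp[OF DL cip prD(1)] is_plot_comp[OF DL cip prD(2)]) (auto simp: D_def D1_def)
    have sm\<mu>: "smooth_on (d + d) {w \<in> D. \<mu> w \<in> W} d (\<lambda>w. c (\<mu> w))" by (rule chartD(5)[OF ch \<mu>])
    \<comment> \<open>The pair consisting of the unit and the point with coordinates
      \<open>y\<close>.\<close>
    define pair where "pair y = (\<lambda>i. if i < d then x0 i else if i < d + d then y (i - d) else 0)" for y :: "nat \<Rightarrow> real"
    have pr_pair: "pr1 (pair y) = x0" "pr2 (pair y) = y" if "y \<in> eucl d" for y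
      using x0E that by (auto simp: pr1_def pr2_def pair_def in_eucl)
    have cE: "y \<in> eucl d" if "y \<in> c ` W" for y using that open_eucl_subset[OF cO] by blast
    have \<mu>_pair: "\<mu> (pair y) = ci y" if "y \<in> c ` W" for y
      using pr_pair[OF cE[OF that]] ciW(1)[OF that] WG by (auto simp: \<mu>_def ci_x0)
    have pairD: "pair y \<in> {w \<in> D. \<mu> w \<in> W}" if "y \<in> c ` W" for y
    proof -
      have "pair y \<in> eucl (d + d)" by (simp add: pair_def in_eucl)
      then show ?thesis using pr_pair[OF cE[OF that]] \<mu>_pair[OF that] ciW(1)[OF that] that x0W by (simp add: D_def D1_def)
    qed
    have pair: "smooth_on d (c ` W) (d + d) pair"
    proof (rule smooth_onI[OF cO])
      show "smooth_fun_on d (c ` W) (\<lambda>y. pair y j)" for j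
        unfolding pair_def by (cases "j < d"; cases "j < d + d") (auto intro!: smooth_fun_on_coord smooth_fun_on_const cO)
    qed (simp add: pair_def in_eucl)
    \<comment> \<open>The derivative of the product with respect to its first factor at the unit:
      component \<open>l\<close> of the right invariant vector field that belongs to the coordinate
      direction \<open>k\<close>.\<close>
    define N where "N l k y = partial_deriv k (\<lambda>w. c (\<mu> w) l) (pair y)" for l k y
    have N: "smooth_fun_on d (c ` W) (N l k)" if "l < d" "k < d" for l k
      unfolding N_def using that pairD
      by (intro smooth_fun_on_compose[OF smooth_fun_on_partial[OF smooth_on_coord[OF sm\<mu>]] pair]) auto
    define a where "a v = A (s v) (plot_partial P n s v)" for v
    have a_lie: "a v \<in> tangent_space L \<one>\<^bsub>G\<^esub>" if "v \<in> V'" for v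
      using A_lie[OF is_plot_carrier[OF DP s that] plot_partial_tangent[OF DP s that]] by (simp add: a_def lie_algebra_def)
    have a_sm: "smooth_fun_on (Suc n) V' (\<lambda>v. a v f)" if "f \<in> smooth_functions L" for f
      unfolding a_def by (rule A_coeff_smooth[OF s _ that]) simp
    let ?N = "Suc n + d"
    define vp where "vp z = (\<lambda>i. if i < Suc n then z i else 0)" for z :: "nat \<Rightarrow> real"
    define yp where "yp z = (\<lambda>i. if i < d then z (Suc n + i) else 0)" for z :: "nat \<Rightarrow> real"
    have EN: "open_eucl ?N (eucl ?N)" by simp
    have vyp: "smooth_on ?N (eucl ?N) (Suc n) vp" "smooth_on ?N (eucl ?N) d yp"
      by (rule smooth_onI[OF EN]; auto simp: vp_def yp_def in_eucl intro!: smooth_fun_on_coord)+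
    define \<Omega>1 where "\<Omega>1 = {z \<in> eucl ?N. vp z \<in> V'}"
    define \<Omega> where "\<Omega> = {z \<in> \<Omega>1. yp z \<in> c ` W}"
    have \<Omega>1: "open_eucl ?N \<Omega>1" unfolding \<Omega>1_def by (rule open_eucl_smooth_preimage[OF vyp(1) V'O])
    have yp1: "smooth_on ?N \<Omega>1 d yp" by (rule smooth_on_subset[OF vyp(2) \<Omega>1]) (auto simp: \<Omega>1_def)
    have \<Omega>: "open_eucl ?N \<Omega>" unfolding \<Omega>_def by (rule open_eucl_smooth_preimage[OF yp1 cO])
    have vyp\<Omega>: "smooth_on ?N \<Omega> (Suc n) vp" "smooth_on ?N \<Omega> d yp"
    proof -
      have sub: "\<Omega> \<subseteq> eucl ?N" by (auto simp: \<Omega>_def \<Omega>1_def)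
      show "smooth_on ?N \<Omega> (Suc n) vp" by (rule smooth_on_subset[OF vyp(1) \<Omega> sub])
      show "smooth_on ?N \<Omega> d yp" by (rule smooth_on_subset[OF vyp(2) \<Omega> sub])
    qed
    \<comment> \<open>The numbers \<open>a (vp z) (e k)\<close> are the components of
      \<open>A(\<partial>s)\<close> in the coordinate basis of the Lie algebra.\<close>
    define F where "F l z = (\<Sum>k<d. - (N l k (yp z) * a (vp z) (e k)))" for l z
    have F: "smooth_fun_on ?N \<Omega> (F l)" if "l < d" for l
      unfolding F_def[abs_def]
      by (intro smooth_fun_on_sum[OF \<Omega>] smooth_fun_on_minus smooth_fun_on_mult
           smooth_fun_on_compose[OF N vyp\<Omega>(2)] smooth_fun_on_compose[OF a_sm vyp\<Omega>(1)] e)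
         (use that in \<open>auto simp: \<Omega>_def \<Omega>1_def\<close>)
    have jn: "vp (join n d v y) = v" if "v \<in> eucl (Suc n)" for v y
      using that by (auto simp: vp_def in_eucl fun_eq_iff)
    have jy: "yp (join n d v y) = (\<lambda>i. if i < d then y i else 0)" for v y
      by (auto simp: yp_def fun_eq_iff)
    have jyx: "yp (join n d v x0) = x0" for v using x0E by (auto simp: jy in_eucl)
    \<comment> \<open>The unit only serves as a centre for the local solution; nothing fixes the
      value of \<open>g\<close> at \<open>v0\<close>.\<close>
    have z0: "join n d v0 x0 \<in> \<Omega>"
      using jn[OF v0E, of x0] jyx[of v0] V'(1) x0W join_eucl[of n d v0 x0] by (simp add: \<Omega>_def \<Omega>1_def)
    have v0': "(\<lambda>i. if i < Suc n then join n d v0 x0 i else 0) = v0" using jn[OF v0E, of x0] by (simp add: vp_def)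
    show thesis
    proof (rule ode_local_solution[OF z0 \<Omega> F], assumption, unfold v0')
      fix r y assume r: "r > 0"
        and ys: "\<And>l. l < d \<Longrightarrow> smooth_fun_on (Suc n) (cube (Suc n) v0 r) (y l)"
        and y\<Omega>: "\<And>v. v \<in> cube (Suc n) v0 r \<Longrightarrow> join n d v (\<lambda>l. y l v) \<in> \<Omega>"
        and yd: "\<And>v l. v \<in> cube (Suc n) v0 r \<Longrightarrow> l < d \<Longrightarrow> partial_deriv n (y l) v = F l (join n d v (\<lambda>l. y l v))"
      let ?C = "cube (Suc n) v0 r"
      have CO: "open_eucl (Suc n) ?C" by (rule open_eucl_cube)
      have CE: "v \<in> eucl (Suc n)" if "v \<in> ?C" for v using that cube_subset by blast
      have CV: "?C \<subseteq> V'" using y\<Omega> jn[OF CE] by (force simp: \<Omega>_def \<Omega>1_def)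
      define yv where "yv v = (\<lambda>i. if i < d then y i v else 0)" for v
      have yvW: "yv v \<in> c ` W" if "v \<in> ?C" for v using y\<Omega>[OF that] by (simp add: \<Omega>_def jy yv_def)
      have yvs: "smooth_on (Suc n) ?C d yv"
        by (rule smooth_onI[OF CO]) (use ys in \<open>auto simp: yv_def in_eucl\<close>)
      define g where "g v = ci (yv v)" for v
      have g: "is_plot L (Suc n) ?C g" unfolding g_def by (rule is_plot_comp[OF DL cip yvs yvW])
      have sC: "is_plot P (Suc n) ?C s" by (rule is_plot_subset[OF DP s CO CV])
      show thesis
      proof (rule that[OF r, of "\<lambda>v. act P (s v) (g v)"])
        show "?C \<subseteq> V" using CV V' by blast
        show "is_plot P (Suc n) ?C (\<lambda>v. act P (s v) (g v))" by (rule plot_act[OF sC g])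
        show "\<pi> (act P (s v) (g v)) = \<Gamma> v" if "v \<in> ?C" for v
          using \<pi>s[of v] CV that is_plot_carrier[OF DP sC that] plot_G[OF g that] by auto
        show "horizontal n ?C (\<lambda>v. act P (s v) (g v))"
          unfolding horizontal_def
        proof
          fix v assume v: "v \<in> ?C"
          have vV: "v \<in> V'" using v CV by blast
          have gv: "g v \<in> carrier G" by (rule plot_G[OF g v])
          have "Ad G (inv\<^bsub>G\<^esub> (g v)) (a v) f + MC G n g v f = 0" for f
          proof (cases "f \<in> smooth_functions L")
            case True
            \<comment> \<open>The test function \<open>f\<close> read near \<open>g v\<close> by
              left translation; \<open>\<phi>\<close> below is \<open>f\<close> composed with
              conjugation, the form in which \<open>Ad\<close> acts on test functions.\<close>
            define R where "R h = f (inv\<^bsub>G\<^esub> (g v) \<otimes>\<^bsub>G\<^esub> h)" for h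
            define \<phi> where "\<phi> h = f (inv\<^bsub>G\<^esub> (g v) \<otimes>\<^bsub>G\<^esub> h \<otimes>\<^bsub>G\<^esub> g v)" for h
            have R: "R \<in> smooth_functions L"
              unfolding R_def[abs_def] by (rule smooth_functions_comp[OF DL True mult_left_smooth]) (use gv in simp)
            have \<phi>: "\<phi> \<in> smooth_functions L"
              unfolding \<phi>_def[abs_def]
              by (rule smooth_functions_comp[OF DL smooth_functions_comp[OF DL True mult_right_smooth[OF gv]] mult_left_smooth]) (use gv in simp)
            have "Ad G (inv\<^bsub>G\<^esub> (g v)) (a v) f = a v \<phi>"
              using True gv by (simp add: Ad_def pushforward_def comp_def \<phi>_def[abs_def])
            also have "\<dots> = (\<Sum>k<d. a v (e k) * partial_deriv k (\<lambda>z. \<phi> (ci z)) x0)"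
              unfolding ci_def x0_def by (rule exp[OF a_lie[OF vV] \<phi>])
            finally have Ad: "Ad G (inv\<^bsub>G\<^esub> (g v)) (a v) f = (\<Sum>k<d. a v (e k) * partial_deriv k (\<lambda>z. \<phi> (ci z)) x0)" .
            have Rsm: "smooth_fun_on d (c ` W) (\<lambda>z. R (ci z))" by (rule smooth_functions_plot[OF R cip])
            \<comment> \<open>The chain rule for \<open>h \<mapsto> R (h g(v))\<close> at the unit:
              the right invariant fields applied to \<open>R\<close> give the coordinate derivatives
              of the conjugated function, which links the flow equation to
              \<open>Ad\<close>.\<close>
            have key: "(\<Sum>l<d. N l k (yv v) * partial_deriv l (\<lambda>z. R (ci z)) (yv v)) = partial_deriv k (\<lambda>z. \<phi> (ci z)) x0"
              if k: "k < d" for k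
            proof -
              note yW = yvW[OF v]
              have "partial_deriv k (\<lambda>w. R (\<mu> w)) (pair (yv v)) =
                 (\<Sum>l<d. partial_deriv k (\<lambda>w. c (\<mu> w) l) (pair (yv v)) * partial_deriv l (\<lambda>z. R (inv_into W c z)) (c (\<mu> (pair (yv v)))))"
                by (rule chart_partial[OF DL ch \<mu> _ _ _ Rsm[unfolded ci_def]])
                   (use pairD[OF yW] k \<mu>_pair[OF yW] ciW[OF yW] yW in auto)
              also have "\<dots> = (\<Sum>l<d. N l k (yv v) * partial_deriv l (\<lambda>z. R (ci z)) (yv v))"
                using \<mu>_pair[OF yW] ciW[OF yW] by (simp add: N_def ci_def[symmetric])
              also have "partial_deriv k (\<lambda>w. R (\<mu> w)) (pair (yv v)) = partial_deriv k (\<lambda>z. R (ci z \<otimes>\<^bsub>G\<^esub> g v)) x0"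
              proof -
                have "pr1 ((pair (yv v))(k := t)) = (pr1 (pair (yv v)))(k := t)" "pr2 ((pair (yv v))(k := t)) = pr2 (pair (yv v))" for t
                  using k by (auto simp: pr1_def pr2_def)
                then have "pr1 ((pair (yv v))(k := t)) = x0(k := t)" "pr2 ((pair (yv v))(k := t)) = yv v" for t
                  by (simp_all add: pr_pair[OF cE[OF yW]])
                moreover have "pair (yv v) k = x0 k" using k by (simp add: pair_def)
                ultimately show ?thesis by (simp add: partial_deriv_def \<mu>_def g_def)
              qed
              also have "\<dots> = partial_deriv k (\<lambda>z. \<phi> (ci z)) x0"
              proof (rule partial_deriv_cong[OF cO x0W k])
                fix z assume "z \<in> c ` W"
                then have "ci z \<in> carrier G" using ciW(1) WG by blast
                then show "R (ci z \<otimes>\<^bsub>G\<^esub> g v) = \<phi> (ci z)" using gv by (simp add: R_def \<phi>_def m_assoc)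
              qed
              finally show ?thesis by simp
            qed
            have "MC G n g v f = partial_deriv n (\<lambda>w. R (ci (yv w))) v"
              using True by (simp add: MC_def plot_partial_apply R_def g_def)
            also have "\<dots> = (\<Sum>l<d. partial_deriv n (\<lambda>w. yv w l) v * partial_deriv l (\<lambda>z. R (ci z)) (yv v))"
              by (rule partial_deriv_comp[OF Rsm yvs _ v]) (use yvW in auto)
            also have "\<dots> = (\<Sum>l<d. (\<Sum>k<d. - (N l k (yv v) * a v (e k))) * partial_deriv l (\<lambda>z. R (ci z)) (yv v))"
            proof (rule sum.cong[OF refl])
              fix l assume "l \<in> {..<d}"
              then have l: "l < d" by simp
              have "partial_deriv n (\<lambda>w. yv w l) v = F l (join n d v (\<lambda>l. y l v))" using yd[OF v l] l by (simp add: yv_def)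
              also have "\<dots> = (\<Sum>k<d. - (N l k (yv v) * a v (e k)))"
                by (simp add: F_def jn[OF CE[OF v]] jy yv_def)
              finally show "partial_deriv n (\<lambda>w. yv w l) v * partial_deriv l (\<lambda>z. R (ci z)) (yv v) =
                (\<Sum>k<d. - (N l k (yv v) * a v (e k))) * partial_deriv l (\<lambda>z. R (ci z)) (yv v)" by simp
            qed
            also have "\<dots> = (\<Sum>k<d. - (a v (e k) * (\<Sum>l<d. N l k (yv v) * partial_deriv l (\<lambda>z. R (ci z)) (yv v))))"
              unfolding sum_distrib_right sum_distrib_left sum_negf[symmetric]
              by (subst sum.swap) (simp add: mult_ac)
            also have "\<dots> = - Ad G (inv\<^bsub>G\<^esub> (g v)) (a v) f"
              unfolding Ad by (simp add: key sum_negf)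
            finally show ?thesis by simp
          qed (simp add: Ad_def pushforward_def MC_def plot_partial_def)
          then show "A (act P (s v) (g v)) (plot_partial P n (\<lambda>v. act P (s v) (g v)) v) = (\<lambda>f. 0)"
            unfolding A_mult[OF sC g v lessI] a_def by simp
        qed
      qed
    qed
  qed
qed

text \<open>Bolzano's principle for intervals replaces a subdivision of [a,b]. The margin
  \<open>r\<close> on both sides provides the open overlap on which two lifts are compared and
  glued, and the neighbourhood \<open>N\<close> of the parameter shrinks at each gluing.\<close>

lemma horizontal_lift_on_interval:
  assumes U: "open_eucl n U" and \<Gamma>: "is_plot M (Suc n) (slab n U UNIV) \<Gamma>" and u0: "u0 \<in> U" and ab: "a \<le> b"
  shows "\<exists>N \<sigma> r. u0 \<in> N \<and> N \<subseteq> U \<and> open_eucl n N \<and> 0 < r \<and> is_plot P (Suc n) (slab n N {a - r<..<b + r}) \<sigma> \<and>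
    (\<forall>v\<in>slab n N {a - r<..<b + r}. \<pi> (\<sigma> v) = \<Gamma> v) \<and> horizontal n (slab n N {a - r<..<b + r}) \<sigma>" (is "?Q a b")
  using ab
proof (induction rule: Bolzano)
  case (local x)
  have u0E: "u0 \<in> eucl n" using u0 open_eucl_subset[OF U] by blast
  have v0: "u0(n := x) \<in> slab n U UNIV" by (rule slabI[OF u0 u0E]) simp
  obtain r \<sigma> where r: "r > 0" "cube (Suc n) (u0(n := x)) r \<subseteq> slab n U UNIV" and \<sigma>: "is_plot P (Suc n) (cube (Suc n) (u0(n := x)) r) \<sigma>"
    "\<And>v. v \<in> cube (Suc n) (u0(n := x)) r \<Longrightarrow> \<pi> (\<sigma> v) = \<Gamma> v" "horizontal n (cube (Suc n) (u0(n := x)) r) \<sigma>"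
    using local_horizontal_lift[OF \<Gamma> v0] by blast
  let ?N = "cube n u0 r"
  have sub: "slab n ?N {x - r<..<x + r} \<subseteq> cube (Suc n) (u0(n := x)) r"
  proof
    fix v assume v: "v \<in> slab n ?N {x - r<..<x + r}"
    have "\<bar>v i - (u0(n := x)) i\<bar> < r" if "i < Suc n" for i
    proof (cases "i = n")
      case False
      then have "i < n" using that by simp
      then have "\<bar>(v(n := 0)) i - u0 i\<bar> < r" using v by (auto simp: slab_def cube_def)
      then show ?thesis using False by simp
    qed (use v in \<open>auto simp: slab_def abs_less_iff\<close>)
    then show "v \<in> cube (Suc n) (u0(n := x)) r" using v by (auto simp: slab_def cube_def)
  qed
  have NU: "?N \<subseteq> U"
  proof
    fix u assume u: "u \<in> ?N"
    then have uE: "u \<in> eucl n" using cube_subset by blast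
    have "u(n := x) \<in> slab n ?N {x - r<..<x + r}" by (rule slabI[OF u uE]) (use r in simp)
    then have "u(n := x) \<in> slab n U UNIV" using sub r(2) by blast
    then have "(u(n := x))(n := 0) \<in> U" by (simp add: slab_def)
    then show "u \<in> U" using uE by (simp add: in_eucl fun_upd_idem)
  qed
  \<comment> \<open>For an interval around \<open>x\<close> of length below \<open>r / 2\<close>, a
    margin of \<open>r / 2\<close> at both ends still stays within distance \<open>r\<close> of
    \<open>x\<close>.\<close>
  show ?case
  proof (intro exI[of _ "r / 2"] conjI allI impI)
    show "r / 2 > 0" using r by simp
    fix a b assume ab: "a \<le> x \<and> x \<le> b \<and> b - a < r / 2"
    let ?S = "slab n ?N {a - r / 2<..<b + r / 2}"
    have S: "?S \<subseteq> cube (Suc n) (u0(n := x)) r"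
      by (rule subset_trans[OF slab_mono[OF order_refl] sub]) (use ab in auto)
    have SO: "open_eucl (Suc n) ?S" by (intro open_eucl_slab open_eucl_cube) simp
    show "?Q a b"
      by (rule exI[of _ ?N], rule exI[of _ \<sigma>], rule exI[of _ "r / 2"], intro conjI)
         (use r NU S cube_self[OF u0E r(1)] \<sigma>(2,3) in
           \<open>auto simp: open_eucl_cube horizontal_def intro!: is_plot_subset[OF DP \<sigma>(1) SO S]\<close>)
  qed
next
  case (trans a b c)
  obtain N1 \<sigma>1 r1 where 1: "u0 \<in> N1" "N1 \<subseteq> U" "open_eucl n N1" "0 < r1" and \<sigma>1: "is_plot P (Suc n) (slab n N1 {a - r1<..<b + r1}) \<sigma>1"
    "\<And>v. v \<in> slab n N1 {a - r1<..<b + r1} \<Longrightarrow> \<pi> (\<sigma>1 v) = \<Gamma> v" "horizontal n (slab n N1 {a - r1<..<b + r1}) \<sigma>1"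
    using trans(1) by blast
  obtain N2 \<sigma>2 r2 where 2: "u0 \<in> N2" "N2 \<subseteq> U" "open_eucl n N2" "0 < r2" and \<sigma>2: "is_plot P (Suc n) (slab n N2 {b - r2<..<c + r2}) \<sigma>2"
    "\<And>v. v \<in> slab n N2 {b - r2<..<c + r2} \<Longrightarrow> \<pi> (\<sigma>2 v) = \<Gamma> v" "horizontal n (slab n N2 {b - r2<..<c + r2}) \<sigma>2"
    using trans(2) by blast
  note abc = trans(3,4)
  define N where "N = N1 \<inter> N2"
  define r where "r = min r1 r2"
  have N: "u0 \<in> N" "N \<subseteq> U" "open_eucl n N" using 1 2 by (auto simp: N_def)
  have NE: "u \<in> eucl n" if "u \<in> N" for u using that open_eucl_subset[OF N(3)] by blast
  have r: "r > 0" "r \<le> r1" "r \<le> r2" using 1 2 by (auto simp: r_def)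
  let ?S1 = "slab n N {a - r<..<b + r}" and ?S2 = "slab n N {b - r<..<c + r}" and ?S = "slab n N {a - r<..<c + r}"
  have sub1: "?S1 \<subseteq> slab n N1 {a - r1<..<b + r1}" and sub2: "?S2 \<subseteq> slab n N2 {b - r2<..<c + r2}"
    using r by (auto simp: slab_def N_def)
  have O: "open_eucl (Suc n) (slab n N {t<..<t'})" for t t' by (intro open_eucl_slab N(3)) simp
  have s1: "is_plot P (Suc n) ?S1 \<sigma>1" "horizontal n ?S1 \<sigma>1" and s2: "is_plot P (Suc n) ?S2 \<sigma>2" "horizontal n ?S2 \<sigma>2"
    using is_plot_subset[OF DP \<sigma>1(1) O sub1] is_plot_subset[OF DP \<sigma>2(1) O sub2] \<sigma>1(3) \<sigma>2(3) sub1 sub2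
    by (auto simp: horizontal_def)
  have nb: "u(n := b) \<in> ?S1" "u(n := b) \<in> ?S2" if "u \<in> N" for u
    using slabI[OF that NE[OF that]] abc r by auto
  \<comment> \<open>The translation that makes the second lift agree with the first at time
    \<open>b\<close>, depending smoothly on the parameter.\<close>
  define k where "k u = \<delta> (\<sigma>2 (u(n := b))) (\<sigma>1 (u(n := b)))" for u
  have k: "is_plot L n N k"
    unfolding k_def
    by (rule plot_diff[OF is_plot_comp[OF DP s2(1) smooth_on_insert_last[OF N(3)]] is_plot_comp[OF DP s1(1) smooth_on_insert_last[OF N(3)]]])
       (use nb \<sigma>1(2) \<sigma>2(2) sub1 sub2 in \<open>auto simp: subset_iff\<close>)
  define \<tau> where "\<tau> v = act P (\<sigma>2 v) (k (v(n := 0)))" for v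
  have \<tau>: "is_plot P (Suc n) ?S2 \<tau>" "horizontal n ?S2 \<tau>" "\<And>v. v \<in> ?S2 \<Longrightarrow> \<pi> (\<tau> v) = \<Gamma> v"
    using plot_translate[OF s2 k] \<sigma>2(2) sub2 by (auto simp: \<tau>_def[abs_def])
  have \<tau>b: "\<sigma>1 (v(n := b)) = \<tau> (v(n := b))" if "v(n := 0) \<in> N" for v
  proof -
    have eq: "(v(n := 0))(n := b) = v(n := b)" by simp
    note m = nb[OF that, unfolded eq]
    have "act P (\<sigma>2 (v(n := b))) (\<delta> (\<sigma>2 (v(n := b))) (\<sigma>1 (v(n := b)))) = \<sigma>1 (v(n := b))"
      using m is_plot_carrier[OF DP s1(1) m(1)] is_plot_carrier[OF DP s2(1) m(2)] \<sigma>1(2) \<sigma>2(2) sub1 sub2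
      by (intro act_diff) (auto simp: subset_iff)
    then show ?thesis by (simp add: \<tau>_def k_def)
  qed
  \<comment> \<open>Agreement at the single time \<open>b\<close> spreads over the whole overlap by
    uniqueness; the glued map then coincides with a plot on each of two open sets.\<close>
  have agree: "\<sigma>1 v = \<tau> v" if v: "v \<in> slab n N {b - r<..<b + r}" for v
  proof -
    let ?O = "slab n N {b - r<..<b + r}"
    have O1: "?O \<subseteq> ?S1" and O2: "?O \<subseteq> ?S2" using abc by (auto simp: slab_def)
    have "\<sigma>1 (v(n := v n)) = \<tau> (v(n := v n))"
    proof (rule horizontal_lift_unique[of "Suc n" ?O \<sigma>1 n \<tau> b])
      show "is_plot P (Suc n) ?O \<sigma>1" "is_plot P (Suc n) ?O \<tau>"
        by (rule is_plot_subset[OF DP s1(1) O O1] is_plot_subset[OF DP \<tau>(1) O O2])+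
      show "horizontal n ?O \<sigma>1" "horizontal n ?O \<tau>" using s1(2) \<tau>(2) O1 O2 by (auto simp: horizontal_def)
      show "\<pi> (\<tau> w) = \<pi> (\<sigma>1 w)" if "w \<in> ?O" for w
        using \<tau>(3)[OF subsetD[OF O2 that]] \<sigma>1(2)[OF subsetD[OF sub1 subsetD[OF O1 that]]] by simp
      show "v(n := t) \<in> ?O" if "min b (v n) \<le> t" "t \<le> max b (v n)" for t
      proof (rule slab_upd[OF v])
        have "v n \<in> {b - r<..<b + r}" using v by (simp add: slab_def)
        then show "t \<in> {b - r<..<b + r}" using that r by (auto simp: min_def max_def split: if_splits)
      qed
      show "\<sigma>1 (v(n := b)) = \<tau> (v(n := b))" using \<tau>b v by (simp add: slab_def)
    qed simp
    then show ?thesis by simp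
  qed
  define \<sigma> where "\<sigma> v = (if v n < b then \<sigma>1 v else \<tau> v)" for v
  have e1: "\<sigma> v = \<sigma>1 v" if "v \<in> ?S1" for v
    using agree[of v] that r by (auto simp: \<sigma>_def slab_def)
  have e2: "\<sigma> v = \<tau> v" if "v \<in> ?S2" for v
    using agree[of v] that r by (auto simp: \<sigma>_def slab_def)
  have p1: "is_plot P (Suc n) ?S1 \<sigma>" using s1(1) is_plot_cong[of ?S1 \<sigma> \<sigma>1] e1 by blast
  have p2: "is_plot P (Suc n) ?S2 \<sigma>" using \<tau>(1) is_plot_cong[of ?S2 \<sigma> \<tau>] e2 by blast
  have S12: "?S1 \<subseteq> ?S" "?S2 \<subseteq> ?S" using abc by (auto simp: slab_def)
  have cover: "v \<in> ?S1 \<or> v \<in> ?S2" if "v \<in> ?S" for v using that r by (auto simp: slab_def)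
  have pS: "is_plot P (Suc n) ?S \<sigma>"
  proof (rule is_plot_local[OF DP])
    show "\<exists>V. v \<in> V \<and> V \<subseteq> ?S \<and> is_plot P (Suc n) V \<sigma>" if "v \<in> ?S" for v
      using cover[OF that] p1 p2 S12 by blast
  qed
  moreover have "\<pi> (\<sigma> v) = \<Gamma> v" if "v \<in> ?S" for v
    using cover[OF that] e1[of v] e2[of v] \<sigma>1(2)[of v] \<tau>(3)[of v] sub1 by auto
  moreover have "horizontal n ?S \<sigma>"
    unfolding horizontal_def
  proof
    fix v assume "v \<in> ?S"
    then consider "v \<in> ?S1" | "v \<in> ?S2" using cover by blast
    then show "A (\<sigma> v) (plot_partial P n \<sigma> v) = (\<lambda>f. 0)"
    proof cases
      case 1
      then show ?thesis using A_plot_cong[where \<sigma>=\<sigma> and \<tau>=\<sigma>1, OF O 1 lessI e1] s1(2) by (simp add: horizontal_def)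
    next
      case 2
      then show ?thesis using A_plot_cong[where \<sigma>=\<sigma> and \<tau>=\<tau>, OF O 2 lessI e2] \<tau>(2) by (simp add: horizontal_def)
    qed
  qed
  ultimately show ?case using N r(1) by blast
qed

text \<open>A point of \<open>eucl n\<close> has coordinate 0 at index \<open>n\<close> and is
  therefore itself the point of the slab at time 0; this is how the initial condition
  \<open>\<sigma> u = z u\<close> is to be read.\<close>

lemma horizontal_lift_exists:
  assumes U: "open_eucl n U" and \<Gamma>: "is_plot M (Suc n) (slab n U UNIV) \<Gamma>" and u0: "u0 \<in> U"
    and z: "is_plot P n U z" "\<And>u. u \<in> U \<Longrightarrow> \<pi> (z u) = \<Gamma> u"
  obtains N \<sigma> r where "u0 \<in> N" "N \<subseteq> U" "open_eucl n N" "0 < r" "is_plot P (Suc n) (slab n N {- r<..<1 + r}) \<sigma>"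
    "\<And>v. v \<in> slab n N {- r<..<1 + r} \<Longrightarrow> \<pi> (\<sigma> v) = \<Gamma> v" "horizontal n (slab n N {- r<..<1 + r}) \<sigma>"
    "\<And>u. u \<in> N \<Longrightarrow> \<sigma> u = z u"
proof -
  obtain N \<sigma> r where N: "u0 \<in> N" "N \<subseteq> U" "open_eucl n N" "0 < r" and \<sigma>: "is_plot P (Suc n) (slab n N {0 - r<..<1 + r}) \<sigma>"
    "\<And>v. v \<in> slab n N {0 - r<..<1 + r} \<Longrightarrow> \<pi> (\<sigma> v) = \<Gamma> v" "horizontal n (slab n N {0 - r<..<1 + r}) \<sigma>"
    using horizontal_lift_on_interval[OF U \<Gamma> u0 zero_le_one] by blast
  have NE: "u \<in> eucl n" if "u \<in> N" for u using that open_eucl_subset[OF N(3)] by blast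
  have n0: "u(n := 0) = u" if "u \<in> N" for u using NE[OF that] by (simp add: in_eucl fun_upd_idem)
  have nS: "u \<in> slab n N {0 - r<..<1 + r}" if "u \<in> N" for u
    using slabI[OF that NE[OF that], of 0 "{0 - r<..<1 + r}"] N(4) n0[OF that] by simp
  have "is_plot P n N (\<lambda>u. \<sigma> (u(n := 0)))"
    by (rule is_plot_comp[OF DP \<sigma>(1) smooth_on_insert_last[OF N(3)]]) (use nS n0 in auto)
  then have \<sigma>N: "is_plot P n N \<sigma>" by (subst is_plot_cong[where q="\<lambda>u. \<sigma> (u(n := 0))"]) (auto simp: n0)
  have zN: "is_plot P n N z" by (rule is_plot_subset[OF DP z(1) N(3,2)])
  have eq: "\<pi> (z u) = \<pi> (\<sigma> u)" if "u \<in> N" for u using z(2)[of u] \<sigma>(2)[OF nS[OF that]] N(2) that by auto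
  define k where "k u = \<delta> (\<sigma> u) (z u)" for u
  have k: "is_plot L n N k" unfolding k_def by (rule plot_diff[OF \<sigma>N zN eq])
  note T = plot_translate[OF \<sigma>(1,3) k]
  show thesis
  proof (rule that[OF N, of "\<lambda>v. act P (\<sigma> v) (k (v(n := 0)))"])
    show "act P (\<sigma> u) (k (u(n := 0))) = z u" if "u \<in> N" for u
      unfolding n0[OF that] k_def
      by (rule act_diff[OF is_plot_carrier[OF DP \<sigma>N that] is_plot_carrier[OF DP zN that] eq[OF that]])
  qed (use T \<sigma>(2) in \<open>simp_all\<close>)
qed

end

section \<open>Paths and parallel transport\<close>

lemma smooth_fromE:
  assumes "smooth_from n S X f" "x \<in> S"
  obtains V g where "x \<in> V" "(n, V, g) \<in> plots X" "\<And>y. y \<in> S \<Longrightarrow> y \<in> V \<Longrightarrow> f y = g y"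
proof -
  obtain V g where "x \<in> V \<and> (n, V, g) \<in> plots X \<and> (\<forall>y\<in>S \<inter> V. f y = g y)"
    using bspec[OF assms(1)[unfolded smooth_from_def] assms(2)] by (elim exE)
  then show thesis by (intro that[of V g]) auto
qed

text \<open>Different local extensions of \<open>f\<close> may disagree off \<open>S\<close>, but
  \<open>h\<close> takes its values in \<open>S\<close>, where all of them equal \<open>f\<close>.
  So a composite with values in a closed set is an honest plot.\<close>

lemma smooth_from_comp:
  assumes X: "diffeology X" and f: "smooth_from n S X f" and h: "smooth_on m V n h" "\<And>v. v \<in> V \<Longrightarrow> h v \<in> S"
  shows "is_plot X m V (\<lambda>v. f (h v))"
proof (rule is_plot_local[OF X])
  fix v assume v: "v \<in> V"
  obtain V' g where g: "h v \<in> V'" "(n, V', g) \<in> plots X" "\<And>y. y \<in> S \<Longrightarrow> y \<in> V' \<Longrightarrow> f y = g y"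
    using smooth_fromE[OF f h(2)[OF v]] by blast
  have gp: "is_plot X n V' g" by (rule plots_is_plot(1)[OF X g(2)])
  let ?W = "{w \<in> V. h w \<in> V'}"
  have W: "open_eucl m ?W" by (rule open_eucl_smooth_preimage[OF h(1) is_plot_open[OF X gp]])
  have "smooth_on m ?W n h" by (rule smooth_on_subset[OF h(1) W]) auto
  then have "is_plot X m ?W (\<lambda>w. g (h w))" by (rule is_plot_comp[OF X gp]) simp
  moreover have "g (h w) = f (h w)" if "w \<in> ?W" for w using that g(3) h(2) by simp
  ultimately have "is_plot X m ?W (\<lambda>w. f (h w))" using is_plot_cong[of ?W "\<lambda>w. g (h w)" "\<lambda>w. f (h w)" X m] by blast
  then show "\<exists>W. v \<in> W \<and> W \<subseteq> V \<and> is_plot X m W (\<lambda>w. f (h w))"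
    by (intro exI[of _ ?W] conjI) (use v g(1) in auto)
qed

lemma smooth_fromI:
  assumes "\<And>x. x \<in> S \<Longrightarrow> \<exists>V p. x \<in> V \<and> is_plot X n V p \<and> (\<forall>y\<in>S \<inter> V. f y = p y)"
  shows "smooth_from n S X f"
  unfolding smooth_from_def
proof
  fix x assume "x \<in> S"
  then obtain V p where "x \<in> V" "is_plot X n V p" "\<forall>y\<in>S \<inter> V. f y = p y" using assms by blast
  then show "\<exists>V g. x \<in> V \<and> (n, V, g) \<in> plots X \<and> (\<forall>y\<in>S \<inter> V. f y = g y)"
    by (intro exI[of _ V] exI[of _ "restrict p V"]) (auto simp: is_plot_def)
qed

lemma smooth_from_carrier:
  assumes "diffeology X" "smooth_from n S X f" "x \<in> S"
  shows "f x \<in> carrier X"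
proof -
  obtain V g where "x \<in> V" "(n, V, g) \<in> plots X" "\<And>y. y \<in> S \<Longrightarrow> y \<in> V \<Longrightarrow> f y = g y"
    using smooth_fromE[OF assms(2,3)] by blast
  then show ?thesis using is_plot_carrier[OF assms(1) plots_is_plot(1)[OF assms(1)]] assms(3) by fastforce
qed

abbreviation unit_segment :: "(nat \<Rightarrow> real) set" where
  "unit_segment \<equiv> {x \<in> eucl (Suc 0). x 0 \<in> {0..1}}"

lemma smooth_path_iff: "smooth_path X \<gamma> \<longleftrightarrow> smooth_from (Suc 0) unit_segment X (\<lambda>x. \<gamma> (x 0))"
  by (simp add: smooth_path_def)

lemma DERIV_vec1:
  assumes "smooth_fun_on (Suc 0) V F" "vec1 t \<in> V"
  shows "DERIV (\<lambda>s. F (vec1 s)) t :> partial_deriv 0 F (vec1 t)"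
  using smooth_fun_on_DERIV[OF assms(1) _ assms(2), of 0] by simp

lemma open_vec1: "open_eucl (Suc 0) V \<Longrightarrow> vec1 t \<in> V \<Longrightarrow> eventually (\<lambda>s. vec1 s \<in> V) (nhds t)"
  using eventually_upd[of "Suc 0" V "vec1 t" 0] by simp

text \<open>The derivative within [0,1] is one-sided at the end points and equals the derivative of
  any local extension; the velocity is thus independent of the extension.\<close>

lemma velocity_eq:
  assumes X: "diffeology X" and g: "is_plot X (Suc 0) V g" and t: "vec1 t \<in> V" "t \<in> {0..1}"
    and \<gamma>: "\<And>s. s \<in> {0..1} \<Longrightarrow> vec1 s \<in> V \<Longrightarrow> \<gamma> s = g (vec1 s)"
  shows "velocity X \<gamma> t = plot_partial X 0 g (vec1 t)"
    "f \<in> smooth_functions X \<Longrightarrow> ((\<lambda>s. f (\<gamma> s)) has_real_derivative velocity X \<gamma> t f) (at t within {0..1})"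
proof -
  have D: "((\<lambda>s. f (\<gamma> s)) has_real_derivative partial_deriv 0 (\<lambda>x. f (g x)) (vec1 t)) (at t within {0..1})"
    if f: "f \<in> smooth_functions X" for f
  proof -
    have D0: "((\<lambda>s. f (g (vec1 s))) has_real_derivative partial_deriv 0 (\<lambda>x. f (g x)) (vec1 t)) (at t within {0..1})"
      using DERIV_vec1[OF smooth_functions_plot[OF f g] t(1)] has_field_derivative_at_within by blast
    have "eventually (\<lambda>s. vec1 s \<in> V) (nhds t)" by (rule open_vec1[OF is_plot_open[OF X g] t(1)])
    then obtain e where e: "e > 0" "\<And>s. dist s t < e \<Longrightarrow> vec1 s \<in> V" by (auto simp: eventually_nhds_metric)
    show ?thesis
      by (rule has_field_derivative_transform_within[OF D0 e(1) t(2)]) (use \<gamma> e(2) in \<open>simp add: dist_commute\<close>)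
  qed
  have v: "velocity X \<gamma> t f = partial_deriv 0 (\<lambda>x. f (g x)) (vec1 t)" if "f \<in> smooth_functions X" for f
    using vector_derivative_within_cbox[of 0 1 t "\<lambda>s. f (\<gamma> s)"] D[OF that] t(2) that
    by (simp add: velocity_def comp_def has_real_derivative_iff_has_vector_derivative cbox_interval)
  show "velocity X \<gamma> t = plot_partial X 0 g (vec1 t)"
  proof
    fix f show "velocity X \<gamma> t f = plot_partial X 0 g (vec1 t) f"
      using v[of f] by (cases "f \<in> smooth_functions X") (simp add: plot_partial_apply, simp add: velocity_def plot_partial_def)
  qed
  show "f \<in> smooth_functions X \<Longrightarrow> ((\<lambda>s. f (\<gamma> s)) has_real_derivative velocity X \<gamma> t f) (at t within {0..1})"
    using D v by simp
qed

lemma smooth_path_extension: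
  assumes X: "diffeology X" and \<gamma>: "smooth_path X \<gamma>" and t: "t \<in> {0..1}"
  obtains V g where "vec1 t \<in> V" "is_plot X (Suc 0) V g" "\<And>s. s \<in> {0..1} \<Longrightarrow> vec1 s \<in> V \<Longrightarrow> \<gamma> s = g (vec1 s)"
proof -
  have "vec1 t \<in> unit_segment" using t by simp
  then obtain V g where g: "vec1 t \<in> V" "(Suc 0, V, g) \<in> plots X" "\<And>y. y \<in> unit_segment \<Longrightarrow> y \<in> V \<Longrightarrow> \<gamma> (y 0) = g y"
    using smooth_fromE[OF \<gamma>[unfolded smooth_path_iff]] by blast
  show thesis
  proof (rule that[OF g(1) plots_is_plot(1)[OF X g(2)]])
    show "\<gamma> s = g (vec1 s)" if "s \<in> {0..1}" "vec1 s \<in> V" for s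
      using g(3)[of "vec1 s"] that by simp
  qed
qed

lemma velocity_tangent:
  assumes X: "diffeology X" and \<gamma>: "smooth_path X \<gamma>" and t: "t \<in> {0..1}"
  shows "velocity X \<gamma> t \<in> tangent_space X (\<gamma> t)"
proof -
  obtain V g where g: "vec1 t \<in> V" "is_plot X (Suc 0) V g" "\<And>s. s \<in> {0..1} \<Longrightarrow> vec1 s \<in> V \<Longrightarrow> \<gamma> s = g (vec1 s)"
    using smooth_path_extension[OF X \<gamma> t] by blast
  then show ?thesis
    using velocity_eq(1)[OF X g(2,1) t g(3)] plot_partial_tangent[OF X g(2,1)] t by simp
qed

lemma velocity_DERIV:
  assumes X: "diffeology X" and \<gamma>: "smooth_path X \<gamma>" and t: "t \<in> {0..1}" and f: "f \<in> smooth_functions X"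
  shows "((\<lambda>s. f (\<gamma> s)) has_real_derivative velocity X \<gamma> t f) (at t within {0..1})"
proof -
  obtain V g where g: "vec1 t \<in> V" "is_plot X (Suc 0) V g" "\<And>s. s \<in> {0..1} \<Longrightarrow> vec1 s \<in> V \<Longrightarrow> \<gamma> s = g (vec1 s)"
    using smooth_path_extension[OF X \<gamma> t] by blast
  show ?thesis by (rule velocity_eq(2)[OF X g(2,1) t g(3) f])
qed

text \<open>As \<open>h\<close> has all its values in [0,1], the derivative of the path within [0,1]
  suffices for the chain rule, also where \<open>h s\<close> is an end point.\<close>

lemma DERIV_path_reparam:
  assumes X: "diffeology X" and \<gamma>: "smooth_path X \<gamma>" and h: "\<And>s. h s \<in> {0..1}" "DERIV h s :> h'"
    and f: "f \<in> smooth_functions X"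
  shows "DERIV (\<lambda>s. f (\<gamma> (h s))) s :> velocity X \<gamma> (h s) f * h'"
proof -
  have "((\<lambda>s. f (\<gamma> s)) has_real_derivative velocity X \<gamma> (h s) f) (at (h s) within h ` UNIV)"
    by (rule DERIV_subset[OF velocity_DERIV[OF X \<gamma> h(1) f]]) (use h(1) in auto)
  from DERIV_image_chain[OF this, of h' ] h(2) show ?thesis by (simp add: comp_def)
qed

lemma path_reparam_plot:
  assumes X: "diffeology X" and \<gamma>: "smooth_path X \<gamma>" and h: "\<And>s. h s \<in> {0..1}"
    and V: "open_eucl n V" and sm: "smooth_fun_on n V (\<lambda>x. h (x i))"
  shows "is_plot X n V (\<lambda>x. \<gamma> (h (x i)))"
proof -
  have "is_plot X n V (\<lambda>x. \<gamma> (vec1 (h (x i)) 0))"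
  proof (rule smooth_from_comp[OF X \<gamma>[unfolded smooth_path_iff]])
    show "smooth_on n V (Suc 0) (\<lambda>x. vec1 (h (x i)))"
      by (rule smooth_onI[OF V]) (use sm in auto)
  qed (use h in auto)
  then show ?thesis by simp
qed

lemma smooth_step_in: "smooth_step t \<in> {0..1}"
  using smooth_step_range by simp

section \<open>Paths with sitting instances\<close>

definition clamp01 :: "real \<Rightarrow> real" where "clamp01 t = max 0 (min 1 t)"

lemma clamp01 [simp]: "t \<in> {0..1} \<Longrightarrow> clamp01 t = t" "clamp01 t \<in> {0..1}"
  by (auto simp: clamp01_def)

lemma sitting_pathsD:
  assumes "\<gamma> \<in> sitting_paths X"
  shows "smooth_path X \<gamma>" "\<And>t. t \<in> {0..1} \<Longrightarrow> \<gamma> t \<in> carrier X" "\<gamma> \<in> extensional {0..1}"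
  using assms by (auto simp: sitting_paths_def PiE_def)

text \<open>Clamping is not smooth at 0 and 1, but the path is constant near these points, so
  extending it by constants beyond the ends is smooth.\<close>

lemma sitting_clamp_plot:
  assumes X: "diffeology X" and \<gamma>: "\<gamma> \<in> sitting_paths X" and h: "smooth_fun_on n V h"
  shows "is_plot X n V (\<lambda>x. \<gamma> (clamp01 (h x)))"
proof (rule is_plot_local[OF X])
  fix v assume v: "v \<in> V"
  obtain e where e: "e > 0" "\<And>t. t \<in> {0..1} \<Longrightarrow> t < e \<Longrightarrow> \<gamma> t = \<gamma> 0" "\<And>t. t \<in> {0..1} \<Longrightarrow> 1 - e < t \<Longrightarrow> \<gamma> t = \<gamma> 1"
    using \<gamma> unfolding sitting_paths_def by blast
  have VO: "open_eucl n V" by (rule smooth_fun_on_open[OF h])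
  have O: "open_eucl n {x \<in> V. h x \<in> T}" if "open T" for T
    by (rule open_eucl_vimage[OF VO smooth_fun_on_continuous[OF h] that])
  consider "h v < e" | "1 - e < h v" | "0 < h v" "h v < 1" using e(1) by linarith
  then show "\<exists>W. v \<in> W \<and> W \<subseteq> V \<and> is_plot X n W (\<lambda>x. \<gamma> (clamp01 (h x)))"
  proof cases
    case 1
    let ?W = "{x \<in> V. h x \<in> {..<e}}"
    have "is_plot X n ?W (\<lambda>x. \<gamma> 0)" by (rule is_plot_const[OF X sitting_pathsD(2)[OF \<gamma>] O]) auto
    moreover have "\<gamma> (clamp01 (h x)) = \<gamma> 0" if "x \<in> ?W" for x
      using that e(1) by (intro e(2)) (auto simp: clamp01_def)
    ultimately have "is_plot X n ?W (\<lambda>x. \<gamma> (clamp01 (h x)))" using is_plot_cong[of ?W "\<lambda>x. \<gamma> (clamp01 (h x))" "\<lambda>x. \<gamma> 0"] by blast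
    then show ?thesis by (intro exI[of _ ?W] conjI) (use v 1 in auto)
  next
    case 2
    let ?W = "{x \<in> V. h x \<in> {1 - e<..}}"
    have "is_plot X n ?W (\<lambda>x. \<gamma> 1)" by (rule is_plot_const[OF X sitting_pathsD(2)[OF \<gamma>] O]) auto
    moreover have "\<gamma> (clamp01 (h x)) = \<gamma> 1" if "x \<in> ?W" for x
      using that e(1) by (intro e(3)) (auto simp: clamp01_def)
    ultimately have "is_plot X n ?W (\<lambda>x. \<gamma> (clamp01 (h x)))" using is_plot_cong[of ?W "\<lambda>x. \<gamma> (clamp01 (h x))" "\<lambda>x. \<gamma> 1"] by blast
    then show ?thesis by (intro exI[of _ ?W] conjI) (use v 2 in auto)
  next
    case 3
    let ?W = "{x \<in> V. h x \<in> {0<..<1}}"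
    have W: "open_eucl n ?W" by (rule O) simp
    have "is_plot X n ?W (\<lambda>x. \<gamma> (vec1 (h x) 0))"
    proof (rule smooth_from_comp[OF X sitting_pathsD(1)[OF \<gamma>, unfolded smooth_path_iff]])
      show "smooth_on n ?W (Suc 0) (\<lambda>x. vec1 (h x))"
        by (rule smooth_onI[OF W]) (use smooth_fun_on_subset[OF h W] in auto)
    qed auto
    moreover have "\<gamma> (clamp01 (h x)) = \<gamma> (vec1 (h x) 0)" if "x \<in> ?W" for x using that by simp
    ultimately have "is_plot X n ?W (\<lambda>x. \<gamma> (clamp01 (h x)))" using is_plot_cong[of ?W "\<lambda>x. \<gamma> (clamp01 (h x))" "\<lambda>x. \<gamma> (vec1 (h x) 0)"] by blast
    then show ?thesis by (intro exI[of _ ?W] conjI) (use v 3 in auto)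
  qed
qed

text \<open>Both paths are constant near the junction. Hence each of the two formulas, continued by
  clamping, describes the concatenation slightly beyond \<open>1/2\<close>, and the two open ranges
  cover [0,1].\<close>

lemma concat_sitting:
  assumes X: "diffeology X" and \<gamma>: "\<gamma> \<in> sitting_paths X" and \<tau>: "\<tau> \<in> sitting_paths X" and eq: "\<tau> 1 = \<gamma> 0"
  shows "concat_path \<gamma> \<tau> \<in> sitting_paths X"
proof -
  let ?c = "concat_path \<gamma> \<tau>"
  obtain e where e: "e > 0" "\<And>t. t \<in> {0..1} \<Longrightarrow> t < e \<Longrightarrow> \<gamma> t = \<gamma> 0" "\<And>t. t \<in> {0..1} \<Longrightarrow> 1 - e < t \<Longrightarrow> \<gamma> t = \<gamma> 1"
    using \<gamma> unfolding sitting_paths_def by blast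
  obtain d where d: "d > 0" "\<And>t. t \<in> {0..1} \<Longrightarrow> t < d \<Longrightarrow> \<tau> t = \<tau> 0" "\<And>t. t \<in> {0..1} \<Longrightarrow> 1 - d < t \<Longrightarrow> \<tau> t = \<tau> 1"
    using \<tau> unfolding sitting_paths_def by blast
  have c1: "?c t = \<tau> (clamp01 (2 * t))" if "t \<in> {0..1}" "t < 1/2 + e / 2" for t
  proof (cases "t \<le> 1/2")
    case False
    then have "\<gamma> (2 * t - 1) = \<gamma> 0" using that by (intro e(2)) auto
    then show ?thesis using False that eq by (simp add: concat_path_def clamp01_def min_def)
  qed (use that in \<open>auto simp: concat_path_def clamp01_def\<close>)
  have c2: "?c t = \<gamma> (clamp01 (2 * t - 1))" if "t \<in> {0..1}" "1/2 - d / 2 < t" for t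
  proof (cases "t \<le> 1/2")
    case True
    then have "\<tau> (2 * t) = \<tau> 1" using that by (intro d(3)) auto
    then show ?thesis using True that eq
      by (cases "2 * t = 1") (auto simp: concat_path_def clamp01_def min_def max_def)
  qed (use that in \<open>auto simp: concat_path_def clamp01_def\<close>)
  have "smooth_path X ?c"
    unfolding smooth_path_iff
  proof (rule smooth_fromI)
    fix x assume x: "x \<in> unit_segment"
    let ?V1 = "{x \<in> eucl (Suc 0). x 0 \<in> {..<1/2 + e / 2}}" and ?V2 = "{x \<in> eucl (Suc 0). x 0 \<in> {1/2 - d / 2<..}}"
    have V: "open_eucl (Suc 0) ?V1" "open_eucl (Suc 0) ?V2"
      by (rule open_eucl_vimage; simp add: continuous_on_coord)+
    have "is_plot X (Suc 0) ?V1 (\<lambda>x. \<tau> (clamp01 (2 * x 0)))" "is_plot X (Suc 0) ?V2 (\<lambda>x. \<gamma> (clamp01 (2 * x 0 - 1)))"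
      using V by (auto intro!: sitting_clamp_plot[OF X] \<gamma> \<tau> smooth_fun_on_mult smooth_fun_on_diff smooth_fun_on_const smooth_fun_on_coord)
    note p = this
    have "x \<in> ?V1 \<or> x \<in> ?V2" using x e(1) d(1) by auto
    then show "\<exists>V p. x \<in> V \<and> is_plot X (Suc 0) V p \<and> (\<forall>y\<in>unit_segment \<inter> V. ?c (y 0) = p y)"
    proof
      assume "x \<in> ?V1"
      then show ?thesis using c1 p(1) by (intro exI[of _ ?V1] exI[of _ "\<lambda>x. \<tau> (clamp01 (2 * x 0))"]) auto
    next
      assume "x \<in> ?V2"
      then show ?thesis using c2 p(2) by (intro exI[of _ ?V2] exI[of _ "\<lambda>x. \<gamma> (clamp01 (2 * x 0 - 1))"]) auto
    qed
  qed
  moreover have "?c \<in> {0..1} \<rightarrow>\<^sub>E carrier X"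
    using sitting_pathsD(2)[OF \<gamma>] sitting_pathsD(2)[OF \<tau>] by (auto simp: concat_path_def)
  \<comment> \<open>Double speed halves the sitting intervals; the bound \<open>1/2\<close> keeps
    \<open>t\<close> in the half that belongs to the respective path.\<close>
  moreover have "\<exists>\<epsilon>>0. (\<forall>t\<in>{0..1}. t < \<epsilon> \<longrightarrow> ?c t = ?c 0) \<and> (\<forall>t\<in>{0..1}. 1 - \<epsilon> < t \<longrightarrow> ?c t = ?c 1)"
  proof (intro exI[of _ "min (1/2) (min (d / 2) (e / 2))"] conjI ballI impI)
    fix t :: real assume t: "t \<in> {0..1}"
    { assume "t < min (1/2) (min (d / 2) (e / 2))"
      then have "\<tau> (2 * t) = \<tau> 0" "t \<le> 1/2" using t by (auto intro: d(2))
      then show "?c t = ?c 0" using t by (simp add: concat_path_def) }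
    { assume "1 - min (1/2) (min (d / 2) (e / 2)) < t"
      then have "\<gamma> (2 * t - 1) = \<gamma> 1" "\<not> t \<le> 1/2" using t by (auto intro: e(3))
      then show "?c t = ?c 1" using t by (simp add: concat_path_def) }
  qed (use d(1) e(1) in simp)
  ultimately show ?thesis by (simp add: sitting_paths_def)
qed

lemma const_sitting:
  assumes X: "diffeology X" and x: "x \<in> carrier X"
  shows "const_path x \<in> sitting_paths X"
proof -
  have "smooth_path X (const_path x)"
    unfolding smooth_path_iff
  proof (rule smooth_fromI)
    show "\<exists>V p. y \<in> V \<and> is_plot X (Suc 0) V p \<and> (\<forall>y\<in>unit_segment \<inter> V. const_path x (y 0) = p y)" if "y \<in> unit_segment" for y
      using that is_plot_const[OF X x open_eucl_eucl]
      by (intro exI[of _ "eucl (Suc 0)"] exI[of _ "\<lambda>_. x"]) (auto simp: const_path_def)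
  qed
  then show ?thesis using x unfolding sitting_paths_def
    by (auto simp: const_path_def intro!: exI[of _ 1])
qed

context bundle_connection begin

lemma horizontal_liftD:
  assumes "horizontal_lift P \<pi> A \<gamma> \<sigma>"
  shows "smooth_path P \<sigma>" "\<And>t. t \<in> {0..1} \<Longrightarrow> \<sigma> t \<in> carrier P" "\<And>t. t \<in> {0..1} \<Longrightarrow> \<pi> (\<sigma> t) = \<gamma> t"
    "\<And>t. t \<in> {0..1} \<Longrightarrow> A (\<sigma> t) (velocity P \<sigma> t) = (\<lambda>f. 0)"
  using assms by (auto simp: horizontal_lift_def zero_fun_def)

lemma form_scale_zero:
  assumes "p \<in> carrier P" "v \<in> tangent_space P p" "A p v = (\<lambda>f. 0)"
  shows "A p (\<lambda>f. v f * a) = (\<lambda>f. 0)"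
  using form_lincomb[OF form assms(1,2,2), of a 0] assms(3) by (simp add: mult.commute)

text \<open>A change of parameter multiplies the velocity by \<open>h'\<close>, and linearity of
  \<open>A\<close> preserves horizontality for every value of this factor, 0 included. So
  \<open>h\<close> need not be monotone.\<close>

lemma lift_reparam:
  assumes \<sigma>: "horizontal_lift P \<pi> A \<gamma> \<sigma>" and h: "\<And>s. h s \<in> {0..1}" "\<And>s. \<exists>h'. DERIV h s :> h'"
    and sm: "smooth_fun_on (Suc 0) (eucl (Suc 0)) (\<lambda>x. h (x 0))"
  shows "is_plot P (Suc 0) (eucl (Suc 0)) (\<lambda>x. \<sigma> (h (x 0)))" "horizontal 0 (eucl (Suc 0)) (\<lambda>x. \<sigma> (h (x 0)))"
    "\<pi> (\<sigma> (h s)) = \<gamma> (h s)"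
proof -
  note l = horizontal_liftD[OF \<sigma>]
  show "is_plot P (Suc 0) (eucl (Suc 0)) (\<lambda>x. \<sigma> (h (x 0)))"
    by (rule path_reparam_plot[OF DP l(1) h(1) open_eucl_eucl sm])
  show "\<pi> (\<sigma> (h s)) = \<gamma> (h s)" by (rule l(3)[OF h(1)])
  show "horizontal 0 (eucl (Suc 0)) (\<lambda>x. \<sigma> (h (x 0)))"
    unfolding horizontal_def
  proof
    fix u :: "nat \<Rightarrow> real"
    obtain h' where h': "DERIV h (u 0) :> h'" using h(2) by blast
    have "plot_partial P 0 (\<lambda>x. \<sigma> (h (x 0))) u = (\<lambda>f. velocity P \<sigma> (h (u 0)) f * h')"
    proof
      fix f
      show "plot_partial P 0 (\<lambda>x. \<sigma> (h (x 0))) u f = velocity P \<sigma> (h (u 0)) f * h'"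
      proof (cases "f \<in> smooth_functions P")
        case True
        have "DERIV (\<lambda>s. f (\<sigma> (h s))) (u 0) :> velocity P \<sigma> (h (u 0)) f * h'"
          by (rule DERIV_path_reparam[OF DP l(1) h(1) h' True])
        then show ?thesis using True by (simp add: plot_partial_apply partial_deriv_def DERIV_imp_deriv)
      qed (simp add: plot_partial_def velocity_def)
    qed
    then show "A (\<sigma> (h (u 0))) (plot_partial P 0 (\<lambda>x. \<sigma> (h (x 0))) u) = (\<lambda>f. 0)"
      using form_scale_zero[OF l(2)[OF h(1)] velocity_tangent[OF DP l(1) h(1)] l(4)[OF h(1)]] by simp
  qed
qed

lemma smooth_step_coord: "open_eucl n V \<Longrightarrow> smooth_fun_on n V (\<lambda>x. smooth_step (x i))"
  by (intro smooth_fun_on_step smooth_fun_on_coord)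

lemma smooth_step_differentiable: "\<exists>h'. DERIV smooth_step t :> h'"
  by (rule exI) (rule DERIV_smooth_step)

lemmas lift_step = lift_reparam[where h=smooth_step, OF _ smooth_step_in smooth_step_differentiable smooth_step_coord[OF open_eucl_eucl]]

text \<open>The case without parameters, where \<open>eucl 0\<close> is a single point. The path is
  extended by clamping and not reparametrised, so that the lift lies over \<open>\<gamma>\<close>
  itself.\<close>

lemma horizontal_lift_of_path:
  assumes \<gamma>: "\<gamma> \<in> sitting_paths M" and p: "p \<in> carrier P" "\<pi> p = \<gamma> 0"
  obtains \<sigma> where "horizontal_lift P \<pi> A \<gamma> \<sigma>" "\<sigma> 0 = p"
proof -
  define z0 where "z0 = (\<lambda>_::nat. 0::real)"
  have E0: "eucl 0 = {z0}" by (auto simp: eucl_def z0_def)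
  have slab: "slab 0 {z0} T = {x \<in> eucl (Suc 0). x 0 \<in> T}" for T
    by (auto simp: slab_def z0_def in_eucl fun_eq_iff)
  have \<Gamma>: "is_plot M (Suc 0) (slab 0 (eucl 0) UNIV) (\<lambda>x. \<gamma> (clamp01 (x 0)))"
    unfolding E0 slab by (rule sitting_clamp_plot[OF DM \<gamma>]) (auto intro: smooth_fun_on_coord)
  have zp: "is_plot P 0 (eucl 0) (\<lambda>_. p)" by (rule is_plot_const[OF DP p(1) open_eucl_eucl])
  obtain N \<sigma> r where N: "z0 \<in> N" "N \<subseteq> eucl 0" "open_eucl 0 N" "0 < r" and \<sigma>: "is_plot P (Suc 0) (slab 0 N {- r<..<1 + r}) \<sigma>"
    "\<And>v. v \<in> slab 0 N {- r<..<1 + r} \<Longrightarrow> \<pi> (\<sigma> v) = \<gamma> (clamp01 (v 0))" "horizontal 0 (slab 0 N {- r<..<1 + r}) \<sigma>"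
    "\<And>u. u \<in> N \<Longrightarrow> \<sigma> u = p"
  proof (rule horizontal_lift_exists[OF open_eucl_eucl \<Gamma> _ zp, of z0])
    show "\<pi> p = \<gamma> (clamp01 (u 0))" if "u \<in> eucl 0" for u using that p(2) unfolding E0 by (simp add: z0_def clamp01_def)
  qed (use E0 in auto)
  have N0: "N = {z0}" using N E0 by auto
  let ?S = "slab 0 N {- r<..<1 + r}"
  have vS: "vec1 t \<in> ?S" if "t \<in> {0..1}" for t using that N(4) by (auto simp: N0 slab)
  show thesis
  proof (rule that[of "\<lambda>t. \<sigma> (vec1 t)"])
    have "vec1 0 = z0" by (auto simp: vec1_def z0_def)
    then show "\<sigma> (vec1 0) = p" using \<sigma>(4)[OF N(1)] by simp
    show "horizontal_lift P \<pi> A \<gamma> (\<lambda>t. \<sigma> (vec1 t))"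
      unfolding horizontal_lift_def
    proof (intro conjI ballI)
      show "smooth_path P (\<lambda>t. \<sigma> (vec1 t))"
        unfolding smooth_path_iff
      proof (rule smooth_fromI)
        fix x assume "x \<in> unit_segment"
        then show "\<exists>V q. x \<in> V \<and> is_plot P (Suc 0) V q \<and> (\<forall>y\<in>unit_segment \<inter> V. \<sigma> (vec1 (y 0)) = q y)"
          using \<sigma>(1) N(4) by (intro exI[of _ ?S] exI[of _ \<sigma>]) (auto simp: vec1_eta N0 slab)
      qed
      fix t :: real assume t: "t \<in> {0..1}"
      show "\<sigma> (vec1 t) \<in> carrier P" by (rule is_plot_carrier[OF DP \<sigma>(1) vS[OF t]])
      show "\<pi> (\<sigma> (vec1 t)) = \<gamma> t" using \<sigma>(2)[OF vS[OF t]] t by simp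
      have "velocity P (\<lambda>t. \<sigma> (vec1 t)) t = plot_partial P 0 \<sigma> (vec1 t)"
        by (rule velocity_eq(1)[OF DP \<sigma>(1) vS[OF t] t]) simp
      then show "A (\<sigma> (vec1 t)) (velocity P (\<lambda>t. \<sigma> (vec1 t)) t) = 0"
        using \<sigma>(3) vS[OF t] by (simp add: horizontal_def zero_fun_def)
    qed
  qed
qed

text \<open>The step function turns paths on \<open>[0,1]\<close> into plots on a neighbourhood of \<open>[0,1]\<close>, where the
  uniqueness of horizontal lifts is available.\<close>

lemma lift_endpoint_unique:
  assumes \<sigma>: "horizontal_lift P \<pi> A \<gamma> \<sigma>" and V: "open_eucl (Suc 0) V" "\<And>t. t \<in> {0..1} \<Longrightarrow> vec1 t \<in> V"
    and \<tau>: "is_plot P (Suc 0) V \<tau>" "horizontal 0 V \<tau>" "\<And>v. v \<in> V \<Longrightarrow> \<pi> (\<tau> v) = \<gamma> (smooth_step (v 0))"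
    and 0: "\<tau> (vec1 0) = \<sigma> 0"
  shows "\<tau> (vec1 1) = \<sigma> 1"
proof -
  let ?\<sigma> = "\<lambda>x::nat \<Rightarrow> real. \<sigma> (smooth_step (x 0))"
  have VE: "V \<subseteq> eucl (Suc 0)" by (rule open_eucl_subset[OF V(1)])
  have "?\<sigma> ((vec1 0)(0 := 1)) = \<tau> ((vec1 0)(0 := 1))"
  proof (rule horizontal_lift_unique[of "Suc 0" V ?\<sigma> 0 \<tau> 0 1 "vec1 0"])
    show "is_plot P (Suc 0) V ?\<sigma>" by (rule is_plot_subset[OF DP lift_step(1)[OF \<sigma>] V(1) VE])
    show "horizontal 0 V ?\<sigma>" using lift_step(2)[OF \<sigma>] VE by (auto simp: horizontal_def)
    show "\<pi> (\<tau> v) = \<pi> (?\<sigma> v)" if "v \<in> V" for v using lift_step(3)[OF \<sigma>] \<tau>(3)[OF that] by simp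
  qed (use \<tau> 0 V(2) in \<open>auto simp: min_def max_def split: if_splits\<close>)
  then show ?thesis by simp
qed

section \<open>Algebraic properties of parallel transport\<close>

lemma parallel_transport_eq:
  assumes \<sigma>: "horizontal_lift P \<pi> A \<gamma> \<sigma>" and p: "\<sigma> 0 = p"
  shows "parallel_transport P \<pi> A \<gamma> p = \<sigma> 1"
proof -
  have "w = \<sigma> 1" if "horizontal_lift P \<pi> A \<gamma> \<tau>" "\<tau> 0 = p" "\<tau> 1 = w" for \<tau> w
  proof -
    have "(\<lambda>x::nat \<Rightarrow> real. \<tau> (smooth_step (x 0))) (vec1 1) = \<sigma> 1"
      by (rule lift_endpoint_unique[OF \<sigma> open_eucl_eucl _ lift_step(1,2)[OF that(1)]])
         (use lift_step(3)[OF that(1)] that p in auto)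
    then show ?thesis using that by simp
  qed
  then have "(THE w. \<exists>\<sigma>. horizontal_lift P \<pi> A \<gamma> \<sigma> \<and> \<sigma> 0 = p \<and> \<sigma> 1 = w) = \<sigma> 1"
    using \<sigma> p by (intro the_equality) blast+
  moreover have "p \<in> carrier (fibre P \<pi> (\<gamma> 0))"
    using horizontal_liftD(2,3)[OF \<sigma>, of 0] p by (simp add: fibre_def Let_def)
  ultimately show ?thesis by (simp add: parallel_transport_def)
qed

text \<open>A horizontal plot over the path reparametrised by the step function computes the
  transport along \<open>\<gamma>\<close>: the reparametrised lift of \<open>\<gamma>\<close> is
  such a plot too and has the same end points.\<close>

lemma parallel_transport_plot:
  assumes \<gamma>: "\<gamma> \<in> sitting_paths M" and V: "open_eucl (Suc 0) V" "\<And>t. t \<in> {0..1} \<Longrightarrow> vec1 t \<in> V"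
    and \<tau>: "is_plot P (Suc 0) V \<tau>" "horizontal 0 V \<tau>" "\<And>v. v \<in> V \<Longrightarrow> \<pi> (\<tau> v) = \<gamma> (smooth_step (v 0))"
    and p: "\<tau> (vec1 0) = p"
  shows "parallel_transport P \<pi> A \<gamma> p = \<tau> (vec1 1)"
proof -
  have "p \<in> carrier P" "\<pi> p = \<gamma> 0" using is_plot_carrier[OF DP \<tau>(1) V(2)[of 0]] \<tau>(3)[OF V(2)[of 0]] p by auto
  then obtain \<sigma> where \<sigma>: "horizontal_lift P \<pi> A \<gamma> \<sigma>" "\<sigma> 0 = p" by (rule horizontal_lift_of_path[OF \<gamma>])
  then show ?thesis using parallel_transport_eq[OF \<sigma>] lift_endpoint_unique[OF \<sigma>(1) V \<tau>] p by simp
qed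

lemma parallel_transport_step:
  assumes "\<gamma> \<in> sitting_paths M" and "is_plot P (Suc 0) (eucl (Suc 0)) \<tau>" "horizontal 0 (eucl (Suc 0)) \<tau>"
    "\<And>v. \<pi> (\<tau> v) = \<gamma> (smooth_step (v 0))"
  shows "parallel_transport P \<pi> A \<gamma> (\<tau> (vec1 0)) = \<tau> (vec1 1)"
  by (rule parallel_transport_plot[OF assms(1) open_eucl_eucl _ assms(2,3,4) refl]) simp

lemma parallel_transport_fibre:
  assumes \<gamma>: "\<gamma> \<in> sitting_paths M" and p: "p \<in> carrier P" "\<pi> p = \<gamma> 0"
  shows "parallel_transport P \<pi> A \<gamma> p \<in> carrier P" "\<pi> (parallel_transport P \<pi> A \<gamma> p) = \<gamma> 1"
proof -
  obtain \<sigma> where \<sigma>: "horizontal_lift P \<pi> A \<gamma> \<sigma>" "\<sigma> 0 = p" by (rule horizontal_lift_of_path[OF \<gamma> p])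
  show "parallel_transport P \<pi> A \<gamma> p \<in> carrier P" "\<pi> (parallel_transport P \<pi> A \<gamma> p) = \<gamma> 1"
    using horizontal_liftD(2,3)[OF \<sigma>(1), of 1] by (simp_all add: parallel_transport_eq[OF \<sigma>])
qed

lemma parallel_transport_equivariant:
  assumes \<gamma>: "\<gamma> \<in> sitting_paths M" and p: "p \<in> carrier P" "\<pi> p = \<gamma> 0" and g: "g \<in> carrier G"
  shows "parallel_transport P \<pi> A \<gamma> (act P p g) = act P (parallel_transport P \<pi> A \<gamma> p) g"
proof -
  obtain \<sigma> where \<sigma>: "horizontal_lift P \<pi> A \<gamma> \<sigma>" "\<sigma> 0 = p" by (rule horizontal_lift_of_path[OF \<gamma> p])
  let ?\<tau> = "\<lambda>x::nat \<Rightarrow> real. act P (\<sigma> (smooth_step (x 0))) g"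
  have k: "is_plot L (Suc 0) (eucl (Suc 0)) (\<lambda>_. g)" by (rule is_plot_const[OF DL _ open_eucl_eucl]) (use g in simp)
  have "MC G 0 (\<lambda>_. g) u = (\<lambda>f. 0)" for u
    by (auto simp: MC_def plot_partial_def comp_def)
  then have h: "horizontal 0 (eucl (Suc 0)) ?\<tau>"
    using horizontal_act[OF lift_step(1,2)[OF \<sigma>(1)] k] by simp
  have "parallel_transport P \<pi> A \<gamma> (?\<tau> (vec1 0)) = ?\<tau> (vec1 1)"
    by (rule parallel_transport_step[OF \<gamma> plot_act[OF lift_step(1)[OF \<sigma>(1)] k] h])
       (use lift_step(3)[OF \<sigma>(1)] horizontal_liftD(2)[OF \<sigma>(1) smooth_step_in] g in simp)
  then show ?thesis by (simp add: \<sigma>(2) parallel_transport_eq[OF \<sigma>])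
qed

lemma parallel_transport_concat:
  assumes \<gamma>: "\<gamma> \<in> sitting_paths M" and \<tau>: "\<tau> \<in> sitting_paths M" and eq: "\<tau> 1 = \<gamma> 0"
    and p: "p \<in> carrier P" "\<pi> p = \<tau> 0"
  shows "parallel_transport P \<pi> A (concat_path \<gamma> \<tau>) p = parallel_transport P \<pi> A \<gamma> (parallel_transport P \<pi> A \<tau> p)"
proof -
  let ?c = "concat_path \<gamma> \<tau>"
  have c: "?c \<in> sitting_paths M" by (rule concat_sitting[OF DM \<gamma> \<tau> eq])
  have "?c 0 = \<tau> 0" by (simp add: concat_path_def)
  then obtain \<sigma> where \<sigma>: "horizontal_lift P \<pi> A ?c \<sigma>" "\<sigma> 0 = p" using horizontal_lift_of_path[OF c] p by metis
  \<comment> \<open>The lift of the concatenation is restricted to its two halves, each of them run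
    through with the step function.\<close>
  define h1 where "h1 t = smooth_step t / 2" for t
  define h2 where "h2 t = 1/2 + smooth_step t / 2" for t
  have r: "h1 t \<in> {0..1}" "h2 t \<in> {0..1}" for t
    using smooth_step_range[of t] by (auto simp: h1_def h2_def)
  have d: "\<exists>h'. DERIV h1 t :> h'" "\<exists>h'. DERIV h2 t :> h'" for t
  proof -
    show "\<exists>h'. DERIV h1 t :> h'" unfolding h1_def[abs_def]
      by (rule exI, rule DERIV_cdivide[OF DERIV_smooth_step])
    show "\<exists>h'. DERIV h2 t :> h'" unfolding h2_def[abs_def]
      by (rule exI, rule DERIV_add[OF DERIV_const DERIV_cdivide[OF DERIV_smooth_step]])
  qed
  have s: "smooth_fun_on (Suc 0) (eucl (Suc 0)) (\<lambda>x. h1 (x 0))" "smooth_fun_on (Suc 0) (eucl (Suc 0)) (\<lambda>x. h2 (x 0))"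
    unfolding h1_def h2_def divide_inverse
    by (intro smooth_fun_on_add smooth_fun_on_mult smooth_fun_on_const smooth_step_coord open_eucl_eucl)+
  note l1 = lift_reparam[OF \<sigma>(1) r(1) d(1) s(1)] and l2 = lift_reparam[OF \<sigma>(1) r(2) d(2) s(2)]
  have "parallel_transport P \<pi> A \<tau> (\<sigma> (h1 (vec1 0 0))) = \<sigma> (h1 (vec1 1 0))"
  proof (rule parallel_transport_step[OF \<tau> l1(1,2)])
    show "\<pi> (\<sigma> (h1 (v 0))) = \<tau> (smooth_step (v 0))" for v :: "nat \<Rightarrow> real"
      unfolding l1(3) using smooth_step_range[of "v 0"] by (simp add: concat_path_def h1_def)
  qed
  then have 1: "parallel_transport P \<pi> A \<tau> p = \<sigma> (1/2)" by (simp add: h1_def \<sigma>(2))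
  have "parallel_transport P \<pi> A \<gamma> (\<sigma> (h2 (vec1 0 0))) = \<sigma> (h2 (vec1 1 0))"
  proof (rule parallel_transport_step[OF \<gamma> l2(1,2)])
    \<comment> \<open>At time \<open>1/2\<close> exactly the concatenation has its value from
      \<open>\<tau>\<close>; at this point \<open>eq\<close> supplies the value of
      \<open>\<gamma>\<close>.\<close>
    show "\<pi> (\<sigma> (h2 (v 0))) = \<gamma> (smooth_step (v 0))" for v :: "nat \<Rightarrow> real"
      unfolding l2(3) using smooth_step_range[of "v 0"] eq
      by (cases "smooth_step (v 0) = 0") (auto simp: concat_path_def h2_def)
  qed
  then have 2: "parallel_transport P \<pi> A \<gamma> (\<sigma> (1/2)) = \<sigma> 1" by (simp add: h2_def)
  show ?thesis using 1 2 parallel_transport_eq[OF \<sigma>] by simp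
qed

lemma horizontal_const: "p \<in> carrier P \<Longrightarrow> horizontal i U (\<lambda>_. p)"
proof -
  assume p: "p \<in> carrier P"
  have "plot_partial P i (\<lambda>_. p) u = (\<lambda>f. 0)" for u by (auto simp: plot_partial_def comp_def)
  then show ?thesis using form_zero[OF form p] by (simp add: horizontal_def)
qed

lemma parallel_transport_const:
  assumes p: "p \<in> carrier P"
  shows "parallel_transport P \<pi> A (const_path (\<pi> p)) p = p"
  by (rule parallel_transport_step[OF const_sitting[OF DM \<pi>_carrier[OF p]] is_plot_const[OF DP p open_eucl_eucl] horizontal_const[OF p]])
     (simp add: const_path_def smooth_step_range)

end

section \<open>Thin homotopies\<close>

text \<open>The second difference over a small rectangle, evaluated by two applications of the mean
  value theorem, first in direction \<open>i\<close> and then in direction \<open>j\<close>. Its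
  left side is symmetric in the two directions.\<close>

lemma second_difference:
  assumes f: "smooth_fun_on n U f" and d: "d > 0" "cube n x d \<subseteq> U" and x: "x \<in> eucl n" and ij: "i < n" "j < n" "i \<noteq> j"
  defines "h \<equiv> d / 2"
  shows "\<exists>\<xi>\<in>cube n x d. f (x(i := x i + h, j := x j + h)) - f (x(i := x i + h)) - f (x(j := x j + h)) + f x
     = h * h * partial_deriv j (partial_deriv i f) \<xi>"
proof -
  have h: "h > 0" "h < d" using d(1) by (auto simp: h_def)
  have in_c: "x(i := s, j := t) \<in> cube n x d" if "x i \<le> s" "s \<le> x i + h" "x j \<le> t" "t \<le> x j + h" for s t
    using x ij that h by (auto simp: cube_def in_eucl)
  have xj: "x(i := s, j := x j) = x(i := s)" for s using ij by (auto simp: fun_eq_iff)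
  let ?G = "\<lambda>s. f (x(i := s, j := x j + h)) - f (x(i := s, j := x j))"
  have Di: "DERIV (\<lambda>s. f (x(i := s, j := t))) s :> partial_deriv i f (x(i := s, j := t))"
    if "x i \<le> s" "s \<le> x i + h" "x j \<le> t" "t \<le> x j + h" for s t
  proof -
    have eq: "x(i := s, j := t) = (x(j := t))(i := s)" for s using ij by (auto simp: fun_eq_iff)
    have "(x(j := t))(i := s) \<in> U" using in_c[OF that] d(2) unfolding eq by blast
    from smooth_fun_on_DERIV_upd[OF f ij(1) this] show ?thesis unfolding eq .
  qed
  have "\<exists>s. x i < s \<and> s < x i + h \<and> ?G (x i + h) - ?G (x i) = (x i + h - x i) *
      (partial_deriv i f (x(i := s, j := x j + h)) - partial_deriv i f (x(i := s, j := x j)))"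
  proof (rule MVT2)
    show "DERIV ?G s :> partial_deriv i f (x(i := s, j := x j + h)) - partial_deriv i f (x(i := s, j := x j))"
      if "x i \<le> s" "s \<le> x i + h" for s
      by (rule DERIV_diff[OF Di[OF that] Di[OF that]]) (use h in auto)
  qed (use h in simp)
  then obtain s where s: "x i < s" "s < x i + h" "?G (x i + h) - ?G (x i) = (x i + h - x i) *
      (partial_deriv i f (x(i := s, j := x j + h)) - partial_deriv i f (x(i := s, j := x j)))" by blast
  have "\<exists>t. x j < t \<and> t < x j + h \<and> partial_deriv i f (x(i := s, j := x j + h)) - partial_deriv i f (x(i := s, j := x j))
     = (x j + h - x j) * partial_deriv j (partial_deriv i f) (x(i := s, j := t))"
  proof (rule MVT2)
    fix t assume "x j \<le> t" "t \<le> x j + h"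
    then have "x(i := s, j := t) \<in> U" using in_c[of s t] s d(2) by auto
    then show "DERIV (\<lambda>t. partial_deriv i f (x(i := s, j := t))) t :> partial_deriv j (partial_deriv i f) (x(i := s, j := t))"
      by (rule smooth_fun_on_DERIV_upd[OF smooth_fun_on_partial[OF f ij(1)] ij(2)])
  qed (use h in simp)
  then obtain t where t: "x j < t" "t < x j + h" "partial_deriv i f (x(i := s, j := x j + h)) - partial_deriv i f (x(i := s, j := x j))
     = (x j + h - x j) * partial_deriv j (partial_deriv i f) (x(i := s, j := t))" by blast
  have "x(i := x i, j := x j + h) = x(j := x j + h)" "x(i := x i, j := x j) = x" using ij by (auto simp: fun_eq_iff)
  then have "f (x(i := x i + h, j := x j + h)) - f (x(i := x i + h)) - f (x(j := x j + h)) + f x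
     = h * h * partial_deriv j (partial_deriv i f) (x(i := s, j := t))"
    using s(3) t(3) xj[of "x i + h"] by (simp add: algebra_simps)
  then show ?thesis using in_c[of s t] s t by (intro bexI[of _ "x(i := s, j := t)"]) auto
qed

text \<open>The same second difference is a multiple of either mixed derivative, each taken at some
  point of an arbitrarily small cube; continuity of both then excludes a gap between their values at
  \<open>x\<close>.\<close>

lemma partial_deriv_commute:
  assumes f: "smooth_fun_on n U f" and x: "x \<in> U" and ij: "i < n" "j < n"
  shows "partial_deriv i (partial_deriv j f) x = partial_deriv j (partial_deriv i f) x"
proof (rule ccontr)
  assume ne: "partial_deriv i (partial_deriv j f) x \<noteq> partial_deriv j (partial_deriv i f) x" (is "?a \<noteq> ?b")
  then have "i \<noteq> j" by auto
  have U: "open_eucl n U" by (rule smooth_fun_on_open[OF f])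
  have xE: "x \<in> eucl n" using x open_eucl_subset[OF U] by blast
  define e where "e = \<bar>?a - ?b\<bar> / 2"
  have e: "e > 0" using ne by (simp add: e_def)
  have c: "continuous_on U (partial_deriv i (partial_deriv j f))" "continuous_on U (partial_deriv j (partial_deriv i f))"
    using f ij by (auto intro!: smooth_fun_on_continuous smooth_fun_on_partial)
  obtain d1 where d1: "d1 > 0" "cube n x d1 \<subseteq> U" "\<And>y. y \<in> cube n x d1 \<Longrightarrow> \<bar>partial_deriv i (partial_deriv j f) y - ?a\<bar> < e"
    using continuous_on_cubeD[OF U c(1) x e] by blast
  obtain d2 where d2: "d2 > 0" "cube n x d2 \<subseteq> U" "\<And>y. y \<in> cube n x d2 \<Longrightarrow> \<bar>partial_deriv j (partial_deriv i f) y - ?b\<bar> < e"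
    using continuous_on_cubeD[OF U c(2) x e] by blast
  define d where "d = min d1 d2"
  have d: "d > 0" "cube n x d \<subseteq> U" using d1 d2 cube_mono[of d d1 n x] by (auto simp: d_def)
  obtain \<xi> where \<xi>: "\<xi> \<in> cube n x d" "f (x(i := x i + d / 2, j := x j + d / 2)) - f (x(i := x i + d / 2)) - f (x(j := x j + d / 2)) + f x
     = d / 2 * (d / 2) * partial_deriv j (partial_deriv i f) \<xi>"
    using second_difference[OF f d xE ij \<open>i \<noteq> j\<close>] by blast
  obtain \<zeta> where \<zeta>: "\<zeta> \<in> cube n x d" "f (x(j := x j + d / 2, i := x i + d / 2)) - f (x(j := x j + d / 2)) - f (x(i := x i + d / 2)) + f x
     = d / 2 * (d / 2) * partial_deriv i (partial_deriv j f) \<zeta>"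
    using second_difference[OF f d xE ij(2,1)] \<open>i \<noteq> j\<close> by blast
  have eq: "x(j := x j + d / 2, i := x i + d / 2) = x(i := x i + d / 2, j := x j + d / 2)"
    using \<open>i \<noteq> j\<close> by (auto simp: fun_eq_iff)
  have "d / 2 * (d / 2) * partial_deriv j (partial_deriv i f) \<xi> = d / 2 * (d / 2) * partial_deriv i (partial_deriv j f) \<zeta>"
    using \<xi>(2) \<zeta>(2)[unfolded eq] by linarith
  then have "partial_deriv j (partial_deriv i f) \<xi> = partial_deriv i (partial_deriv j f) \<zeta>" using d(1) by simp
  moreover have "\<xi> \<in> cube n x d2" "\<zeta> \<in> cube n x d1" using \<xi>(1) \<zeta>(1) cube_mono[of d d2 n x] cube_mono[of d d1 n x] by (auto simp: d_def)
  ultimately show False using d1(3)[of \<zeta>] d2(3)[of \<xi>] e_def by (auto simp: abs_if split: if_splits)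
qed

lemma partial_deriv_sum:
  assumes "open_eucl n U" "\<And>k. k \<in> J \<Longrightarrow> smooth_fun_on n U (f k)" "finite J" "i < n" "x \<in> U"
  shows "partial_deriv i (\<lambda>x. \<Sum>k\<in>J. f k x) x = (\<Sum>k\<in>J. partial_deriv i (f k) x)"
  by (rule partial_derivI) (intro DERIV_sum smooth_fun_on_DERIV[OF assms(2)] assms)

section \<open>Exterior derivatives in coordinates\<close>

lemma sum_combination:
  "\<alpha> * (\<Sum>k\<in>J. a k * b k) + \<beta> * (\<Sum>k\<in>J. a' k * b k) = (\<Sum>k\<in>J. (\<alpha> * a k + \<beta> * a' k) * b k)" for \<alpha> :: real
  by (simp add: sum_distrib_left sum.distrib distrib_right mult.assoc)

text \<open>The exterior derivative at \<open>z\<close> of the 1-form with the coefficients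
  \<open>a k\<close>, evaluated on the pair of vectors \<open>Y\<close>, \<open>X\<close> in this
  order.\<close>

definition dform :: "nat \<Rightarrow> (nat \<Rightarrow> (nat \<Rightarrow> real) \<Rightarrow> real) \<Rightarrow> (nat \<Rightarrow> real) \<Rightarrow> (nat \<Rightarrow> real) \<Rightarrow> (nat \<Rightarrow> real) \<Rightarrow> real" where
  "dform m a z X Y = (\<Sum>k<m. \<Sum>l<m. partial_deriv l (a k) z * (X k * Y l - Y k * X l))"

text \<open>The second derivatives of the plot cancel by symmetry.\<close>

lemma dform_pullback:
  assumes a: "\<And>k. k < m \<Longrightarrow> smooth_fun_on m Z (a k)" and C: "smooth_on n V m C" "C ` V \<subseteq> Z" and v: "v \<in> V" and ij: "i < n" "j < n"
  shows "partial_deriv j (\<lambda>v. \<Sum>k<m. partial_deriv i (\<lambda>v. C v k) v * a k (C v)) v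
      - partial_deriv i (\<lambda>v. \<Sum>k<m. partial_deriv j (\<lambda>v. C v k) v * a k (C v)) v
    = dform m a (C v) (\<lambda>k. partial_deriv i (\<lambda>v. C v k) v) (\<lambda>k. partial_deriv j (\<lambda>v. C v k) v)"
proof -
  have V: "open_eucl n V" by (rule smooth_on_open[OF C(1)])
  have aC: "smooth_fun_on n V (\<lambda>v. a k (C v))" if "k < m" for k by (rule smooth_fun_on_compose[OF a[OF that] C])
  have Ck: "smooth_fun_on n V (\<lambda>v. C v k)" if "k < m" for k by (rule smooth_on_coord[OF C(1) that])
  have D: "partial_deriv j (\<lambda>v. \<Sum>k<m. partial_deriv i (\<lambda>v. C v k) v * a k (C v)) v
    = (\<Sum>k<m. partial_deriv j (partial_deriv i (\<lambda>v. C v k)) v * a k (C v)) +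
      (\<Sum>k<m. \<Sum>l<m. partial_deriv l (a k) (C v) * (partial_deriv i (\<lambda>v. C v k) v * partial_deriv j (\<lambda>v. C v l) v))"
    if ij: "i < n" "j < n" for i j
  proof -
    have "partial_deriv j (\<lambda>v. \<Sum>k<m. partial_deriv i (\<lambda>v. C v k) v * a k (C v)) v
      = (\<Sum>k<m. partial_deriv j (\<lambda>v. partial_deriv i (\<lambda>v. C v k) v * a k (C v)) v)"
      using v ij by (intro partial_deriv_sum[OF V] smooth_fun_on_mult smooth_fun_on_partial Ck aC) auto
    also have "\<dots> = (\<Sum>k<m. partial_deriv j (partial_deriv i (\<lambda>v. C v k)) v * a k (C v) +
        (\<Sum>l<m. partial_deriv l (a k) (C v) * (partial_deriv i (\<lambda>v. C v k) v * partial_deriv j (\<lambda>v. C v l) v)))"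
    proof (rule sum.cong[OF refl])
      fix k assume "k \<in> {..<m}"
      then have k: "k < m" by simp
      have "partial_deriv j (\<lambda>v. partial_deriv i (\<lambda>v. C v k) v * a k (C v)) v =
        partial_deriv j (partial_deriv i (\<lambda>v. C v k)) v * a k (C v) + partial_deriv i (\<lambda>v. C v k) v * partial_deriv j (\<lambda>v. a k (C v)) v"
        by (rule partial_deriv_mult[OF smooth_fun_on_partial[OF Ck[OF k] ij(1)] aC[OF k] ij(2) v])
      also have "partial_deriv j (\<lambda>v. a k (C v)) v = (\<Sum>l<m. partial_deriv j (\<lambda>v. C v l) v * partial_deriv l (a k) (C v))"
        by (rule partial_deriv_comp[OF a[OF k] C v ij(2)])
      finally show "partial_deriv j (\<lambda>v. partial_deriv i (\<lambda>v. C v k) v * a k (C v)) v =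
        partial_deriv j (partial_deriv i (\<lambda>v. C v k)) v * a k (C v) +
        (\<Sum>l<m. partial_deriv l (a k) (C v) * (partial_deriv i (\<lambda>v. C v k) v * partial_deriv j (\<lambda>v. C v l) v))"
        by (simp add: sum_distrib_left mult_ac)
    qed
    finally show ?thesis by (simp add: sum.distrib)
  qed
  have "(\<Sum>k<m. partial_deriv j (partial_deriv i (\<lambda>v. C v k)) v * a k (C v)) =
    (\<Sum>k<m. partial_deriv i (partial_deriv j (\<lambda>v. C v k)) v * a k (C v))"
    using partial_deriv_commute[OF Ck v ij] by (intro sum.cong) auto
  then show ?thesis
    unfolding D[OF ij] D[OF ij(2,1)] dform_def
    by (simp add: sum_subtractf[symmetric] right_diff_distrib)
qed

lemma dform_combination: "dform m a z (\<lambda>k. \<alpha> * X k + \<beta> * Y k) Y = \<alpha> * dform m a z X Y"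
  unfolding dform_def sum_distrib_left by (intro sum.cong refl) (simp add: algebra_simps)

lemma dform_zero: "(\<And>k. k < m \<Longrightarrow> Y k = 0) \<Longrightarrow> dform m a z X Y = 0"
  by (simp add: dform_def)

lemma deriv_shift: "deriv (\<lambda>t. \<phi> (a + t)) 0 = deriv \<phi> (a::real)"
  using DERIV_shift[of \<phi> _ 0 a] by (simp add: deriv_def add.commute)

lemma plot_partial_line_cong:
  "(\<And>t. p (u(i := t)) = q (u(i := t))) \<Longrightarrow> plot_partial X i p u = plot_partial X i q u"
  by (auto simp: plot_partial_def partial_deriv_def)

lemma partial_deriv_line_zero:
  assumes T: "open_eucl n T" and o: "x \<in> T" "i < n" and c: "\<And>t. x(i := t) \<in> T \<Longrightarrow> \<psi> (x(i := t)) = k"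
  shows "partial_deriv i \<psi> x = 0"
proof (rule partial_derivI)
  have "eventually (\<lambda>t. k = \<psi> (x(i := t))) (nhds (x i))"
    using eventually_upd[OF T o] by eventually_elim (simp add: c)
  then show "DERIV (\<lambda>t. \<psi> (x(i := t))) (x i) :> 0"
    using DERIV_const[of k "at (x i)"] by (subst DERIV_cong_ev[OF refl _ refl, symmetric])
qed

context bundle_connection begin

lemma form_in_chart:
  assumes ch: "chart P m W c" and \<tau>: "is_plot P n T \<tau>" and v: "v \<in> T" "\<tau> v \<in> W" and j: "j < n"
  shows "A (\<tau> v) (plot_partial P j \<tau> v) f =
    (\<Sum>k<m. partial_deriv j (\<lambda>v. c (\<tau> v) k) v * A (inv_into W c (c (\<tau> v))) (plot_partial P k (inv_into W c) (c (\<tau> v))) f)"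
proof -
  let ?T = "{v \<in> T. \<tau> v \<in> W}"
  have sm: "smooth_on n ?T m (\<lambda>v. c (\<tau> v))" by (rule chartD(5)[OF ch \<tau>])
  have inv: "inv_into W c (c (\<tau> v)) = \<tau> v" if "v \<in> ?T" for v using that chartD(2)[OF ch] by simp
  have vT: "v \<in> ?T" using v by simp
  have "A (\<tau> v) (plot_partial P j \<tau> v) = A (inv_into W c (c (\<tau> v))) (plot_partial P j (\<lambda>v. inv_into W c (c (\<tau> v))) v)"
    by (rule A_plot_cong[OF smooth_on_open[OF sm] vT j]) (use inv in simp)
  also have "\<dots> = (\<lambda>f. \<Sum>k<m. partial_deriv j (\<lambda>v. c (\<tau> v) k) v * A (inv_into W c (c (\<tau> v))) (plot_partial P k (inv_into W c) (c (\<tau> v))) f)"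
    by (rule form_plot_comp[OF DP form chartD(4)[OF ch] sm _ vT j]) auto
  finally show ?thesis by simp
qed

text \<open>The right side depends on \<open>\<tau>\<close> only through its value and its first
  partial derivatives at \<open>v\<close>. This allows one surface to be exchanged for another that
  is tangent to it at the point.\<close>

lemma form_exterior_derivative:
  assumes ch: "chart P m W c" and \<tau>: "is_plot P n T \<tau>" and v: "v \<in> T" "\<tau> v \<in> W" and ij: "i < n" "j < n" and f: "f \<in> smooth_functions L"
  shows "partial_deriv j (\<lambda>v. A (\<tau> v) (plot_partial P i \<tau> v) f) v - partial_deriv i (\<lambda>v. A (\<tau> v) (plot_partial P j \<tau> v) f) v =
    dform m (\<lambda>k z. A (inv_into W c z) (plot_partial P k (inv_into W c) z) f) (c (\<tau> v))
      (\<lambda>k. partial_deriv i (\<lambda>v. c (\<tau> v) k) v) (\<lambda>k. partial_deriv j (\<lambda>v. c (\<tau> v) k) v)"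
proof -
  let ?T = "{v \<in> T. \<tau> v \<in> W}"
  have sm: "smooth_on n ?T m (\<lambda>v. c (\<tau> v))" by (rule chartD(5)[OF ch \<tau>])
  have vT: "v \<in> ?T" using v by simp
  let ?a = "\<lambda>k z. A (inv_into W c z) (plot_partial P k (inv_into W c) z) f"
  have "partial_deriv j (\<lambda>v. A (\<tau> v) (plot_partial P i \<tau> v) f) v = partial_deriv j (\<lambda>v. \<Sum>k<m. partial_deriv i (\<lambda>v. c (\<tau> v) k) v * ?a k (c (\<tau> v))) v"
    if "i < n" "j < n" for i j
    by (rule partial_deriv_cong[OF smooth_on_open[OF sm] vT that(2)]) (use form_in_chart[OF ch \<tau> _ _ that(1)] in auto)
  note this[OF ij] this[OF ij(2,1)]
  moreover have "smooth_fun_on m (c ` W) (?a k)" if "k < m" for k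
    by (rule A_coeff_smooth[OF chartD(4)[OF ch] that f])
  ultimately show ?thesis using dform_pullback[of m "c ` W" ?a n ?T "\<lambda>v. c (\<tau> v)" v i j, OF _ sm _ vT ij] by auto
qed

text \<open>If a combination of the two partial derivatives of \<open>\<sigma>\<close> is vertical, it agrees with that of
  \<open>s(v\<^sub>0) \<cdot> g\<close>, where \<open>\<sigma> = s \<cdot> g\<close> for a lift \<open>s\<close> of the projection of \<open>\<sigma>\<close>.\<close>

lemma vertical_combination:
  assumes \<sigma>: "is_plot P n V \<sigma>" and v0: "v0 \<in> V" and ij: "i < n" "j < n"
    and dep: "\<And>f. f \<in> smooth_functions M \<Longrightarrow>
      \<alpha> * partial_deriv i (\<lambda>v. f (\<pi> (\<sigma> v))) v0 + \<beta> * partial_deriv j (\<lambda>v. f (\<pi> (\<sigma> v))) v0 = 0"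
  obtains V' s g where "v0 \<in> V'" "V' \<subseteq> V" "is_plot P n V' s" "is_plot L n V' g" "\<And>v. v \<in> V' \<Longrightarrow> \<sigma> v = act P (s v) (g v)"
    "\<And>F. \<alpha> * plot_partial P i \<sigma> v0 F + \<beta> * plot_partial P j \<sigma> v0 F =
       \<alpha> * plot_partial P i (\<lambda>v. act P (s v0) (g v)) v0 F + \<beta> * plot_partial P j (\<lambda>v. act P (s v0) (g v)) v0 F"
proof -
  let ?x = "\<pi> (\<sigma> v0)"
  note \<pi>\<sigma> = plot_\<pi>[OF \<sigma>]
  have x: "?x \<in> carrier M" by (rule is_plot_carrier[OF DM \<pi>\<sigma> v0])
  show thesis
  proof (rule local_section[OF x])
    fix U S assume U: "?x \<in> U" "D_open M U" and S: "\<And>y. y \<in> U \<Longrightarrow> \<pi> (S y) = y"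
      "\<And>n V \<Gamma>. is_plot M n V \<Gamma> \<Longrightarrow> (\<And>v. v \<in> V \<Longrightarrow> \<Gamma> v \<in> U) \<Longrightarrow> is_plot P n V (\<lambda>v. S (\<Gamma> v))"
    let ?V = "{v \<in> V. \<pi> (\<sigma> v) \<in> U}"
    have V: "open_eucl n ?V" by (rule D_open_plot[OF U(2) \<pi>\<sigma>])
    have v0V: "v0 \<in> ?V" using v0 U(1) by simp
    define s where "s v = S (\<pi> (\<sigma> v))" for v
    define g where "g v = \<delta> (s v) (\<sigma> v)" for v
    have s: "is_plot P n ?V s" unfolding s_def by (rule S(2)[OF is_plot_subset[OF DM \<pi>\<sigma> V]]) auto
    have \<sigma>V: "is_plot P n ?V \<sigma>" by (rule is_plot_subset[OF DP \<sigma> V]) auto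
    have \<pi>s: "\<pi> (\<sigma> v) = \<pi> (s v)" if "v \<in> ?V" for v using S(1) that by (simp add: s_def)
    have g: "is_plot L n ?V g" unfolding g_def by (rule plot_diff[OF s \<sigma>V \<pi>s])
    have sg: "\<sigma> v = act P (s v) (g v)" if "v \<in> ?V" for v
      unfolding g_def by (rule act_diff[OF is_plot_carrier[OF DP s that] is_plot_carrier[OF DP \<sigma>V that] \<pi>s[OF that], symmetric])
    have g0: "g v0 \<in> carrier G" by (rule plot_G[OF g v0V])
    obtain m W c where ch: "chart M m W c" and xW: "?x \<in> W" using manifold_chart[OF M x] by blast
    \<comment> \<open>The hypothesis speaks of smooth functions on \<open>M\<close>; global
      functions that are coordinates to first order transfer it to the coordinates of the
      chart.\<close>
    have coord: "\<alpha> * partial_deriv i (\<lambda>v. c (\<pi> (\<sigma> v)) k) v0 + \<beta> * partial_deriv j (\<lambda>v. c (\<pi> (\<sigma> v)) k) v0 = 0" if k: "k < m" for k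
    proof (rule partial_coordinate[OF DM ch xW k])
      fix e assume e: "e \<in> smooth_functions M" "\<And>n U p u i. is_plot M n U p \<Longrightarrow> u \<in> U \<Longrightarrow> p u = ?x \<Longrightarrow> i < n \<Longrightarrow>
         plot_partial M i p u e = partial_deriv i (\<lambda>u. c (p u) k) u"
      show ?thesis using dep[OF e(1)] e(2)[OF \<pi>\<sigma> v0 refl ij(1)] e(2)[OF \<pi>\<sigma> v0 refl ij(2)] e(1) by (simp add: plot_partial_apply)
    qed
    let ?Z = "{z \<in> c ` W. inv_into W c z \<in> U}"
    have Z: "open_eucl m ?Z" by (rule D_open_plot[OF U(2) chartD(4)[OF ch]])
    \<comment> \<open>The lift \<open>s\<close> factors through the projection, so its derivatives
      are combinations of the derivatives of the base coordinates, whose given combination is 0.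
      Only the part of the Leibniz rule that differentiates \<open>g\<close> survives.\<close>
    have base: "\<alpha> * partial_deriv i (\<lambda>v. F (act P (s v) (g v0))) v0 + \<beta> * partial_deriv j (\<lambda>v. F (act P (s v) (g v0))) v0 = 0"
      if F: "F \<in> smooth_functions P" for F
    proof -
      have "is_plot P m ?Z (\<lambda>z. S (inv_into W c z))"
        by (rule S(2)[OF is_plot_subset[OF DM chartD(4)[OF ch] Z]]) auto
      then have "is_plot P m ?Z (\<lambda>z. act P (S (inv_into W c z)) (g v0))"
        by (rule plot_act) (rule is_plot_const[OF DL _ Z], use g0 in simp)
      then have smF: "smooth_fun_on m ?Z (\<lambda>z. F (act P (S (inv_into W c z)) (g v0)))" by (rule smooth_functions_plot[OF F])
      have cx: "c ?x \<in> ?Z" using xW U(1) chartD(2)[OF ch] by simp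
      have "partial_deriv l (\<lambda>v. F (act P (s v) (g v0))) v0 = (\<Sum>k<m. partial_deriv l (\<lambda>v. c (\<pi> (\<sigma> v)) k) v0 *
          partial_deriv k (\<lambda>z. F (act P (S (inv_into W c z)) (g v0))) (c ?x))" if l: "l < n" for l
        unfolding s_def
        by (rule chart_partial[OF DM ch \<pi>\<sigma> v0 xW l, of ?Z "\<lambda>y. F (act P (S y) (g v0))"]) (use smF cx in auto)
      then have "\<alpha> * partial_deriv i (\<lambda>v. F (act P (s v) (g v0))) v0 + \<beta> * partial_deriv j (\<lambda>v. F (act P (s v) (g v0))) v0 =
        (\<Sum>k<m. (\<alpha> * partial_deriv i (\<lambda>v. c (\<pi> (\<sigma> v)) k) v0 + \<beta> * partial_deriv j (\<lambda>v. c (\<pi> (\<sigma> v)) k) v0) *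
          partial_deriv k (\<lambda>z. F (act P (S (inv_into W c z)) (g v0))) (c ?x))"
        by (simp only: ij sum_combination)
      also have "\<dots> = 0" using coord by simp
      finally show ?thesis .
    qed
    have comb: "\<alpha> * plot_partial P i \<sigma> v0 F + \<beta> * plot_partial P j \<sigma> v0 F =
       \<alpha> * plot_partial P i (\<lambda>v. act P (s v0) (g v)) v0 F + \<beta> * plot_partial P j (\<lambda>v. act P (s v0) (g v)) v0 F" for F
    proof (cases "F \<in> smooth_functions P")
      case True
      have "plot_partial P l \<sigma> v0 F = plot_partial P l (\<lambda>v. act P (s v) (g v0)) v0 F + plot_partial P l (\<lambda>v. act P (s v0) (g v)) v0 F" if l: "l < n" for l
        using plot_partial_cong[where p=\<sigma> and q="\<lambda>v. act P (s v) (g v)", OF V v0V l sg, of P] act_leibniz[OF s g v0V l] by simp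
      from this[OF ij(1)] this[OF ij(2)] base[OF True] show ?thesis
        using True by (simp add: plot_partial_apply algebra_simps)
    qed (simp add: plot_partial_def)
    show thesis by (rule that[OF v0V _ s g sg comb]) auto
  qed
qed

text \<open>Let \<open>w = \<alpha> \<partial>\<^sub>0 + \<beta> \<partial>\<^sub>1\<close> be the direction in which \<open>\<sigma>\<close> is vertical. The surface
  \<open>\<tau>(r, s) = \<sigma>(v\<^sub>0 + s e\<^sub>1) h(r)\<close> with \<open>h(r) = g(v\<^sub>0)\<inverse> g(v\<^sub>0 + r w)\<close> has the tangent vectors \<open>\<partial>\<^sub>w \<sigma>\<close> and
  \<open>\<partial>\<^sub>1 \<sigma>\<close> at the origin, and by equivariance of \<open>A\<close> the exterior derivative of \<open>A\<close> vanishes on it.\<close>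

lemma flat_along_dependent_directions:
  assumes \<sigma>: "is_plot P 2 V \<sigma>" "horizontal 1 V \<sigma>" and v0: "v0 \<in> V" and ab: "\<alpha> \<noteq> 0 \<or> \<beta> \<noteq> 0"
    and dep: "\<And>f. f \<in> smooth_functions M \<Longrightarrow>
      \<alpha> * partial_deriv 0 (\<lambda>v. f (\<pi> (\<sigma> v))) v0 + \<beta> * partial_deriv 1 (\<lambda>v. f (\<pi> (\<sigma> v))) v0 = 0"
    and f: "f \<in> smooth_functions L"
  shows "partial_deriv 1 (\<lambda>v. A (\<sigma> v) (plot_partial P 0 \<sigma> v) f) v0 = 0"
proof (rule vertical_combination[OF \<sigma>(1) v0 _ _ dep], simp, simp, assumption)
  fix V' s g assume V': "v0 \<in> V'" "V' \<subseteq> V" and s: "is_plot P 2 V' s" and g: "is_plot L 2 V' g"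
    and sg: "\<And>v. v \<in> V' \<Longrightarrow> \<sigma> v = act P (s v) (g v)"
    and comb: "\<And>F. \<alpha> * plot_partial P 0 \<sigma> v0 F + \<beta> * plot_partial P 1 \<sigma> v0 F =
       \<alpha> * plot_partial P 0 (\<lambda>v. act P (s v0) (g v)) v0 F + \<beta> * plot_partial P 1 (\<lambda>v. act P (s v0) (g v)) v0 F"
  have VO: "open_eucl 2 V" and V'O: "open_eucl 2 V'" using is_plot_open[OF DP] \<sigma>(1) s by blast+
  have v0E: "v0 \<in> eucl 2" using v0 open_eucl_subset[OF VO] by blast
  have p0: "\<sigma> v0 \<in> carrier P" by (rule is_plot_carrier[OF DP \<sigma>(1) v0])
  have s0: "s v0 \<in> carrier P" by (rule is_plot_carrier[OF DP s V'(1)])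
  have g0: "g v0 \<in> carrier G" by (rule plot_G[OF g V'(1)])
  obtain m W c where ch: "chart P m W c" and pW: "\<sigma> v0 \<in> W" using manifold_chart[OF P p0] by blast
  let ?a = "\<lambda>k z. A (inv_into W c z) (plot_partial P k (inv_into W c) z) f"
  define X where "X k = partial_deriv 0 (\<lambda>v. c (\<sigma> v) k) v0" for k
  define Y where "Y k = partial_deriv 1 (\<lambda>v. c (\<sigma> v) k) v0" for k
  have hor: "A (\<sigma> v) (plot_partial P 1 \<sigma> v) = (\<lambda>f. 0)" if "v \<in> V" for v using \<sigma>(2) that by (simp add: horizontal_def)
  \<comment> \<open>\<open>A(\<partial>\<^sub>1 \<sigma>)\<close> vanishes on all of
    \<open>V\<close>, hence also its derivative in direction 0, and one of the two terms of the
    exterior derivative drops out.\<close>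
  have B1: "partial_deriv 0 (\<lambda>v. A (\<sigma> v) (plot_partial P 1 \<sigma> v) f) v0 = 0"
    by (rule partial_deriv_line_zero[OF VO v0, of _ _ 0]) (use hor in auto)
  have main: "partial_deriv 1 (\<lambda>v. A (\<sigma> v) (plot_partial P 0 \<sigma> v) f) v0 = dform m ?a (c (\<sigma> v0)) X Y"
    using form_exterior_derivative[OF ch \<sigma>(1) v0 pW _ _ f, of 0 1] B1 unfolding X_def Y_def by simp
  show ?thesis
  proof (cases "\<alpha> = 0")
    case True
    \<comment> \<open>Here \<open>\<partial>\<^sub>1 \<sigma>\<close> itself is vertical. Being
      horizontal as well, it is 0, and the exterior derivative vanishes on it.\<close>
    then have "plot_partial P 1 \<sigma> v0 = plot_partial P 1 (\<lambda>v. act P (s v0) (g v)) v0" using comb ab by auto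
    moreover have "A (act P (s v0) (g v0)) (plot_partial P 1 (\<lambda>v. act P (s v0) (g v)) v0) = MC G 1 g v0"
      "plot_partial P 1 (\<lambda>v. act P (s v0) (g v)) v0 = pushforward P (act P (act P (s v0) (g v0))) (MC G 1 g v0)"
      using A_vertical[OF g V'(1) _ s0, of 1] by auto
    moreover have "MC G 1 g v0 = (\<lambda>f. 0)" using calculation hor[OF v0] sg[OF V'(1)] by simp
    ultimately have "plot_partial P 1 \<sigma> v0 = pushforward P (act P (act P (s v0) (g v0))) (\<lambda>f. 0)" by simp
    also have "\<dots> = (\<lambda>f. 0)" by (auto simp: pushforward_def)
    finally have "plot_partial P 1 \<sigma> v0 = (\<lambda>f. 0)" .
    then have "Y k = 0" if k: "k < m" for k
    proof -
      assume z: "plot_partial P 1 \<sigma> v0 = (\<lambda>f. 0)"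
      show ?thesis
      proof (rule partial_coordinate[OF DP ch pW k])
        fix e assume "\<And>n U p u i. is_plot P n U p \<Longrightarrow> u \<in> U \<Longrightarrow> p u = \<sigma> v0 \<Longrightarrow> i < n \<Longrightarrow>
         plot_partial P i p u e = partial_deriv i (\<lambda>u. c (p u) k) u"
        from this[OF \<sigma>(1) v0 refl, of 1] z show ?thesis by (simp add: Y_def)
      qed
    qed
    then show ?thesis unfolding main by (rule dform_zero)
  next
    case False
    \<comment> \<open>The line through \<open>v0\<close> in direction
      \<open>(\<alpha>, \<beta>)\<close>; \<open>sh\<close> below is the line in direction
      1.\<close>
    define ln where "ln r = (\<lambda>i::nat. if i = 0 then v0 0 + r * \<alpha> else if i = 1 then v0 1 + r * \<beta> else 0)" for r :: real
    define sh where "sh t = v0(1 := v0 1 + t)" for t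
    have lnE: "ln r \<in> eucl 2" "sh r \<in> eucl 2" for r using v0E by (auto simp: ln_def sh_def in_eucl)
    have ln0: "ln 0 = v0" using v0E by (auto simp: ln_def in_eucl fun_eq_iff)
    have sh0: "sh 0 = v0" by (simp add: sh_def)
    have E2: "open_eucl 2 (eucl 2)" by simp
    have sm: "smooth_on 2 (eucl 2) 2 (\<lambda>x. ln (x 0))" "smooth_on 2 (eucl 2) 2 (\<lambda>x. sh (x 1))"
    proof -
      show "smooth_on 2 (eucl 2) 2 (\<lambda>x. ln (x 0))"
      proof (rule smooth_onI[OF E2 lnE(1)])
        show "smooth_fun_on 2 (eucl 2) (\<lambda>x. ln (x 0) j)" for j
          unfolding ln_def by (cases "j = 0"; cases "j = 1") (auto intro!: smooth_fun_on_add smooth_fun_on_mult smooth_fun_on_coord smooth_fun_on_const)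
      qed
      show "smooth_on 2 (eucl 2) 2 (\<lambda>x. sh (x 1))"
      proof (rule smooth_onI[OF E2 lnE(2)])
        show "smooth_fun_on 2 (eucl 2) (\<lambda>x. sh (x 1) j)" for j
          unfolding sh_def by (cases "j = 1") (auto intro!: smooth_fun_on_add smooth_fun_on_coord smooth_fun_on_const)
      qed
    qed
    define T1 where "T1 = {x \<in> eucl 2. ln (x 0) \<in> V'}"
    define T where "T = {x \<in> T1. sh (x 1) \<in> V}"
    have T1: "open_eucl 2 T1" unfolding T1_def by (rule open_eucl_smooth_preimage[OF sm(1) V'O])
    have "smooth_on 2 T1 2 (\<lambda>x. sh (x 1))" by (rule smooth_on_subset[OF sm(2) T1]) (auto simp: T1_def)
    then have T: "open_eucl 2 T" unfolding T_def by (rule open_eucl_smooth_preimage[OF _ VO])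
    have TE: "T \<subseteq> eucl 2" by (auto simp: T_def T1_def)
    have Tln: "ln (x 0) \<in> V'" and Tsh: "sh (x 1) \<in> V" if "x \<in> T" for x using that by (auto simp: T_def T1_def)
    define z where "z = (\<lambda>_::nat. 0::real)"
    have z0: "z 0 = 0" "z (Suc 0) = 0" "z 1 = 0" by (auto simp: z_def)
    have zT: "z \<in> T" using V' v0 by (auto simp: T_def T1_def z_def in_eucl ln0[unfolded ln_def] ln0 sh0)
    define h where "h x = inv\<^bsub>G\<^esub> (g v0) \<otimes>\<^bsub>G\<^esub> g (ln (x 0))" for x :: "nat \<Rightarrow> real"
    define \<sigma>' where "\<sigma>' x = \<sigma> (sh (x 1))" for x :: "nat \<Rightarrow> real"
    define \<tau> where "\<tau> x = act P (\<sigma>' x) (h x)" for x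
    have gln: "is_plot L 2 T (\<lambda>x. g (ln (x 0)))"
      by (rule is_plot_comp[OF DL g smooth_on_subset[OF sm(1) T TE]]) (rule Tln)
    have h: "is_plot L 2 T h"
      unfolding h_def using g0 by (intro plot_mult gln is_plot_const[OF DL _ T]) simp
    have \<sigma>': "is_plot P 2 T \<sigma>'"
      unfolding \<sigma>'_def by (rule is_plot_comp[OF DP \<sigma>(1) smooth_on_subset[OF sm(2) T TE]]) (rule Tsh)
    have \<tau>: "is_plot P 2 T \<tau>" unfolding \<tau>_def by (rule plot_act[OF \<sigma>' h])
    have hz: "h z = \<one>\<^bsub>G\<^esub>" using g0 by (simp add: h_def z0 ln0)
    have \<sigma>'z: "\<sigma>' z = \<sigma> v0" by (simp add: \<sigma>'_def z0 sh0)
    have \<tau>z: "\<tau> z = \<sigma> v0" using p0 by (simp add: \<tau>_def hz \<sigma>'z)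
    have d1: "partial_deriv 1 (\<lambda>x. c (\<tau> x) k) z = Y k" for k
    proof -
      have "\<tau> (z(1 := t)) = \<sigma> (v0(1 := v0 1 + t))" if "z(1 := t) \<in> T" for t
      proof -
        have "h (z(1 := t)) = \<one>\<^bsub>G\<^esub>" using hz by (simp add: h_def)
        then show ?thesis using is_plot_carrier[OF DP \<sigma>' that] by (simp add: \<tau>_def \<sigma>'_def sh_def)
      qed
      then have "eventually (\<lambda>t. c (\<tau> (z(1 := t))) k = c (\<sigma> (v0(1 := v0 1 + t))) k) (nhds (z 1))"
        using eventually_upd[OF T zT, of 1] by (auto elim!: eventually_mono)
      then have "partial_deriv 1 (\<lambda>x. c (\<tau> x) k) z = deriv (\<lambda>t. c (\<sigma> (v0(1 := v0 1 + t))) k) (z 1)"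
        unfolding partial_deriv_def by (rule deriv_cong_ev) simp
      also have "\<dots> = Y k" unfolding z0 Y_def partial_deriv_def using deriv_shift[of "\<lambda>t. c (\<sigma> (v0(1 := t))) k" "v0 1"] by simp
      finally show ?thesis .
    qed
    have d0: "partial_deriv 0 (\<lambda>x. c (\<tau> x) k) z = \<alpha> * X k + \<beta> * Y k" if k: "k < m" for k
    proof (rule partial_coordinate[OF DP ch pW k])
      fix e assume e: "e \<in> smooth_functions P" and ec: "\<And>n U p u i. is_plot P n U p \<Longrightarrow> u \<in> U \<Longrightarrow> p u = \<sigma> v0 \<Longrightarrow> i < n \<Longrightarrow>
         plot_partial P i p u e = partial_deriv i (\<lambda>u. c (p u) k) u"
      let ?F = "\<lambda>v. e (act P (s v0) (g v))"
      have F: "smooth_fun_on 2 V' ?F"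
        by (rule smooth_functions_plot[OF e plot_act[OF is_plot_const[OF DP s0 V'O] g]])
      have "((\<lambda>r. ?F (ln r)) has_real_derivative (\<Sum>l<2. partial_deriv l ?F (ln 0) * (if l = 0 then \<alpha> else \<beta>))) (at 0 within UNIV)"
        by (rule smooth_DERIV_along_curve[OF F]) (use V' ln0 lnE in \<open>auto simp: ln_def intro!: derivative_eq_intros\<close>)
      then have D: "DERIV (\<lambda>r. ?F (ln r)) 0 :> \<alpha> * partial_deriv 0 ?F v0 + \<beta> * partial_deriv 1 ?F v0"
        by (simp add: ln0 numeral_2_eq_2 mult.commute)
      have "\<tau> (z(0 := r)) = act P (s v0) (g (ln r))" if "z(0 := r) \<in> T" for r
      proof -
        have gl: "g (ln r) \<in> carrier G" using plot_G[OF g Tln[OF that]] by simp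
        have "\<tau> (z(0 := r)) = act P (act P (s v0) (g v0)) (inv\<^bsub>G\<^esub> (g v0) \<otimes>\<^bsub>G\<^esub> g (ln r))"
          using sg[OF V'(1)] by (simp add: \<tau>_def \<sigma>'_def h_def z0 sh0)
        also have "\<dots> = act P (s v0) (g v0 \<otimes>\<^bsub>G\<^esub> (inv\<^bsub>G\<^esub> (g v0) \<otimes>\<^bsub>G\<^esub> g (ln r)))"
          using s0 g0 gl by (intro act_mult) auto
        finally show ?thesis using g0 gl by (simp add: m_assoc[symmetric])
      qed
      then have "eventually (\<lambda>r. ?F (ln r) = e (\<tau> (z(0 := r)))) (nhds (z 0))"
        using eventually_upd[OF T zT, of 0] by (auto elim!: eventually_mono)
      then have "DERIV (\<lambda>r. e (\<tau> (z(0 := r)))) (z 0) :> \<alpha> * partial_deriv 0 ?F v0 + \<beta> * partial_deriv 1 ?F v0"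
        using D by (subst DERIV_cong_ev[OF refl _ refl, symmetric]) (auto simp: z0)
      then have "partial_deriv 0 (\<lambda>x. e (\<tau> x)) z = \<alpha> * partial_deriv 0 ?F v0 + \<beta> * partial_deriv 1 ?F v0"
        by (rule partial_derivI)
      then have "plot_partial P 0 \<tau> z e = \<alpha> * plot_partial P 0 \<sigma> v0 e + \<beta> * plot_partial P 1 \<sigma> v0 e"
        using comb[of e] e by (simp add: plot_partial_apply)
      then show ?thesis
        using ec[OF \<tau> zT \<tau>z, of 0] ec[OF \<sigma>(1) v0 refl, of 0] ec[OF \<sigma>(1) v0 refl, of 1] by (simp add: X_def Y_def)
    qed
    \<comment> \<open>In direction 0 the surface moves in one fibre by \<open>h\<close>, so
      \<open>A\<close> returns the Maurer-Cartan value of \<open>h\<close>, which does not change in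
      direction 1.\<close>
    have e1: "partial_deriv 1 (\<lambda>x. A (\<tau> x) (plot_partial P 0 \<tau> x) f) z = 0"
    proof (rule partial_deriv_line_zero[OF T zT])
      fix t assume zt: "z(1 := t) \<in> T"
      let ?u = "z(1 := t)"
      have "plot_partial P 0 \<tau> ?u = plot_partial P 0 (\<lambda>x. act P (\<sigma>' ?u) (h x)) ?u"
        by (rule plot_partial_line_cong) (simp add: \<tau>_def \<sigma>'_def)
      then have "A (\<tau> ?u) (plot_partial P 0 \<tau> ?u) = MC G 0 h ?u"
        using A_vertical(2)[OF h zt _ is_plot_carrier[OF DP \<sigma>' zt], of 0] by (simp add: \<tau>_def)
      also have "\<dots> = MC G 0 h z"
        by (auto simp: MC_def plot_partial_def partial_deriv_def comp_def h_def z0)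
      finally show "A (\<tau> ?u) (plot_partial P 0 \<tau> ?u) f = MC G 0 h z f" by simp
    qed simp
    \<comment> \<open>In direction 1 the surface is a right translate of \<open>\<sigma>'\<close> by
      a fixed element, so equivariance carries horizontality of \<open>\<sigma>\<close> over, along
      the whole line in direction 0.\<close>
    have e0: "partial_deriv 0 (\<lambda>x. A (\<tau> x) (plot_partial P 1 \<tau> x) f) z = 0"
    proof (rule partial_deriv_line_zero[OF T zT])
      fix r assume zr: "z(0 := r) \<in> T"
      let ?u = "z(0 := r)"
      have hu: "h ?u \<in> carrier G" by (rule plot_G[OF h zr])
      have "plot_partial P 1 \<sigma>' ?u = plot_partial P 1 \<sigma> v0"
        using deriv_shift[of "\<lambda>t. F (\<sigma> (v0(1 := t)))" "v0 1" for F]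
        by (auto simp: plot_partial_def partial_deriv_def comp_def \<sigma>'_def sh_def z0)
      moreover have "\<sigma>' ?u = \<sigma> v0" using \<sigma>'z by (simp add: \<sigma>'_def)
      ultimately have "A (\<sigma>' ?u) (plot_partial P 1 \<sigma>' ?u) = (\<lambda>f. 0)" using hor[OF v0] by simp
      then have "A (act P (\<sigma>' ?u) (h ?u)) (plot_partial P 1 (\<lambda>x. act P (\<sigma>' x) (h ?u)) ?u) = (\<lambda>f. 0)"
        using A_right[OF \<sigma>' zr _ hu, of 1] by simp
      moreover have "plot_partial P 1 \<tau> ?u = plot_partial P 1 (\<lambda>x. act P (\<sigma>' x) (h ?u)) ?u"
        by (rule plot_partial_line_cong) (simp add: \<tau>_def h_def)
      ultimately show "A (\<tau> ?u) (plot_partial P 1 \<tau> ?u) f = 0" by (simp add: \<tau>_def)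
    qed simp
    have "dform m ?a (c (\<tau> z)) (\<lambda>k. partial_deriv 0 (\<lambda>x. c (\<tau> x) k) z) (\<lambda>k. partial_deriv 1 (\<lambda>x. c (\<tau> x) k) z) = 0"
      using form_exterior_derivative[OF ch \<tau> zT _ _ _ f, of 0 1] e0 e1 pW by (simp add: \<tau>z)
    moreover have "dform m ?a (c (\<tau> z)) (\<lambda>k. partial_deriv 0 (\<lambda>x. c (\<tau> x) k) z) (\<lambda>k. partial_deriv 1 (\<lambda>x. c (\<tau> x) k) z)
      = dform m ?a (c (\<sigma> v0)) (\<lambda>k. \<alpha> * X k + \<beta> * Y k) Y"
      unfolding dform_def by (intro sum.cong refl) (simp add: d0 d1[unfolded One_nat_def] \<tau>z)
    \<comment> \<open>The first vector is \<open>\<alpha> X + \<beta> Y\<close>, and its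
      \<open>Y\<close> part is killed by antisymmetry. Dividing by \<open>\<alpha>\<close> gives the
      claim for \<open>X\<close> and \<open>Y\<close>.\<close>
    ultimately have "\<alpha> * dform m ?a (c (\<sigma> v0)) X Y = 0" by (simp add: dform_combination)
    then show ?thesis using False main by simp
  qed
qed

end

section \<open>Rank, slices and thin homotopies\<close>

lemma vector_space_tvec: "vector_space (scale_tvec :: real \<Rightarrow> 'a tvec \<Rightarrow> 'a tvec)"
  by unfold_locales (auto simp: scale_tvec_def fun_eq_iff plus_fun_def algebra_simps)

text \<open>Without such a relation the two velocities would be distinct and independent and would
  form a basis of the image of the differential, which would have dimension 2.\<close>

lemma rank_le_1_dependent:
  assumes "rank_differential M H s t \<le> 1"
  obtains a b where "a \<noteq> 0 \<or> b \<noteq> 0"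
    "\<And>f. a * velocity M (\<lambda>s'. H s' t) s f + b * velocity M (\<lambda>t'. H s t') t f = 0"
proof -
  interpret tv: vector_space "scale_tvec :: real \<Rightarrow> 'a tvec \<Rightarrow> 'a tvec" by (rule vector_space_tvec)
  define V where "V = velocity M (\<lambda>s'. H s' t) s"
  define W where "W = velocity M (\<lambda>t'. H s t') t"
  have sd: "square_differential M H s t (a, b) = scale_tvec a V + scale_tvec b W" for a b
    by (simp add: square_differential_def V_def W_def scale_tvec_def plus_fun_def)
  have "\<exists>a b. (a \<noteq> 0 \<or> b \<noteq> 0) \<and> scale_tvec a V + scale_tvec b W = 0"
  proof (rule ccontr)
    assume no: "\<not> (\<exists>a b. (a \<noteq> 0 \<or> b \<noteq> 0) \<and> scale_tvec a V + scale_tvec b W = 0)"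
    have W0: "W \<noteq> 0"
    proof
      assume "W = 0"
      then have "scale_tvec 0 V + scale_tvec 1 W = 0" by simp
      then show False using no by (metis zero_neq_one)
    qed
    have VW: "V \<notin> tv.span {W}"
    proof
      assume "V \<in> tv.span {W}"
      then obtain k where "V = scale_tvec k W" by (auto simp: tv.span_singleton)
      then have "scale_tvec 1 V + scale_tvec (- k) W = 0" by simp
      then show False using no by (metis zero_neq_one)
    qed
    then have ne: "V \<noteq> W" using tv.span_base[of W "{W}"] by auto
    have ind: "tv.independent {V, W}"
      using VW W0 ne by (subst tv.independent_insert) (auto simp: tv.dependent_single)
    have "tv.dim (range (square_differential M H s t)) = 2"
    proof (rule tv.dim_unique)
      show "{V, W} \<subseteq> range (square_differential M H s t)"
      proof -
        have "V = square_differential M H s t (1, 0)" "W = square_differential M H s t (0, 1)" by (simp_all add: sd)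
        then show ?thesis by blast
      qed
      show "range (square_differential M H s t) \<subseteq> tv.span {V, W}"
      proof -
        have "scale_tvec a V + scale_tvec b W \<in> tv.span {V, W}" for a b
          by (intro tv.span_add tv.span_scale tv.span_base) simp_all
        then show ?thesis by (auto simp: sd)
      qed
    qed (use ind ne in auto)
    then show False using assms by (simp add: rank_differential_def)
  qed
  then obtain a b where ab: "a \<noteq> 0 \<or> b \<noteq> 0" "scale_tvec a V + scale_tvec b W = 0" by blast
  have "a * V f + b * W f = 0" for f using fun_cong[OF ab(2), of f] by (simp add: scale_tvec_def)
  then show thesis using that[OF ab(1)] by (simp add: V_def W_def)
qed

lemma rank_le_1I:
  assumes "\<And>f. velocity M (\<lambda>t'. H s t') t f = 0"
  shows "rank_differential M H s t \<le> 1"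
proof -
  interpret tv: vector_space "scale_tvec :: real \<Rightarrow> 'a tvec \<Rightarrow> 'a tvec" by (rule vector_space_tvec)
  let ?V = "velocity M (\<lambda>s'. H s' t) s"
  have "square_differential M H s t (a, b) = scale_tvec a ?V" for a b
    using assms by (simp add: square_differential_def scale_tvec_def)
  moreover have "scale_tvec a ?V \<in> tv.span {?V}" for a by (intro tv.span_scale tv.span_base) simp
  ultimately have "range (square_differential M H s t) \<subseteq> tv.span {?V}" by auto
  then have "tv.dim (range (square_differential M H s t)) \<le> card {?V}"
    by (rule tv.dim_le_card) simp
  then show ?thesis by (simp add: rank_differential_def)
qed

definition vec2 :: "real \<Rightarrow> real \<Rightarrow> nat \<Rightarrow> real" where
  "vec2 s t = (\<lambda>i. if i = 0 then s else if i = 1 then t else 0)"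

lemma vec2_simps [simp]: "vec2 s t 0 = s" "vec2 s t (Suc 0) = t" "vec2 s t \<in> eucl (Suc (Suc 0))"
  by (auto simp: vec2_def in_eucl)

lemma vec2_smooth:
  assumes "smooth_fun_on n V f" "smooth_fun_on n V g"
  shows "smooth_on n V (Suc (Suc 0)) (\<lambda>x. vec2 (f x) (g x))"
proof (rule smooth_onI[OF smooth_fun_on_open[OF assms(1)]])
  show "smooth_fun_on n V (\<lambda>x. vec2 (f x) (g x) j)" if "j < Suc (Suc 0)" for j
    using assms that by (cases "j = 0") (auto simp: less_Suc_eq)
qed simp

abbreviation unit_square :: "(nat \<Rightarrow> real) set" where
  "unit_square \<equiv> {x \<in> eucl (Suc (Suc 0)). x 0 \<in> {0..1} \<and> x (Suc 0) \<in> {0..1}}"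

lemma smooth_path_slice:
  assumes X: "diffeology X" and H: "smooth_from (Suc (Suc 0)) unit_square X (\<lambda>x. H (x 0) (x (Suc 0)))"
    and fg: "smooth_fun_on (Suc 0) (eucl (Suc 0)) f" "smooth_fun_on (Suc 0) (eucl (Suc 0)) g"
    and r: "\<And>x. x \<in> unit_segment \<Longrightarrow> f x \<in> {0..1} \<and> g x \<in> {0..1}"
    and \<gamma>: "\<And>x. x \<in> unit_segment \<Longrightarrow> \<gamma> (x 0) = H (f x) (g x)"
  shows "smooth_path X \<gamma>"
  unfolding smooth_path_iff
proof (rule smooth_fromI)
  fix x assume x: "x \<in> unit_segment"
  have in_sq: "vec2 (f y) (g y) \<in> unit_square" if "y \<in> unit_segment" for y using r[OF that] by simp
  obtain V q where V: "vec2 (f x) (g x) \<in> V" "(Suc (Suc 0), V, q) \<in> plots X"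
    "\<And>y. y \<in> unit_square \<Longrightarrow> y \<in> V \<Longrightarrow> H (y 0) (y (Suc 0)) = q y"
    using smooth_fromE[OF H in_sq[OF x]] by blast
  have q: "is_plot X (Suc (Suc 0)) V q" by (rule plots_is_plot(1)[OF X V(2)])
  note sm = vec2_smooth[OF fg]
  let ?V = "{y \<in> eucl (Suc 0). vec2 (f y) (g y) \<in> V}"
  have O: "open_eucl (Suc 0) ?V" by (rule open_eucl_smooth_preimage[OF sm is_plot_open[OF X q]])
  have "smooth_on (Suc 0) ?V (Suc (Suc 0)) (\<lambda>y. vec2 (f y) (g y))" by (rule smooth_on_subset[OF sm O]) auto
  then have "is_plot X (Suc 0) ?V (\<lambda>y. q (vec2 (f y) (g y)))" by (rule is_plot_comp[OF X q]) simp
  moreover have "\<gamma> (y 0) = q (vec2 (f y) (g y))" if "y \<in> unit_segment" "y \<in> ?V" for y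
    using V(3)[OF in_sq[OF that(1)]] that(2) \<gamma>[OF that(1)] by simp
  ultimately show "\<exists>V p. x \<in> V \<and> is_plot X (Suc 0) V p \<and> (\<forall>y\<in>unit_segment \<inter> V. \<gamma> (y 0) = p y)"
    by (intro exI[of _ ?V] exI[of _ "\<lambda>y. q (vec2 (f y) (g y))"]) (use x V(1) in auto)
qed

lemma thin_homotopyD:
  assumes "thin_homotopy M \<gamma>0 \<gamma>1 H"
  shows "smooth_from (Suc (Suc 0)) unit_square M (\<lambda>x. H (x 0) (x (Suc 0)))"
    "\<And>s. s \<in> {0..1} \<Longrightarrow> H s 0 = \<gamma>0 s" "\<And>s. s \<in> {0..1} \<Longrightarrow> H s 1 = \<gamma>1 s"
    "\<And>t. t \<in> {0..1} \<Longrightarrow> H 0 t = \<gamma>0 0" "\<And>t. t \<in> {0..1} \<Longrightarrow> H 1 t = \<gamma>0 1"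
    "\<And>s t. s \<in> {0..1} \<Longrightarrow> t \<in> {0..1} \<Longrightarrow> rank_differential M H s t \<le> 1"
    "\<exists>\<epsilon>>0. \<forall>s\<in>{0..1}. \<forall>t\<in>{0..1}. (s < \<epsilon> \<longrightarrow> H s t = H 0 t) \<and> (1 - \<epsilon> < s \<longrightarrow> H s t = H 1 t)"
proof -
  show "smooth_from (Suc (Suc 0)) unit_square M (\<lambda>x. H (x 0) (x (Suc 0)))"
    using assms by (simp add: thin_homotopy_def numeral_2_eq_2)
  show "\<exists>\<epsilon>>0. \<forall>s\<in>{0..1}. \<forall>t\<in>{0..1}. (s < \<epsilon> \<longrightarrow> H s t = H 0 t) \<and> (1 - \<epsilon> < s \<longrightarrow> H s t = H 1 t)"
    using assms unfolding thin_homotopy_def by meson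
qed (use assms in \<open>auto simp: thin_homotopy_def\<close>)

text \<open>The homotopy is constant in the deformation parameter, so its differential has rank at
  most 1. The lemma puts each path into its own class, and classes are therefore nonempty.\<close>

lemma thin_rel_refl:
  assumes X: "diffeology M" and \<gamma>: "\<gamma> \<in> sitting_paths M"
  shows "(\<gamma>, \<gamma>) \<in> thin_rel M"
proof -
  obtain e where e: "e > 0" "\<And>t. t \<in> {0..1} \<Longrightarrow> t < e \<Longrightarrow> \<gamma> t = \<gamma> 0" "\<And>t. t \<in> {0..1} \<Longrightarrow> 1 - e < t \<Longrightarrow> \<gamma> t = \<gamma> 1"
    using \<gamma> unfolding sitting_paths_def by blast
  have "is_plot M 2 (eucl 2) (\<lambda>x. \<gamma> (clamp01 (x 0)))"
    by (rule sitting_clamp_plot[OF X \<gamma>]) (simp add: smooth_fun_on_coord)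
  then have "smooth_from 2 {x \<in> topspace (Euclidean_space 2). x 0 \<in> {0..1} \<and> x 1 \<in> {0..1}} M (\<lambda>x. \<gamma> (x 0))"
    by (intro smooth_fromI exI[of _ "eucl 2"] exI[of _ "\<lambda>x. \<gamma> (clamp01 (x 0))"]) auto
  moreover have "rank_differential M (\<lambda>s t. \<gamma> s) s t \<le> 1" if "t \<in> {0..1}" for s t
  proof (rule rank_le_1I)
    have "vector_derivative (\<lambda>t'. f (\<gamma> s)) (at t within {0..1}) = 0" for f :: "_ \<Rightarrow> real"
      using vector_derivative_within_cbox[of 0 1 t "\<lambda>t'. f (\<gamma> s)" 0] that by (simp add: cbox_interval)
    then show "velocity M (\<lambda>t'. \<gamma> s) t f = 0" for f by (simp add: velocity_def comp_def)
  qed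
  moreover have "\<exists>\<epsilon>>0. \<forall>s\<in>{0..1}. \<forall>t\<in>{0..1::real}. (s < \<epsilon> \<longrightarrow> \<gamma> s = \<gamma> 0) \<and> (1 - \<epsilon> < s \<longrightarrow> \<gamma> s = \<gamma> 1) \<and>
        (t < \<epsilon> \<longrightarrow> \<gamma> s = \<gamma> s) \<and> (1 - \<epsilon> < t \<longrightarrow> \<gamma> s = \<gamma> s)"
  proof (rule exI[of _ e], intro conjI ballI impI)
    show "e > 0" by (rule e(1))
    show "\<gamma> s = \<gamma> 0" if "s \<in> {0..1}" "s < e" for s using that by (rule e(2))
    show "\<gamma> s = \<gamma> 1" if "s \<in> {0..1}" "1 - e < s" for s using that by (rule e(3))
  qed (rule refl)+
  ultimately have "thin_homotopy M \<gamma> \<gamma> (\<lambda>s t. \<gamma> s)" unfolding thin_homotopy_def by simp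
  then show ?thesis using \<gamma> unfolding thin_rel_def by blast
qed

section \<open>Transport along thin homotopies and smoothness of transport\<close>

context bundle_connection begin

text \<open>Freezing the parameter \<open>u\<close> turns a family of lifts into a horizontal plot
  of one variable, whose end point is the transported point.\<close>

lemma transport_endpoint:
  assumes r: "r > 0" and \<sigma>: "is_plot P (Suc n) (slab n N {- r<..<1 + r}) \<sigma>" "horizontal n (slab n N {- r<..<1 + r}) \<sigma>"
    and N: "open_eucl n N" "u \<in> N" and \<gamma>: "\<gamma> \<in> sitting_paths M"
    and \<pi>: "\<And>s. s \<in> {- r<..<1 + r} \<Longrightarrow> \<pi> (\<sigma> (u(n := s))) = \<gamma> (smooth_step s)"
  shows "parallel_transport P \<pi> A \<gamma> (\<sigma> (u(n := 0))) = \<sigma> (u(n := 1))"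
proof -
  let ?V = "{x \<in> eucl (Suc 0). x 0 \<in> {- r<..<1 + r}}"
  let ?\<tau> = "\<lambda>x::nat \<Rightarrow> real. \<sigma> (u(n := x 0))"
  have V: "open_eucl (Suc 0) ?V" by (rule open_eucl_vimage) (auto simp: continuous_on_coord)
  have uE: "u \<in> eucl n" using N open_eucl_subset by blast
  have in_slab: "u(n := s) \<in> slab n N {- r<..<1 + r}" if "s \<in> {- r<..<1 + r}" for s
    by (rule slabI[OF N(2) uE that])
  have sm: "smooth_on (Suc 0) ?V (Suc n) (\<lambda>x. u(n := x 0))"
  proof (rule smooth_onI[OF V])
    show "smooth_fun_on (Suc 0) ?V (\<lambda>x. (u(n := x 0)) j)" for j
      using smooth_fun_on_coord[OF V, of 0] smooth_fun_on_const[OF V, of "u j"] by (cases "j = n") simp_all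
  qed (use uE in \<open>auto simp: in_eucl\<close>)
  have "parallel_transport P \<pi> A \<gamma> (?\<tau> (vec1 0)) = ?\<tau> (vec1 1)"
  proof (rule parallel_transport_plot[OF \<gamma> V])
    show "vec1 t \<in> ?V" if "t \<in> {0..1}" for t using that r by auto
    show "is_plot P (Suc 0) ?V ?\<tau>" by (rule is_plot_comp[OF DP \<sigma>(1) sm]) (use in_slab in auto)
    have "plot_partial P 0 ?\<tau> x = plot_partial P n \<sigma> (u(n := x 0))" for x
      by (auto simp: plot_partial_def partial_deriv_def)
    then show "horizontal 0 ?V ?\<tau>" using \<sigma>(2) in_slab by (simp add: horizontal_def)
    show "\<pi> (?\<tau> v) = \<gamma> (smooth_step (v 0))" if "v \<in> ?V" for v using \<pi> that by simp
  qed (simp add: fun_upd_def)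
  then show ?thesis by simp
qed

text \<open>For a thin homotopy, \<open>A\<close> evaluated on the derivative of the lifts in the direction of the
  deformation does not change along the paths; as it vanishes at the common starting point, the
  endpoint of the lift does not move.\<close>

lemma parallel_transport_thin:
  assumes rel: "(\<gamma>0, \<gamma>1) \<in> thin_rel M" and p: "p \<in> carrier P" "\<pi> p = \<gamma>0 0"
  shows "parallel_transport P \<pi> A \<gamma>0 p = parallel_transport P \<pi> A \<gamma>1 p"
proof -
  obtain H where \<gamma>: "\<gamma>0 \<in> sitting_paths M" "\<gamma>1 \<in> sitting_paths M" and th: "thin_homotopy M \<gamma>0 \<gamma>1 H"
    using rel unfolding thin_rel_def by blast
  note H = thin_homotopyD[OF th]
  \<comment> \<open>The restriction makes the slices extensional, as elements of
    \<open>sitting_paths\<close> have to be.\<close>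
  define path where "path t = restrict (\<lambda>s. H s t) {0..1}" for t
  have coordE: "smooth_fun_on n (eucl n) (\<lambda>x. x i)" "smooth_fun_on n (eucl n) (\<lambda>x. k)" for n i and k :: real
    by (auto intro!: smooth_fun_on_coord smooth_fun_on_const)
  have sl1: "smooth_path M (\<lambda>s. H s t)" if "t \<in> {0..1}" for t
    by (rule smooth_path_slice[OF DM H(1) coordE(1)[of _ 0] coordE(2)[of _ t]]) (use that in auto)
  have sl2: "smooth_path M (\<lambda>t. H s t)" if "s \<in> {0..1}" for s
    by (rule smooth_path_slice[OF DM H(1) coordE(2)[of _ s] coordE(1)[of _ 0]]) (use that in auto)
  have path: "path t \<in> sitting_paths M" if t: "t \<in> {0..1}" for t
    unfolding sitting_paths_def mem_Collect_eq
  proof (intro conjI)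
    have "H s t \<in> carrier M" if "s \<in> {0..1}" for s
      using smooth_from_carrier[OF DM H(1), of "vec2 s t"] that t by simp
    then show "path t \<in> {0..1} \<rightarrow>\<^sub>E carrier M" by (auto simp: path_def)
    show "smooth_path M (path t)"
      by (rule smooth_path_slice[OF DM H(1) coordE(1)[of _ 0] coordE(2)[of _ t]]) (use t in \<open>auto simp: path_def\<close>)
    obtain e where e: "e > 0" "\<forall>s\<in>{0..1}. \<forall>t\<in>{0..1}. (s < e \<longrightarrow> H s t = H 0 t) \<and> (1 - e < s \<longrightarrow> H s t = H 1 t)"
      using H(7) by blast
    have pe: "path t s = H s t" if "s \<in> {0..1}" for s using that by (simp add: path_def)
    have zero_in_unit: "0 \<in> {0..1::real}" and one_in_unit: "1 \<in> {0..1::real}" by simp_all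
    show "\<exists>\<epsilon>>0. (\<forall>s\<in>{0..1}. s < \<epsilon> \<longrightarrow> path t s = path t 0) \<and> (\<forall>s\<in>{0..1}. 1 - \<epsilon> < s \<longrightarrow> path t s = path t 1)"
    proof (rule exI[of _ e], intro conjI ballI impI)
      show "e > 0" by (rule e(1))
      show "path t s = path t 0" if "s \<in> {0..1}" "s < e" for s
        unfolding pe[OF that(1)] pe[OF zero_in_unit] using e(2) that t by blast
      show "path t s = path t 1" if "s \<in> {0..1}" "1 - e < s" for s
        unfolding pe[OF that(1)] pe[OF one_in_unit] using e(2) that t by blast
    qed
  qed
  have ext: "path 0 = \<gamma>0" "path 1 = \<gamma>1"
  proof -
    have "restrict \<gamma>0 {0..1} = \<gamma>0" "restrict \<gamma>1 {0..1} = \<gamma>1"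
      using sitting_pathsD(3)[OF \<gamma>(1)] sitting_pathsD(3)[OF \<gamma>(2)] by (auto intro: extensional_restrict)
    moreover have "path 0 = restrict \<gamma>0 {0..1}" "path 1 = restrict \<gamma>1 {0..1}"
      unfolding path_def using H(2,3) by (auto intro!: restrict_ext)
    ultimately show "path 0 = \<gamma>0" "path 1 = \<gamma>1" by auto
  qed
  \<comment> \<open>Time must be the last coordinate, so the arguments are exchanged: coordinate 0
    is the deformation, coordinate 1 the path parameter. Both pass through the step function, which
    makes \<open>K\<close> a plot on the whole plane.\<close>
  define K where "K v = H (smooth_step (v (Suc 0))) (smooth_step (v 0))" for v :: "nat \<Rightarrow> real"
  have E2: "open_eucl (Suc (Suc 0)) (eucl (Suc (Suc 0)))" by simp
  have K: "is_plot M (Suc (Suc 0)) (eucl (Suc (Suc 0))) K"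
  proof -
    have "is_plot M (Suc (Suc 0)) (eucl (Suc (Suc 0))) (\<lambda>v. (\<lambda>x. H (x 0) (x (Suc 0))) (vec2 (smooth_step (v (Suc 0))) (smooth_step (v 0))))"
      by (rule smooth_from_comp[OF DM H(1) vec2_smooth[OF smooth_step_coord[OF E2] smooth_step_coord[OF E2]]]) (simp add: smooth_step_range)
    then show ?thesis by (simp add: K_def[abs_def])
  qed
  have slabE: "slab (Suc 0) (eucl (Suc 0)) UNIV = eucl (Suc (Suc 0))"
    by (auto simp: slab_def intro!: drop_last_eucl)
  define E where "E t = parallel_transport P \<pi> A (path (smooth_step t)) p" for t
  \<comment> \<open>A lift exists only over a small neighbourhood of each deformation parameter, so
    the end point is first shown to be locally constant; Bolzano's principle then compares 0 with
    1.\<close>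
  have loc: "\<exists>d>0. \<forall>t. \<bar>t - t0\<bar> < d \<longrightarrow> E t = E t0" for t0
  proof -
    have zp: "is_plot P (Suc 0) (eucl (Suc 0)) (\<lambda>_. p)" by (rule is_plot_const[OF DP p(1)]) simp
    have E1: "open_eucl (Suc 0) (eucl (Suc 0))" by simp
    have vec1_eucl: "vec1 t0 \<in> eucl (Suc 0)" by simp
    have pK: "\<pi> p = K u" if "u \<in> eucl (Suc 0)" for u
      using that p(2) H(4)[OF smooth_step_in] by (simp add: K_def in_eucl)
    obtain N \<sigma> r where N: "vec1 t0 \<in> N" "N \<subseteq> eucl (Suc 0)" "open_eucl (Suc 0) N" "0 < r"
      and \<sigma>: "is_plot P (Suc (Suc 0)) (slab (Suc 0) N {- r<..<1 + r}) \<sigma>"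
      "\<And>v. v \<in> slab (Suc 0) N {- r<..<1 + r} \<Longrightarrow> \<pi> (\<sigma> v) = K v" "horizontal (Suc 0) (slab (Suc 0) N {- r<..<1 + r}) \<sigma>"
      "\<And>u. u \<in> N \<Longrightarrow> \<sigma> u = p"
      by (rule horizontal_lift_exists[OF E1 K[folded slabE] vec1_eucl zp pK], assumption, rule that)
    let ?S = "slab (Suc 0) N {- r<..<1 + r}"
    have S: "open_eucl (Suc (Suc 0)) ?S" by (rule is_plot_open[OF DP \<sigma>(1)])
    have NE: "u \<in> eucl (Suc 0)" if "u \<in> N" for u using N(2) that by blast
    have u1: "u(Suc 0 := 0) = u" if "u \<in> N" for u using NE[OF that] by (simp add: in_eucl fun_upd_idem)
    have inS: "u(Suc 0 := s) \<in> ?S" if "u \<in> N" "s \<in> {- r<..<1 + r}" for u s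
      by (rule slabI[OF that(1) NE[OF that(1)] that(2)])
    have flat: "partial_deriv 1 (\<lambda>v. A (\<sigma> v) (plot_partial P 0 \<sigma> v) f) v0 = 0"
      if v0: "v0 \<in> ?S" and f: "f \<in> smooth_functions L" for v0 f
    proof -
      define s where "s = smooth_step (v0 (Suc 0))"
      define t where "t = smooth_step (v0 0)"
      have st: "s \<in> {0..1}" "t \<in> {0..1}" by (simp_all add: s_def t_def smooth_step_range)
      obtain a b where ab: "a \<noteq> 0 \<or> b \<noteq> 0" "\<And>f. a * velocity M (\<lambda>s'. H s' t) s f + b * velocity M (\<lambda>t'. H s t') t f = 0"
        using rank_le_1_dependent[OF H(6)[OF st]] by blast
      define h1 where "h1 = pi * sin (pi * v0 (Suc 0)) / 2"
      define h0 where "h0 = pi * sin (pi * v0 0) / 2"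
      have d0: "partial_deriv 0 (\<lambda>v. f (\<pi> (\<sigma> v))) v0 = velocity M (\<lambda>t'. H s t') t f * h0" if f: "f \<in> smooth_functions M" for f
      proof -
        have "partial_deriv 0 (\<lambda>v. f (\<pi> (\<sigma> v))) v0 = partial_deriv 0 (\<lambda>v. f (K v)) v0"
          by (rule partial_deriv_cong[OF S v0]) (simp_all add: \<sigma>(2))
        also have "\<dots> = deriv (\<lambda>\<theta>. f (H s (smooth_step \<theta>))) (v0 0)" by (simp add: partial_deriv_def K_def s_def)
        also have "\<dots> = velocity M (\<lambda>t'. H s t') t f * h0"
          unfolding t_def h0_def by (rule DERIV_imp_deriv[OF DERIV_path_reparam[OF DM sl2[OF st(1)] smooth_step_in DERIV_smooth_step f]])
        finally show ?thesis .
      qed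
      have d1: "partial_deriv 1 (\<lambda>v. f (\<pi> (\<sigma> v))) v0 = velocity M (\<lambda>s'. H s' t) s f * h1" if f: "f \<in> smooth_functions M" for f
      proof -
        have "partial_deriv 1 (\<lambda>v. f (\<pi> (\<sigma> v))) v0 = partial_deriv 1 (\<lambda>v. f (K v)) v0"
          by (rule partial_deriv_cong[OF S v0]) (simp_all add: \<sigma>(2))
        also have "\<dots> = deriv (\<lambda>\<theta>. f (H (smooth_step \<theta>) t)) (v0 (Suc 0))" by (simp add: partial_deriv_def K_def t_def)
        also have "\<dots> = velocity M (\<lambda>s'. H s' t) s f * h1"
          unfolding s_def h1_def by (rule DERIV_imp_deriv[OF DERIV_path_reparam[OF DM sl1[OF st(2)] smooth_step_in DERIV_smooth_step f]])
        finally show ?thesis .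
      qed
      \<comment> \<open>The step function multiplies the velocities of \<open>H\<close> by
        \<open>h0\<close> and \<open>h1\<close>. Where one factor is 0 the corresponding partial
        derivative vanishes and gives a trivial relation; otherwise the coefficients of the relation
        for \<open>H\<close> are divided by the factors.\<close>
      have "\<exists>\<alpha> \<beta>. (\<alpha> \<noteq> 0 \<or> \<beta> \<noteq> 0) \<and> (\<forall>f\<in>smooth_functions M.
          \<alpha> * partial_deriv 0 (\<lambda>v. f (\<pi> (\<sigma> v))) v0 + \<beta> * partial_deriv 1 (\<lambda>v. f (\<pi> (\<sigma> v))) v0 = 0)"
      proof -
        consider "h0 = 0" | "h1 = 0" | "h0 \<noteq> 0" "h1 \<noteq> 0" by blast
        then show ?thesis
        proof cases
          case 1 then show ?thesis using d0 by (intro exI[of _ 1] exI[of _ 0]) simp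
        next
          case 2 then show ?thesis using d1 by (intro exI[of _ 0] exI[of _ 1]) simp
        next
          case 3
          then show ?thesis using ab d0 d1 by (intro exI[of _ "b / h0"] exI[of _ "a / h1"]) (auto simp: add.commute)
        qed
      qed
      then obtain \<alpha> \<beta> where "\<alpha> \<noteq> 0 \<or> \<beta> \<noteq> 0" "\<And>f. f \<in> smooth_functions M \<Longrightarrow>
          \<alpha> * partial_deriv 0 (\<lambda>v. f (\<pi> (\<sigma> v))) v0 + \<beta> * partial_deriv 1 (\<lambda>v. f (\<pi> (\<sigma> v))) v0 = 0" by blast
      then show ?thesis
        using flat_along_dependent_directions[of ?S \<sigma> v0 \<alpha> \<beta> f] \<sigma>(1,3) v0 f by (simp add: numeral_2_eq_2)
    qed
    \<comment> \<open>On the initial line all lifts start at \<open>p\<close>, so the derivative of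
      \<open>\<sigma>\<close> in the deformation direction is 0 there.\<close>
    have start: "A (\<sigma> u) (plot_partial P 0 \<sigma> u) = (\<lambda>f. 0)" if u: "u \<in> N" for u
    proof -
      have uS: "u \<in> ?S" using inS[OF u, of 0] u1[OF u] N(4) by simp
      have "partial_deriv 0 (\<lambda>v. f (\<sigma> v)) u = 0" for f
      proof (rule partial_deriv_line_zero[OF S uS])
        fix t assume t: "u(0 := t) \<in> ?S"
        then have "(u(0 := t))(Suc 0 := 0) \<in> N" by (simp add: slab_def)
        moreover have "(u(0 := t))(Suc 0 := 0) = u(0 := t)" using u1[OF u] by (metis fun_upd_twist zero_neq_one One_nat_def)
        ultimately show "f (\<sigma> (u(0 := t))) = f p" using \<sigma>(4) by simp
      qed simp
      then have "plot_partial P 0 \<sigma> u = (\<lambda>f. 0)" by (auto simp: plot_partial_def comp_def)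
      then show ?thesis using form_zero[OF form is_plot_carrier[OF DP \<sigma>(1) uS]] by simp
    qed
    have along: "A (\<sigma> v) (plot_partial P 0 \<sigma> v) = (\<lambda>f. 0)" if v: "v \<in> ?S" for v
    proof
      fix f
      show "A (\<sigma> v) (plot_partial P 0 \<sigma> v) f = 0"
      proof (cases "f \<in> smooth_functions L")
        case True
        let ?B = "\<lambda>v. A (\<sigma> v) (plot_partial P 0 \<sigma> v) f"
        have B: "smooth_fun_on (Suc (Suc 0)) ?S ?B" by (rule A_coeff_smooth[OF \<sigma>(1) _ True]) simp
        have vN: "v(Suc 0 := 0) \<in> N" and v1: "v (Suc 0) \<in> {- r<..<1 + r}" using v by (auto simp: slab_def)
        have "\<exists>t. min 0 (v (Suc 0)) \<le> t \<and> t \<le> max 0 (v (Suc 0)) \<and> ?B (v(Suc 0 := v (Suc 0))) - ?B (v(Suc 0 := 0)) = 0 * (v (Suc 0) - 0)"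
        proof (rule MVT_segment)
          fix t assume "min 0 (v (Suc 0)) \<le> t" "t \<le> max 0 (v (Suc 0))"
          then have "t \<in> {- r<..<1 + r}" using v1 N(4) by (auto simp: min_def max_def split: if_splits)
          from slab_upd[OF v this] have vt: "v(Suc 0 := t) \<in> ?S" .
          have "DERIV (\<lambda>t. ?B (v(Suc 0 := t))) t :> partial_deriv (Suc 0) ?B (v(Suc 0 := t))"
            by (rule smooth_fun_on_DERIV_upd[OF B _ vt]) simp
          then show "DERIV (\<lambda>t. ?B (v(Suc 0 := t))) t :> 0" using flat[OF vt True] by simp
        qed
        then have "?B v = ?B (v(Suc 0 := 0))" by auto
        then show ?thesis using start[OF vN] by simp
      next
        case False
        \<comment> \<open>Values of \<open>A\<close> are derivations and are 0 on functions that are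
          not smooth, by the convention for tangent vectors.\<close>
        have "A (\<sigma> v) (plot_partial P 0 \<sigma> v) \<in> tangent_space L \<one>\<^bsub>G\<^esub>"
          using A_lie[OF is_plot_carrier[OF DP \<sigma>(1) v] plot_partial_tangent[OF DP \<sigma>(1) v]] by (simp add: lie_algebra_def)
        then show ?thesis using False by (simp add: tangent_space_def)
      qed
    qed
    have one: "1 \<in> {- r<..<1 + r}" using N(4) by auto
    define e where "e u = \<sigma> (u(Suc 0 := 1))" for u
    have e: "is_plot P (Suc 0) N e"
      unfolding e_def by (rule is_plot_comp[OF DP \<sigma>(1) smooth_on_insert_last[OF N(3)]]) (rule inS[OF _ one])
    have "plot_partial P 0 e u = plot_partial P 0 \<sigma> (u(Suc 0 := 1))" for u
    proof -
      have "(u(0 := t))(Suc 0 := 1) = (u(Suc 0 := 1))(0 := t)" for t by (simp add: fun_upd_twist)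
      then show ?thesis by (auto simp: plot_partial_def partial_deriv_def e_def)
    qed
    \<comment> \<open>The curve of end points is horizontal and lies over a constant path. So is the
      constant curve, and uniqueness of lifts identifies the two.\<close>
    then have eh: "horizontal 0 N e" using along[OF inS[OF _ one]] by (simp add: horizontal_def e_def)
    have e\<pi>: "\<pi> (e u) = \<gamma>0 1" if "u \<in> N" for u
      unfolding e_def \<sigma>(2)[OF inS[OF that one]] using H(5)[OF smooth_step_in] by (simp add: K_def)
    have Ee: "E t = e (vec1 t)" if "vec1 t \<in> N" for t
    proof -
      have "parallel_transport P \<pi> A (path (smooth_step t)) (\<sigma> ((vec1 t)(Suc 0 := 0))) = \<sigma> ((vec1 t)(Suc 0 := 1))"
      proof (rule transport_endpoint[OF N(4) \<sigma>(1,3) N(3) that path[OF smooth_step_in]])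
        show "\<pi> (\<sigma> ((vec1 t)(Suc 0 := s))) = path (smooth_step t) (smooth_step s)" if "s \<in> {- r<..<1 + r}" for s
          unfolding \<sigma>(2)[OF inS[OF \<open>vec1 t \<in> N\<close> that]] using smooth_step_in[of s] by (simp add: K_def path_def)
      qed
      then show ?thesis using u1[OF that] \<sigma>(4)[OF that] by (simp add: E_def e_def)
    qed
    obtain d where d: "d > 0" "cube (Suc 0) (vec1 t0) d \<subseteq> N" using open_euclD[OF N(3,1)] .
    have near: "vec1 t \<in> N" if "\<bar>t - t0\<bar> < d" for t using that d(2) by (auto simp: cube_def subset_iff)
    have pe: "e (vec1 t0) \<in> carrier P" by (rule is_plot_carrier[OF DP e N(1)])
    have "E t = E t0" if t: "\<bar>t - t0\<bar> < d" for t
    proof -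
      have "e ((vec1 t0)(0 := t)) = (\<lambda>_. e (vec1 t0)) ((vec1 t0)(0 := t))"
      proof (rule horizontal_lift_unique[of "Suc 0" N e 0 "\<lambda>_. e (vec1 t0)" t0 t, OF e eh is_plot_const[OF DP pe N(3)] horizontal_const[OF pe]])
        show "\<pi> (e (vec1 t0)) = \<pi> (e v)" if "v \<in> N" for v using e\<pi> that N(1) by simp
        show "(vec1 t0)(0 := s) \<in> N" if "min t0 t \<le> s" "s \<le> max t0 t" for s
          using near[of s] that t d(1) by (auto simp: min_def max_def abs_if split: if_splits)
      qed simp_all
      then show ?thesis using Ee near[OF t] N(1) by simp
    qed
    then show ?thesis using d(1) by blast
  qed
  have "E 0 = E 1"
  proof (rule Bolzano[of 0 1 "\<lambda>a b. E a = E b"])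
    fix x :: real
    obtain d where d: "d > 0" "\<And>t. \<bar>t - x\<bar> < d \<Longrightarrow> E t = E x" using loc by blast
    have "E a = E b" if "a \<le> x" "x \<le> b" "b - a < d" for a b
      using d(2)[of a] d(2)[of b] that by simp
    then show "\<exists>d>0. \<forall>a b. a \<le> x \<and> x \<le> b \<and> b - a < d \<longrightarrow> E a = E b" using d(1) by blast
  qed auto
  then show ?thesis by (simp add: E_def ext)
qed

text \<open>A plot of paths is a smooth map on a set that is closed in time; reparametrising time by
  the step function gives a plot on an open slab. Its horizontal lift is smooth in the parameters,
  and the transported point is the value of the lift at time 1.\<close>

lemma parallel_transport_smooth:
  assumes q: "(n, V, q) \<in> plots (path_space M)" and z: "z \<in> carrier P" "\<And>v. v \<in> V \<Longrightarrow> q v 0 = \<pi> z"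
  shows "is_plot P n V (\<lambda>v. parallel_transport P \<pi> A (q v) z)"
proof (rule is_plot_local[OF DP])
  fix u0 assume u0: "u0 \<in> V"
  have V: "open_eucl n V" and qs: "\<And>v. v \<in> V \<Longrightarrow> q v \<in> sitting_paths M" and
    sm: "smooth_from (Suc n) {x \<in> eucl (Suc n). x(n := 0) \<in> V \<and> x n \<in> {0..1}} M (\<lambda>x. q (x(n := 0)) (x n))"
    using q by (auto simp: path_space_def)
  have VE: "v \<in> eucl n" if "v \<in> V" for v using that open_eucl_subset[OF V] by blast
  have n0: "v(n := 0) = v" if "v \<in> V" for v using VE[OF that] by (simp add: in_eucl fun_upd_idem)
  let ?S = "slab n V UNIV"
  have S: "open_eucl (Suc n) ?S" by (intro open_eucl_slab V) simp
  let ?\<Gamma> = "\<lambda>v. q (v(n := 0)) (smooth_step (v n))"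
  have "is_plot M (Suc n) ?S (\<lambda>v. (\<lambda>x. q (x(n := 0)) (x n)) (v(n := smooth_step (v n))))"
  proof (rule smooth_from_comp[OF DM sm])
    show "smooth_on (Suc n) ?S (Suc n) (\<lambda>v. v(n := smooth_step (v n)))"
    proof (rule smooth_onI[OF S])
      show "smooth_fun_on (Suc n) ?S (\<lambda>v. (v(n := smooth_step (v n))) j)" for j
        by (cases "j = n") (auto intro!: smooth_step_coord smooth_fun_on_coord S)
    qed (auto simp: slab_def in_eucl)
  qed (auto simp: slab_def in_eucl smooth_step_range)
  then have \<Gamma>: "is_plot M (Suc n) ?S ?\<Gamma>" by simp
  have zc: "is_plot P n V (\<lambda>_. z)" by (rule is_plot_const[OF DP z(1) V])
  have z\<Gamma>: "\<pi> z = ?\<Gamma> u" if "u \<in> V" for u using z(2)[OF that] n0[OF that] VE[OF that] by (simp add: in_eucl)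
  obtain N \<sigma> r where N: "u0 \<in> N" "N \<subseteq> V" "open_eucl n N" "0 < r"
    and \<sigma>: "is_plot P (Suc n) (slab n N {- r<..<1 + r}) \<sigma>"
      "\<And>v. v \<in> slab n N {- r<..<1 + r} \<Longrightarrow> \<pi> (\<sigma> v) = ?\<Gamma> v" "horizontal n (slab n N {- r<..<1 + r}) \<sigma>"
      "\<And>u. u \<in> N \<Longrightarrow> \<sigma> u = z"
    by (rule horizontal_lift_exists[OF V \<Gamma> u0 zc z\<Gamma>], assumption, rule that)
  have inS: "u(n := s) \<in> slab n N {- r<..<1 + r}" if "u \<in> N" "s \<in> {- r<..<1 + r}" for u s
    using slabI[OF that(1) VE that(2)] that N(2) by blast
  have "is_plot P n N (\<lambda>u. \<sigma> (u(n := 1)))"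
    by (rule is_plot_comp[OF DP \<sigma>(1) smooth_on_insert_last[OF N(3)]]) (use inS N(4) in auto)
  moreover have "\<sigma> (u(n := 1)) = parallel_transport P \<pi> A (q u) z" if u: "u \<in> N" for u
  proof -
    have uV: "u \<in> V" using u N(2) by blast
    have "parallel_transport P \<pi> A (q u) (\<sigma> (u(n := 0))) = \<sigma> (u(n := 1))"
    proof (rule transport_endpoint[OF N(4) \<sigma>(1,3) N(3) u qs[OF uV]])
      show "\<pi> (\<sigma> (u(n := s))) = q u (smooth_step s)" if "s \<in> {- r<..<1 + r}" for s
        unfolding \<sigma>(2)[OF inS[OF u that]] using n0[OF uV] by simp
    qed
    then show ?thesis using n0[OF uV] \<sigma>(4)[OF u] by simp
  qed
  ultimately have "is_plot P n N (\<lambda>v. parallel_transport P \<pi> A (q v) z)"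
    using is_plot_cong[of N "\<lambda>u. \<sigma> (u(n := 1))" "\<lambda>v. parallel_transport P \<pi> A (q v) z" P n] by blast
  then show "\<exists>W. u0 \<in> W \<and> W \<subseteq> V \<and> is_plot P n W (\<lambda>v. parallel_transport P \<pi> A (q v) z)" using N by blast
qed

end

section \<open>Holonomy as a functor to torsors\<close>

text \<open>A fibre of \<open>P\<close> carries only the subspace diffeology; this lemma gives it an
  atlas by transport from \<open>G\<close> along a smooth bijection with smooth inverse.\<close>

lemma manifold_transfer:
  assumes X: "manifold X" and Y: "diffeology Y" and \<psi>: "smooth_map X Y \<psi>" and \<theta>: "smooth_map Y X \<theta>"
    and \<theta>\<psi>: "\<And>x. x \<in> carrier X \<Longrightarrow> \<theta> (\<psi> x) = x" and \<psi>\<theta>: "\<And>y. y \<in> carrier Y \<Longrightarrow> \<psi> (\<theta> y) = y"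
  shows "manifold Y"
proof -
  have DX: "diffeology X" by (rule manifold_diffeology[OF X])
  obtain n T \<A> where at: "smooth_atlas n T \<A>" "carrier X = topspace T" "plots X = atlas_plots n T \<A>"
    using X unfolding manifold_def by blast
  have \<psi>c: "\<psi> x \<in> carrier Y" if "x \<in> carrier X" for x using \<psi> that by (auto simp: smooth_map_def)
  have \<theta>c: "\<theta> y \<in> carrier X" if "y \<in> carrier Y" for y using \<theta> that by (auto simp: smooth_map_def)
  \<comment> \<open>The topology is pulled back along \<open>\<theta>\<close>, which makes
    \<open>\<theta>\<close> and \<open>\<psi>\<close> mutually inverse homeomorphisms.\<close>
  define T' where "T' = pullback_topology (carrier Y) \<theta> T"
  define \<B> where "\<B> = (\<lambda>(W, c). (\<psi> ` W, c \<circ> \<theta>)) ` \<A>"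
  have top: "topspace T' = carrier Y"
    using \<theta>c at(2) by (auto simp: T'_def topspace_pullback_topology)
  have cont\<theta>: "continuous_map T' T \<theta>"
    using continuous_map_pullback[OF continuous_map_id, of "carrier Y" \<theta> T] by (simp add: T'_def)
  have cont\<psi>: "continuous_map T T' \<psi>"
    unfolding T'_def
  proof (rule continuous_map_pullback')
    show "continuous_map T T (\<theta> \<circ> \<psi>)"
      by (rule continuous_map_eq[OF continuous_map_id]) (use \<theta>\<psi> at(2) in simp)
  qed (use \<psi>c at(2) in auto)
  have maps: "homeomorphic_maps T' T \<theta> \<psi>"
    using cont\<theta> cont\<psi> \<theta>\<psi> \<psi>\<theta> at(2) top by (simp add: homeomorphic_maps_def)
  have hom: "homeomorphic_map T' T \<theta>" using maps by (auto simp: homeomorphic_map_maps)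
  then have hs: "T' homeomorphic_space T" by (rule homeomorphic_map_imp_homeomorphic_space)
  have WX: "W \<subseteq> carrier X" "openin T W" "openin (Euclidean_space n) (c ` W)"
      "homeomorphic_map (subtopology T W) (subtopology (Euclidean_space n) (c ` W)) c" "inj_on c W" if "(W, c) \<in> \<A>" for W c
  proof -
    show o: "openin T W" "openin (Euclidean_space n) (c ` W)"
      and h: "homeomorphic_map (subtopology T W) (subtopology (Euclidean_space n) (c ` W)) c"
      using at(1) that by (auto simp: smooth_atlas_def)
    show W: "W \<subseteq> carrier X" using openin_subset[OF o(1)] at(2) by simp
    show "inj_on c W" using homeomorphic_imp_injective_map[OF h] W at(2) by (simp add: Int_absorb1)
  qed
  have im: "\<psi> ` W = \<theta> -` W \<inter> carrier Y" if "W \<subseteq> carrier X" for W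
    using that \<psi>c \<theta>\<psi> \<psi>\<theta> by (auto simp: image_iff) (metis \<psi>\<theta>)
  have cim: "(c \<circ> \<theta>) ` (\<psi> ` W) = c ` W" if "W \<subseteq> carrier X" for W and c :: "'a \<Rightarrow> nat \<Rightarrow> real"
    using that \<theta>\<psi> by (auto simp: image_iff subset_iff)
  have atlas: "smooth_atlas n T' \<B>"
    unfolding smooth_atlas_def
  proof (intro conjI ballI)
    show "Hausdorff_space T'" "second_countable T'"
      using homeomorphic_Hausdorff_space[OF hs] homeomorphic_space_second_countability[OF hs] at(1) by (auto simp: smooth_atlas_def)
    have "(\<Union>(W, c)\<in>\<B>. W) = \<psi> ` (\<Union>(W, c)\<in>\<A>. W)" by (auto simp: \<B>_def)
    also have "\<dots> = \<psi> ` carrier X" using at by (simp add: smooth_atlas_def)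
    also have "\<dots> = carrier Y" using im[of "carrier X"] \<theta>c by auto
    finally show "(\<Union>(W, c)\<in>\<B>. W) = topspace T'" using top by simp
  next
    fix b assume "b \<in> \<B>"
    then obtain W c where b: "b = (\<psi> ` W, c \<circ> \<theta>)" and Wc: "(W, c) \<in> \<A>" by (auto simp: \<B>_def)
    have "openin T' (\<psi> ` W)" using WX(2)[OF Wc] im[OF WX(1)[OF Wc]] by (auto simp: T'_def openin_pullback_topology)
    moreover have "homeomorphic_map (subtopology T' (\<psi> ` W)) (subtopology T W) \<theta>"
    proof (rule homeomorphic_map_subtopologies[OF hom])
      show "\<theta> ` (topspace T' \<inter> \<psi> ` W) = topspace T \<inter> W"
      proof -
        have W: "topspace T \<inter> W = W" using WX(1)[OF Wc] at(2) by auto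
        have "topspace T' \<inter> \<psi> ` W = \<psi> ` W" unfolding top im[OF WX(1)[OF Wc]] by blast
        moreover have "\<theta> ` \<psi> ` W = W"
        proof -
          have "\<theta> (\<psi> x) = x" if "x \<in> W" for x using that WX(1)[OF Wc] \<theta>\<psi> by blast
          then have "(\<lambda>x. \<theta> (\<psi> x)) ` W = (\<lambda>x. x) ` W" by (rule image_cong[OF refl])
          then show ?thesis by (simp add: image_image)
        qed
        ultimately show ?thesis using W by simp
      qed
    qed
    then have "homeomorphic_map (subtopology T' (\<psi> ` W)) (subtopology (Euclidean_space n) (c ` W)) (c \<circ> \<theta>)"
      using WX(4)[OF Wc] by (rule homeomorphic_map_compose)
    ultimately show "case b of (W, c) \<Rightarrow> openin T' W \<and> openin (Euclidean_space n) (c ` W) \<and>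
        homeomorphic_map (subtopology T' W) (subtopology (Euclidean_space n) (c ` W)) c"
      unfolding b using WX(3)[OF Wc] by (simp only: cim[OF WX(1)[OF Wc]] prod.case simp_thms)
    show "case b of (W, c) \<Rightarrow> \<forall>(W', c')\<in>\<B>. smooth_on n (c ` (W \<inter> W')) n (c' \<circ> inv_into W c)"
      unfolding b prod.case
    proof (rule ballI)
    fix b' assume "b' \<in> \<B>"
    then obtain W' c' where b': "b' = (\<psi> ` W', c' \<circ> \<theta>)" and Wc': "(W', c') \<in> \<A>" by (auto simp: \<B>_def)
    have inj\<psi>: "inj_on \<psi> (carrier X)" using \<theta>\<psi> by (metis inj_onI)
    have "\<psi> ` W \<inter> \<psi> ` W' = \<psi> ` (W \<inter> W')" using inj_on_image_Int[OF inj\<psi> WX(1)[OF Wc] WX(1)[OF Wc']] by simp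
    then have dom: "(c \<circ> \<theta>) ` (\<psi> ` W \<inter> \<psi> ` W') = c ` (W \<inter> W')" using cim[of "W \<inter> W'" c] WX(1)[OF Wc] by auto
    have sm: "smooth_on n (c ` (W \<inter> W')) n (c' \<circ> inv_into W c)" using at(1) Wc Wc' by (auto simp: smooth_atlas_def)
    have "(c' \<circ> \<theta> \<circ> inv_into (\<psi> ` W) (c \<circ> \<theta>)) x = (c' \<circ> inv_into W c) x" if x: "x \<in> c ` (W \<inter> W')" for x
    proof -
      obtain w where w: "w \<in> W" "x = c w" using x by auto
      have "inj_on (c \<circ> \<theta>) (\<psi> ` W)"
        using WX(5)[OF Wc] WX(1)[OF Wc] \<theta>\<psi> by (auto simp: inj_on_def subset_iff)
      then have "inv_into (\<psi> ` W) (c \<circ> \<theta>) ((c \<circ> \<theta>) (\<psi> w)) = \<psi> w" using w(1) by (intro inv_into_f_f) auto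
      moreover have "\<theta> (\<psi> w) = w" using w(1) WX(1)[OF Wc] \<theta>\<psi> by blast
      ultimately show ?thesis using inv_into_f_f[OF WX(5)[OF Wc] w(1)] w(2) by simp
    qed
    then have "smooth_on n (c ` (W \<inter> W')) n (c' \<circ> \<theta> \<circ> inv_into (\<psi> ` W) (c \<circ> \<theta>))"
      using sm smooth_on_cong[of "c ` (W \<inter> W')" "c' \<circ> \<theta> \<circ> inv_into (\<psi> ` W) (c \<circ> \<theta>)" "c' \<circ> inv_into W c" n n] by blast
    then show "case b' of (W', c') \<Rightarrow> smooth_on n ((c \<circ> \<theta>) ` (\<psi> ` W \<inter> W')) n (c' \<circ> inv_into (\<psi> ` W) (c \<circ> \<theta>))"
      unfolding b' prod.case dom .
    qed
  qed
  \<comment> \<open>Smoothness of \<open>\<psi>\<close> and \<open>\<theta>\<close> reduces plots of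
    \<open>Y\<close> to plots of \<open>X\<close>, and these are described by the given
    atlas.\<close>
  have plots: "(k, U, p) \<in> plots Y \<longleftrightarrow> (k, U, p) \<in> atlas_plots n T' \<B>" if p: "p \<in> U \<rightarrow>\<^sub>E carrier Y" for k U p
  proof -
    have pY: "p u \<in> carrier Y" if "u \<in> U" for u using p that by auto
    have "(k, U, p) \<in> plots Y \<longleftrightarrow> is_plot Y k U p" using PiE_restrict[OF p] by (simp add: is_plot_def)
    also have "\<dots> \<longleftrightarrow> is_plot X k U (\<lambda>u. \<theta> (p u))"
    proof
      assume "is_plot X k U (\<lambda>u. \<theta> (p u))"
      then have "is_plot Y k U (\<lambda>u. \<psi> (\<theta> (p u)))" by (rule is_plot_image[OF \<psi>])
      then show "is_plot Y k U p" using is_plot_cong[of U "\<lambda>u. \<psi> (\<theta> (p u))" p Y k] \<psi>\<theta> pY by simp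
    qed (rule is_plot_image[OF \<theta>])
    also have "\<dots> \<longleftrightarrow> (k, U, restrict (\<lambda>u. \<theta> (p u)) U) \<in> atlas_plots n T \<A>" by (simp add: is_plot_def at(3))
    also have "\<dots> \<longleftrightarrow> (k, U, p) \<in> atlas_plots n T' \<B>"
    proof -
      have 1: "continuous_map (subtopology (Euclidean_space k) U) T (restrict (\<lambda>u. \<theta> (p u)) U) \<longleftrightarrow>
          continuous_map (subtopology (Euclidean_space k) U) T' p" (is "?l \<longleftrightarrow> ?r") if U: "openin (Euclidean_space k) U"
      proof -
        have tU: "topspace (subtopology (Euclidean_space k) U) = U" using openin_subset[OF U] by auto
        show ?thesis
        proof
          assume ?l
          then have "continuous_map (subtopology (Euclidean_space k) U) T' (\<psi> \<circ> restrict (\<lambda>u. \<theta> (p u)) U)"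
            using cont\<psi> by (rule continuous_map_compose)
          then show ?r by (rule continuous_map_eq) (use tU \<psi>\<theta> pY in simp)
        next
          assume ?r
          then have "continuous_map (subtopology (Euclidean_space k) U) T (\<theta> \<circ> p)"
            using cont\<theta> by (rule continuous_map_compose)
          then show ?l by (rule continuous_map_eq) (use tU in simp)
        qed
      qed
      have 2: "smooth_on k {u \<in> U. restrict (\<lambda>u. \<theta> (p u)) U u \<in> W} n (c \<circ> restrict (\<lambda>u. \<theta> (p u)) U) \<longleftrightarrow>
          smooth_on k {u \<in> U. p u \<in> \<psi> ` W} n ((c \<circ> \<theta>) \<circ> p)" if Wc: "(W, c) \<in> \<A>" for W c
      proof -
        have "{u \<in> U. p u \<in> \<psi> ` W} = {u \<in> U. restrict (\<lambda>u. \<theta> (p u)) U u \<in> W}"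
          using im[OF WX(1)[OF Wc]] pY by auto
        moreover have "smooth_on k {u \<in> U. p u \<in> \<psi> ` W} n (c \<circ> restrict (\<lambda>u. \<theta> (p u)) U) \<longleftrightarrow>
            smooth_on k {u \<in> U. p u \<in> \<psi> ` W} n ((c \<circ> \<theta>) \<circ> p)"
          by (rule smooth_on_cong) simp
        ultimately show ?thesis by simp
      qed
      have "restrict (\<lambda>u. \<theta> (p u)) U \<in> U \<rightarrow>\<^sub>E topspace T" "p \<in> U \<rightarrow>\<^sub>E topspace T'"
        using \<theta>c pY at(2) p top by auto
      note P = this
      have "(\<forall>(W, c)\<in>\<A>. smooth_on k {u \<in> U. restrict (\<lambda>u. \<theta> (p u)) U u \<in> W} n (c \<circ> restrict (\<lambda>u. \<theta> (p u)) U)) \<longleftrightarrow>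
          (\<forall>(W, c)\<in>\<A>. smooth_on k {u \<in> U. p u \<in> \<psi> ` W} n ((c \<circ> \<theta>) \<circ> p))" (is "Ball \<A> ?f = Ball \<A> ?g")
      proof (rule ball_cong[OF refl])
        show "?f t = ?g t" if "t \<in> \<A>" for t by (cases t) (use 2 that in \<open>simp only: prod.case\<close>)
      qed
      also have "\<dots> \<longleftrightarrow> (\<forall>(W, c)\<in>\<B>. smooth_on k {u \<in> U. p u \<in> W} n (c \<circ> p))" unfolding \<B>_def by (simp add: case_prod_beta)
      finally have 3: "(\<forall>(W, c)\<in>\<A>. smooth_on k {u \<in> U. restrict (\<lambda>u. \<theta> (p u)) U u \<in> W} n (c \<circ> restrict (\<lambda>u. \<theta> (p u)) U)) \<longleftrightarrow>
          (\<forall>(W, c)\<in>\<B>. smooth_on k {u \<in> U. p u \<in> W} n (c \<circ> p))" .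
      show ?thesis
        unfolding atlas_plots_def mem_Collect_eq prod.case by (simp only: 1 3 P simp_thms cong: conj_cong)
    qed
    finally show ?thesis .
  qed
  have "plots Y = atlas_plots n T' \<B>"
  proof (rule Set.set_eqI)
    fix t :: "'c plot"
    obtain k U p where t: "t = (k, U, p)" by (metis prod_cases3)
    have "p \<in> U \<rightarrow>\<^sub>E carrier Y" if "t \<in> plots Y \<or> t \<in> atlas_plots n T' \<B>"
      using that Y top unfolding t by (auto simp: diffeology_def atlas_plots_def)
    then show "t \<in> plots Y \<longleftrightarrow> t \<in> atlas_plots n T' \<B>" using plots unfolding t by blast
  qed
  then show ?thesis using Y atlas top unfolding manifold_def by metis
qed

lemma fibre_simps [simp]:
  "carrier (fibre P \<pi> x) = {p \<in> carrier P. \<pi> p = x}" "act (fibre P \<pi> x) = act P"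
  by (simp_all add: fibre_def Let_def)

lemma is_plot_fibre:
  "is_plot (fibre P \<pi> x) n U q \<longleftrightarrow> is_plot P n U q \<and> (\<forall>u\<in>U. q u \<in> carrier P \<and> \<pi> (q u) = x)"
  using is_plot_subspace[of P "{p \<in> carrier P. \<pi> p = x}" n U q] by (simp add: is_plot_def fibre_def Let_def)

lemma diffeology_fibre:
  assumes "diffeology P"
  shows "diffeology (fibre P \<pi> x)"
proof -
  have "diffeology (subspace_dspace P {p \<in> carrier P. \<pi> p = x})" by (rule diffeology_subspace[OF assms]) auto
  moreover have "carrier (fibre P \<pi> x) = carrier (subspace_dspace P {p \<in> carrier P. \<pi> p = x})"
    "plots (fibre P \<pi> x) = plots (subspace_dspace P {p \<in> carrier P. \<pi> p = x})"
    by (simp_all add: fibre_def Let_def subspace_dspace_def)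
  ultimately show ?thesis by (simp only: diffeology_def)
qed

text \<open>Works with pairs of plots directly and so does not presuppose that the product has been
  shown to be a diffeology.\<close>

lemma smooth_map_productI:
  assumes "\<And>x y. x \<in> carrier X \<Longrightarrow> y \<in> carrier Y \<Longrightarrow> F (x, y) \<in> carrier Z"
    and "\<And>n U p q. is_plot X n U p \<Longrightarrow> is_plot Y n U q \<Longrightarrow> is_plot Z n U (\<lambda>u. F (p u, q u))"
  shows "smooth_map (product_dspace X Y) Z F"
  unfolding smooth_map_def
proof (intro conjI ballI)
  show "F \<in> carrier (product_dspace X Y) \<rightarrow> carrier Z" using assms(1) by (auto simp: product_dspace_def)
next
  fix t assume t: "t \<in> plots (product_dspace X Y)"
  obtain n U p where tp: "t = (n, U, p)" by (metis prod_cases3)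
  have "is_plot X n U (\<lambda>u. fst (p u))" "is_plot Y n U (\<lambda>u. snd (p u))"
    using t unfolding tp by (auto simp: product_dspace_def is_plot_def comp_def)
  from assms(2)[OF this] show "case t of (n, U, p) \<Rightarrow> (n, U, restrict (F \<circ> p) U) \<in> plots Z"
    by (simp add: tp is_plot_def comp_def)
qed

text \<open>Torsor maps are compared as functions on the whole type, so the default value off the
  fibre takes part in the equations below.\<close>

lemma parallel_transport_outside: "p \<notin> carrier (fibre P \<pi> (\<gamma> 0)) \<Longrightarrow> parallel_transport P \<pi> A \<gamma> p = undefined"
  by (simp only: parallel_transport_def restrict_apply if_False)

section \<open>Arrows of the thin groupoid and their representatives\<close>

lemma arrowE:
  assumes "a \<in> Arr (thin_groupoid M)"
  obtains \<gamma> where "\<gamma> \<in> sitting_paths M" "a = thin_rel M `` {\<gamma>}"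
  using assms by (auto simp: thin_groupoid_def thin_arrows_def quotient_dspace_def path_space_def quotient_def)

lemma thin_relD:
  assumes "(\<gamma>, \<tau>) \<in> thin_rel M"
  shows "\<gamma> \<in> sitting_paths M" "\<tau> \<in> sitting_paths M" "\<gamma> 0 = \<tau> 0" "\<gamma> 1 = \<tau> 1"
  using assms by (auto simp: thin_rel_def)

text \<open>Source and target are defined by \<open>the_elem\<close> of an image; the image is a
  singleton because related paths have the same end points.\<close>

lemma arrow_endpoints:
  assumes a: "a \<in> Arr (thin_groupoid M)" and \<gamma>: "\<gamma> \<in> a"
  shows "\<gamma> \<in> sitting_paths M" "Src (thin_groupoid M) a = \<gamma> 0" "Tgt (thin_groupoid M) a = \<gamma> 1"
proof -
  obtain \<tau> where \<tau>: "\<tau> \<in> sitting_paths M" "a = thin_rel M `` {\<tau>}" by (rule arrowE[OF a])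
  have rel: "(\<tau>, \<omega>) \<in> thin_rel M" if "\<omega> \<in> a" for \<omega> using that \<tau>(2) by blast
  show "\<gamma> \<in> sitting_paths M" by (rule thin_relD(2)[OF rel[OF \<gamma>]])
  have "\<omega> 0 = \<gamma> 0" "\<omega> 1 = \<gamma> 1" if "\<omega> \<in> a" for \<omega>
    using thin_relD(3,4)[OF rel[OF that]] thin_relD(3,4)[OF rel[OF \<gamma>]] by simp_all
  note same = this
  have "(\<lambda>\<omega>. \<omega> 0) ` a = (\<lambda>_. \<gamma> 0) ` a" by (rule image_cong[OF refl same(1)])
  moreover have "(\<lambda>\<omega>. \<omega> 1) ` a = (\<lambda>_. \<gamma> 1) ` a" by (rule image_cong[OF refl same(2)])
  ultimately have "(\<lambda>\<omega>. \<omega> 0) ` a = {\<gamma> 0}" "(\<lambda>\<omega>. \<omega> 1) ` a = {\<gamma> 1}" unfolding image_constant[OF \<gamma>] .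
  then show "Src (thin_groupoid M) a = \<gamma> 0" "Tgt (thin_groupoid M) a = \<gamma> 1" by (simp_all add: thin_groupoid_def)
qed

lemma concat_path_endpoints [simp]: "concat_path \<gamma> \<tau> 0 = \<tau> 0" "concat_path \<gamma> \<tau> 1 = \<gamma> 1"
  by (simp_all add: concat_path_def)

context bundle_connection begin

lemma fibre_nonempty:
  assumes x: "x \<in> carrier M"
  obtains p where "p \<in> carrier P" "\<pi> p = x"
proof (rule local_section[OF x])
  fix U S assume U: "x \<in> U" and S: "\<And>y. y \<in> U \<Longrightarrow> \<pi> (S y) = y"
    "\<And>n V \<Gamma>. is_plot M n V \<Gamma> \<Longrightarrow> (\<And>v. v \<in> V \<Longrightarrow> \<Gamma> v \<in> U) \<Longrightarrow> is_plot P n V (\<lambda>v. S (\<Gamma> v))"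
  have "is_plot P (Suc 0) (eucl (Suc 0)) (\<lambda>_. S x)" by (rule S(2)[OF is_plot_const[OF DM x open_eucl_eucl] U])
  from is_plot_carrier[OF DP this, of "vec1 0"] show thesis by (intro that[of "S x"] S(1) U) simp_all
qed

text \<open>The orbit map of a point \<open>p0\<close> and division by \<open>p0\<close> identify
  the fibre with \<open>G\<close>, which supplies the manifold structure. The inverse of
  \<open>(p, g) \<mapsto> (p, p g)\<close> is given by the division map and is smooth because
  division is.\<close>

lemma torsor_fibre:
  assumes x: "x \<in> carrier M"
  shows "torsor G (fibre P \<pi> x)"
proof -
  let ?F = "fibre P \<pi> x"
  let ?\<Phi> = "\<lambda>(p, g). (p, act ?F p g)"
  have DF: "diffeology ?F" by (rule diffeology_fibre[OF DP])
  obtain p0 where p0: "p0 \<in> carrier P" "\<pi> p0 = x" by (rule fibre_nonempty[OF x])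
  have plot_F: "is_plot ?F n U (\<lambda>u. act P (p u) (g u))" if "is_plot ?F n U p" "is_plot L n U g" for n U p g
    using plot_act[of n U p g] plot_G[of n U g] that unfolding is_plot_fibre by auto
  have diff_F: "is_plot L n U (\<lambda>u. \<delta> (p u) (q u))" if "is_plot ?F n U p" "is_plot ?F n U q" for n U p q
    by (rule plot_diff) (use that in \<open>auto simp: is_plot_fibre\<close>)
  have const_F: "is_plot ?F n U (\<lambda>_. p0)" if "open_eucl n U" for n U
    using is_plot_const[OF DP p0(1) that] p0 by (simp add: is_plot_fibre)
  have "manifold ?F"
  proof (rule manifold_transfer[OF L DF, of "act P p0" "\<delta> p0"])
    show "smooth_map L ?F (act P p0)"
    proof (rule smooth_mapI[OF DL])
      show "is_plot ?F n U (\<lambda>u. act P p0 (g u))" if "is_plot L n U g" for n U g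
        by (rule plot_F[OF const_F[OF is_plot_open[OF DL that]] that])
    qed (use p0 in simp)
    show "smooth_map ?F L (\<delta> p0)"
    proof (rule smooth_mapI[OF DF])
      show "is_plot L n U (\<lambda>u. \<delta> p0 (q u))" if "is_plot ?F n U q" for n U q
        by (rule diff_F[OF const_F[OF is_plot_open[OF DF that]] that])
    qed (use p0 diff_carrier in simp)
    show "\<delta> p0 (act P p0 g) = g" if "g \<in> carrier L" for g using diff_eqI[OF p0(1)] that by simp
    show "act P p0 (\<delta> p0 p) = p" if "p \<in> carrier ?F" for p using act_diff[OF p0(1)] that p0(2) by simp
  qed
  moreover have "smooth_right_action G ?F"
    unfolding smooth_right_action_def
  proof (intro conjI)
    show "smooth_map (product_dspace ?F L) ?F (\<lambda>(p, g). act ?F p g)"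
      by (rule smooth_map_productI) (auto intro: plot_F)
  qed (use act_mult in auto)
  moreover have "g = \<one>\<^bsub>G\<^esub>" if "p \<in> carrier P" "g \<in> carrier G" "act P p g = p" for p g
    using diff_eqI[OF that] diff_eqI[OF that(1) one_closed act_one[OF that(1)]] by simp
  moreover have "\<exists>g\<in>carrier G. act P p g = q" if "p \<in> carrier P" "q \<in> carrier P" "\<pi> q = \<pi> p" for p q
    using act_diff[OF that] diff_carrier[OF that] by blast
  moreover have "diffeomorphism (product_dspace ?F L) (product_dspace ?F ?F) ?\<Phi>"
    unfolding diffeomorphism_def
  proof (intro conjI)
    let ?C = "carrier (product_dspace ?F L)"
    have C: "(p, g) \<in> ?C \<longleftrightarrow> p \<in> carrier P \<and> \<pi> p = x \<and> g \<in> carrier G" for p g by (auto simp: product_dspace_def)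
    have inj: "inj_on ?\<Phi> ?C"
    proof (rule inj_onI)
      fix a b assume ab: "a \<in> ?C" "b \<in> ?C" "?\<Phi> a = ?\<Phi> b"
      obtain p g q h where eq: "a = (p, g)" "b = (q, h)" by (metis surj_pair)
      then have "p \<in> carrier P" "g \<in> carrier G" "h \<in> carrier G" "q = p" "act P p g = act P p h" using ab C by auto
      then show "a = b" using diff_eqI[of p g] diff_eqI[of p h] eq by metis
    qed
    have inv: "(p, \<delta> p q) \<in> ?C" "?\<Phi> (p, \<delta> p q) = (p, q)" if "p \<in> carrier ?F" "q \<in> carrier ?F" for p q
      using that diff_carrier[of p q] act_diff[of p q] by (auto simp: C)
    have inv_into: "inv_into ?C ?\<Phi> (p, q) = (p, \<delta> p q)" if "p \<in> carrier ?F" "q \<in> carrier ?F" for p q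
      by (rule inv_into_f_eq[OF inj inv[OF that]])
    have F_F: "carrier (product_dspace ?F ?F) = carrier ?F \<times> carrier ?F" by (simp add: product_dspace_def)
    have "?\<Phi> ` ?C = carrier (product_dspace ?F ?F)"
    proof
      show "?\<Phi> ` ?C \<subseteq> carrier (product_dspace ?F ?F)" by (auto simp: product_dspace_def)
      show "carrier (product_dspace ?F ?F) \<subseteq> ?\<Phi> ` ?C"
      proof
        fix t assume "t \<in> carrier (product_dspace ?F ?F)"
        then obtain p q where t: "t = (p, q)" "p \<in> carrier ?F" "q \<in> carrier ?F" unfolding F_F by blast
        show "t \<in> ?\<Phi> ` ?C" unfolding t(1)
          by (rule image_eqI[of "(p, q)" ?\<Phi> "(p, \<delta> p q)" ?C]) (rule inv(2)[OF t(2,3), symmetric], rule inv(1)[OF t(2,3)])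
      qed
    qed
    then show "bij_betw ?\<Phi> ?C (carrier (product_dspace ?F ?F))" using inj by (simp add: bij_betw_def)
    show "smooth_map (product_dspace ?F L) (product_dspace ?F ?F) ?\<Phi>"
      by (rule smooth_map_productI) (auto simp: F_F is_plot_product intro: plot_F)
    show "smooth_map (product_dspace ?F ?F) (product_dspace ?F L) (inv_into ?C ?\<Phi>)"
    proof (rule smooth_map_productI)
      show "inv_into ?C ?\<Phi> (p, q) \<in> ?C" if "p \<in> carrier ?F" "q \<in> carrier ?F" for p q
        unfolding inv_into[OF that] by (rule inv(1)[OF that])
      fix n U p q assume p: "is_plot ?F n U p" and q: "is_plot ?F n U q"
      have "is_plot (product_dspace ?F L) n U (\<lambda>u. (p u, \<delta> (p u) (q u)))"
        using p diff_F[OF p q] by (simp add: is_plot_product)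
      moreover have "inv_into ?C ?\<Phi> (p u, q u) = (p u, \<delta> (p u) (q u))" if "u \<in> U" for u
        by (rule inv_into[OF is_plot_carrier[OF DF p that] is_plot_carrier[OF DF q that]])
      ultimately show "is_plot (product_dspace ?F L) n U (\<lambda>u. inv_into ?C ?\<Phi> (p u, q u))"
        using is_plot_cong[of U "\<lambda>u. inv_into ?C ?\<Phi> (p u, q u)" "\<lambda>u. (p u, \<delta> (p u) (q u))"] by blast
    qed
  qed
  ultimately show ?thesis using p0 unfolding torsor_def by auto
qed

lemma transport_map_thin:
  assumes rel: "(\<gamma>, \<tau>) \<in> thin_rel M"
  shows "transport_map P \<pi> A \<gamma> = transport_map P \<pi> A \<tau>"
proof -
  note ends = thin_relD(3,4)[OF rel]
  have "parallel_transport P \<pi> A \<gamma> p = parallel_transport P \<pi> A \<tau> p" for p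
  proof (cases "p \<in> carrier (fibre P \<pi> (\<gamma> 0))")
    case True
    then show ?thesis using parallel_transport_thin[OF rel, of p] by simp
  next
    case False
    then show ?thesis
      using parallel_transport_outside[of p P \<pi> \<gamma> A] parallel_transport_outside[of p P \<pi> \<tau> A] by (simp only: ends(1) not_False_eq_True simp_thms)
  qed
  then show ?thesis using ends by (simp add: transport_map_def fun_eq_iff)
qed

text \<open>Every element of the class is related to one fixed path \<open>\<tau>\<close>, so both
  the path selected by \<open>SOME\<close> and \<open>\<gamma>\<close> have the transport map of
  \<open>\<tau>\<close>.\<close>

lemma hol_eq:
  assumes a: "a \<in> Arr (thin_groupoid M)" and \<gamma>: "\<gamma> \<in> a"
  shows "hol P \<pi> A a = transport_map P \<pi> A \<gamma>"
proof -
  obtain \<tau> where \<tau>: "a = thin_rel M `` {\<tau>}" by (rule arrowE[OF a])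
  have "transport_map P \<pi> A \<omega> = transport_map P \<pi> A \<tau>" if "\<omega> \<in> a" for \<omega>
    using transport_map_thin[of \<tau> \<omega>] that \<tau> by simp
  then show ?thesis using someI[of "\<lambda>\<gamma>. \<gamma> \<in> a", OF \<gamma>] \<gamma> unfolding hol_def by metis
qed

lemma arrow_class:
  assumes "\<gamma> \<in> sitting_paths M"
  shows "thin_rel M `` {\<gamma>} \<in> Arr (thin_groupoid M)" "\<gamma> \<in> thin_rel M `` {\<gamma>}"
  using thin_rel_refl[OF DM assms] assms
  by (auto simp: thin_groupoid_def thin_arrows_def quotient_dspace_def path_space_def quotient_def)

lemma arrow_representative:
  assumes "a \<in> Arr (thin_groupoid M)"
  obtains \<gamma> where "\<gamma> \<in> a"
  using arrowE[OF assms] arrow_class(2) by metis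

lemma transport_map_arrow:
  assumes \<gamma>: "\<gamma> \<in> sitting_paths M"
  shows "transport_map P \<pi> A \<gamma> \<in> Arr (torsor_groupoid G)"
proof -
  have "torsor G (fibre P \<pi> (\<gamma> 0))" "torsor G (fibre P \<pi> (\<gamma> 1))"
    using torsor_fibre sitting_pathsD(2)[OF \<gamma>] by simp_all
  moreover have "parallel_transport P \<pi> A \<gamma> \<in> carrier (fibre P \<pi> (\<gamma> 0)) \<rightarrow>\<^sub>E carrier (fibre P \<pi> (\<gamma> 1))"
    using parallel_transport_fibre[OF \<gamma>] by (auto simp: parallel_transport_def)
  moreover have "equivariant G (fibre P \<pi> (\<gamma> 0)) (fibre P \<pi> (\<gamma> 1)) (parallel_transport P \<pi> A \<gamma>)"
    using parallel_transport_equivariant[OF \<gamma>] by (simp add: equivariant_def)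
  ultimately show ?thesis unfolding torsor_groupoid_def transport_map_def by auto
qed

lemma transport_map_concat:
  assumes \<gamma>: "\<gamma> \<in> sitting_paths M" and \<tau>: "\<tau> \<in> sitting_paths M" and eq: "\<tau> 1 = \<gamma> 0"
  shows "transport_map P \<pi> A (concat_path \<gamma> \<tau>) = Comp (torsor_groupoid G) (transport_map P \<pi> A \<gamma>) (transport_map P \<pi> A \<tau>)"
proof -
  have "parallel_transport P \<pi> A (concat_path \<gamma> \<tau>) =
      compose (carrier (fibre P \<pi> (\<tau> 0))) (parallel_transport P \<pi> A \<gamma>) (parallel_transport P \<pi> A \<tau>)"
  proof
    fix p show "parallel_transport P \<pi> A (concat_path \<gamma> \<tau>) p =
      compose (carrier (fibre P \<pi> (\<tau> 0))) (parallel_transport P \<pi> A \<gamma>) (parallel_transport P \<pi> A \<tau>) p"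
    proof (cases "p \<in> carrier (fibre P \<pi> (\<tau> 0))")
      case True
      then show ?thesis using parallel_transport_concat[OF \<gamma> \<tau> eq, of p] by (simp add: compose_def)
    next
      case False
      then show ?thesis
        using parallel_transport_outside[of p P \<pi> "concat_path \<gamma> \<tau>" A] by (simp only: compose_def restrict_apply if_False concat_path_endpoints not_False_eq_True simp_thms)
    qed
  qed
  then show ?thesis by (simp add: transport_map_def torsor_groupoid_def)
qed

lemma transport_map_const:
  assumes x: "x \<in> carrier M"
  shows "transport_map P \<pi> A (const_path x) = Unit (torsor_groupoid G) (fibre P \<pi> x)"
proof -
  have cp [simp]: "const_path x 0 = x" "const_path x 1 = x" by (simp_all add: const_path_def)
  have "parallel_transport P \<pi> A (const_path x) p = restrict id (carrier (fibre P \<pi> x)) p" for p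
  proof (cases "p \<in> carrier (fibre P \<pi> x)")
    case True
    then show ?thesis using parallel_transport_const[of p] by auto
  next
    case False
    then show ?thesis
      using parallel_transport_outside[of p P \<pi> "const_path x" A] by (simp only: cp restrict_apply if_False not_False_eq_True simp_thms)
  qed
  then have "parallel_transport P \<pi> A (const_path x) = restrict id (carrier (fibre P \<pi> x))" by (rule ext)
  then show ?thesis by (simp add: transport_map_def torsor_groupoid_def)
qed

lemma hol_functor: "is_functor (thin_groupoid M) (torsor_groupoid G) (fibre P \<pi>) (hol P \<pi> A)"
  unfolding is_functor_def
proof (intro conjI ballI impI)
  fix x assume "x \<in> Obj (thin_groupoid M)"
  then have x: "x \<in> carrier M" by (simp add: thin_groupoid_def)
  show "fibre P \<pi> x \<in> Obj (torsor_groupoid G)" using torsor_fibre[OF x] by (simp add: torsor_groupoid_def)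
  have "Unit (thin_groupoid M) x = thin_rel M `` {const_path x}" by (simp add: thin_groupoid_def)
  then show "hol P \<pi> A (Unit (thin_groupoid M) x) = Unit (torsor_groupoid G) (fibre P \<pi> x)"
    using hol_eq[OF arrow_class[OF const_sitting[OF DM x]]] transport_map_const[OF x] by simp
next
  fix a assume a: "a \<in> Arr (thin_groupoid M)"
  obtain \<gamma> where \<gamma>: "\<gamma> \<in> a" by (rule arrow_representative[OF a])
  note e = arrow_endpoints[OF a \<gamma>]
  show "hol P \<pi> A a \<in> Arr (torsor_groupoid G)" unfolding hol_eq[OF a \<gamma>] by (rule transport_map_arrow[OF e(1)])
  show "Src (torsor_groupoid G) (hol P \<pi> A a) = fibre P \<pi> (Src (thin_groupoid M) a)"
    "Tgt (torsor_groupoid G) (hol P \<pi> A a) = fibre P \<pi> (Tgt (thin_groupoid M) a)"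
    unfolding hol_eq[OF a \<gamma>] e(2,3) by (simp_all add: transport_map_def torsor_groupoid_def)
next
  fix a b assume a: "a \<in> Arr (thin_groupoid M)" and b: "b \<in> Arr (thin_groupoid M)"
    and ab: "Src (thin_groupoid M) a = Tgt (thin_groupoid M) b"
  let ?C = "Comp (thin_groupoid M) a b"
  have C: "?C = (\<Union>\<gamma>\<in>a. \<Union>\<tau>\<in>b. thin_rel M `` {concat_path \<gamma> \<tau>})" by (simp add: thin_groupoid_def)
  have ends: "\<tau> 1 = \<gamma> 0" if "\<gamma> \<in> a" "\<tau> \<in> b" for \<gamma> \<tau>
    using arrow_endpoints(2)[OF a that(1)] arrow_endpoints(3)[OF b that(2)] ab by simp
  obtain \<gamma> \<tau> where "\<gamma> \<in> a" "\<tau> \<in> b" using arrow_representative[OF a] arrow_representative[OF b] by metis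
  note m = this
  have "concat_path \<gamma> \<tau> \<in> thin_rel M `` {concat_path \<gamma> \<tau>}"
    by (rule arrow_class(2)[OF concat_sitting[OF DM arrow_endpoints(1)[OF a m(1)] arrow_endpoints(1)[OF b m(2)] ends[OF m]]])
  then have "concat_path \<gamma> \<tau> \<in> ?C" unfolding C using m by blast
  \<comment> \<open>The composite is defined as a union of classes. The path that \<open>hol\<close>
    selects from it lies in the class of one concatenation of representatives, and whichever pair
    this is, its transport is the composite of the two transports.\<close>
  then have "(SOME \<omega>. \<omega> \<in> ?C) \<in> ?C" by (rule someI[of "\<lambda>\<omega>. \<omega> \<in> ?C"])
  then obtain \<gamma>' \<tau>' where m: "\<gamma>' \<in> a" "\<tau>' \<in> b" and rel: "(concat_path \<gamma>' \<tau>', SOME \<omega>. \<omega> \<in> ?C) \<in> thin_rel M"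
    unfolding C by auto
  have "hol P \<pi> A ?C = transport_map P \<pi> A (concat_path \<gamma>' \<tau>')"
    unfolding hol_def by (rule transport_map_thin[OF rel, symmetric])
  also have "\<dots> = Comp (torsor_groupoid G) (hol P \<pi> A a) (hol P \<pi> A b)"
    unfolding hol_eq[OF a m(1)] hol_eq[OF b m(2)]
    by (rule transport_map_concat[OF arrow_endpoints(1)[OF a m(1)] arrow_endpoints(1)[OF b m(2)] ends[OF m]])
  finally show "hol P \<pi> A ?C = Comp (torsor_groupoid G) (hol P \<pi> A a) (hol P \<pi> A b)" .
qed

text \<open>Plots of the quotient lift locally to plots of paths, for which transport of a fixed
  point \<open>z\<close> is smooth; the division map of \<open>P\<close> turns this into a plot of
  \<open>G\<close>, as the structure of the automorphism group demands for each base point.\<close>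

lemma hol_smooth:
  assumes x: "x \<in> carrier M"
  shows "smooth_map (thin_pi1 M x) (aut_space G (fibre P \<pi> x)) (hol P \<pi> A)"
proof -
  let ?F = "fibre P \<pi> x"
  let ?Aut = "carrier (aut_space G ?F)"
  let ?loops = "{a \<in> Arr (thin_groupoid M). Src (thin_groupoid M) a = x \<and> Tgt (thin_groupoid M) a = x}"
  have aut: "hol P \<pi> A a \<in> ?Aut" if "a \<in> ?loops" for a
    using hol_functor that unfolding is_functor_def by (auto simp: aut_space_def Let_def torsor_groupoid_def)
  have "(n, U, restrict (hol P \<pi> A \<circ> q) U) \<in> plots (aut_space G ?F)" if "(n, U, q) \<in> plots (thin_pi1 M x)" for n U q
  proof -
    have q: "(n, U, q) \<in> plots (thin_arrows M)" "\<And>u. u \<in> U \<Longrightarrow> q u \<in> ?loops"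
      using that by (auto simp: thin_pi1_def subspace_dspace_def)
    have lift: "\<exists>V p. u \<in> V \<and> V \<subseteq> U \<and> (n, V, p) \<in> plots (path_space M) \<and> (\<forall>v\<in>V. q v = thin_rel M `` {p v})" if "u \<in> U" for u
      using q(1) that by (auto simp: thin_arrows_def quotient_dspace_def)
    have "is_plot L n U (\<lambda>u. \<delta> z (tm_fun (hol P \<pi> A (q u)) z))" if z: "z \<in> carrier P" "\<pi> z = x" for z
    proof (rule is_plot_local[OF DL])
      fix u assume u: "u \<in> U"
      obtain V p where lp: "u \<in> V \<and> V \<subseteq> U \<and> (n, V, p) \<in> plots (path_space M) \<and> (\<forall>v\<in>V. q v = thin_rel M `` {p v})"
        using lift[OF u] by (elim exE) (rule that)
      have V: "u \<in> V" "V \<subseteq> U" and p: "(n, V, p) \<in> plots (path_space M)" using lp by simp_all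
      have qp: "q v = thin_rel M `` {p v}" if "v \<in> V" for v using lp that by simp
      have OV: "open_eucl n V" and ps: "\<And>v. v \<in> V \<Longrightarrow> p v \<in> sitting_paths M" using p by (auto simp: path_space_def)
      have pq: "p v \<in> q v" "q v \<in> Arr (thin_groupoid M)" "Src (thin_groupoid M) (q v) = x" "Tgt (thin_groupoid M) (q v) = x" if "v \<in> V" for v
        using arrow_class(2)[OF ps[OF that]] qp[OF that] q(2)[of v] that V(2) by auto
      have ends: "p v 0 = x" "p v 1 = x" if "v \<in> V" for v
        using arrow_endpoints(2,3)[OF pq(2,1)[OF that]] pq(3,4)[OF that] by simp_all
      have T: "is_plot P n V (\<lambda>v. parallel_transport P \<pi> A (p v) z)"
        by (rule parallel_transport_smooth[OF p z(1)]) (use ends z(2) in simp)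
      have "is_plot L n V (\<lambda>v. \<delta> z (parallel_transport P \<pi> A (p v) z))"
        by (rule plot_diff[OF is_plot_const[OF DP z(1) OV] T]) (use ends z ps parallel_transport_fibre(2) in simp)
      moreover have "tm_fun (hol P \<pi> A (q v)) = parallel_transport P \<pi> A (p v)" if "v \<in> V" for v
        unfolding hol_eq[OF pq(2,1)[OF that]] by (simp add: transport_map_def)
      ultimately have "is_plot L n V (\<lambda>u. \<delta> z (tm_fun (hol P \<pi> A (q u)) z))"
        using is_plot_cong[of V "\<lambda>u. \<delta> z (tm_fun (hol P \<pi> A (q u)) z)" "\<lambda>v. \<delta> z (parallel_transport P \<pi> A (p v) z)" L n] by simp
      then show "\<exists>W. u \<in> W \<and> W \<subseteq> U \<and> is_plot L n W (\<lambda>u. \<delta> z (tm_fun (hol P \<pi> A (q u)) z))" using V by blast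
    qed
    \<comment> \<open>\<open>torsor_diff\<close> uses only the action and the carrier of
      \<open>G\<close>, so division in the fibre is division in \<open>P\<close>.\<close>
    moreover have "restrict (\<lambda>u. torsor_diff G ?F z (tm_fun (restrict (hol P \<pi> A \<circ> q) U u) z)) U =
        restrict (\<lambda>u. \<delta> z (tm_fun (hol P \<pi> A (q u)) z)) U" for z
      by (rule restrict_ext) (simp add: torsor_diff_def)
    moreover have "restrict (hol P \<pi> A \<circ> q) U \<in> U \<rightarrow>\<^sub>E ?Aut" using aut q(2) by auto
    ultimately show ?thesis unfolding aut_space_def Let_def by (simp add: is_plot_def)
  qed
  moreover have "hol P \<pi> A \<in> carrier (thin_pi1 M x) \<rightarrow> ?Aut"
    using aut by (auto simp: thin_pi1_def subspace_dspace_def)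
  ultimately show ?thesis unfolding smooth_map_def by auto
qed

end

theorem theorem3p8:
  fixes G :: "'g lie_group_data"
    and M :: "'m dspace"
    and P :: "('p, 'g) gspace"
    and \<pi> :: "'p \<Rightarrow> 'm"
    and A :: "'p \<Rightarrow> 'p tvec \<Rightarrow> 'g tvec"
  assumes "lie_group G"
    and "manifold M"
    and "principal_bundle G M P \<pi>"
    and "connection_form G P A"
  shows "(\<forall>a \<in> Arr (thin_groupoid M). \<forall>\<gamma> \<in> a. hol P \<pi> A a = transport_map P \<pi> A \<gamma>) \<and>
         transport_functor G M (fibre P \<pi>) (hol P \<pi> A)"
proof -
  interpret bundle_connection G M P \<pi> A by (rule bundle_connection.intro) (fact assms)+
  show ?thesis using hol_eq hol_functor hol_smooth unfolding transport_functor_def by blast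
qed

end
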